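(* Let $G$ be a finite group, $\mathcal{O}$ as in the context, $b$ a block idempotent of $\mathcal{O}G$ with block algebra $\mathcal{B}=b\,\mathcal{O}G$, $\ell$ a source idempotent of $b$ with defect group $D$ and associated block fusion system $\mathcal{F}_D(b)$, and $\mathcal{S}=\ell\mathcal{B}\ell$ the corresponding source algebra. If $\mathcal{S}$ has all twisted units, then every $(D,D)$-invariant $\mathcal{O}$-basis $X$ of $\mathcal{S}$ is an $\mathcal{F}_D(b)$-characteristic $(D,D)$-biset.
   Context: $\mathcal{O}$ is a complete local noetherian domain with maximal ideal $\mathfrak{m}$ and algebraically closed residue field $k$ of characteristic $p>0$ (possibly $\mathcal{O}=k$). For a $p$-group $P$ acting on an $\mathcal{O}$-module $M$, the Brauer quotient is $M(P)=M^P/(\mathfrak{m}M^P+\sum_{R<P}\mathrm{tr}_R^P(M^R))$, with $\mathrm{br}_P:M^P\to M(P)$ the quotient map; $G$ acts on $\mathcal{O}G$ by conjugation. A Brauer pair is a pair $(P,e)$ with $P$ a $p$-subgroup of $G$ and $e$ a block idempotent of $(\mathcal{O}G)(P)$; Brauer pairs carry the standard $G$-equivariant inclusion partial order $\le$ (Alperin–Broué). A block idempotent $b$ is a primitive idempotent of $Z(\mathcal{O}G)$. A source idempotent of $b$ is a primitive idempotent $\ell$ of $\mathcal{B}^D$ (for a $p$-subgroup $D$, with $D$ acting by conjugation) such that $\mathrm{br}_D(\ell)\neq 0$ and $(D,e_D)$ is a maximal Brauer pair with $(1,b)\le(D,e_D)$ and $\mathrm{br}_D(\ell)e_D=\mathrm{br}_D(\ell)$;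 $D$ is then a defect group of $b$. For $Q\le D$ let $e_Q$ be the unique block of $(\mathcal{O}G)(Q)$ with $(Q,e_Q)\le(D,e_D)$. The block fusion system $\mathcal{F}_D(b)$ is the category with objects the subgroups of $D$ and $\mathrm{Hom}(P,Q)=\{c_g|_P: g\in G,\ {}^g(P,e_P)\le(Q,e_Q)\}$. The source algebra $\mathcal{S}=\ell\mathcal{B}\ell$ is an interior $D$-algebra via $d\mapsto d\ell$, so $D\times D$ acts on it by $(d_1,d_2)\cdot a=d_1ad_2^{-1}$; a $(D,D)$-invariant $\mathcal{O}$-basis is an $\mathcal{O}$-basis $X$ with $dX=X=Xd$ for all $d\in D$, regarded as a $(D,D)$-biset. Twisted Brauer quotients: for $P\le D$ and an injective homomorphism $\varphi:P\to D$, let $\Delta(\varphi,P)=\{(\varphi(p),p):p\in P\}$, ${}^\varphi\mathcal{S}^P=\{a\in\mathcal{S}:\varphi(p)a=ap\ \forall p\in P\}$, and $\mathcal{S}(\varphi)$ the Brauer quotient of $\mathcal{S}$ at $\Delta(\varphi,P)\le D\times D$, with map $\mathrm{br}_\varphi$; $\mathcal{S}(P)=\mathcal{S}(\iota_P)$ for the inclusion $\iota_P$. Multiplication induces $\mathcal{S}(\psi)\times\mathcal{S}(\varphi)\to\mathcal{S}(\psi\varphi)$, $\mathrm{br}_\psi(a)\mathrm{br}_\varphi(c)=\mathrm{br}_{\psi\varphi}(ac)$. For a group isomorphism $\varphi:P\to Q$ between subgroups of $D$ with $\mathcal{S}(\varphi)\neq0$, a twisted unit of $\varphi$ is an element $u\in\mathcal{S}(\varphi)$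 for which there is $u^\dagger\in\mathcal{S}(\varphi^{-1})$ with $u^\dagger u=1_{\mathcal{S}(P)}$. $\mathcal{S}$ has all twisted units if every such $\varphi$ (i.e. every isomorphism $\varphi$ with $\mathcal{S}(\varphi)\ne0$) has a twisted unit. For a fusion system $\mathcal{F}$ on a $p$-group $S$, an $(S,S)$-biset $\Omega$ is $\mathcal{F}$-characteristic if: (1) the left and right $S$-actions are free; (2) $\Omega\cong\Omega^\circ$, where $\Omega^\circ$ is $\Omega$ with action $s\odot\omega\odot t=t^{-1}\omega s^{-1}$; (3) every point stabilizer $\{(s,t):s\omega=\omega t\}$ has the form $\Delta(\varphi,P)$ with $\varphi\in\mathrm{Hom}_\mathcal{F}(P,S)$; (4) for every $P\le S$ and $\varphi\in\mathrm{Hom}_\mathcal{F}(P,S)$, the $(P,S)$-biset obtained by restriction is isomorphic to the $(P,S)$-biset with action $p\odot\omega\odot s=\varphi(p)\omega s$; (5) $|\Omega|/|S|$ is prime to $p$. *)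

theory Defs
  imports "HOL-Computational_Algebra.Primes" "HOL-Algebra.Group" "HOL-Algebra.Coset" "HOL-Library.Function_Algebras"
begin

definition ring_ideal :: "'o::comm_ring_1 set \<Rightarrow> bool" where
  "ring_ideal I \<longleftrightarrow> 0 \<in> I \<and> (\<forall>x\<in>I. \<forall>y\<in>I. x + y \<in> I) \<and> (\<forall>r. \<forall>x\<in>I. r * x \<in> I)"

primrec mpow :: "'o::comm_ring_1 set \<Rightarrow> nat \<Rightarrow> 'o set" where
  "mpow m 0 = UNIV"
| "mpow m (Suc k) = {\<Sum>i<(n::nat). x i * y i | n x y. \<forall>i<n. x i \<in> m \<and> y i \<in> mpow m k}"

definition cln_domain :: "'o::idom set \<Rightarrow> bool" where
  "cln_domain m \<longleftrightarrow>
     ring_ideal m \<and> 1 \<notin> m \<and> (\<forall>x. x \<notin> m \<longrightarrow> (\<exists>y. x * y = 1)) \<and>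
     (\<forall>I::'o set. ring_ideal I \<longrightarrow> (\<exists>F. finite F \<and> F \<subseteq> I \<and> I = {\<Sum>f\<in>F. c f * f | c. True})) \<and>
     (\<forall>s::nat \<Rightarrow> _. (\<forall>k. \<exists>N. \<forall>n\<ge>N. \<forall>n'\<ge>N. s n - s n' \<in> mpow m k) \<longrightarrow>
         (\<exists>L. \<forall>k. \<exists>N. \<forall>n\<ge>N. s n - L \<in> mpow m k))"

definition residue_alg_closed_char :: "'o::idom set \<Rightarrow> nat \<Rightarrow> bool" where
  "residue_alg_closed_char m p \<longleftrightarrow> prime p \<and> of_nat p \<in> m \<and>
     (\<forall>n\<ge>1. \<forall>c::nat \<Rightarrow> _. \<exists>x. x ^ n + (\<Sum>i<n. c i * x ^ i) \<in> m)"

definition grpalg :: "'g monoid \<Rightarrow> ('g \<Rightarrow> 'o::comm_ring_1) set" where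
  "grpalg G = {a. \<forall>x. x \<notin> carrier G \<longrightarrow> a x = 0}"

definition gmult :: "'g monoid \<Rightarrow> ('g \<Rightarrow> 'o::comm_ring_1) \<Rightarrow> ('g \<Rightarrow> 'o) \<Rightarrow> ('g \<Rightarrow> 'o)" where
  "gmult G a c = (\<lambda>x. if x \<in> carrier G
      then (\<Sum>y\<in>carrier G. a y * c (inv\<^bsub>G\<^esub> y \<otimes>\<^bsub>G\<^esub> x)) else 0)"

definition gelem :: "'g monoid \<Rightarrow> 'g \<Rightarrow> ('g \<Rightarrow> 'o::comm_ring_1)" where
  "gelem G g = (\<lambda>x. if x = g then 1 else 0)"

definition smult :: "'o::comm_ring_1 \<Rightarrow> ('g \<Rightarrow> 'o) \<Rightarrow> ('g \<Rightarrow> 'o)" where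
  "smult r a = (\<lambda>x. r * a x)"

definition conj_act :: "'g monoid \<Rightarrow> 'g \<Rightarrow> ('g \<Rightarrow> 'o::comm_ring_1) \<Rightarrow> ('g \<Rightarrow> 'o)" where
  "conj_act G g a = (\<lambda>x. if x \<in> carrier G then a (inv\<^bsub>G\<^esub> g \<otimes>\<^bsub>G\<^esub> x \<otimes>\<^bsub>G\<^esub> g) else 0)"

definition prim_idem :: "('a \<Rightarrow> 'a \<Rightarrow> 'a) \<Rightarrow> 'a set \<Rightarrow> 'a::{zero,plus} \<Rightarrow> bool" where
  "prim_idem mul A e \<longleftrightarrow> e \<in> A \<and> mul e e = e \<and> e \<noteq> 0 \<and>
     (\<forall>u\<in>A. \<forall>v\<in>A. mul u u = u \<and> mul v v = v \<and> mul u v = 0 \<and> mul v u = 0 \<and> e = u + v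
        \<longrightarrow> u = 0 \<or> v = 0)"

definition centre :: "'g monoid \<Rightarrow> ('g \<Rightarrow> 'o::comm_ring_1) set" where
  "centre G = {z \<in> grpalg G. \<forall>a\<in>grpalg G. gmult G z a = gmult G a z}"

definition block_idem :: "'g monoid \<Rightarrow> ('g \<Rightarrow> 'o::comm_ring_1) \<Rightarrow> bool" where
  "block_idem G b \<longleftrightarrow> prim_idem (gmult G) (centre G) b"

definition blockalg :: "'g monoid \<Rightarrow> ('g \<Rightarrow> 'o::comm_ring_1) \<Rightarrow> ('g \<Rightarrow> 'o) set" where
  "blockalg G b = {gmult G b a | a. a \<in> grpalg G}"

definition fixpts :: "('h \<Rightarrow> 'm \<Rightarrow> 'm) \<Rightarrow> 'm set \<Rightarrow> 'h set \<Rightarrow> 'm set" where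
  "fixpts act M Q = {a \<in> M. \<forall>q\<in>Q. act q a = a}"

definition rel_trace :: "('h, 'c) monoid_scheme \<Rightarrow> ('h \<Rightarrow> 'm \<Rightarrow> 'm::comm_monoid_add)
    \<Rightarrow> 'h set \<Rightarrow> 'h set \<Rightarrow> 'm \<Rightarrow> 'm" where
  "rel_trace H act R Q a = (\<Sum>C\<in>{q <#\<^bsub>H\<^esub> R | q. q \<in> Q}. act (SOME q. q \<in> C) a)"

definition mod_span :: "'o set \<Rightarrow> ('g \<Rightarrow> 'o::comm_ring_1) set \<Rightarrow> ('g \<Rightarrow> 'o) set" where
  "mod_span m A = {\<Sum>i<(n::nat). smult (c i) (a i) | n c a. \<forall>i<n. c i \<in> m \<and> a i \<in> A}"

definition brauer_kernel :: "'o::comm_ring_1 set \<Rightarrow> ('h, 'c) monoid_scheme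
    \<Rightarrow> ('h \<Rightarrow> ('g \<Rightarrow> 'o) \<Rightarrow> ('g \<Rightarrow> 'o)) \<Rightarrow> ('g \<Rightarrow> 'o) set \<Rightarrow> 'h set \<Rightarrow> ('g \<Rightarrow> 'o) set" where
  "brauer_kernel m H act M Q =
     {u + v | u v. u \<in> mod_span m (fixpts act M Q) \<and>
        v \<in> {\<Sum>R\<in>{R. subgroup R H \<and> R \<subset> Q}. rel_trace H act R Q (f R) | f.
               \<forall>R. subgroup R H \<and> R \<subset> Q \<longrightarrow> f R \<in> fixpts act M R}}"

definition ogfix :: "'g monoid \<Rightarrow> 'g set \<Rightarrow> ('g \<Rightarrow> 'o::comm_ring_1) set" where
  "ogfix G P = fixpts (conj_act G) (grpalg G) P"

definition ogker :: "'o::comm_ring_1 set \<Rightarrow> 'g monoid \<Rightarrow> 'g set \<Rightarrow> ('g \<Rightarrow> 'o) set" where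
  "ogker m G P = brauer_kernel m G (conj_act G) (grpalg G) P"

definition p_subgroup :: "nat \<Rightarrow> 'g monoid \<Rightarrow> 'g set \<Rightarrow> bool" where
  "p_subgroup p G P \<longleftrightarrow> subgroup P G \<and> (\<exists>n. card P = p ^ n)"

text \<open>e \<in> (OG)^P represents (via br_P) a block idempotent of (OG)(P), i.e. a primitive
  idempotent of the centre of (OG)(P) = (OG)^P / ogker m G P.\<close>
definition brauer_block :: "'o::comm_ring_1 set \<Rightarrow> 'g monoid \<Rightarrow> 'g set \<Rightarrow> ('g \<Rightarrow> 'o) \<Rightarrow> bool" where
  "brauer_block m G P e \<longleftrightarrow>
     (let A = ogfix G P; K = ogker m G P;
          cent = (\<lambda>z. \<forall>a\<in>A. gmult G z a - gmult G a z \<in> K)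
      in e \<in> A \<and> cent e \<and> gmult G e e - e \<in> K \<and> e \<notin> K \<and>
         (\<forall>u\<in>A. \<forall>v\<in>A. cent u \<and> cent v \<and> gmult G u u - u \<in> K \<and> gmult G v v - v \<in> K \<and>
             gmult G u v \<in> K \<and> gmult G v u \<in> K \<and> e - (u + v) \<in> K \<longrightarrow> u \<in> K \<or> v \<in> K))"

definition brauer_pair :: "'o::comm_ring_1 set \<Rightarrow> nat \<Rightarrow> 'g monoid \<Rightarrow> 'g set \<Rightarrow> ('g \<Rightarrow> 'o) \<Rightarrow> bool" where
  "brauer_pair m p G P e \<longleftrightarrow> p_subgroup p G P \<and> brauer_block m G P e"

definition bp_le :: "'o::comm_ring_1 set \<Rightarrow> 'g monoid \<Rightarrow> 'g set \<times> ('g \<Rightarrow> 'o) \<Rightarrow> 'g set \<times> ('g \<Rightarrow> 'o) \<Rightarrow> bool" where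
  "bp_le m G Qf Pe \<longleftrightarrow> (case Qf of (Q, f) \<Rightarrow> case Pe of (P, e) \<Rightarrow>
     Q \<subseteq> P \<and> (\<forall>i. prim_idem (gmult G) (ogfix G P) i \<and> gmult G i e \<notin> ogker m G P
        \<longrightarrow> gmult G i f \<notin> ogker m G Q))"

definition conj_pair :: "'g monoid \<Rightarrow> 'g \<Rightarrow> 'g set \<times> ('g \<Rightarrow> 'o::comm_ring_1) \<Rightarrow> 'g set \<times> ('g \<Rightarrow> 'o)" where
  "conj_pair G g Pe = (case Pe of (P, e) \<Rightarrow>
      ((\<lambda>x. g \<otimes>\<^bsub>G\<^esub> x \<otimes>\<^bsub>G\<^esub> inv\<^bsub>G\<^esub> g) ` P, conj_act G g e))"

definition source_idem :: "'o::comm_ring_1 set \<Rightarrow> nat \<Rightarrow> 'g monoid \<Rightarrow> ('g \<Rightarrow> 'o) \<Rightarrow> 'g set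
    \<Rightarrow> ('g \<Rightarrow> 'o) \<Rightarrow> ('g \<Rightarrow> 'o) \<Rightarrow> bool" where
  "source_idem m p G b D l eD \<longleftrightarrow>
     block_idem G b \<and> p_subgroup p G D \<and>
     prim_idem (gmult G) (fixpts (conj_act G) (blockalg G b) D) l \<and>
     l \<notin> ogker m G D \<and>
     brauer_pair m p G D eD \<and>
     (\<forall>P e. brauer_pair m p G P e \<and> bp_le m G (D, eD) (P, e) \<longrightarrow> P = D \<and> e - eD \<in> ogker m G D) \<and>
     bp_le m G ({\<one>\<^bsub>G\<^esub>}, b) (D, eD) \<and>
     gmult G l eD - l \<in> ogker m G D"

definition fus_hom :: "'o::comm_ring_1 set \<Rightarrow> nat \<Rightarrow> 'g monoid \<Rightarrow> 'g set \<Rightarrow> ('g \<Rightarrow> 'o)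
    \<Rightarrow> 'g set \<Rightarrow> 'g set \<Rightarrow> ('g \<Rightarrow> 'g) \<Rightarrow> bool" where
  "fus_hom m p G D eD P Q phi \<longleftrightarrow>
     subgroup P G \<and> P \<subseteq> D \<and> subgroup Q G \<and> Q \<subseteq> D \<and>
     (\<exists>g\<in>carrier G. \<exists>eP eQ.
        brauer_pair m p G P eP \<and> bp_le m G (P, eP) (D, eD) \<and>
        brauer_pair m p G Q eQ \<and> bp_le m G (Q, eQ) (D, eD) \<and>
        bp_le m G (conj_pair G g (P, eP)) (Q, eQ) \<and>
        (\<forall>x\<in>P. phi x = g \<otimes>\<^bsub>G\<^esub> x \<otimes>\<^bsub>G\<^esub> inv\<^bsub>G\<^esub> g))"

definition srcalg :: "'g monoid \<Rightarrow> ('g \<Rightarrow> 'o::comm_ring_1) \<Rightarrow> ('g \<Rightarrow> 'o) \<Rightarrow> ('g \<Rightarrow> 'o) set" where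
  "srcalg G b l = {gmult G (gmult G l a) l | a. a \<in> blockalg G b}"

text \<open>Left and right actions of d via the structural map d \<mapsto> d l.\<close>
definition lact :: "'g monoid \<Rightarrow> ('g \<Rightarrow> 'o::comm_ring_1) \<Rightarrow> 'g \<Rightarrow> ('g \<Rightarrow> 'o) \<Rightarrow> ('g \<Rightarrow> 'o)" where
  "lact G l d a = gmult G (gmult G (gelem G d) l) a"

definition ract :: "'g monoid \<Rightarrow> ('g \<Rightarrow> 'o::comm_ring_1) \<Rightarrow> ('g \<Rightarrow> 'o) \<Rightarrow> 'g \<Rightarrow> ('g \<Rightarrow> 'o)" where
  "ract G l a d = gmult G a (gmult G (gelem G d) l)"

definition dd_act :: "'g monoid \<Rightarrow> ('g \<Rightarrow> 'o::comm_ring_1) \<Rightarrow> 'g \<times> 'g \<Rightarrow> ('g \<Rightarrow> 'o) \<Rightarrow> ('g \<Rightarrow> 'o)" where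
  "dd_act G l d a = ract G l (lact G l (fst d) a) (inv\<^bsub>G\<^esub> (snd d))"

definition Delta :: "('g \<Rightarrow> 'g) \<Rightarrow> 'g set \<Rightarrow> ('g \<times> 'g) set" where
  "Delta phi P = {(phi x, x) | x. x \<in> P}"

definition tw_fix :: "'g monoid \<Rightarrow> ('g \<Rightarrow> 'o::comm_ring_1) \<Rightarrow> ('g \<Rightarrow> 'o) \<Rightarrow> ('g \<Rightarrow> 'g) \<Rightarrow> 'g set \<Rightarrow> ('g \<Rightarrow> 'o) set" where
  "tw_fix G b l phi P = fixpts (dd_act G l) (srcalg G b l) (Delta phi P)"

definition tw_ker :: "'o::comm_ring_1 set \<Rightarrow> 'g monoid \<Rightarrow> ('g \<Rightarrow> 'o) \<Rightarrow> ('g \<Rightarrow> 'o) \<Rightarrow> ('g \<Rightarrow> 'g) \<Rightarrow> 'g set \<Rightarrow> ('g \<Rightarrow> 'o) set" where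
  "tw_ker m G b l phi P = brauer_kernel m (G \<times>\<times> G) (dd_act G l) (srcalg G b l) (Delta phi P)"

definition all_twisted_units :: "'o::comm_ring_1 set \<Rightarrow> 'g monoid \<Rightarrow> ('g \<Rightarrow> 'o) \<Rightarrow> 'g set \<Rightarrow> ('g \<Rightarrow> 'o) \<Rightarrow> bool" where
  "all_twisted_units m G b D l \<longleftrightarrow>
     (\<forall>P Q phi. subgroup P G \<and> P \<subseteq> D \<and> subgroup Q G \<and> Q \<subseteq> D \<and>
        (\<forall>x\<in>P. \<forall>y\<in>P. phi (x \<otimes>\<^bsub>G\<^esub> y) = phi x \<otimes>\<^bsub>G\<^esub> phi y) \<and> bij_betw phi P Q \<and>
        (\<exists>a\<in>tw_fix G b l phi P. a \<notin> tw_ker m G b l phi P)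
      \<longrightarrow> (\<exists>u\<in>tw_fix G b l phi P. \<exists>u'\<in>tw_fix G b l (inv_into P phi) Q.
             gmult G u' u - l \<in> tw_ker m G b l id P))"

definition lin_indep :: "('g \<Rightarrow> 'o::comm_ring_1) set \<Rightarrow> bool" where
  "lin_indep X \<longleftrightarrow> (\<forall>F c. finite F \<and> F \<subseteq> X \<and> (\<Sum>x\<in>F. smult (c x) x) = 0 \<longrightarrow> (\<forall>x\<in>F. c x = 0))"

definition lin_span :: "('g \<Rightarrow> 'o::comm_ring_1) set \<Rightarrow> ('g \<Rightarrow> 'o) set" where
  "lin_span X = {\<Sum>x\<in>F. smult (c x) x | F c. finite F \<and> F \<subseteq> X}"

definition dd_inv_basis :: "'g monoid \<Rightarrow> ('g \<Rightarrow> 'o::comm_ring_1) \<Rightarrow> 'g set \<Rightarrow> ('g \<Rightarrow> 'o) \<Rightarrow> ('g \<Rightarrow> 'o) set \<Rightarrow> bool" where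
  "dd_inv_basis G b D l X \<longleftrightarrow> X \<subseteq> srcalg G b l \<and> lin_indep X \<and> lin_span X = srcalg G b l \<and>
     (\<forall>d\<in>D. lact G l d ` X = X \<and> (\<lambda>x. ract G l x d) ` X = X)"

text \<open>Omega (with actions la, ra of S) is an F-characteristic (S,S)-biset, where
  F P Q phi means phi \<in> Hom_F(P,Q).\<close>
definition char_biset :: "nat \<Rightarrow> 'g monoid \<Rightarrow> 'g set \<Rightarrow> ('g set \<Rightarrow> 'g set \<Rightarrow> ('g \<Rightarrow> 'g) \<Rightarrow> bool)
    \<Rightarrow> ('g \<Rightarrow> 'x \<Rightarrow> 'x) \<Rightarrow> ('x \<Rightarrow> 'g \<Rightarrow> 'x) \<Rightarrow> 'x set \<Rightarrow> bool" where
  "char_biset p G S F la ra Om \<longleftrightarrow> finite Om \<and>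
     (\<forall>s\<in>S. \<forall>w\<in>Om. la s w = w \<longrightarrow> s = \<one>\<^bsub>G\<^esub>) \<and>
     (\<forall>t\<in>S. \<forall>w\<in>Om. ra w t = w \<longrightarrow> t = \<one>\<^bsub>G\<^esub>) \<and>
     (\<exists>beta. bij_betw beta Om Om \<and> (\<forall>s\<in>S. \<forall>t\<in>S. \<forall>w\<in>Om.
        beta (ra (la s w) t) = ra (la (inv\<^bsub>G\<^esub> t) (beta w)) (inv\<^bsub>G\<^esub> s))) \<and>
     (\<forall>w\<in>Om. \<exists>P phi. subgroup P G \<and> P \<subseteq> S \<and> F P S phi \<and>
        {(s, t). s \<in> S \<and> t \<in> S \<and> la s w = ra w t} = Delta phi P) \<and>
     (\<forall>P phi. subgroup P G \<and> P \<subseteq> S \<and> F P S phi \<longrightarrow>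
        (\<exists>beta. bij_betw beta Om Om \<and> (\<forall>q\<in>P. \<forall>s\<in>S. \<forall>w\<in>Om.
           beta (ra (la q w) s) = ra (la (phi q) (beta w)) s))) \<and>
     coprime (card Om div card S) p"

end

theory Submission
  imports Defs "HOL-Algebra.Sylow" "HOL-Computational_Algebra.Polynomial" "HOL-Algebra.Left_Coset"
begin

text \<open>Brauer maps are computed by coefficients: the kernel of the Brauer map at \<open>\<Delta>(\<phi>, P)\<close> consists of the
  fixed points whose coefficients at the elements \<open>g\<close> with \<open>\<phi>(x) g = g x\<close> lie in \<open>m\<close>, and for an element of
  the source algebra the same kernel is described by the coefficients at the fixed points of an invariant
  basis. A twisted unit of \<open>\<phi>\<close> therefore gives equally many fixed points for \<open>\<phi>\<close> and for the identities of \<open>P\<close> and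
  \<open>\<phi>(P)\<close>, and Burnside's theorem on marks yields the self-duality and the stability under fusion. Writing the
  block as a trace of \<open>\<alpha> l \<beta>\<close> shows that a morphism of the fusion system has a nonzero twisted Brauer quotient
  after composition with morphisms that have one, and twisted units undo the composition. For the
  last condition, the points \<open>x\<close> with \<open>x D = D x\<close> are counted: there are \<open>n |D|\<close> of them, where \<open>n\<close> is the inertial
  index, and \<open>n\<close> is invertible in the residue field because \<open>n\<close> times an eigenvalue is 1.\<close>

subsection \<open>Actions of finite groups and local rings\<close>

text \<open>No quotient is ever formed: Brauer quotients, their centres and corner rings are treated
  as congruences modulo a kernel inside the group algebra, so arguments over the residue field
  become statements about coefficients in \<open>m\<close>. The obstacle is fusion. For a block e of
  P below \<open>(D, eD)\<close>, the trace formula puts e only in the ideal of some x l x^-1 with P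
  contained in x D x^-1, not in that of \<open>l\<close>. So a morphism c_g yields nonzero elements
  for c_(x^-1) relative to the inclusion and relative to c_g, with the same x. Twisted units make
  nonvanishing of twisted quotients an equivalence relation, and this cancels x. The count for the
  last condition rests on the Brauer quotient of the source algebra at D having dimension |Z(D)|.
  There \<open>eD\<close> is, modulo the kernel, a relative trace from Z(D) to C_G(D), the form that
  defect zero takes for C_G(D)/Z(D); the trace of a nilpotent operator then shows that the sum of
  Z(D) kills the nilpotent elements of the corner of \<open>l\<close>.\<close>

definition is_action :: "('h, 'c) monoid_scheme => ('h => 'w => 'w) => 'w set => bool" where
  "is_action H act W \<longleftrightarrow> (\<forall>h\<in>carrier H. \<forall>w\<in>W. act h w \<in> W) \<and> (\<forall>w\<in>W. act \<one>\<^bsub>H\<^esub> w = w) \<and>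
     (\<forall>h\<in>carrier H. \<forall>k\<in>carrier H. \<forall>w\<in>W. act (h \<otimes>\<^bsub>H\<^esub> k) w = act h (act k w))"

lemma is_action_inv:
  assumes "group H" "is_action H act W" "h \<in> carrier H" "w \<in> W"
  shows "act (inv\<^bsub>H\<^esub> h) (act h w) = w" "act h (act (inv\<^bsub>H\<^esub> h) w) = w"
proof -
  interpret group H by fact
  have "act (inv\<^bsub>H\<^esub> h) (act h w) = act (inv\<^bsub>H\<^esub> h \<otimes>\<^bsub>H\<^esub> h) w"
    "act h (act (inv\<^bsub>H\<^esub> h) w) = act (h \<otimes>\<^bsub>H\<^esub> inv\<^bsub>H\<^esub> h) w"
    using assms(2-4) unfolding is_action_def by (metis inv_closed)+
  then show "act (inv\<^bsub>H\<^esub> h) (act h w) = w" "act h (act (inv\<^bsub>H\<^esub> h) w) = w"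
    using assms(2-4) by (auto simp: is_action_def)
qed

lemma subgroup_stabilizer:
  assumes "group H" "is_action H act W" "w \<in> W"
  shows "subgroup {h \<in> carrier H. act h w = w} H"
proof -
  interpret group H by fact
  show ?thesis
  proof (rule subgroupI)
    show "{h \<in> carrier H. act h w = w} ~= {}" using assms by (auto simp: is_action_def)
  next
    fix a assume "a \<in> {h \<in> carrier H. act h w = w}"
    then show "inv\<^bsub>H\<^esub> a \<in> {h \<in> carrier H. act h w = w}"
      using is_action_inv(1)[OF assms(1,2) _ assms(3), of a] by auto
  next
    fix a b assume "a \<in> {h \<in> carrier H. act h w = w}" "b \<in> {h \<in> carrier H. act h w = w}"
    then show "a \<otimes>\<^bsub>H\<^esub> b \<in> {h \<in> carrier H. act h w = w}"
      using assms by (auto simp: is_action_def)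
  qed auto
qed

lemma card_orbit_stabilizer:
  assumes "group H" "finite (carrier H)" "is_action H act W" "w \<in> W"
  shows "card (carrier H) = card ((%h. act h w) ` carrier H) * card {h \<in> carrier H. act h w = w}"
proof -
  interpret group H by fact
  let ?S = "{h \<in> carrier H. act h w = w}"
  have fib: "card {h \<in> carrier H. act h w = act k w} = card ?S" if k: "k \<in> carrier H" for k
  proof -
    have "bij_betw (%h. k \<otimes>\<^bsub>H\<^esub> h) ?S {h \<in> carrier H. act h w = act k w}"
    proof (rule bij_betw_byWitness[where f' = "%h. inv\<^bsub>H\<^esub> k \<otimes>\<^bsub>H\<^esub> h"])
      show "\<forall>a\<in>?S. inv\<^bsub>H\<^esub> k \<otimes>\<^bsub>H\<^esub> (k \<otimes>\<^bsub>H\<^esub> a) = a"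
        using k by (auto simp: m_assoc[symmetric])
      show "\<forall>a\<in>{h \<in> carrier H. act h w = act k w}. k \<otimes>\<^bsub>H\<^esub> (inv\<^bsub>H\<^esub> k \<otimes>\<^bsub>H\<^esub> a) = a"
        using k by (auto simp: m_assoc[symmetric])
      show "(%h. k \<otimes>\<^bsub>H\<^esub> h) ` ?S \<subseteq> {h \<in> carrier H. act h w = act k w}"
        using assms(3,4) k by (auto simp: is_action_def)
      show "(%h. inv\<^bsub>H\<^esub> k \<otimes>\<^bsub>H\<^esub> h) ` {h \<in> carrier H. act h w = act k w} \<subseteq> ?S"
        using assms(3,4) k is_action_inv[OF assms(1,3) k assms(4)]
        by (auto simp: is_action_def)
    qed
    then show ?thesis by (simp add: bij_betw_same_card)
  qed
  have "card (carrier H) = (\<Sum>v\<in>(%h. act h w) ` carrier H. card {h \<in> carrier H. act h w = v})"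
    using sum.group[OF assms(2), of "(%h. act h w) ` carrier H" "%h. act h w" "%_. 1::nat"]
    by (simp add: assms(2))
  also have "\<dots> = (\<Sum>v\<in>(%h. act h w) ` carrier H. card ?S)"
    by (rule sum.cong) (auto simp: fib)
  finally show ?thesis by simp
qed

lemma orbit_closed:
  assumes "group H" "is_action H act W" "w \<in> W" "h \<in> carrier H" "v \<in> W"
  shows "act h v \<in> (%k. act k w) ` carrier H \<longleftrightarrow> v \<in> (%k. act k w) ` carrier H"
proof -
  interpret group H by fact
  have *: "act h v \<in> (%k. act k w) ` carrier H" if "v \<in> (%k. act k w) ` carrier H" "h \<in> carrier H" for h v
  proof -
    from that obtain k where k: "k \<in> carrier H" "v = act k w" by auto
    then have "act h v = act (h \<otimes>\<^bsub>H\<^esub> k) w" using assms that by (auto simp: is_action_def)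
    then show ?thesis using k that by auto
  qed
  have "act (inv\<^bsub>H\<^esub> h) (act h v) = v" using is_action_inv(1)[OF assms(1,2,4,5)] .
  then show ?thesis using *[of v h] *[of "act h v" "inv\<^bsub>H\<^esub> h"] assms(4) by auto
qed

lemma is_action_diff_orbit:
  assumes "group H" "is_action H act W" "w \<in> W"
  shows "is_action H act (W - (%k. act k w) ` carrier H)"
  using assms(2) orbit_closed[OF assms] unfolding is_action_def by auto

lemma is_action_orbit:
  assumes "group H" "is_action H act W" "w \<in> W"
  shows "is_action H act ((%k. act k w) ` carrier H)"
proof -
  have sub: "(%k. act k w) ` carrier H \<subseteq> W" using assms by (auto simp: is_action_def)
  have "act h v \<in> (%k. act k w) ` carrier H" if "h \<in> carrier H" "v \<in> (%k. act k w) ` carrier H" for h v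
    using orbit_closed[OF assms that(1), of v] that(2) sub by blast
  moreover have "act \<one>\<^bsub>H\<^esub> v = v" if "v \<in> (%k. act k w) ` carrier H" for v
    using that sub assms(2) unfolding is_action_def by blast
  moreover have "act (h \<otimes>\<^bsub>H\<^esub> k) v = act h (act k v)"
    if "v \<in> (%k. act k w) ` carrier H" "h \<in> carrier H" "k \<in> carrier H" for v h k
    using that sub assms(2) unfolding is_action_def by blast
  ultimately show ?thesis unfolding is_action_def by blast
qed

text \<open>A non-fixed orbit has length a positive power of p and f is constant on it, so it
  contributes a multiple of p. The values lie in an arbitrary commutative semiring because the lemma
  serves both for coefficients in O and for plain counting in \<open>nat\<close>.\<close>

lemma pgroup_sum_fixed:
  fixes f :: "'w => 'c::comm_semiring_1"
  assumes H: "group H" "finite (carrier H)" "card (carrier H) = p ^ n" "prime p"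
    and "finite W" "is_action H act W"
    and "!!h w. h \<in> carrier H ==> w \<in> W ==> f (act h w) = f w"
  shows "\<exists>c. sum f W = sum f {w \<in> W. \<forall>h\<in>carrier H. act h w = w} + of_nat p * c"
  using assms(5-)
proof (induction W rule: finite_psubset_induct)
  case (psubset W)
  show ?case
  proof (cases "\<forall>w\<in>W. \<forall>h\<in>carrier H. act h w = w")
    case True
    then have "{w \<in> W. \<forall>h\<in>carrier H. act h w = w} = W" by auto
    then show ?thesis by (auto intro: exI[of _ 0])
  next
    case False
    then obtain w where w: "w \<in> W" "\<not> (\<forall>h\<in>carrier H. act h w = w)" by auto
    interpret group H by fact
    let ?O = "(%k. act k w) ` carrier H"
    have wO: "w \<in> ?O" using psubset.prems(1) w(1) by (auto simp: is_action_def intro!: image_eqI[of _ _ "\<one>\<^bsub>H\<^esub>"])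
    have subO: "?O \<subseteq> W" using psubset.prems(1) w(1) by (auto simp: is_action_def)
    note cs = card_orbit_stabilizer[OF H(1,2) psubset.prems(1) w(1)]
    have "card ?O dvd p ^ n" using cs H(3) by (metis dvd_triv_left)
    then obtain k where k: "card ?O = p ^ k" using H(4) by (metis divides_primepow_nat)
    have "k ~= 0"
    proof
      assume "k = 0"
      then have "card ?O = 1" using k by simp
      then have "?O = {w}" using wO by (metis card_1_singletonE singletonD)
      then show False using w(2) by auto
    qed
    then have "p dvd card ?O" using k by simp
    then obtain j where j: "card ?O = p * j" by auto
    have fO: "sum f ?O = of_nat p * (of_nat j * f w)"
    proof -
      have "sum f ?O = (\<Sum>v\<in>?O. f w)" using psubset.prems(2) w(1) by (intro sum.cong) auto
      then show ?thesis by (simp add: j mult.assoc)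
    qed
    have "W - ?O \<subset> W" using wO w(1) by auto
    from psubset.IH[OF this is_action_diff_orbit[OF H(1) psubset.prems(1) w(1)]] psubset.prems(2)
    obtain c where c: "sum f (W - ?O) = sum f {w \<in> W - ?O. \<forall>h\<in>carrier H. act h w = w} + of_nat p * c"
      by auto
    have nofix: "\<not> (\<forall>h\<in>carrier H. act h v = v)" if "v \<in> ?O" for v
    proof
      assume a: "\<forall>h\<in>carrier H. act h v = v"
      from that obtain k where k: "k \<in> carrier H" "v = act k w" by auto
      have "act (inv\<^bsub>H\<^esub> k) v = w" using is_action_inv(1)[OF H(1) psubset.prems(1) k(1) w(1)] k(2) by simp
      then have "v = w" using a k(1) by auto
      then show False using a w(2) by auto
    qed
    have "{w \<in> W - ?O. \<forall>h\<in>carrier H. act h w = w} = {w \<in> W. \<forall>h\<in>carrier H. act h w = w}"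
      using nofix by auto
    moreover have "sum f W = sum f (W - ?O) + sum f ?O"
      using sum.subset_diff[OF subO psubset.hyps(1)] .
    ultimately have "sum f W = sum f {w \<in> W. \<forall>h\<in>carrier H. act h w = w} + of_nat p * (c + of_nat j * f w)"
      using c fO by (simp add: distrib_left add.assoc)
    then show ?thesis by blast
  qed
qed

definition fixset :: "('h => 'w => 'w) => 'h set => 'w set => 'w set" where
  "fixset act K W = {w \<in> W. \<forall>h\<in>K. act h w = w}"

text \<open>Take x in X with a stabilizer of maximal order. Equal marks give y in Y fixed by the
  stabilizer of x, and then x' in X fixed by the stabilizer of y; maximality forces the stabilizers
  of x and y to coincide. The two orbits are then isomorphic, so they have equal marks and can be
  removed from both sets.\<close>

theorem marks_determine_action:
  assumes H: "group H" "finite (carrier H)"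
    and "finite X" "finite Y" "is_action H a X" "is_action H b Y"
    and "!!K. subgroup K H ==> card (fixset a K X) = card (fixset b K Y)"
  shows "\<exists>\<beta>. bij_betw \<beta> X Y \<and> (\<forall>h\<in>carrier H. \<forall>x\<in>X. \<beta> (a h x) = b h (\<beta> x))"
  using assms(3-)
proof (induction X arbitrary: Y rule: finite_psubset_induct)
  case (psubset X)
  interpret group H by fact
  show ?case
  proof (cases "X = {}")
    case True
    have "fixset b {\<one>\<^bsub>H\<^esub>} Y = Y" using psubset.prems(3) by (auto simp: fixset_def is_action_def)
    moreover have "fixset a {\<one>\<^bsub>H\<^esub>} X = {}" using True by (auto simp: fixset_def)
    ultimately have "Y = {}" using psubset.prems(4)[OF triv_subgroup] psubset.prems(1) by auto
    then show ?thesis using True by (auto simp: bij_betw_def)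
  next
    case False
    let ?sa = "%x. {h \<in> carrier H. a h x = x}" and ?sb = "%x. {h \<in> carrier H. b h x = x}"
    have finS: "finite ((%x. card (?sa x)) ` X)" using psubset.hyps by auto
    obtain x where x: "x \<in> X" and xmax: "!!x'. x' \<in> X ==> card (?sa x') \<le> card (?sa x)"
    proof -
      have "Max ((%x. card (?sa x)) ` X) \<in> (%x. card (?sa x)) ` X" using finS False by (intro Max_in) auto
      then obtain x where "x \<in> X" "Max ((%x. card (?sa x)) ` X) = card (?sa x)" by auto
      then show ?thesis using that[of x] Max_ge[OF finS] by auto
    qed
    have "x \<in> fixset a (?sa x) X" using x by (auto simp: fixset_def)
    then have "card (fixset a (?sa x) X) ~= 0" using psubset.hyps by (auto simp: fixset_def)
    then have "card (fixset b (?sa x) Y) ~= 0"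
      using psubset.prems(4)[OF subgroup_stabilizer[OF H(1) psubset.prems(2) x]] by auto
    then have "fixset b (?sa x) Y ~= {}" by auto
    then obtain y where y: "y \<in> Y" and sub1: "?sa x \<subseteq> ?sb y"
      by (auto simp: fixset_def)
    have "y \<in> fixset b (?sb y) Y" using y by (auto simp: fixset_def)
    then have "card (fixset b (?sb y) Y) ~= 0" using psubset.prems(1) by (auto simp: fixset_def)
    then have "card (fixset a (?sb y) X) ~= 0"
      using psubset.prems(4)[OF subgroup_stabilizer[OF H(1) psubset.prems(3) y]] by auto
    then have "fixset a (?sb y) X ~= {}" by auto
    then obtain x' where x': "x' \<in> X" and sub2: "?sb y \<subseteq> ?sa x'"
      by (auto simp: fixset_def)
    have "card (?sb y) \<le> card (?sa x')" using sub2 H(2) by (intro card_mono) auto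
    then have "card (?sb y) \<le> card (?sa x)" using xmax[OF x'] by simp
    then have stab: "?sa x = ?sb y" using sub1 H(2) by (intro card_seteq) auto
    let ?Ox = "(%h. a h x) ` carrier H" and ?Oy = "(%h. b h y) ` carrier H"
    have eqiff: "a h x = a k x \<longleftrightarrow> b h y = b k y" if hk: "h \<in> carrier H" "k \<in> carrier H" for h k
    proof -
      have "a h x = a k x \<longleftrightarrow> a (inv\<^bsub>H\<^esub> k \<otimes>\<^bsub>H\<^esub> h) x = x"
      proof
        assume "a h x = a k x"
        then show "a (inv\<^bsub>H\<^esub> k \<otimes>\<^bsub>H\<^esub> h) x = x"
          using is_action_inv(1)[OF H(1) psubset.prems(2) hk(2) x] psubset.prems(2) hk x
          by (auto simp: is_action_def)
      next
        assume "a (inv\<^bsub>H\<^esub> k \<otimes>\<^bsub>H\<^esub> h) x = x"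
        then have "a k (a (inv\<^bsub>H\<^esub> k) (a h x)) = a k x"
          using psubset.prems(2) hk x by (auto simp: is_action_def)
        then show "a h x = a k x"
          using is_action_inv(2)[OF H(1) psubset.prems(2) hk(2), of "a h x"] psubset.prems(2) hk x
          by (auto simp: is_action_def)
      qed
      moreover have "b h y = b k y \<longleftrightarrow> b (inv\<^bsub>H\<^esub> k \<otimes>\<^bsub>H\<^esub> h) y = y"
      proof
        assume "b h y = b k y"
        then show "b (inv\<^bsub>H\<^esub> k \<otimes>\<^bsub>H\<^esub> h) y = y"
          using is_action_inv(1)[OF H(1) psubset.prems(3) hk(2) y] psubset.prems(3) hk y
          by (auto simp: is_action_def)
      next
        assume "b (inv\<^bsub>H\<^esub> k \<otimes>\<^bsub>H\<^esub> h) y = y"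
        then have "b k (b (inv\<^bsub>H\<^esub> k) (b h y)) = b k y"
          using psubset.prems(3) hk y by (auto simp: is_action_def)
        then show "b h y = b k y"
          using is_action_inv(2)[OF H(1) psubset.prems(3) hk(2), of "b h y"] psubset.prems(3) hk y
          by (auto simp: is_action_def)
      qed
      moreover have "a (inv\<^bsub>H\<^esub> k \<otimes>\<^bsub>H\<^esub> h) x = x \<longleftrightarrow> b (inv\<^bsub>H\<^esub> k \<otimes>\<^bsub>H\<^esub> h) y = y"
        using stab hk by blast
      ultimately show ?thesis by blast
    qed
    \<comment> \<open>The choice of h does not matter: by \<open>eqiff\<close>, all elements
      carrying x to v carry y to one and the same point.\<close>
    define \<beta>0 where "\<beta>0 v = b (SOME h. h \<in> carrier H \<and> a h x = v) y" for v
    have \<beta>0: "\<beta>0 (a h x) = b h y" if "h \<in> carrier H" for h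
    proof -
      have "\<exists>k. k \<in> carrier H \<and> a k x = a h x" using that by auto
      from someI_ex[OF this] show ?thesis unfolding \<beta>0_def using eqiff that by auto
    qed
    have bij0: "bij_betw \<beta>0 ?Ox ?Oy"
      by (auto simp: bij_betw_def inj_on_def \<beta>0 eqiff image_iff)
    have equiv0: "\<beta>0 (a h v) = b h (\<beta>0 v)" if "h \<in> carrier H" "v \<in> ?Ox" for h v
    proof -
      from that obtain k where k: "k \<in> carrier H" "v = a k x" by auto
      then have "a h v = a (h \<otimes>\<^bsub>H\<^esub> k) x" "b h (b k y) = b (h \<otimes>\<^bsub>H\<^esub> k) y"
        using psubset.prems(2,3) that x y by (auto simp: is_action_def)
      then show ?thesis using k that by (simp add: \<beta>0)
    qed
    have subx: "?Ox \<subseteq> X" and suby: "?Oy \<subseteq> Y" using psubset.prems(2,3) x y by (auto simp: is_action_def)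
    have xO: "x \<in> ?Ox" using psubset.prems(2) x by (auto simp: is_action_def intro!: image_eqI[of _ _ "\<one>\<^bsub>H\<^esub>"])
    have marks: "card (fixset a K (X - ?Ox)) = card (fixset b K (Y - ?Oy))" if K: "subgroup K H" for K
    proof -
      have KH: "K \<subseteq> carrier H" using K by (rule subgroup.subset)
      have "bij_betw \<beta>0 (fixset a K ?Ox) (fixset b K ?Oy)"
      proof (rule bij_betw_subset[OF bij0])
        show "fixset a K ?Ox \<subseteq> ?Ox" by (auto simp: fixset_def)
        have 1: "a h v = v \<longleftrightarrow> b h (\<beta>0 v) = \<beta>0 v" if "v \<in> ?Ox" "h \<in> K" for h v
        proof -
          have "a h v \<in> ?Ox"
            using is_action_orbit[OF H(1) psubset.prems(2) x] that KH by (auto simp: is_action_def)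
          then show ?thesis using bij0 that equiv0[of h v] KH unfolding bij_betw_def inj_on_def
            by (metis subsetD)
        qed
        show "\<beta>0 ` fixset a K ?Ox = fixset b K ?Oy"
        proof
          show "\<beta>0 ` fixset a K ?Ox \<subseteq> fixset b K ?Oy"
            using 1 bij0 unfolding fixset_def bij_betw_def by blast
          show "fixset b K ?Oy \<subseteq> \<beta>0 ` fixset a K ?Ox"
          proof
            fix u assume u: "u \<in> fixset b K ?Oy"
            then obtain v where v: "v \<in> ?Ox" "u = \<beta>0 v" using bij0 unfolding bij_betw_def fixset_def by blast
            then have "v \<in> fixset a K ?Ox" using 1 u unfolding fixset_def by blast
            then show "u \<in> \<beta>0 ` fixset a K ?Ox" using v by blast
          qed
        qed
      qed
      then have e0: "card (fixset a K ?Ox) = card (fixset b K ?Oy)" by (rule bij_betw_same_card)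
      have "fixset a K X = fixset a K (X - ?Ox) \<union> fixset a K ?Ox"
        "fixset b K Y = fixset b K (Y - ?Oy) \<union> fixset b K ?Oy"
        using subx suby by (auto simp: fixset_def)
      moreover have "card (fixset a K (X - ?Ox) \<union> fixset a K ?Ox) = card (fixset a K (X - ?Ox)) + card (fixset a K ?Ox)"
        by (rule card_Un_disjoint) (use psubset.hyps(1) H(2) in \<open>auto simp: fixset_def\<close>)
      moreover have "card (fixset b K (Y - ?Oy) \<union> fixset b K ?Oy) = card (fixset b K (Y - ?Oy)) + card (fixset b K ?Oy)"
        by (rule card_Un_disjoint) (use psubset.prems(1) H(2) in \<open>auto simp: fixset_def\<close>)
      ultimately show ?thesis using psubset.prems(4)[OF K] e0 by simp
    qed
    have "X - ?Ox \<subset> X" using xO x by auto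
    from psubset.IH[OF this _ is_action_diff_orbit[OF H(1) psubset.prems(2) x] is_action_diff_orbit[OF H(1) psubset.prems(3) y] marks]
    obtain \<beta>' where \<beta>': "bij_betw \<beta>' (X - ?Ox) (Y - ?Oy)" "!!h v. h \<in> carrier H ==> v \<in> X - ?Ox ==> \<beta>' (a h v) = b h (\<beta>' v)"
      using psubset.prems(1) by auto
    define \<beta> where "\<beta> v = (if v \<in> ?Ox then \<beta>0 v else \<beta>' v)" for v
    have "bij_betw \<beta> (?Ox \<union> (X - ?Ox)) (?Oy \<union> (Y - ?Oy))"
    proof (rule bij_betw_combine)
      show "bij_betw \<beta> ?Ox ?Oy" using bij0 by (subst bij_betw_cong[where g = \<beta>0]) (auto simp: \<beta>_def)
      show "bij_betw \<beta> (X - ?Ox) (Y - ?Oy)" using \<beta>'(1) by (subst bij_betw_cong[where g = \<beta>']) (auto simp: \<beta>_def)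
    qed auto
    moreover have "?Ox \<union> (X - ?Ox) = X" "?Oy \<union> (Y - ?Oy) = Y" using subx suby by auto
    moreover have "\<beta> (a h v) = b h (\<beta> v)" if "h \<in> carrier H" "v \<in> X" for h v
      using orbit_closed[OF H(1) psubset.prems(2) x that(1) that(2)] equiv0[OF that(1)] \<beta>'(2)[OF that(1)] that(2)
      by (auto simp: \<beta>_def)
    ultimately show ?thesis by (metis (no_types, lifting))
  qed
qed

section \<open>Linear algebra and polynomials modulo a local ideal\<close>

locale local_ideal =
  fixes m :: "'o::idom set"
  assumes ideal: "ring_ideal m" and one_notin: "1 \<notin> m" and unit: "x \<notin> m ==> \<exists>y. x * y = 1"
begin

lemma m_zero [simp]: "0 \<in> m" and m_add: "x \<in> m ==> y \<in> m ==> x + y \<in> m"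
  and m_mult: "x \<in> m ==> r * x \<in> m"
  using ideal by (auto simp: ring_ideal_def)

lemma m_mult2: "x \<in> m ==> x * r \<in> m" using m_mult[of x r] by (simp add: mult.commute)
lemma m_minus: "x \<in> m ==> - x \<in> m" using m_mult[of x "-1"] by simp
lemma m_diff: "x \<in> m ==> y \<in> m ==> x - y \<in> m" using m_add[of x "-y"] m_minus by simp
lemma m_sum: "(!!i. i \<in> A ==> f i \<in> m) ==> sum f A \<in> m"
  by (induction A rule: infinite_finite_induct) (auto intro: m_add)
lemma m_trans: "x - y \<in> m ==> y - z \<in> m ==> x - z \<in> m"
  using m_add[of "x - y" "y - z"] by simp
lemma m_cong: "x - y \<in> m ==> x \<in> m \<longleftrightarrow> y \<in> m"
  using m_add[of "x - y" y] m_diff[of x "x - y"] by auto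
text \<open>Gaussian elimination over the residue field, written as congruences modulo
  \<open>m\<close>: a pivot outside \<open>m\<close> is inverted and its variable removed. This
  takes the place of dimension counts: it gives a polynomial relation for an element, bounds
  orthogonal families of idempotents and compares Brauer quotients.\<close>

lemma kernel_vector:
  assumes "finite I" "finite J" "card I < card J"
  shows "\<exists>v. (\<exists>j\<in>J. v j \<notin> m) \<and> (\<forall>i\<in>I. (\<Sum>j\<in>J. A i j * v j) \<in> m)"
  using assms
proof (induction I arbitrary: J A rule: finite_induct)
  case empty
  then have "J ~= {}" by auto
  then show ?case using one_notin by (intro exI[of _ "%_. 1"]) auto
next
  case (insert i0 I)
  show ?case
  proof (cases "\<forall>j\<in>J. A i0 j \<in> m")
    case True
    have "card I < card J" using insert by auto
    from insert.IH[OF insert.prems(1) this, of A]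
    obtain v where "\<exists>j\<in>J. v j \<notin> m" "\<forall>i\<in>I. (\<Sum>j\<in>J. A i j * v j) \<in> m" by auto
    then show ?thesis using True by (intro exI[of _ v]) (auto intro!: m_sum m_mult2)
  next
    case False
    then obtain j0 where j0: "j0 \<in> J" "A i0 j0 \<notin> m" by auto
    then obtain w where w: "A i0 j0 * w = 1" using unit by auto
    have "card I < card (J - {j0})" using insert j0 by auto
    from insert.IH[OF _ this, of "%i j. A i j - A i j0 * w * A i0 j"] insert.prems
    obtain v where v: "\<exists>j\<in>J - {j0}. v j \<notin> m"
      "!!i. i \<in> I ==> (\<Sum>j\<in>J - {j0}. (A i j - A i j0 * w * A i0 j) * v j) \<in> m" by auto
    define s where "s = (\<Sum>j\<in>J - {j0}. A i0 j * v j)"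
    \<comment> \<open>The pivot variable is chosen so that equation \<open>i0\<close> holds exactly;
      the reduced rows then give back the other equations.\<close>
    define u where "u = v(j0 := - w * s)"
    have split: "(\<Sum>j\<in>J. A i j * u j) = A i j0 * (- w * s) + (\<Sum>j\<in>J - {j0}. A i j * v j)" for i
    proof -
      have "(\<Sum>j\<in>J. A i j * u j) = A i j0 * u j0 + (\<Sum>j\<in>J - {j0}. A i j * u j)"
        using insert.prems j0 by (simp add: sum.remove)
      moreover have "(\<Sum>j\<in>J - {j0}. A i j * u j) = (\<Sum>j\<in>J - {j0}. A i j * v j)"
        by (rule sum.cong) (auto simp: u_def)
      ultimately show ?thesis by (simp add: u_def)
    qed
    have "(\<Sum>j\<in>J. A i0 j * u j) = 0"
    proof -
      have "A i0 j0 * (- w * s) = - s" using w by (metis mult.assoc mult_minus_left mult_minus_right mult_1)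
      then show ?thesis unfolding split by (simp add: s_def)
    qed
    moreover have "(\<Sum>j\<in>J. A i j * u j) \<in> m" if "i \<in> I" for i
    proof -
      have "(\<Sum>j\<in>J - {j0}. (A i j - A i j0 * w * A i0 j) * v j) = (\<Sum>j\<in>J - {j0}. A i j * v j) - A i j0 * w * s"
        by (simp add: s_def sum_distrib_left left_diff_distrib sum_subtractf mult.assoc)
      then have "(\<Sum>j\<in>J. A i j * u j) = (\<Sum>j\<in>J - {j0}. (A i j - A i j0 * w * A i0 j) * v j)"
        unfolding split by simp
      then show ?thesis using v(2)[OF that] by simp
    qed
    moreover have "\<exists>j\<in>J. u j \<notin> m" using v(1) by (auto simp: u_def)
    ultimately show ?thesis by (intro exI[of _ u]) auto
  qed
qed

end

primrec matpow :: "'i set => ('i => 'i => 'o::comm_ring_1) => nat => 'i => 'i => 'o" where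
  "matpow I M 0 = (%i j. if i = j then 1 else 0)"
| "matpow I M (Suc n) = (%i j. \<Sum>k\<in>I. M i k * matpow I M n k j)"

context local_ideal
begin

text \<open>A column v of the last power of M that is nonzero modulo \<open>m\<close> lies in the
  kernel of M. On the quotient by v, with the coordinate i eliminated where v is a unit, M induces
  the smaller matrix \<open>M'\<close>, which is again nilpotent and has the same trace modulo
  \<open>m\<close>.\<close>

lemma trace_nilpotent:
  assumes "finite I" "!!i j. i \<in> I ==> j \<in> I ==> matpow I M N i j \<in> m"
  shows "(\<Sum>i\<in>I. M i i) \<in> m"
  using assms
proof (induction "card I" arbitrary: I M N)
  case 0
  then show ?case by auto
next
  case (Suc c)
  define P where "P n \<longleftrightarrow> (\<forall>i\<in>I. \<forall>j\<in>I. matpow I M n i j \<in> m)" for n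
  have "P N" using Suc by (auto simp: P_def)
  then have PL: "P (LEAST n. P n)" by (rule LeastI)
  have "\<not> P 0" using one_notin Suc.hyps(2) by (auto simp: P_def) (metis card.empty ex_in_conv nat.simps(3))
  then obtain n where n: "(LEAST n. P n) = Suc n" using PL by (cases "LEAST n. P n") auto
  then have "\<not> P n" using not_less_Least[of n P] by auto
  then obtain i j where ij: "i \<in> I" "j \<in> I" "matpow I M n i j \<notin> m" by (auto simp: P_def)
  define v where "v k = matpow I M n k j" for k
  have Mv: "(\<Sum>l\<in>I. M k l * v l) \<in> m" if "k \<in> I" for k
    using PL n ij that by (auto simp: P_def v_def)
  obtain w where w: "v i * w = 1" using unit ij(3) by (auto simp: v_def)
  define M' where "M' k l = M k l - v k * w * M i l" for k l
  let ?I = "I - {i}"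
  have pw: "matpow ?I M' n k l - (matpow I M n k l - v k * w * matpow I M n i l) \<in> m"
    if "k \<in> ?I" "l \<in> ?I" for n k l
    using that
  proof (induction n arbitrary: k)
    case 0
    then show ?case by auto
  next
    case (Suc n)
    let ?Q = "%t. matpow I M n t l"
    have a: "matpow ?I M' (Suc n) k l - (\<Sum>t\<in>?I. M' k t * (?Q t - v t * w * ?Q i)) \<in> m"
    proof -
      have "matpow ?I M' (Suc n) k l - (\<Sum>t\<in>?I. M' k t * (?Q t - v t * w * ?Q i))
        = (\<Sum>t\<in>?I. M' k t * (matpow ?I M' n t l - (?Q t - v t * w * ?Q i)))"
        by (simp add: right_diff_distrib sum_subtractf)
      also have "\<dots> \<in> m" using Suc by (intro m_sum m_mult) auto
      finally show ?thesis .
    qed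
    \<comment> \<open>The term t = i vanishes, so the sum may run over all of I; the entries of M v,
      which lie in \<open>m\<close>, can then be split off.\<close>
    have "?Q i - v i * w * ?Q i = 0" using w by simp
    then have "(\<Sum>t\<in>?I. M' k t * (?Q t - v t * w * ?Q i)) = (\<Sum>t\<in>I. M' k t * (?Q t - v t * w * ?Q i))"
      using Suc.prems ij \<open>finite I\<close> by (simp add: sum.remove[of I i])
    also have "\<dots> = (\<Sum>t\<in>I. M k t * ?Q t) - v k * w * (\<Sum>t\<in>I. M i t * ?Q t)
        - w * ?Q i * (\<Sum>t\<in>I. M k t * v t) + v k * w * w * ?Q i * (\<Sum>t\<in>I. M i t * v t)"
      by (simp add: M'_def algebra_simps sum.distrib sum_subtractf sum_distrib_left)
    finally have b: "(\<Sum>t\<in>?I. M' k t * (?Q t - v t * w * ?Q i))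
        - (matpow I M (Suc n) k l - v k * w * matpow I M (Suc n) i l)
        = v k * w * w * ?Q i * (\<Sum>t\<in>I. M i t * v t) - w * ?Q i * (\<Sum>t\<in>I. M k t * v t)"
      by simp
    have d: "\<dots> \<in> m" using Mv Suc.prems ij by (intro m_diff m_mult) auto
    have "(\<Sum>t\<in>?I. M' k t * (?Q t - v t * w * ?Q i))
        - (matpow I M (Suc n) k l - v k * w * matpow I M (Suc n) i l) \<in> m"
      unfolding b by (rule d)
    with a show ?case by (rule m_trans)
  qed
  have "(\<Sum>k\<in>?I. M' k k) \<in> m"
  proof (rule Suc.hyps(1)[where M = M' and N = N])
    show "c = card ?I" "finite ?I" using Suc ij by auto
    fix k l assume kl: "k \<in> ?I" "l \<in> ?I"
    have "matpow I M N k l - v k * w * matpow I M N i l \<in> m"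
      using Suc.prems(2) kl ij by (intro m_diff m_mult) auto
    then show "matpow ?I M' N k l \<in> m" using pw[OF kl, of N] m_cong by blast
  qed
  moreover have "(\<Sum>k\<in>?I. M' k k) = (\<Sum>k\<in>I. M k k) - w * (\<Sum>k\<in>I. M i k * v k)"
  proof -
    have "M' i i = 0" using w by (simp add: M'_def)
    then have "(\<Sum>k\<in>?I. M' k k) = (\<Sum>k\<in>I. M' k k)"
      using Suc.prems ij by (simp add: sum.remove[of I i])
    then show ?thesis by (simp add: M'_def sum_subtractf sum_distrib_left mult_ac)
  qed
  ultimately have "(\<Sum>k\<in>I. M k k) - w * (\<Sum>k\<in>I. M i k * v k) \<in> m" by simp
  then show ?case using m_cong m_mult[OF Mv[OF ij(1)]] by (metis diff_add_cancel m_add)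
qed

lemma monic_synthetic_div:
  assumes "lead_coeff (g::'o poly) = 1" "degree g ~= 0"
  obtains q where "[:-c, 1:] * q = g - [:poly g c:]" "lead_coeff q = 1" "degree g = Suc (degree q)"
proof -
  let ?q = "synthetic_div g c"
  have eq: "g = [:-c, 1:] * ?q + [:poly g c:]" by (rule synthetic_div_correct'[symmetric])
  have deg: "degree g = Suc (degree ?q)" using assms(2) by (simp add: degree_synthetic_div)
  have "coeff g (degree g) = coeff ([:-c, 1:] * ?q + [:poly g c:]) (degree g)" by (subst (1) eq) simp
  also have "\<dots> = lead_coeff ?q" by (simp add: deg coeff_pCons coeff_eq_0)
  finally have "lead_coeff ?q = 1" using assms(1) by simp
  moreover have "[:-c, 1:] * ?q = g - [:poly g c:]" by (subst synthetic_div_correct'[symmetric, of g c]) simp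
  ultimately show ?thesis using that deg by blast
qed

lemma bezout_power:
  fixes h y :: "'c::comm_ring_1"
  assumes "1 = h * s' + y * t'"
  shows "\<exists>s t. 1 = h * s + y ^ r * t"
proof (induction r)
  case 0
  show ?case by (intro exI[of _ 0] exI[of _ 1]) simp
next
  case (Suc r)
  then obtain s t where st: "1 = h * s + y ^ r * t" by auto
  have "1 = (h * s + y ^ r * t) * (h * s' + y * t')" by (simp only: st[symmetric] assms[symmetric] mult_1)
  also have "\<dots> = h * (s * (h * s' + y * t') + y ^ r * t * s') + y ^ Suc r * (t * t')"
    by (simp add: algebra_simps)
  finally show ?case by blast
qed

text \<open>O[x]/I is a nonzero finite-dimensional algebra over k with only trivial idempotents, so
  it is local, and x has a single eigenvalue c because k is algebraically closed. Concretely, a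
  monic g of least degree in I has a root c modulo \<open>m\<close>; if the powers of x - c did not
  exhaust g modulo I, the complementary factor would produce an idempotent.\<close>

lemma poly_ideal_local:
  fixes I :: "'o poly set"
  assumes AC: "!!n (c::nat => 'o). n \<ge> 1 ==> \<exists>x. x ^ n + (\<Sum>i<n. c i * x ^ i) \<in> m"
    and I: "ring_ideal I" "1 \<notin> I" "!!c. c \<in> m ==> [:c:] \<in> I"
    and idem: "!!f. f * f - f \<in> I ==> f \<in> I \<or> 1 - f \<in> I"
    and f0: "f0 \<in> I" "coeff f0 k0 \<notin> m"
  shows "\<exists>c N. [:- c, 1:] ^ N \<in> I"
proof -
  have I0: "0 \<in> I" and Iadd: "!!x y. x \<in> I ==> y \<in> I ==> x + y \<in> I" and Imult: "!!x r. x \<in> I ==> r * x \<in> I"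
    using I(1) by (auto simp: ring_ideal_def)
  have Imult2: "x * r \<in> I" if "x \<in> I" for x r using Imult[OF that, of r] by (simp add: mult.commute)
  have Idiff: "x - y \<in> I" if "x \<in> I" "y \<in> I" for x y using Iadd[OF that(1) Imult[OF that(2), of "-1"]] by simp
  have coefm: "f \<in> I" if "\<forall>i. coeff f i \<in> m" for f
    using that
  proof (induction f)
    case 0
    then show ?case by (simp add: I0)
  next
    case (pCons a f)
    have "a \<in> m" using pCons.prems[rule_format, of 0] by simp
    moreover have "\<forall>i. coeff f i \<in> m" using pCons.prems by (metis coeff_pCons_Suc)
    ultimately have "[:a:] + [:0, 1:] * f \<in> I" using pCons.IH I(3) by (intro Iadd Imult) auto
    then show ?case by simp
  qed
  define Mon where "Mon n \<longleftrightarrow> (\<exists>g\<in>I. lead_coeff g = 1 \<and> degree g = n)" for n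
  have "\<exists>n. Mon n"
  proof -
    let ?A = "{i. coeff f0 i \<notin> m}"
    have finA: "finite ?A"
    proof (rule finite_subset)
      show "?A \<subseteq> {..degree f0}" using coeff_eq_0[of f0] by (auto simp: not_less[symmetric])
    qed simp
    \<comment> \<open>Polynomials with all coefficients in \<open>m\<close> belong to I, so f0 can
      be cut off after its last coefficient outside \<open>m\<close> and then scaled to a monic
      polynomial.\<close>
    define k where "k = Max ?A"
    have kA: "coeff f0 k \<notin> m" using Max_in[OF finA] f0(2) unfolding k_def by blast
    have kmax: "coeff f0 i \<in> m" if "i > k" for i using Max_ge[OF finA, of i] that unfolding k_def by force
    let ?g = "poly_cutoff (Suc k) f0"
    have "f0 - ?g \<in> I" by (rule coefm) (auto simp: coeff_poly_cutoff kmax)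
    from Idiff[OF f0(1) this] have gI: "?g \<in> I" by simp
    obtain w where w: "coeff f0 k * w = 1" using unit[OF kA] by auto
    have "coeff ([:w:] * ?g) k = 1" using w by (simp add: coeff_poly_cutoff mult.commute)
    moreover have "degree ([:w:] * ?g) \<le> k" by (rule degree_le) (auto simp: coeff_poly_cutoff)
    ultimately have "degree ([:w:] * ?g) = k" using le_degree[of "[:w:] * ?g" k] by force
    then have "lead_coeff ([:w:] * ?g) = 1" using \<open>coeff ([:w:] * ?g) k = 1\<close> by simp
    then show ?thesis using Imult[OF gI, of "[:w:]"] unfolding Mon_def by blast
  qed
  then have "Mon (LEAST n. Mon n)" by (rule LeastI_ex)
  define n where "n = (LEAST n. Mon n)"
  have nmin: "\<not> Mon j" if "j < n" for j using not_less_Least[of j Mon] that unfolding n_def by auto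
  obtain g where g: "g \<in> I" "lead_coeff g = 1" "degree g = n"
    using \<open>Mon (LEAST n. Mon n)\<close> unfolding n_def[symmetric] by (auto simp: Mon_def)
  have n0: "n ~= 0"
  proof
    assume "n = 0"
    then obtain a where "g = [:a:]" using g(3) degree_0_id by metis
    then show False using g(1,2) I(2) by (auto simp: one_pCons)
  qed
  obtain c where c: "poly g c \<in> m"
  proof -
    have "poly g x = x ^ n + (\<Sum>i<n. coeff g i * x ^ i)" for x
      using g(2,3) by (simp add: poly_altdef lessThan_Suc_atMost[symmetric])
    then show ?thesis using AC[of n "coeff g"] n0 that by (metis One_nat_def Suc_leI neq0_conv)
  qed
  let ?y = "[:- c, 1:]"
  \<comment> \<open>r factors x - c have been split off modulo I, leaving a monic cofactor of degree
    n - r. Degrees bound r, so a largest r exists; there h(c) is a unit, since otherwise one more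
    synthetic division would leave a remainder absorbed by I.\<close>
  define R where "R r \<longleftrightarrow> (\<exists>h. lead_coeff h = 1 \<and> degree h + r = n \<and> ?y ^ r * h \<in> I)" for r
  have step: "?y ^ Suc r * q \<in> I" if "?y ^ r * h \<in> I" "?y * q = h - [:poly h c:]" "poly h c \<in> m" for r h q
  proof -
    have "?y ^ Suc r * q = ?y ^ r * (?y * q)" by (simp only: power_Suc2 mult.assoc)
    also have "?y * q = h - [:poly h c:]" by (rule that(2))
    also have "?y ^ r * (h - [:poly h c:]) = ?y ^ r * h - ?y ^ r * [:poly h c:]" by (rule right_diff_distrib)
    also have "\<dots> \<in> I" by (intro Idiff that Imult I)
    finally show ?thesis .
  qed
  have R1: "R 1"
  proof -
    obtain q where q: "?y * q = g - [:poly g c:]" "lead_coeff q = 1" "degree g = Suc (degree q)"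
      using monic_synthetic_div[OF g(2), of c] g(3) n0 by metis
    show ?thesis unfolding R_def using step[of 0 g q] q c g by (intro exI[of _ q]) auto
  qed
  define r where "r = Max {r. R r}"
  have finR: "finite {r. R r}" by (rule finite_subset[of _ "{..n}"]) (auto simp: R_def)
  have "R r" unfolding r_def using Max_in[OF finR] R1 by blast
  then obtain h where h: "lead_coeff h = 1" "degree h + r = n" "?y ^ r * h \<in> I" by (auto simp: R_def)
  have r1: "r \<ge> 1" using Max_ge[OF finR, of 1] R1 by (simp add: r_def)
  have rmax: "\<not> R (Suc r)" using Max_ge[OF finR, of "Suc r"] by (auto simp: r_def)
  show ?thesis
  proof (cases "degree h = 0")
    case True
    then obtain a where "h = [:a:]" using degree_0_id by metis
    then show ?thesis using h by (intro exI[of _ c] exI[of _ r]) auto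
  next
    case False
    obtain q where q: "?y * q = h - [:poly h c:]" "lead_coeff q = 1" "degree h = Suc (degree q)"
      using monic_synthetic_div[OF h(1) False, of c] by metis
    have "poly h c \<notin> m" using step[OF h(3) q(1)] q h rmax unfolding R_def by auto
    then obtain w where w: "poly h c * w = 1" using unit by auto
    have "h * v + y * (- (q * v)) = (h - y * q) * v" for v y :: "'o poly" by (simp add: algebra_simps)
    then have "h * [:w:] + ?y * (- (q * [:w:])) = (h - ?y * q) * [:w:]" .
    also have "h - ?y * q = [:poly h c:]" using q(1) by simp
    also have "[:poly h c:] * [:w:] = 1" using w by (simp add: one_pCons mult.commute)
    finally obtain s t where st: "1 = h * s + ?y ^ r * t"
      using bezout_power[of h "[:w:]" ?y "- (q * [:w:])" r] by metis
    \<comment> \<open>From 1 = h s + (x - c)^r t and (x - c)^r h in I, the product h s is idempotent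
      modulo I. If h s is in I then so is h, against the minimality of n; if 1 - h s is in I then so
      is (x - c)^r.\<close>
    have "h * s * (h * s) - h * s = - (s * t) * (?y ^ r * h)"
    proof -
      have "h * s - 1 = - (?y ^ r * t)" using st by (metis add_diff_cancel_left' minus_diff_eq)
      moreover have "h * s * (- (Y * t)) = - (s * t) * (Y * h)" for Y :: "'o poly"
        by (simp add: algebra_simps)
      ultimately have "h * s * (h * s - 1) = - (s * t) * (?y ^ r * h)" by (simp only:)
      then show ?thesis by (simp only: right_diff_distrib mult_1_right)
    qed
    then have "h * s \<in> I \<or> 1 - h * s \<in> I" using idem[of "h * s"] Imult[OF h(3)] by metis
    then show ?thesis
    proof
      assume a: "h * s \<in> I"
      have "h * (h * s + Y * t) = h * (h * s) + t * (Y * h)" for Y :: "'o poly" by (simp add: algebra_simps)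
      then have "h = h * (h * s) + t * (?y ^ r * h)" using st by (metis mult_1_right)
      also have "\<dots> \<in> I" by (intro Iadd Imult a h)
      finally have "Mon (degree h)" using h(1) by (auto simp: Mon_def)
      then show ?thesis using nmin[of "degree h"] h(2) r1 by auto
    next
      assume a: "1 - h * s \<in> I"
      have "Y = s * (Y * h) + Y * (1 - h * s)" for Y :: "'o poly" by (simp add: algebra_simps)
      then have "?y ^ r = s * (?y ^ r * h) + ?y ^ r * (1 - h * s)" .
      also have "\<dots> \<in> I" by (intro Iadd Imult a h)
      finally show ?thesis by blast
    qed
  qed
qed

end

section \<open>Powers of the maximal ideal and Krull's intersection theorem\<close>

lemma ring_idealD:
  assumes "ring_ideal I"
  shows "0 \<in> I" "x \<in> I ==> y \<in> I ==> x + y \<in> I" "x \<in> I ==> r * x \<in> I" "x \<in> I ==> x * r \<in> I"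
    "x \<in> I ==> y \<in> I ==> x - y \<in> I" "(!!i. i \<in> A ==> f i \<in> I) ==> sum f A \<in> I"
proof -
  show 0: "0 \<in> I" and a: "x \<in> I ==> y \<in> I ==> x + y \<in> I" and m: "x \<in> I ==> r * x \<in> I" for x y r
    using assms by (auto simp: ring_ideal_def)
  show "x \<in> I ==> x * r \<in> I" using m[of x r] by (simp add: mult.commute)
  show "x \<in> I ==> y \<in> I ==> x - y \<in> I" using a[of x "-1 * y"] m[of y "-1"] by simp
  show "(!!i. i \<in> A ==> f i \<in> I) ==> sum f A \<in> I"
    by (induction A rule: infinite_finite_induct) (auto intro: 0 a)
qed

lemma mpow_Suc_induct:
  assumes "z \<in> mpow m (Suc k)" "P 0" "!!z a b. P z ==> a \<in> m ==> b \<in> mpow m k ==> P (z + a * b)"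
  shows "P z"
proof -
  obtain n x y where z: "z = (\<Sum>i<n. x i * y i)" and xy: "!!i. i < (n::nat) ==> x i \<in> m \<and> y i \<in> mpow m k"
    using assms(1) by auto
  have "j \<le> n ==> P (\<Sum>i<j. x i * y i)" for j
    by (induction j) (use assms(2,3) xy in auto)
  then show ?thesis by (simp add: z)
qed

lemma mpow_Suc_zero: "0 \<in> mpow m (Suc k)"
  by (auto intro!: exI[of _ 0])

lemma mpow_Suc_add_prod:
  assumes "z \<in> mpow m (Suc k)" "a \<in> m" "b \<in> mpow m k"
  shows "z + a * b \<in> mpow m (Suc k)"
proof -
  obtain n x y where z: "z = (\<Sum>i<n. x i * y i)" and xy: "!!i. i < (n::nat) ==> x i \<in> m \<and> y i \<in> mpow m k"
    using assms(1) by auto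
  have "z + a * b = (\<Sum>i<Suc n. (x(n := a)) i * (y(n := b)) i)" by (simp add: z)
  moreover have "\<forall>i<Suc n. (x(n := a)) i \<in> m \<and> (y(n := b)) i \<in> mpow m k" using xy assms by auto
  ultimately show ?thesis unfolding mpow.simps by blast
qed

lemma mpow_Suc_prod: "a \<in> m ==> b \<in> mpow m k ==> a * b \<in> mpow m (Suc k)"
  using mpow_Suc_add_prod[OF mpow_Suc_zero] by fastforce

lemma ring_ideal_mpow:
  assumes "ring_ideal m"
  shows "ring_ideal (mpow m k)"
proof (induction k)
  case 0
  then show ?case by (auto simp: ring_ideal_def)
next
  case (Suc k)
  have add: "z + w \<in> mpow m (Suc k)" if "z \<in> mpow m (Suc k)" "w \<in> mpow m (Suc k)" for z w
    by (rule mpow_Suc_induct[OF that(2)]) (use that(1) mpow_Suc_add_prod in \<open>auto simp: add.assoc[symmetric] simp del: mpow.simps\<close>)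
  have mult: "r * z \<in> mpow m (Suc k)" if "z \<in> mpow m (Suc k)" for r z
  proof (rule mpow_Suc_induct[OF that])
    show "r * 0 \<in> mpow m (Suc k)" by (simp only: mult_zero_right mpow_Suc_zero)
    fix z a b assume "r * z \<in> mpow m (Suc k)" "a \<in> m" "b \<in> mpow m k"
    then have "r * z + (r * a) * b \<in> mpow m (Suc k)"
      using ring_idealD(3)[OF assms] by (intro mpow_Suc_add_prod) auto
    then show "r * (z + a * b) \<in> mpow m (Suc k)" by (simp only: distrib_left mult.assoc)
  qed
  show ?case unfolding ring_ideal_def using add mult mpow_Suc_zero by blast
qed

lemma mpow_1: "ring_ideal m ==> mpow m (Suc 0) = m"
proof
  assume m: "ring_ideal m"
  show "mpow m (Suc 0) \<subseteq> m"
    by (auto intro!: ring_idealD(6)[OF m] ring_idealD(4)[OF m])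
  show "m \<subseteq> mpow m (Suc 0)"
    using mpow_Suc_prod[of _ m 1 0] by fastforce
qed

lemma mpow_Suc_subset:
  assumes "ring_ideal m" "z \<in> mpow m (Suc k)"
  shows "z \<in> mpow m k"
  by (rule mpow_Suc_induct[OF assms(2)])
    (use ring_ideal_mpow[OF assms(1), of k] in \<open>auto simp: ring_ideal_def\<close>)

lemma mpow_mono:
  assumes "ring_ideal m" "j \<le> k" "z \<in> mpow m k"
  shows "z \<in> mpow m j"
  using assms(2,3) by (induction k rule: dec_induct) (use mpow_Suc_subset[OF assms(1)] in blast)+

text \<open>Sums of products from m^j and m^k exhaust m^(j+k); the identity is stated as an
  induction rule.\<close>

lemma mpow_add_induct:
  assumes "ring_ideal m" "z \<in> mpow m (j + k)" "P 0"
    "!!z u v. P z ==> u \<in> mpow m j ==> v \<in> mpow m k ==> P (z + u * v)"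
  shows "P z"
  using assms(2-)
proof (induction j arbitrary: P z)
  case 0
  then show ?case using "0.prems"(3)[of 0 1 z] by simp
next
  case (Suc j)
  have "z \<in> mpow m (Suc (j + k))" using Suc.prems(1) by simp
  then show ?case
  proof (rule mpow_Suc_induct)
    show "P 0" by fact
    fix z a b assume z: "P z" and ab: "a \<in> m" "b \<in> mpow m (j + k)"
    show "P (z + a * b)"
    proof (rule Suc.IH[OF ab(2), of "%w. P (z + a * w)"])
      show "P (z + a * 0)" using z by simp
      fix w u v assume "P (z + a * w)" "u \<in> mpow m j" "v \<in> mpow m k"
      then have "P (z + a * w + (a * u) * v)"
        using mpow_Suc_prod[OF ab(1)] Suc.prems(3) by blast
      then show "P (z + a * (w + u * v))" by (simp add: algebra_simps)
    qed
  qed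
qed

text \<open>Modulo I the power m^n lies in the principal ideal (a), hence m^(n t) lies in (a^t), and
  t = s finishes.\<close>

lemma nilpotent_generator:
  assumes m: "ring_ideal m" and I: "ring_ideal I" and a: "a ^ s \<in> I"
    and n: "!!z. z \<in> mpow m n ==> \<exists>r. z - r * a \<in> I"
  shows "mpow m (n * s) \<subseteq> I"
proof -
  note Id = ring_idealD[OF I]
  have "\<exists>r. z - r * a ^ t \<in> I" if "z \<in> mpow m (n * t)" for z t
    using that
  proof (induction t arbitrary: z)
    case 0
    show ?case by (rule exI[of _ z]) (simp add: Id)
  next
    case (Suc t)
    have "z \<in> mpow m (n + n * t)" using Suc.prems by simp
    then show ?case
    proof (rule mpow_add_induct[OF m])
      show "\<exists>r. 0 - r * a ^ Suc t \<in> I" by (rule exI[of _ 0]) (simp add: Id)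
      fix z u v assume "\<exists>r. z - r * a ^ Suc t \<in> I" and u: "u \<in> mpow m n" and v: "v \<in> mpow m (n * t)"
      then obtain r where r: "z - r * a ^ Suc t \<in> I" by blast
      obtain r1 where r1: "u - r1 * a \<in> I" using n[OF u] by blast
      obtain r2 where r2: "v - r2 * a ^ t \<in> I" using Suc.IH[OF v] by blast
      have "(z - r * a ^ Suc t) + ((u - r1 * a) * v + r1 * a * (v - r2 * a ^ t)) \<in> I"
        by (intro Id r r1 r2)
      also have "(z - r * a ^ Suc t) + ((u - r1 * a) * v + r1 * a * (v - r2 * a ^ t)) = z + u * v - (r + r1 * r2) * a ^ Suc t"
        by (simp add: algebra_simps)
      finally show "\<exists>r. z + u * v - r * a ^ Suc t \<in> I" by blast
    qed
  qed
  then show ?thesis using a Id(5)[of _ "_ * a ^ s"] Id(2,3)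
    by (metis diff_add_cancel subsetI)
qed

definition ideal_add :: "'o::comm_ring_1 set => 'o => 'o set" where
  "ideal_add K a = {z. \<exists>r. z - r * a \<in> K}"

lemma ideal_add:
  assumes "ring_ideal K"
  shows "ring_ideal (ideal_add K a)" "K \<subseteq> ideal_add K a" "a \<in> ideal_add K a"
proof -
  note Id = ring_idealD[OF assms]
  have "\<exists>r. x + y - r * a \<in> K" if "x - r1 * a \<in> K" "y - r2 * a \<in> K" for x y r1 r2
    using Id(2)[OF that] by (intro exI[of _ "r1 + r2"]) (simp add: algebra_simps)
  moreover have "\<exists>t. r * x - t * a \<in> K" if "x - r1 * a \<in> K" for x r1 r
    using Id(3)[OF that, of r] by (intro exI[of _ "r * r1"]) (simp add: algebra_simps)
  ultimately show "ring_ideal (ideal_add K a)"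
    unfolding ring_ideal_def ideal_add_def mem_Collect_eq
    by (intro conjI ballI allI CollectI) ((rule exI[of _ 0], simp add: Id), blast+)
  show "K \<subseteq> ideal_add K a" by (auto simp: ideal_add_def intro!: exI[of _ 0])
  show "a \<in> ideal_add K a" using Id(1) by (auto simp: ideal_add_def intro!: exI[of _ 1])
qed

text \<open>The generators are adjoined to K one at a time: once some power of m lies in K + (g),
  nilpotence of g modulo K moves a higher power into K.\<close>

lemma nilpotent_generators:
  assumes m: "ring_ideal m" and "finite F" "ring_ideal K" "!!f. f \<in> F ==> \<exists>s. f ^ s \<in> K"
    and "!!z. z \<in> mpow m n ==> \<exists>c. z - (\<Sum>f\<in>F. c f * f) \<in> K"
  shows "\<exists>n. mpow m n \<subseteq> K"
  using assms(2-)
proof (induction F arbitrary: K n rule: finite_induct)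
  case empty
  then show ?case by (intro exI[of _ n]) auto
next
  case (insert g F)
  have "\<exists>n. mpow m n \<subseteq> ideal_add K g"
  proof (rule insert.IH)
    show "ring_ideal (ideal_add K g)" using insert.prems(1) by (rule ideal_add)
    show "\<exists>s. f ^ s \<in> ideal_add K g" if "f \<in> F" for f
      using insert.prems(2)[of f] that ideal_add(2)[OF insert.prems(1), of g] by auto
    fix z assume "z \<in> mpow m n"
    then obtain c where c: "z - (\<Sum>f\<in>insert g F. c f * f) \<in> K" using insert.prems(3) by blast
    have "(\<Sum>f\<in>insert g F. c f * f) = (\<Sum>f\<in>F. c f * f) + c g * g" using insert.hyps by (simp add: add.commute)
    then have "z - (\<Sum>f\<in>F. c f * f) - c g * g \<in> K" using c by (simp only: diff_diff_eq)
    then show "\<exists>c. z - (\<Sum>f\<in>F. c f * f) \<in> ideal_add K g" unfolding ideal_add_def by blast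
  qed
  then obtain n' where n': "mpow m n' \<subseteq> ideal_add K g" by blast
  obtain s where s: "g ^ s \<in> K" using insert.prems(2) by auto
  have "mpow m (n' * s) \<subseteq> K"
    by (rule nilpotent_generator[OF m insert.prems(1) s]) (use n' in \<open>auto simp: ideal_add_def\<close>)
  then show ?case by blast
qed

lemma cln_domain_fg:
  fixes m I :: "'o::idom set"
  assumes "cln_domain m" "ring_ideal I"
  obtains F where "finite F" "F \<subseteq> I" "I = {\<Sum>f\<in>F. c f * f | c. True}"
proof -
  have "\<forall>I::'o set. ring_ideal I --> (\<exists>F. finite F \<and> F \<subseteq> I \<and> I = {\<Sum>f\<in>F. c f * f | c. True})"
    using assms(1) unfolding cln_domain_def by (elim conjE)
  from this[rule_format, OF assms(2)]
  have "\<exists>F. finite F \<and> F \<subseteq> I \<and> I = {\<Sum>f\<in>F. c f * f | c. True}" .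
  then show ?thesis using that by (elim exE conjE)
qed

lemma noetherian_chain_stable:
  fixes m :: "'o::idom set" and A :: "nat => 'o set"
  assumes "cln_domain m" "!!n. ring_ideal (A n)" "!!n. A n \<subseteq> A (Suc n)"
  shows "\<exists>n. \<forall>k. A k \<subseteq> A n"
proof -
  have mono: "A i \<subseteq> A j" if "i \<le> j" for i j using that by (induction j rule: dec_induct) (use assms(3) in auto)
  have "ring_ideal (\<Union>n. A n)"
    unfolding ring_ideal_def
  proof (intro conjI ballI allI)
    show "0 \<in> (\<Union>n. A n)" using ring_idealD(1)[OF assms(2)] by blast
    fix x y assume "x \<in> (\<Union>n. A n)" "y \<in> (\<Union>n. A n)"
    then obtain i j where ij: "x \<in> A i" "y \<in> A j" by blast
    have "x \<in> A (max i j)" "y \<in> A (max i j)" using ij mono[of i "max i j"] mono[of j "max i j"] by auto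
    then show "x + y \<in> (\<Union>n. A n)" using ring_idealD(2)[OF assms(2)] by blast
  next
    fix r x assume "x \<in> (\<Union>n. A n)" then show "r * x \<in> (\<Union>n. A n)" using ring_idealD(3)[OF assms(2)] by blast
  qed
  then obtain F where F: "finite F" "F \<subseteq> (\<Union>n. A n)" "(\<Union>n. A n) = {\<Sum>f\<in>F. c f * f | c. True}"
    by (rule cln_domain_fg[OF assms(1)])
  have "\<exists>n. F \<subseteq> A n" using F(1,2)
  proof (induction F rule: finite_induct)
    case (insert x F)
    then obtain n j where "F \<subseteq> A n" "x \<in> A j" by auto
    then have "insert x F \<subseteq> A (max n j)" using mono[of n "max n j"] mono[of j "max n j"] by auto
    then show ?case by blast
  qed auto
  then obtain n where n: "F \<subseteq> A n" by blast
  have "A k \<subseteq> A n" for k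
  proof
    fix z assume "z \<in> A k"
    then have "z \<in> {\<Sum>f\<in>F. c f * f | c. True}" unfolding F(3)[symmetric] by blast
    then obtain c where "z = (\<Sum>f\<in>F. c f * f)" by blast
    then show "z \<in> A n" using n by (auto intro!: ring_idealD(6)[OF assms(2)] ring_idealD(3)[OF assms(2)])
  qed
  then show ?thesis by blast
qed

text \<open>Krull's intersection theorem via an ideal \<open>K\<close> maximal subject to \<open>K \<inter> (x) = m x\<close>: every element
  of \<open>m\<close> is nilpotent modulo \<open>K\<close>, so \<open>K\<close> contains a power of \<open>m\<close> and hence \<open>x\<close>.\<close>

lemma krull_intersection:
  fixes m :: "'o::idom set"
  assumes cln: "cln_domain m" and x: "!!k. x \<in> mpow m k"
  shows "x = 0"
proof -
  have m: "ring_ideal m" "1 \<notin> m" using cln by (auto simp: cln_domain_def)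
  note md = ring_idealD[OF m(1)]
  define mx where "mx = (%a. a * x) ` m"
  define KK where "KK = {K. ring_ideal K \<and> mx \<subseteq> K \<and> (\<forall>r. r * x \<in> K --> r * x \<in> mx)}"
  have mxI: "ring_ideal mx"
    unfolding ring_ideal_def mx_def
  proof (intro conjI ballI allI)
    show "0 \<in> (%a. a * x) ` m" using md(1) by force
    fix u v assume "u \<in> (%a. a * x) ` m" "v \<in> (%a. a * x) ` m"
    then show "u + v \<in> (%a. a * x) ` m" using md(2) by (auto simp: distrib_right[symmetric])
  next
    fix r u assume "u \<in> (%a. a * x) ` m"
    then show "r * u \<in> (%a. a * x) ` m" using md(3) by (auto simp: mult.assoc[symmetric])
  qed
  have "mx \<in> KK" using mxI by (auto simp: KK_def)
  then have ne: "KK ~= {}" by blast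
  have "\<exists>K\<in>KK. \<forall>K'\<in>KK. K \<subseteq> K' --> K' = K"
  proof (rule subset_Zorn_nonempty[OF ne])
    fix C assume C: "C ~= {}" "subset.chain KK C"
    then have CK: "C \<subseteq> KK" and tot: "!!A B. A \<in> C ==> B \<in> C ==> A \<subseteq> B \<or> B \<subseteq> A"
      by (auto simp: subset.chain_def)
    have "ring_ideal (\<Union>C)"
      unfolding ring_ideal_def
    proof (intro conjI ballI allI)
      show "0 \<in> \<Union>C" using C(1) CK ring_idealD(1) by (fastforce simp: KK_def)
      fix u v assume "u \<in> \<Union>C" "v \<in> \<Union>C"
      then obtain A B where AB: "A \<in> C" "u \<in> A" "B \<in> C" "v \<in> B" by blast
      then obtain E where "E \<in> C" "u \<in> E" "v \<in> E" using tot[OF AB(1,3)] by blast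
      moreover have "ring_ideal E" using \<open>E \<in> C\<close> CK by (auto simp: KK_def)
      ultimately show "u + v \<in> \<Union>C" using ring_idealD(2) by blast
    next
      fix r u assume "u \<in> \<Union>C"
      then obtain A where "A \<in> C" "u \<in> A" "ring_ideal A" using CK by (auto simp: KK_def)
      then show "r * u \<in> \<Union>C" using ring_idealD(3) by blast
    qed
    moreover have "mx \<subseteq> \<Union>C" using C(1) CK by (auto simp: KK_def)
    moreover have "\<forall>r. r * x \<in> \<Union>C --> r * x \<in> mx" using CK by (auto simp: KK_def)
    ultimately show "\<Union>C \<in> KK" by (simp add: KK_def)
  qed
  then obtain K where K: "K \<in> KK" and Kmax: "!!K'. K' \<in> KK ==> K \<subseteq> K' ==> K' = K" by blast
  have KI: "ring_ideal K" and mxK: "mx \<subseteq> K" and Kx: "!!r. r * x \<in> K ==> r * x \<in> mx" using K by (auto simp: KK_def)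
  note Kd = ring_idealD[OF KI]
  have nil: "\<exists>s. a ^ s \<in> K" if a: "a \<in> m" for a
  proof -
    \<comment> \<open>The colon ideals (K : a^n) become stationary at some n, and then K + (a^n)
      still meets (x) only in m x: if r x = t a^n modulo K, multiplying by a and using that r a x
      lies in m x puts t a^(n+1) in K, hence t a^n and so r x in K. Maximality of K gives a^n in
      K.\<close>
    define A where "A n = {r. r * a ^ n \<in> K}" for n
    have "ring_ideal (A n)" for n
      using Kd by (auto simp: A_def ring_ideal_def distrib_right mult.assoc)
    moreover have "A n \<subseteq> A (Suc n)" for n
      using Kd(4)[of "_ * a ^ n" a] by (auto simp: A_def mult_ac)
    ultimately obtain n where n: "!!k. A k \<subseteq> A n" using noetherian_chain_stable[OF cln] by meson
    have "ideal_add K (a ^ n) \<in> KK"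
      unfolding KK_def
    proof (intro CollectI conjI allI impI)
      show "ring_ideal (ideal_add K (a ^ n))" "mx \<subseteq> ideal_add K (a ^ n)"
        using ideal_add[OF KI] mxK by blast+
      fix r assume "r * x \<in> ideal_add K (a ^ n)"
      then obtain t where t: "r * x - t * a ^ n \<in> K" by (auto simp: ideal_add_def)
      have "(r * a) * x \<in> K" using mxK md(3)[OF a, of r] by (auto simp: mx_def)
      then have "(r * a) * x - a * (r * x - t * a ^ n) \<in> K" by (rule Kd(5)[OF _ Kd(3)[OF t]])
      then have "t * a ^ Suc n \<in> K" by (simp add: algebra_simps)
      then have "t \<in> A n" using n[of "Suc n"] by (auto simp: A_def)
      then have "t * a ^ n \<in> K" by (simp add: A_def)
      then have "r * x \<in> K" using Kd(2)[OF t] by fastforce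
      then show "r * x \<in> mx" by (rule Kx)
    qed
    then have "ideal_add K (a ^ n) = K" using Kmax ideal_add(2)[OF KI] by blast
    then show ?thesis using ideal_add(3)[OF KI] by blast
  qed
  obtain F where F: "finite F" "F \<subseteq> m" "m = {\<Sum>f\<in>F. c f * f | c. True}"
    by (rule cln_domain_fg[OF cln m(1)])
  have "\<exists>n. mpow m n \<subseteq> K"
  proof (rule nilpotent_generators[OF m(1) F(1) KI])
    show "\<exists>s. f ^ s \<in> K" if "f \<in> F" for f using nil F(2) that by blast
    fix z assume "z \<in> mpow m (Suc 0)"
    then have "z \<in> {\<Sum>f\<in>F. c f * f | c. True}" using F(3) mpow_1[OF m(1)] by blast
    then obtain c where "z = (\<Sum>f\<in>F. c f * f)" by blast
    then show "\<exists>c. z - (\<Sum>f\<in>F. c f * f) \<in> K" using Kd(1) by (intro exI[of _ c]) simp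
  qed
  then have "1 * x \<in> K" using x by auto
  then obtain a where a: "a \<in> m" "x = a * x" using Kx[of 1] by (auto simp: mx_def)
  have "x * (1 - a) = 0" using a(2) by (simp add: algebra_simps)
  moreover have "1 - a ~= 0" using a(1) m(2) by auto
  ultimately show ?thesis by simp
qed

subsection \<open>The group algebra\<close>

lemma fsum_apply:
  fixes F :: "'i => 'a => 'b::comm_monoid_add"
  shows "(\<Sum>i\<in>A. F i) x = (\<Sum>i\<in>A. F i x)"
proof (induction A rule: infinite_finite_induct)
  case (insert a A)
  have "(\<Sum>i\<in>insert a A. F i) x = F a x + (\<Sum>i\<in>A. F i) x" using insert.hyps by simp
  also have "\<dots> = F a x + (\<Sum>i\<in>A. F i x)" by (subst insert.IH) (rule refl)
  finally show ?case using insert.hyps by simp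
qed auto

lemma card_cosets:
  assumes "group H" "subgroup Q H" "subgroup R H" "R \<subseteq> Q" "finite Q"
  shows "card {q <#\<^bsub>H\<^esub> R | q. q \<in> Q} * card R = card Q"
proof -
  interpret H: group H by fact
  interpret Q: group "H\<lparr>carrier := Q\<rparr>" using assms(2) by (rule H.subgroup_imp_group)
  have "subgroup R (H\<lparr>carrier := Q\<rparr>)" using assms by (intro H.subgroup_incl)
  moreover have "lcosets\<^bsub>H\<lparr>carrier := Q\<rparr>\<^esub> R = {q <#\<^bsub>H\<^esub> R | q. q \<in> Q}"
    by (auto simp: LCOSETS_def l_coset_def) blast?
  ultimately show ?thesis using Q.l_lagrange[of R] assms(5) by (simp add: Coset.order_def)
qed

locale group_alg = group G for G :: "'g monoid" (structure) +
  fixes m :: "'o::idom set" and p :: nat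
  assumes fin: "finite (carrier G)" and cln: "cln_domain m" and rac: "residue_alg_closed_char m p"

sublocale group_alg \<subseteq> local_ideal m
proof
  have "ring_ideal m \<and> 1 \<notin> m \<and> (\<forall>x. x \<notin> m --> (\<exists>y. x * y = 1))"
    using cln unfolding cln_domain_def by (elim conjE) (intro conjI)
  then show "ring_ideal m" "1 \<notin> m" "x \<notin> m ==> \<exists>y. x * y = 1" for x by blast+
qed

context group_alg
begin

abbreviation gm :: "('g => 'o) => ('g => 'o) => 'g => 'o" (infixl "\<star>" 70) where "a \<star> c \<equiv> gmult G a c"
abbreviation GA :: "('g => 'o) set" where "GA \<equiv> grpalg G"
abbreviation el :: "'g => 'g => 'o" where "el g \<equiv> gelem G g"
abbreviation sm :: "'o => ('g => 'o) => 'g => 'o" where "sm r a \<equiv> Defs.smult r a"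
abbreviation cj :: "'g => ('g => 'o) => 'g => 'o" where "cj g a \<equiv> conj_act G g a"

lemma prime_p: "prime p" and p_in_m: "of_nat p \<in> m"
  and alg_closed: "!!n (c::nat => 'o). n \<ge> 1 ==> \<exists>x. x ^ n + (\<Sum>i<n. c i * x ^ i) \<in> m"
proof -
  have *: "prime p \<and> of_nat p \<in> m \<and> (\<forall>n\<ge>1. \<forall>c::nat => 'o. \<exists>x. x ^ n + (\<Sum>i<n. c i * x ^ i) \<in> m)"
    using rac unfolding residue_alg_closed_char_def .
  show "prime p" "of_nat p \<in> m" by (rule *[THEN conjunct1], rule *[THEN conjunct2, THEN conjunct1])
  show "\<exists>x. x ^ n + (\<Sum>i<n. c i * x ^ i) \<in> m" if "n \<ge> 1" for n and c :: "nat => 'o"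
    by (rule *[THEN conjunct2, THEN conjunct2, rule_format, OF that])
qed

lemma of_nat_in_m: "p dvd n ==> of_nat n \<in> m"
  by (auto simp: m_mult2 p_in_m)

lemma of_nat_notin_m:
  assumes "coprime n p"
  shows "of_nat n \<notin> m"
proof
  assume a: "of_nat n \<in> m"
  obtain u v where "u * int n + v * int p = gcd (int n) (int p)"
    using bezout_int by blast
  also have "gcd (int n) (int p) = 1" using assms by simp
  finally have "of_int (u * int n + v * int p) = (1::'o)" by simp
  then have "of_int u * of_nat n + of_int v * of_nat p = (1::'o)" by simp
  moreover have "of_int u * of_nat n + of_int v * of_nat p \<in> m"
    using a p_in_m by (intro m_add m_mult)
  ultimately show False using one_notin by simp
qed

lemma sum_fixed_mod:
  assumes "group H" "finite (carrier H)" "card (carrier H) = p ^ n" "finite W" "is_action H act W"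
    and "!!h w. h \<in> carrier H ==> w \<in> W ==> f (act h w) = f w"
  shows "sum f W - sum f {w \<in> W. \<forall>h\<in>carrier H. act h w = w} \<in> m"
proof -
  obtain c where "sum f W = sum f {w \<in> W. \<forall>h\<in>carrier H. act h w = w} + of_nat p * c"
    using pgroup_sum_fixed[where f = f and act = act, OF assms(1-3) prime_p assms(4-6)] by auto
  then show ?thesis by (simp add: m_mult2 p_in_m)
qed

lemma reindex_left: "g \<in> carrier G ==> (\<Sum>y\<in>carrier G. f (g \<otimes> y)) = (\<Sum>y\<in>carrier G. f y)"
  by (rule sum.reindex_bij_witness[where i = "%y. inv g \<otimes> y" and j = "%y. g \<otimes> y"])
     (auto simp: m_assoc[symmetric])

lemma gm_apply: "x \<in> carrier G ==> (a \<star> c) x = (\<Sum>y\<in>carrier G. a y * c (inv y \<otimes> x))"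
  by (simp add: gmult_def)

lemma gm_in [simp]: "a \<star> c \<in> GA"
  by (simp add: grpalg_def gmult_def)

lemma GA_outside: "a \<in> GA ==> x \<notin> carrier G ==> a x = 0"
  by (simp add: grpalg_def)

lemma GA_ext: "a \<in> GA ==> c \<in> GA ==> (!!x. x \<in> carrier G ==> a x = c x) ==> a = c"
  by (rule ext) (metis GA_outside)

lemma el_in [simp]: "g \<in> carrier G ==> el g \<in> GA"
  by (auto simp: grpalg_def gelem_def)

lemma GA_zero [simp]: "0 \<in> GA" and GA_add: "a \<in> GA ==> c \<in> GA ==> a + c \<in> GA"
  and GA_diff: "a \<in> GA ==> c \<in> GA ==> a - c \<in> GA" and GA_sm: "a \<in> GA ==> sm r a \<in> GA"
  and GA_minus: "a \<in> GA ==> - a \<in> GA"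
  by (auto simp: grpalg_def Defs.smult_def)

lemma GA_sum: "(!!i. i \<in> I ==> f i \<in> GA) ==> sum f I \<in> GA"
  by (induction I rule: infinite_finite_induct) (auto intro: GA_add)

lemma gm_assoc: "a \<star> b \<star> c = a \<star> (b \<star> c)"
proof (rule GA_ext)
  fix x assume x: "x \<in> carrier G"
  have "(a \<star> b \<star> c) x = (\<Sum>y\<in>carrier G. \<Sum>z\<in>carrier G. a z * b (inv z \<otimes> y) * c (inv y \<otimes> x))"
    using x by (simp add: gm_apply sum_distrib_right)
  also have "\<dots> = (\<Sum>z\<in>carrier G. \<Sum>y\<in>carrier G. a z * b (inv z \<otimes> y) * c (inv y \<otimes> x))"
    by (rule sum.swap)
  also have "\<dots> = (\<Sum>z\<in>carrier G. \<Sum>w\<in>carrier G. a z * b (inv z \<otimes> (z \<otimes> w)) * c (inv (z \<otimes> w) \<otimes> x))"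
    by (rule sum.cong[OF refl]) (rule reindex_left[symmetric])
  also have "\<dots> = (\<Sum>z\<in>carrier G. \<Sum>w\<in>carrier G. a z * (b w * c (inv w \<otimes> (inv z \<otimes> x))))"
    using x by (intro sum.cong refl) (simp add: m_assoc[symmetric] inv_mult_group mult.assoc)
  also have "\<dots> = (a \<star> (b \<star> c)) x"
    using x by (simp add: gm_apply sum_distrib_left)
  finally show "(a \<star> b \<star> c) x = (a \<star> (b \<star> c)) x" .
qed auto

lemma gm_add_left: "(a + b) \<star> c = a \<star> c + b \<star> c" and gm_add_right: "a \<star> (b + c) = a \<star> b + a \<star> c"
  and gm_diff_left: "(a - b) \<star> c = a \<star> c - b \<star> c" and gm_diff_right: "a \<star> (b - c) = a \<star> b - a \<star> c"
  and gm_minus_left: "(- a) \<star> c = - (a \<star> c)" and gm_minus_right: "a \<star> (- c) = - (a \<star> c)"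
  and gm_zero_left [simp]: "0 \<star> c = 0" and gm_zero_right [simp]: "a \<star> 0 = 0"
  and gm_sm_left: "sm r a \<star> c = sm r (a \<star> c)" and gm_sm_right: "a \<star> sm r c = sm r (a \<star> c)"
  by (rule ext, simp add: gmult_def Defs.smult_def algebra_simps sum.distrib sum_subtractf sum_negf sum_distrib_left)+

lemma gm_sum_left: "(\<Sum>i\<in>I. f i) \<star> c = (\<Sum>i\<in>I. f i \<star> c)"
  using sum_comp_morphism[of "%a. a \<star> c" f I] by (simp add: gm_add_left o_def)
lemma gm_sum_right: "c \<star> (\<Sum>i\<in>I. f i) = (\<Sum>i\<in>I. c \<star> f i)"
  using sum_comp_morphism[of "%a. c \<star> a" f I] by (simp add: gm_add_right o_def)

lemma sm_add: "sm r (a + c) = sm r a + sm r c" and sm_diff: "sm r (a - c) = sm r a - sm r c"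
  and sm_add_scalar: "sm (r + s) a = sm r a + sm s a" and sm_diff_scalar: "sm (r - s) a = sm r a - sm s a"
  and sm_sm: "sm r (sm s a) = sm (r * s) a" and sm_one [simp]: "sm 1 a = a"
  and sm_zero [simp]: "sm 0 a = 0" and sm_zero_right [simp]: "sm r 0 = 0"
  and sm_minus_scalar: "sm (- r) a = - sm r a" and sm_minus: "sm r (- a) = - sm r a"
  by (auto simp: Defs.smult_def fun_eq_iff algebra_simps)

lemma sm_sum: "sm r (\<Sum>i\<in>I. f i) = (\<Sum>i\<in>I. sm r (f i))"
  using sum_comp_morphism[of "sm r" f I] by (simp add: sm_add o_def)
lemma sm_sum_scalar: "sm (\<Sum>i\<in>I. f i) a = (\<Sum>i\<in>I. sm (f i) a)"
  using sum_comp_morphism[of "%r. sm r a" f I] by (simp add: sm_add_scalar o_def)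
lemma sm_apply: "sm r a x = r * a x" by (simp add: Defs.smult_def)

lemmas gm_ring = gm_assoc gm_add_left gm_add_right gm_diff_left gm_diff_right gm_minus_left gm_minus_right
  gm_sm_left gm_sm_right sm_add sm_diff sm_sm sm_minus

lemma el_gm_apply: "g \<in> carrier G ==> x \<in> carrier G ==> (el g \<star> a) x = a (inv g \<otimes> x)"
proof -
  assume g: "g \<in> carrier G" and x: "x \<in> carrier G"
  have "(el g \<star> a) x = (\<Sum>y\<in>carrier G. if y = g then a (inv y \<otimes> x) else 0)"
    unfolding gm_apply[OF x] by (rule sum.cong) (auto simp: gelem_def)
  then show ?thesis using g fin by (simp add: sum.delta')
qed

lemma gm_el_apply: "g \<in> carrier G ==> x \<in> carrier G ==> (a \<star> el g) x = a (x \<otimes> inv g)"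
proof -
  assume g: "g \<in> carrier G" and x: "x \<in> carrier G"
  have "inv y \<otimes> x = g \<longleftrightarrow> y = x \<otimes> inv g" if "y \<in> carrier G" for y
    using that g x by (metis inv_solve_left inv_solve_right inv_closed m_closed)
  then have "(a \<star> el g) x = (\<Sum>y\<in>carrier G. if y = x \<otimes> inv g then a y else 0)"
    unfolding gm_apply[OF x] by (intro sum.cong) (auto simp: gelem_def)
  then show ?thesis using g x fin by (simp add: sum.delta')
qed

lemma el_el: "g \<in> carrier G ==> h \<in> carrier G ==> el g \<star> el h = el (g \<otimes> h)"
proof (rule GA_ext)
  fix x assume g: "g \<in> carrier G" "h \<in> carrier G" and x: "x \<in> carrier G"
  have "inv g \<otimes> x = h \<longleftrightarrow> x = g \<otimes> h" using g x by (metis inv_solve_left)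
  then show "(el g \<star> el h) x = el (g \<otimes> h) x"
    unfolding el_gm_apply[OF g(1) x] by (simp add: gelem_def)
qed (simp_all add: el_in)

lemma el_one_left: "a \<in> GA ==> el \<one> \<star> a = a"
  by (rule GA_ext) (auto simp: el_gm_apply)
lemma el_one_right: "a \<in> GA ==> a \<star> el \<one> = a"
  by (rule GA_ext) (auto simp: gm_el_apply)

lemma gm_el_one: "a \<star> (el \<one> \<star> c) = a \<star> c"
proof (rule GA_ext)
  fix x assume x: "x \<in> carrier G"
  show "(a \<star> (el \<one> \<star> c)) x = (a \<star> c) x"
    unfolding gm_apply[OF x, of a] using x by (intro sum.cong refl) (simp add: el_gm_apply)
qed auto

lemma el_cancel: "g \<in> carrier G ==> a \<star> (el (inv g) \<star> (el g \<star> c)) = a \<star> c"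
  "g \<in> carrier G ==> a \<star> (el g \<star> (el (inv g) \<star> c)) = a \<star> c"
  by (simp_all add: gm_assoc[symmetric, of "el (inv g)"] gm_assoc[symmetric, of "el g"] el_el gm_el_one)

lemma cj_in [simp]: "cj g a \<in> GA" by (simp add: conj_act_def grpalg_def)
lemma cj_eq: "g \<in> carrier G ==> cj g a = el g \<star> a \<star> el (inv g)"
proof (rule GA_ext)
  fix x assume g: "g \<in> carrier G" and x: "x \<in> carrier G"
  show "cj g a x = (el g \<star> a \<star> el (inv g)) x"
    using g x by (simp add: conj_act_def gm_el_apply el_gm_apply m_assoc)
qed auto

lemma cj_apply: "x \<in> carrier G ==> cj g a x = a (inv g \<otimes> x \<otimes> g)" by (simp add: conj_act_def)
lemma cj_add: "cj g (a + c) = cj g a + cj g c" and cj_diff: "cj g (a - c) = cj g a - cj g c"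
  and cj_sm: "cj g (sm r a) = sm r (cj g a)" and cj_zero [simp]: "cj g 0 = 0"
  by (auto simp: conj_act_def fun_eq_iff sm_apply)
lemma cj_sum: "cj g (\<Sum>i\<in>I. f i) = (\<Sum>i\<in>I. cj g (f i))"
  using sum_comp_morphism[of "cj g" f I] by (simp add: cj_add o_def)
lemma cj_mult: "g \<in> carrier G ==> cj g (a \<star> c) = cj g a \<star> cj g c"
  by (simp add: cj_eq gm_assoc el_cancel)
lemma cj_cj: "g \<in> carrier G ==> h \<in> carrier G ==> cj g (cj h a) = cj (g \<otimes> h) a"
  by (rule GA_ext) (auto simp: cj_apply inv_mult_group m_assoc)
lemma cj_one: "a \<in> GA ==> cj \<one> a = a"
  by (rule GA_ext) (auto simp: cj_apply)
lemma cj_inv: "g \<in> carrier G ==> a \<in> GA ==> cj g (cj (inv g) a) = a"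
  "g \<in> carrier G ==> a \<in> GA ==> cj (inv g) (cj g a) = a"
  by (simp_all add: cj_cj cj_one)
lemma el_gm_cj: "g \<in> carrier G ==> el g \<star> a = cj g a \<star> el g"
  by (rule GA_ext) (auto simp: el_gm_apply gm_el_apply cj_apply m_assoc)

text \<open>Pairs \<open>(s, t)\<close> act on the group algebra by \<open>a \<mapsto> s a t\<^sup>-\<^sup>1\<close>; for a set \<open>K\<close> of pairs,
  \<open>Fx K\<close> are the fixed points, \<open>TT K\<close> the fixed group elements and \<open>Kr K\<close> is the kernel of the Brauer map.\<close>

definition Fx :: "('g \<times> 'g) set => ('g => 'o) set" where
  "Fx K = {a \<in> GA. \<forall>(s, t)\<in>K. el s \<star> a = a \<star> el t}"

definition TT :: "('g \<times> 'g) set => 'g set" where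
  "TT K = {g \<in> carrier G. \<forall>(s, t)\<in>K. s \<otimes> g = g \<otimes> t}"

definition Kr :: "('g \<times> 'g) set => ('g => 'o) set" where
  "Kr K = {a \<in> Fx K. \<forall>g\<in>TT K. a g \<in> m}"

definition M0 :: "('g => 'o) set" where "M0 = {a. \<forall>x. a x \<in> m}"

lemma Fx_GA: "a \<in> Fx K ==> a \<in> GA" by (simp add: Fx_def)

lemma Fx_eq: "a \<in> Fx K ==> (s, t) \<in> K ==> el s \<star> a = a \<star> el t" by (auto simp: Fx_def)

lemma Fx_apply:
  assumes "a \<in> Fx K" "(s, t) \<in> K" "s \<in> carrier G" "t \<in> carrier G" "g \<in> carrier G"
  shows "a (s \<otimes> g \<otimes> inv t) = a g"
proof -
  have "(el s \<star> a) (s \<otimes> g) = (a \<star> el t) (s \<otimes> g)" using Fx_eq[OF assms(1,2)] by simp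
  then show ?thesis using assms(3-) by (simp add: el_gm_apply gm_el_apply m_assoc[symmetric])
qed

lemma Fx_zero [simp]: "0 \<in> Fx K" and Fx_add: "a \<in> Fx K ==> c \<in> Fx K ==> a + c \<in> Fx K"
  and Fx_diff: "a \<in> Fx K ==> c \<in> Fx K ==> a - c \<in> Fx K" and Fx_sm: "a \<in> Fx K ==> sm r a \<in> Fx K"
  by (fastforce simp: Fx_def GA_add GA_diff GA_sm gm_ring)+

lemma Fx_sum: "(!!i. i \<in> I ==> f i \<in> Fx K) ==> sum f I \<in> Fx K"
  by (induction I rule: infinite_finite_induct) (auto intro: Fx_add)

lemma Fx_mono: "K' \<subseteq> K ==> a \<in> Fx K ==> a \<in> Fx K'" by (auto simp: Fx_def)

lemma M0_zero [simp]: "0 \<in> M0" and M0_add: "a \<in> M0 ==> c \<in> M0 ==> a + c \<in> M0"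
  and M0_diff: "a \<in> M0 ==> c \<in> M0 ==> a - c \<in> M0" and M0_sm: "a \<in> M0 ==> sm r a \<in> M0"
  and M0_sm': "r \<in> m ==> sm r a \<in> M0"
  by (auto simp: M0_def m_add m_diff m_mult m_mult2 sm_apply)

lemma M0_gm_left: "a \<in> M0 ==> a \<star> c \<in> M0"
  by (auto simp: M0_def gmult_def intro!: m_sum m_mult2)
lemma M0_gm_right: "c \<in> M0 ==> a \<star> c \<in> M0"
  by (auto simp: M0_def gmult_def intro!: m_sum m_mult)

lemma M0_sum: "(!!i. i \<in> I ==> f i \<in> M0) ==> sum f I \<in> M0"
  by (induction I rule: infinite_finite_induct) (auto intro: M0_add)
lemma M0_cj: "a \<in> M0 ==> cj g a \<in> M0" by (auto simp: M0_def conj_act_def)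

lemma Kr_Fx: "a \<in> Kr K ==> a \<in> Fx K" by (simp add: Kr_def)

lemma M0_Kr: "a \<in> M0 ==> a \<in> Fx K ==> a \<in> Kr K" by (auto simp: M0_def Kr_def)

lemma Kr_zero [simp]: "0 \<in> Kr K" and Kr_add: "a \<in> Kr K ==> c \<in> Kr K ==> a + c \<in> Kr K"
  and Kr_diff: "a \<in> Kr K ==> c \<in> Kr K ==> a - c \<in> Kr K" and Kr_sm: "a \<in> Kr K ==> sm r a \<in> Kr K"
  by (auto simp: Kr_def Fx_add Fx_diff Fx_sm m_add m_diff m_mult sm_apply)

lemma Kr_sum: "(!!i. i \<in> I ==> f i \<in> Kr K) ==> sum f I \<in> Kr K"
  by (induction I rule: infinite_finite_induct) (auto intro: Kr_add)

abbreviation Rl :: "('g => 'g) => ('g => 'g) => 'g set => ('g \<times> 'g) set" where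
  "Rl \<alpha> \<beta> P \<equiv> (%x. (\<alpha> x, \<beta> x)) ` P"

lemma Fx_mult: "a \<in> Fx (Rl \<alpha> \<beta> P) ==> c \<in> Fx (Rl \<beta> \<gamma> P) ==> a \<star> c \<in> Fx (Rl \<alpha> \<gamma> P)"
proof -
  assume a: "a \<in> Fx (Rl \<alpha> \<beta> P)" and c: "c \<in> Fx (Rl \<beta> \<gamma> P)"
  have "el (\<alpha> x) \<star> (a \<star> c) = a \<star> c \<star> el (\<gamma> x)" if "x \<in> P" for x
  proof -
    have "el (\<alpha> x) \<star> (a \<star> c) = el (\<alpha> x) \<star> a \<star> c" by (simp add: gm_assoc)
    also have "\<dots> = a \<star> (el (\<beta> x) \<star> c)" using Fx_eq[OF a, of "\<alpha> x" "\<beta> x"] that by (simp add: gm_assoc)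
    also have "\<dots> = a \<star> (c \<star> el (\<gamma> x))" using Fx_eq[OF c, of "\<beta> x" "\<gamma> x"] that by simp
    finally show ?thesis by (simp add: gm_assoc)
  qed
  then show ?thesis by (auto simp: Fx_def)
qed

definition hm :: "'g set => ('g => 'g) => bool" where
  "hm P \<alpha> \<longleftrightarrow> (\<forall>x\<in>P. \<alpha> x \<in> carrier G) \<and> (\<forall>x\<in>P. \<forall>y\<in>P. \<alpha> (x \<otimes> y) = \<alpha> x \<otimes> \<alpha> y)"

lemma hm_one:
  assumes "hm P \<alpha>" "subgroup P G"
  shows "\<alpha> \<one> = \<one>"
proof -
  have "\<one> \<in> P" using assms(2) by (rule subgroup.one_closed)
  then have "\<alpha> \<one> = \<alpha> \<one> \<otimes> \<alpha> \<one>" "\<alpha> \<one> \<in> carrier G" using assms(1) by (force simp: hm_def)+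
  then show ?thesis by (metis r_cancel_one)
qed

lemma p_subgroup_finite: "p_subgroup p G P ==> finite P"
  using fin finite_subset subgroup.subset unfolding p_subgroup_def by blast

lemma p_subgroup_group:
  assumes "p_subgroup p G P"
  obtains n where "group (G\<lparr>carrier := P\<rparr>)" "finite (carrier (G\<lparr>carrier := P\<rparr>))" "card (carrier (G\<lparr>carrier := P\<rparr>)) = p ^ n"
  using assms p_subgroup_finite subgroup_imp_group unfolding p_subgroup_def by auto

text \<open>The Brauer construction is multiplicative: in \<open>(a c)(g) = \<Sum>y. a(y) c(y\<^sup>-\<^sup>1 g)\<close> the group \<open>P\<close> permutes
  the summands, so modulo \<open>p\<close> only the fixed ones matter.\<close>

lemma conv_fixed_mod:
  assumes P: "p_subgroup p G P" and h: "hm P \<alpha>" "hm P \<beta>" "hm P \<gamma>"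
    and a: "a \<in> Fx (Rl \<alpha> \<beta> P)" and c: "c \<in> Fx (Rl \<beta> \<gamma> P)" and g: "g \<in> TT (Rl \<alpha> \<gamma> P)"
  shows "(a \<star> c) g - (\<Sum>y\<in>TT (Rl \<alpha> \<beta> P). a y * c (inv y \<otimes> g)) \<in> m"
proof -
  obtain n where n: "group (G\<lparr>carrier := P\<rparr>)" "finite (carrier (G\<lparr>carrier := P\<rparr>))" "card (carrier (G\<lparr>carrier := P\<rparr>)) = p ^ n"
    using p_subgroup_group[OF P] .
  have sP: "subgroup P G" using P by (simp add: p_subgroup_def)
  have \<alpha>: "!!x. x \<in> P ==> \<alpha> x \<in> carrier G" and \<beta>: "!!x. x \<in> P ==> \<beta> x \<in> carrier G" and \<gamma>: "!!x. x \<in> P ==> \<gamma> x \<in> carrier G"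
    using h by (auto simp: hm_def)
  have gc: "g \<in> carrier G" using g by (simp add: TT_def)
  define act where "act x y = \<alpha> x \<otimes> y \<otimes> inv (\<beta> x)" for x y
  have "is_action (G\<lparr>carrier := P\<rparr>) act (carrier G)"
    unfolding is_action_def act_def
    using h hm_one[OF h(1) sP] hm_one[OF h(2) sP] \<alpha> \<beta>
    by (auto simp: hm_def inv_mult_group m_assoc)
  moreover have "a (act x y) * c (inv (act x y) \<otimes> g) = a y * c (inv y \<otimes> g)" if x: "x \<in> P" and y: "y \<in> carrier G" for x y
  proof -
    have "a (act x y) = a y" unfolding act_def by (rule Fx_apply[OF a]) (use x y \<alpha> \<beta> in auto)
    moreover have "inv (act x y) \<otimes> g = \<beta> x \<otimes> (inv y \<otimes> g) \<otimes> inv (\<gamma> x)"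
    proof -
      have "\<alpha> x \<otimes> g = g \<otimes> \<gamma> x" using g x by (auto simp: TT_def)
      then have "inv (\<alpha> x) \<otimes> g = g \<otimes> inv (\<gamma> x)"
        using gc \<alpha>[OF x] \<gamma>[OF x] by (metis inv_closed inv_solve_left inv_solve_right m_assoc m_closed)
      then have "inv (act x y) \<otimes> g = \<beta> x \<otimes> (inv y \<otimes> (g \<otimes> inv (\<gamma> x)))"
        using x y gc \<alpha>[OF x] \<beta>[OF x] by (simp add: act_def inv_mult_group m_assoc)
      then show ?thesis using gc y \<beta>[OF x] \<gamma>[OF x] by (simp add: m_assoc)
    qed
    moreover have "c (\<beta> x \<otimes> (inv y \<otimes> g) \<otimes> inv (\<gamma> x)) = c (inv y \<otimes> g)"
      by (rule Fx_apply[OF c]) (use x y gc \<beta> \<gamma> in auto)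
    ultimately show ?thesis by simp
  qed
  ultimately have "(\<Sum>y\<in>carrier G. a y * c (inv y \<otimes> g)) -
      (\<Sum>y\<in>{y\<in>carrier G. \<forall>x\<in>carrier (G\<lparr>carrier := P\<rparr>). act x y = y}. a y * c (inv y \<otimes> g)) \<in> m"
    by (intro sum_fixed_mod[OF n fin]) auto
  moreover have "{y\<in>carrier G. \<forall>x\<in>carrier (G\<lparr>carrier := P\<rparr>). act x y = y} = TT (Rl \<alpha> \<beta> P)"
    unfolding TT_def act_def using \<alpha> \<beta> by (auto simp: inv_solve_right')
  ultimately show ?thesis using gc by (simp add: gm_apply)
qed

lemma TT_inv_mult:
  assumes "y \<in> TT (Rl \<alpha> \<beta> P)" "g \<in> TT (Rl \<alpha> \<gamma> P)" "hm P \<alpha>" "hm P \<beta>" "hm P \<gamma>"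
  shows "inv y \<otimes> g \<in> TT (Rl \<beta> \<gamma> P)"
proof -
  have "\<beta> x \<otimes> (inv y \<otimes> g) = inv y \<otimes> g \<otimes> \<gamma> x" if x: "x \<in> P" for x
  proof -
    have c: "\<alpha> x \<in> carrier G" "\<beta> x \<in> carrier G" "\<gamma> x \<in> carrier G" "y \<in> carrier G" "g \<in> carrier G"
      using assms x by (auto simp: TT_def hm_def)
    have e: "\<alpha> x \<otimes> y = y \<otimes> \<beta> x" "\<alpha> x \<otimes> g = g \<otimes> \<gamma> x" using assms x by (auto simp: TT_def)
    have "\<beta> x \<otimes> inv y = inv y \<otimes> \<alpha> x"
      using e(1) c by (metis inv_solve_left inv_solve_right inv_closed m_assoc m_closed)
    then have "\<beta> x \<otimes> (inv y \<otimes> g) = inv y \<otimes> (\<alpha> x \<otimes> g)" using c by (metis inv_closed m_assoc)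
    then show ?thesis using e(2) c by (simp add: m_assoc)
  qed
  then show ?thesis using assms by (auto simp: TT_def)
qed

lemma Kr_mult_right:
  assumes P: "p_subgroup p G P" and h: "hm P \<alpha>" "hm P \<beta>" "hm P \<gamma>"
    and a: "a \<in> Fx (Rl \<alpha> \<beta> P)" and c: "c \<in> Kr (Rl \<beta> \<gamma> P)"
  shows "a \<star> c \<in> Kr (Rl \<alpha> \<gamma> P)"
  unfolding Kr_def
proof (intro CollectI conjI ballI)
  show "a \<star> c \<in> Fx (Rl \<alpha> \<gamma> P)" using Fx_mult[OF a] c by (auto simp: Kr_def)
  fix g assume g: "g \<in> TT (Rl \<alpha> \<gamma> P)"
  have "(\<Sum>y\<in>TT (Rl \<alpha> \<beta> P). a y * c (inv y \<otimes> g)) \<in> m"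
    using TT_inv_mult[OF _ g h] c by (auto simp: Kr_def intro!: m_sum m_mult)
  then show "(a \<star> c) g \<in> m" using conv_fixed_mod[OF P h a Kr_Fx[OF c] g] m_cong by blast
qed

lemma Kr_mult_left:
  assumes P: "p_subgroup p G P" and h: "hm P \<alpha>" "hm P \<beta>" "hm P \<gamma>"
    and a: "a \<in> Kr (Rl \<alpha> \<beta> P)" and c: "c \<in> Fx (Rl \<beta> \<gamma> P)"
  shows "a \<star> c \<in> Kr (Rl \<alpha> \<gamma> P)"
  unfolding Kr_def
proof (intro CollectI conjI ballI)
  show "a \<star> c \<in> Fx (Rl \<alpha> \<gamma> P)" using Fx_mult[OF _ c] a by (auto simp: Kr_def)
  fix g assume g: "g \<in> TT (Rl \<alpha> \<gamma> P)"
  have "(\<Sum>y\<in>TT (Rl \<alpha> \<beta> P). a y * c (inv y \<otimes> g)) \<in> m"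
    using a by (auto simp: Kr_def intro!: m_sum m_mult2)
  then show "(a \<star> c) g \<in> m" using conv_fixed_mod[OF P h Kr_Fx[OF a] c g] m_cong by blast
qed

end

subsection \<open>Brauer quotients and traces\<close>

lemma p_dvd_index:
  assumes "prime p" "c * r = p ^ n" "r < p ^ n"
  shows "p dvd (c::nat)"
proof -
  have "c dvd p ^ n" using assms(2) by (metis dvd_triv_left)
  then obtain k where k: "c = p ^ k" using assms(1) by (metis divides_primepow_nat)
  have "k ~= 0" using assms k by (cases k) auto
  then show ?thesis using k by simp
qed

context group_alg
begin

abbreviation dg :: "'g set => ('g \<times> 'g) set" where "dg P \<equiv> Rl (%x. x) (%x. x) P"
abbreviation FP :: "'g set => ('g => 'o) set" where "FP P \<equiv> Fx (dg P)"
abbreviation KP :: "'g set => ('g => 'o) set" where "KP P \<equiv> Kr (dg P)"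

lemma Delta_Rl: "Delta \<phi> P = Rl \<phi> (%x. x) P"
  by (auto simp: Delta_def)

lemma hm_id: "subgroup P G ==> hm P (%x. x)"
  by (auto simp: hm_def dest: subgroup.mem_carrier)

lemma psub: "p_subgroup p G P ==> subgroup P G" by (simp add: p_subgroup_def)

lemma ogfix_eq:
  assumes P: "subgroup P G"
  shows "ogfix G P = FP P"
proof -
  have "a \<in> FP P" if "a \<in> ogfix G P" for a
  proof -
    have a: "a \<in> GA" "!!q. q \<in> P ==> cj q a = a" using that by (auto simp: ogfix_def fixpts_def)
    then show ?thesis using el_gm_cj[OF subgroup.mem_carrier[OF P]] by (auto simp: Fx_def)
  qed
  moreover have "a \<in> ogfix G P" if a: "a \<in> FP P" for a
  proof -
    have "cj q a = a" if "q \<in> P" for q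
    proof -
      have "el q \<star> a = a \<star> el q" using Fx_eq[OF a, of q q] that by auto
      then show ?thesis
        using subgroup.mem_carrier[OF P that] Fx_GA[OF a] by (simp add: cj_eq gm_assoc el_el el_one_right)
    qed
    then show ?thesis using Fx_GA[OF a] by (auto simp: ogfix_def fixpts_def)
  qed
  ultimately show ?thesis by blast
qed

lemma ogfix_iff: "a \<in> ogfix G P \<longleftrightarrow> a \<in> GA \<and> (\<forall>q\<in>P. cj q a = a)"
  by (simp add: ogfix_def fixpts_def)

lemma FP_cj: "subgroup P G ==> a \<in> FP P ==> q \<in> P ==> cj q a = a"
  by (simp only: ogfix_eq[symmetric] ogfix_iff)

lemma FPI: "subgroup P G ==> a \<in> GA ==> (!!q. q \<in> P ==> cj q a = a) ==> a \<in> FP P"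
  unfolding ogfix_eq[symmetric] ogfix_iff by blast

lemma FP_mult: "a \<in> FP P ==> c \<in> FP P ==> a \<star> c \<in> FP P"
  by (rule Fx_mult)

lemma FP_mono: "P \<subseteq> Q ==> a \<in> FP Q ==> a \<in> FP P"
  by (rule Fx_mono) auto

lemma KP_left: "p_subgroup p G P ==> a \<in> KP P ==> c \<in> FP P ==> a \<star> c \<in> KP P"
  using Kr_mult_left[where \<alpha> = "%x. x" and \<beta> = "%x. x" and \<gamma> = "%x. x"] hm_id psub by blast

lemma KP_right: "p_subgroup p G P ==> a \<in> FP P ==> c \<in> KP P ==> a \<star> c \<in> KP P"
  using Kr_mult_right[where \<alpha> = "%x. x" and \<beta> = "%x. x" and \<gamma> = "%x. x"] hm_id psub by blast

lemma el_FP: "P \<subseteq> carrier G ==> c \<in> TT (dg P) ==> el c \<in> FP P"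
  by (auto simp: Fx_def TT_def el_el subset_iff)

lemma el_one_FP: "P \<subseteq> carrier G ==> el \<one> \<in> FP P"
  by (rule el_FP) (auto simp: TT_def subset_iff)

text \<open>Thus \<open>TT (dg P)\<close> is the centralizer of P, and reading off coefficients
  there modulo \<open>m\<close> is the classical Brauer map onto the group algebra of C_G(P) over
  k.\<close>

lemma TT_dg: "c \<in> TT (dg P) \<longleftrightarrow> c \<in> carrier G \<and> (\<forall>x\<in>P. x \<otimes> c = c \<otimes> x)"
  by (auto simp: TT_def)

lemma subgroup_centralizer: "P \<subseteq> carrier G ==> subgroup (TT (dg P)) G"
proof (rule subgroupI)
  assume P: "P \<subseteq> carrier G"
  show "TT (dg P) \<subseteq> carrier G" by (auto simp: TT_dg)
  have "\<one> \<in> TT (dg P)" using P by (auto simp: TT_dg subset_iff)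
  then show "TT (dg P) ~= {}" by blast
  fix a assume a: "a \<in> TT (dg P)"
  have "x \<otimes> inv a = inv a \<otimes> x" if "x \<in> P" for x
  proof -
    have "x \<in> carrier G" "a \<in> carrier G" "x \<otimes> a = a \<otimes> x" using that P a by (auto simp: TT_dg)
    then show ?thesis by (metis inv_solve_left inv_solve_right inv_closed m_assoc m_closed)
  qed
  then show "inv a \<in> TT (dg P)" using a by (auto simp: TT_dg)
  fix b assume b: "b \<in> TT (dg P)"
  have "x \<otimes> (a \<otimes> b) = a \<otimes> b \<otimes> x" if "x \<in> P" for x
  proof -
    have "x \<in> carrier G" using that P by auto
    then show ?thesis using a b that by (auto simp: TT_dg m_assoc) (metis m_assoc)
  qed
  then show "a \<otimes> b \<in> TT (dg P)" using a b by (auto simp: TT_dg)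
qed

text \<open>If Q leaves evaluation at g unchanged, a relative trace from R takes at g the value |Q :
  R| times one coefficient, and the index of a proper subgroup is divisible by p. Action and module
  are left general so that the lemma covers both conjugation on OG and the two-sided action of D on
  the source algebra.\<close>

lemma brauer_kernel_eval:
  fixes M :: "('g => 'o) set"
  assumes H: "group H" and Q: "subgroup Q H" "finite Q" "card Q = p ^ n"
    and act: "!!q a. q \<in> Q ==> a \<in> M ==> act q a g = a g"
    and a: "a \<in> brauer_kernel m H act M Q"
  shows "a g \<in> m"
proof -
  interpret H: group H by fact
  obtain u v f where uv: "a = u + v" "u \<in> mod_span m (fixpts act M Q)"
    and v: "v = (\<Sum>R\<in>{R. subgroup R H \<and> R \<subset> Q}. rel_trace H act R Q (f R))"
    and f: "\<forall>R. subgroup R H \<and> R \<subset> Q --> f R \<in> fixpts act M R"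
    using a unfolding brauer_kernel_def mem_Collect_eq by (elim exE conjE) (rule that)
  obtain n' c w where u: "u = (\<Sum>i<(n'::nat). sm (c i) (w i))" "!!i. i < n' ==> c i \<in> m"
    using uv(2) unfolding mod_span_def mem_Collect_eq by (elim exE conjE) (rule that, auto)
  have ug: "u g \<in> m" unfolding u(1) fsum_apply by (rule m_sum) (use u(2) in \<open>auto simp: sm_apply m_mult2\<close>)
  have "rel_trace H act R Q (f R) g \<in> m" if R: "subgroup R H" "R \<subset> Q" for R
  proof -
    have "f R \<in> fixpts act M R" by (rule mp[OF spec[OF f] conjI[OF R]])
    then have fM: "f R \<in> M" unfolding fixpts_def by (elim CollectE conjE)
    have "act (SOME q. q \<in> C) (f R) g = f R g" if C: "C \<in> {q <#\<^bsub>H\<^esub> R | q. q \<in> Q}" for C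
    proof -
      obtain q where q: "q \<in> Q" "C = q <#\<^bsub>H\<^esub> R" using C by blast
      have "q \<in> C" using q H.lcos_self[OF _ R(1), of q] subgroup.mem_carrier[OF Q(1)] by auto
      then have "(SOME q. q \<in> C) \<in> C" by (rule someI)
      moreover have "C \<subseteq> Q" using q R subgroup.m_closed[OF Q(1)] by (auto simp: l_coset_def)
      ultimately show ?thesis using act[OF _ fM] by blast
    qed
    then have eq: "rel_trace H act R Q (f R) g = of_nat (card {q <#\<^bsub>H\<^esub> R | q. q \<in> Q}) * f R g"
      unfolding rel_trace_def fsum_apply by simp
    have dv: "p dvd card {q <#\<^bsub>H\<^esub> R | q. q \<in> Q}"
    proof (rule p_dvd_index[OF prime_p])
      show "card {q <#\<^bsub>H\<^esub> R | q. q \<in> Q} * card R = p ^ n"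
        using card_cosets[OF H Q(1) R(1) _ Q(2)] R(2) Q(3) by auto
      show "card R < p ^ n" using psubset_card_mono[OF Q(2) R(2)] Q(3) by simp
    qed
    show ?thesis unfolding eq by (rule m_mult2[OF of_nat_in_m[OF dv]])
  qed
  then have "v g \<in> m" unfolding v fsum_apply by (intro m_sum) auto
  with ug show ?thesis unfolding uv(1) plus_fun_apply by (rule m_add)
qed

lemma ogker_subset_KP:
  assumes P: "p_subgroup p G P" and a: "a \<in> FP P" "a \<in> ogker m G P"
  shows "a \<in> KP P"
proof -
  have "a g \<in> m" if g: "g \<in> TT (dg P)" for g
  proof -
    obtain n where n: "card P = p ^ n" using P by (auto simp: p_subgroup_def)
    show ?thesis
    proof (rule brauer_kernel_eval[where H = G and act = "conj_act G" and M = GA])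
      show "group G" by (rule group_axioms)
      show "subgroup P G" "finite P" "card P = p ^ n" using P psub p_subgroup_finite n by auto
      show "a \<in> brauer_kernel m G (conj_act G) GA P" using a(2) by (simp add: ogker_def)
      fix q and c :: "'g => 'o" assume q: "q \<in> P"
      then have "q \<in> carrier G" "q \<otimes> g = g \<otimes> q" "g \<in> carrier G"
        using g subgroup.mem_carrier[OF psub[OF P]] by (auto simp: TT_dg)
      then have "inv q \<otimes> g \<otimes> q = g" by (metis inv_solve_left m_assoc inv_closed m_closed)
      then show "cj q c g = c g" using \<open>g \<in> carrier G\<close> by (simp add: cj_apply)
    qed
  qed
  then show ?thesis using a by (auto simp: Kr_def)
qed

lemma lcos_eq_iff:
  assumes "subgroup D G" "x \<in> carrier G" "y \<in> carrier G"
  shows "x <# D = y <# D \<longleftrightarrow> inv x \<otimes> y \<in> D"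
proof
  assume "x <# D = y <# D"
  then have "y \<in> x <# D" using lcos_self[OF assms(3,1)] by simp
  then obtain d where "d \<in> D" "y = x \<otimes> d" by (auto simp: l_coset_def)
  then show "inv x \<otimes> y \<in> D" using assms subgroup.mem_carrier[OF assms(1)] by (simp add: m_assoc[symmetric])
next
  assume "inv x \<otimes> y \<in> D"
  then have "y \<in> x <# D" unfolding l_coset_def
    using assms by (auto intro!: bexI[of _ "inv x \<otimes> y"] simp: m_assoc[symmetric])
  then show "x <# D = y <# D" using l_repr_independence[OF _ assms(2,1)] by blast
qed

text \<open>The part of a supported on C_G(P) has coefficients in \<open>m\<close> and P-fixed group
  elements. Off the centralizer a is constant on P-orbits with a proper stabilizer R, and an orbit
  sum is the trace from R to P of one of its points.\<close>

lemma KP_subset_ogker: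
  assumes P: "p_subgroup p G P" and a: "a \<in> KP P"
  shows "a \<in> ogker m G P"
proof -
  have sP: "subgroup P G" using P by (rule psub)
  have PG: "!!q. q \<in> P ==> q \<in> carrier G" by (rule subgroup.mem_carrier[OF sP])
  have aF: "a \<in> FP P" and aG: "a \<in> GA" using a Kr_Fx Fx_GA by auto
  define cn where "cn q x = q \<otimes> x \<otimes> inv q" for q x
  have cn_cn: "cn q (cn r x) = cn (q \<otimes> r) x" if "q \<in> P" "r \<in> P" "x \<in> carrier G" for q r x
    using that PG by (simp add: cn_def inv_mult_group m_assoc)
  have cn_c: "cn q x \<in> carrier G" if "q \<in> P" "x \<in> carrier G" for q x using that PG by (simp add: cn_def)
  have cn1: "cn \<one> x = x" if "x \<in> carrier G" for x using that by (simp add: cn_def)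
  have cn_inv: "cn (inv q) (cn q x) = x" "cn q (cn (inv q) x) = x" if "q \<in> P" "x \<in> carrier G" for q x
    using that cn_cn[of "inv q" q x] cn_cn[of q "inv q" x] subgroup.m_inv_closed[OF sP] PG by (simp_all add: cn1)
  have a_cn: "a (cn q x) = a x" if "q \<in> P" "x \<in> carrier G" for q x
    unfolding cn_def by (rule Fx_apply[OF aF]) (use that PG in auto)
  have cj_val: "cj q c x = c (cn (inv q) x)" if "q \<in> P" "x \<in> carrier G" for q c x
    using that PG by (simp add: cj_apply cn_def)
  define stab where "stab x = {q \<in> P. cn q x = x}" for x
  define orb where "orb x = (%q. cn q x) ` P" for x
  \<comment> \<open>The chosen point depends only on the orbit as a set, so all its members share
    it.\<close>
  define rep where "rep x = (SOME y. y \<in> orb x)" for x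
  have orb_self: "x \<in> orb x" if "x \<in> carrier G" for x
    using cn1[OF that] subgroup.one_closed[OF sP] unfolding orb_def by (metis image_eqI)
  have rep_orb: "rep x \<in> orb x" if "x \<in> carrier G" for x
    unfolding rep_def by (rule someI[of "%y. y \<in> orb x"]) (rule orb_self[OF that])
  have orb_cn: "orb (cn q x) = orb x" if "q \<in> P" "x \<in> carrier G" for q x
  proof
    show "orb (cn q x) \<subseteq> orb x" using that cn_cn subgroup.m_closed[OF sP] by (auto simp: orb_def)
    show "orb x \<subseteq> orb (cn q x)"
    proof
      fix y assume "y \<in> orb x"
      then obtain r where r: "r \<in> P" "y = cn r x" by (auto simp: orb_def)
      then have "y = cn (r \<otimes> inv q) (cn q x)"
        using that cn_inv[OF that] cn_cn[of r "inv q" "cn q x"] subgroup.m_inv_closed[OF sP] cn_c by auto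
      then show "y \<in> orb (cn q x)" using r that subgroup.m_closed[OF sP] subgroup.m_inv_closed[OF sP] by (auto simp: orb_def)
    qed
  qed
  have rep_cn: "rep (cn q x) = rep x" if "q \<in> P" "x \<in> carrier G" for q x
    using orb_cn[OF that] by (simp add: rep_def)
  have stab_TT: "stab x = P \<longleftrightarrow> x \<in> TT (dg P)" if "x \<in> carrier G" for x
  proof -
    have "cn q x = x \<longleftrightarrow> q \<otimes> x = x \<otimes> q" if "q \<in> P" for q
      unfolding cn_def using that \<open>x \<in> carrier G\<close> PG by (metis inv_solve_right m_closed)
    then show ?thesis using that by (auto simp: stab_def TT_dg)
  qed
  have sub_stab: "subgroup (stab x) G" if x: "x \<in> carrier G" for x
  proof (rule subgroupI)
    show "stab x \<subseteq> carrier G" using PG by (auto simp: stab_def)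
    show "stab x ~= {}" using cn1[OF x] subgroup.one_closed[OF sP] by (auto simp: stab_def)
    show "inv q \<in> stab x" if "q \<in> stab x" for q
      using that cn_inv(1)[of q x] x subgroup.m_inv_closed[OF sP] by (auto simp: stab_def)
    show "q \<otimes> r \<in> stab x" if "q \<in> stab x" "r \<in> stab x" for q r
      using that cn_cn[of q r x] x subgroup.m_closed[OF sP] by (auto simp: stab_def)
  qed
  \<comment> \<open>\<open>f R\<close> keeps the value of a at one representative of each orbit,
    namely for those representatives whose stabilizer is exactly R; its trace restores a on these
    orbits.\<close>
  define f where "f R = (%x. if x \<in> carrier G \<and> rep x = x \<and> stab x = R then a x else 0)" for R
  have f_fix: "f R \<in> fixpts (conj_act G) GA R" if R: "subgroup R G" "R \<subset> P" for R
  proof -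
    have "cj q (f R) x = f R x" if q: "q \<in> R" for q x
    proof (cases "x \<in> carrier G")
      case True
      have qP: "q \<in> P" "inv q \<in> P" "inv q \<in> R" using q R subgroup.m_inv_closed[OF sP] subgroup.m_inv_closed[OF R(1)] by auto
      have "f R (cn (inv q) x) = f R x"
      proof (cases "stab x = R \<or> stab (cn (inv q) x) = R")
        case True
        then show ?thesis
        proof
          assume "stab x = R"
          then have "cn (inv q) x = x" using qP by (auto simp: stab_def)
          then show ?thesis by simp
        next
          assume "stab (cn (inv q) x) = R"
          then have "cn q (cn (inv q) x) = cn (inv q) x" using q by (auto simp: stab_def)
          then have "cn (inv q) x = x" using cn_inv(2)[OF qP(1) \<open>x \<in> carrier G\<close>] by simp
          then show ?thesis by simp
        qed
      qed (auto simp: f_def)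
      then show ?thesis using cj_val[OF qP(1) True] by simp
    next
      case False
      then show ?thesis by (simp add: conj_act_def f_def)
    qed
    then show ?thesis by (auto simp: fixpts_def grpalg_def f_def)
  qed
  define C where "C = TT (dg P)"
  have finC: "finite C" unfolding C_def by (rule finite_subset[OF _ fin]) (auto simp: TT_def)
  define u where "u = (\<Sum>x\<in>C. sm (a x) (el x))"
  have u_val: "u y = (if y \<in> C then a y else 0)" for y
    unfolding u_def fsum_apply using finC by (simp add: sm_apply gelem_def if_distrib cong: if_cong)
  have "u \<in> mod_span m (fixpts (conj_act G) GA P)"
  proof -
    obtain h where h: "bij_betw h {..<card C} C"
      using ex_bij_betw_nat_finite[OF finC] by (auto simp: atLeast0LessThan)
    have "u = (\<Sum>i<card C. sm (a (h i)) (el (h i)))"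
      unfolding u_def by (rule sum.reindex_bij_betw[OF h, symmetric])
    moreover have "a (h i) \<in> m \<and> el (h i) \<in> fixpts (conj_act G) GA P" if "i < card C" for i
    proof -
      have hi: "h i \<in> C" using h that by (auto simp: bij_betw_def)
      then have "el (h i) \<in> FP P" using el_FP[OF subgroup.subset[OF sP]] by (simp add: C_def)
      then show ?thesis using hi a ogfix_eq[OF sP] by (auto simp: C_def Kr_def ogfix_def)
    qed
    ultimately show ?thesis unfolding mod_span_def
      by (intro CollectI exI[of _ "card C"] exI[of _ "%i. a (h i)"] exI[of _ "%i. el (h i)"]) auto
  qed
  moreover have "a = u + (\<Sum>R\<in>{R. subgroup R G \<and> R \<subset> P}. rel_trace G (conj_act G) R P (f R))"
  proof (rule GA_ext)
    show "u + (\<Sum>R\<in>{R. subgroup R G \<and> R \<subset> P}. rel_trace G (conj_act G) R P (f R)) \<in> GA"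
      unfolding u_def rel_trace_def
      by (intro GA_add GA_sum GA_sm el_in cj_in) (auto simp: C_def TT_def)
    fix y assume y: "y \<in> carrier G"
    define x0 where "x0 = rep y"
    obtain q0 where q0: "q0 \<in> P" "x0 = cn q0 y" using rep_orb[OF y] by (auto simp: orb_def x0_def)
    have x0c: "x0 \<in> carrier G" using q0 y cn_c by simp
    have yx0: "y = cn (inv q0) x0" using cn_inv(1)[OF q0(1) y] q0(2) by simp
    have ax0: "a x0 = a y" using a_cn[OF q0(1) y] q0(2) by simp
    have repx0: "rep x0 = x0" using rep_cn[OF q0(1) y] q0(2) by (simp add: x0_def)
    have f_val: "f R (cn q y) = (if R = stab x0 \<and> cn q y = x0 then a y else 0)" if "q \<in> P" for q R
      using rep_cn[OF that y] cn_c[OF that y] ax0 repx0 by (auto simp: f_def x0_def)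
    have tr_val: "rel_trace G (conj_act G) R P (f R) y = (if R = stab x0 then a y else 0)"
      if R: "subgroup R G" "R \<subset> P" for R
    proof -
      let ?CC = "{q <# R | q. q \<in> P}"
      have finCC: "finite ?CC" using p_subgroup_finite[OF P] by simp
      have some: "(SOME q. q \<in> K) \<in> K \<and> (SOME q. q \<in> K) \<in> P \<and> K = (SOME q. q \<in> K) <# R" if K: "K \<in> ?CC" for K
      proof -
        obtain q where q: "q \<in> P" "K = q <# R" using K by blast
        then have "q \<in> K" using lcos_self[OF PG R(1)] by auto
        then have *: "(SOME q. q \<in> K) \<in> K" by (rule someI)
        moreover have "K \<subseteq> P" using q R subgroup.m_closed[OF sP] by (auto simp: l_coset_def)
        ultimately show ?thesis using l_repr_independence[OF _ PG[OF q(1)] R(1)] q(2) by blast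
      qed
      have "rel_trace G (conj_act G) R P (f R) y = (\<Sum>K\<in>?CC. f R (cn (inv (SOME q. q \<in> K)) y))"
        unfolding rel_trace_def fsum_apply by (rule sum.cong[OF refl], rule cj_val) (use some y in auto)
      also have "\<dots> = (\<Sum>K\<in>?CC. if R = stab x0 \<and> K = inv q0 <# R then a y else 0)"
      proof (rule sum.cong[OF refl])
        fix K assume K: "K \<in> ?CC"
        let ?q = "SOME q. q \<in> K"
        have q: "?q \<in> P" "K = ?q <# R" using some[OF K] by auto
        have ip: "inv ?q \<in> P" "inv q0 \<in> P" using q q0 subgroup.m_inv_closed[OF sP] by auto
        \<comment> \<open>As R is the stabilizer of x0, the elements of P carrying y to x0 are the
          inverses of the elements of a single coset, so the trace at y has exactly one nonzero
          term.\<close>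
        have "cn (inv ?q) y = x0 \<longleftrightarrow> K = inv q0 <# R" if "R = stab x0"
        proof -
          have "cn (inv ?q) y = cn (inv ?q \<otimes> inv q0) x0"
            using cn_cn[OF ip x0c] yx0 by simp
          then have "cn (inv ?q) y = x0 \<longleftrightarrow> inv ?q \<otimes> inv q0 \<in> R"
            using that ip subgroup.m_closed[OF sP] by (auto simp: stab_def)
          also have "\<dots> \<longleftrightarrow> K = inv q0 <# R"
            using lcos_eq_iff[OF R(1) PG[OF q(1)] PG[OF ip(2)]] q(2) by simp
          finally show ?thesis .
        qed
        then show "f R (cn (inv ?q) y) = (if R = stab x0 \<and> K = inv q0 <# R then a y else 0)"
          unfolding f_val[OF ip(1)] by auto
      qed
      also have "\<dots> = (if R = stab x0 then a y else 0)"
      proof (cases "R = stab x0")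
        case True
        have "inv q0 <# R \<in> ?CC" using q0 subgroup.m_inv_closed[OF sP] by blast
        then show ?thesis using True finCC by (simp add: sum.delta)
      qed auto
      finally show ?thesis .
    qed
    have finR: "finite {R. subgroup R G \<and> R \<subset> P}"
      by (rule finite_subset[of _ "Pow P"]) (use p_subgroup_finite[OF P] in auto)
    have "(\<Sum>R\<in>{R. subgroup R G \<and> R \<subset> P}. rel_trace G (conj_act G) R P (f R)) y
        = (\<Sum>R\<in>{R. subgroup R G \<and> R \<subset> P}. if R = stab x0 then a y else 0)"
      unfolding fsum_apply by (rule sum.cong) (auto simp: tr_val)
    also have "\<dots> = (if stab x0 \<subset> P then a y else 0)"
      using finR sub_stab[OF x0c] by (simp add: sum.delta')
    also have "stab x0 \<subset> P \<longleftrightarrow> y \<notin> C"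
    proof -
      have "x0 \<in> C \<longleftrightarrow> y \<in> C"
      proof
        assume "x0 \<in> C"
        then have "cn (inv q0) x0 = x0"
          using stab_TT[OF x0c] q0 subgroup.m_inv_closed[OF sP] by (auto simp: C_def stab_def)
        then show "y \<in> C" using yx0 \<open>x0 \<in> C\<close> by simp
      next
        assume "y \<in> C"
        then have "cn q0 y = y" using stab_TT[OF y] q0 by (auto simp: C_def stab_def)
        then show "x0 \<in> C" using q0 \<open>y \<in> C\<close> by simp
      qed
      then show ?thesis using stab_TT[OF x0c] by (auto simp: C_def stab_def)
    qed
    finally have "(\<Sum>R\<in>{R. subgroup R G \<and> R \<subset> P}. rel_trace G (conj_act G) R P (f R)) y = (if y \<notin> C then a y else 0)" .
    then show "a y = (u + (\<Sum>R\<in>{R. subgroup R G \<and> R \<subset> P}. rel_trace G (conj_act G) R P (f R))) y"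
      by (simp add: u_val)
  qed (rule aG)
  ultimately show ?thesis
    unfolding ogker_def brauer_kernel_def using f_fix by blast
qed

lemma ogker_iff: "p_subgroup p G P ==> a \<in> FP P ==> a \<in> ogker m G P \<longleftrightarrow> a \<in> KP P"
  using ogker_subset_KP KP_subset_ogker by blast

text \<open>Modulo the kernel a product at c is the convolution over C_G(P). The substitution of
  y^-1 c for y exchanges the factors, because z is invariant under conjugation by c.\<close>

lemma centralizing_central:
  assumes P: "p_subgroup p G P" and z: "z \<in> FP P" "!!c. c \<in> TT (dg P) ==> cj c z = z" and a: "a \<in> FP P"
  shows "z \<star> a - a \<star> z \<in> KP P"
  unfolding Kr_def
proof (intro CollectI conjI ballI)
  show "z \<star> a - a \<star> z \<in> FP P" using z a by (intro Fx_diff FP_mult)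
  fix c assume c: "c \<in> TT (dg P)"
  have sC: "subgroup (TT (dg P)) G" by (rule subgroup_centralizer) (rule subgroup.subset[OF psub[OF P]])
  note h = hm_id[OF psub[OF P]]
  have CG: "!!y. y \<in> TT (dg P) ==> y \<in> carrier G" by (auto simp: TT_def)
  have "(\<Sum>y\<in>TT (dg P). z y * a (inv y \<otimes> c)) = (\<Sum>y\<in>TT (dg P). a y * z (inv y \<otimes> c))"
  proof (rule sum.reindex_bij_witness[where i = "%y. c \<otimes> inv y" and j = "%y. inv y \<otimes> c"])
    fix y assume y: "y \<in> TT (dg P)"
    show "c \<otimes> inv (inv y \<otimes> c) = y" "inv (c \<otimes> inv y) \<otimes> c = y"
      using CG[OF y] CG[OF c] by (simp_all add: inv_mult_group m_assoc[symmetric]) (simp add: m_assoc)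
    show "inv y \<otimes> c \<in> TT (dg P)" "c \<otimes> inv y \<in> TT (dg P)"
      using y c subgroup.m_closed[OF sC] subgroup.m_inv_closed[OF sC] by auto
    have "cj c z y = z y" using z(2)[OF c] by simp
    then have "z (inv c \<otimes> y \<otimes> c) = z y" using CG[OF y] by (simp add: cj_apply)
    moreover have "inv (inv y \<otimes> c) \<otimes> c = inv c \<otimes> y \<otimes> c" using CG[OF y] CG[OF c] by (simp add: inv_mult_group)
    ultimately show "a (inv y \<otimes> c) * z (inv (inv y \<otimes> c) \<otimes> c) = z y * a (inv y \<otimes> c)" by (simp add: mult.commute)
  qed
  then have "((z \<star> a) c - (\<Sum>y\<in>TT (dg P). z y * a (inv y \<otimes> c))) - ((a \<star> z) c - (\<Sum>y\<in>TT (dg P). a y * z (inv y \<otimes> c)))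
      = (z \<star> a - a \<star> z) c" by simp
  moreover have "((z \<star> a) c - (\<Sum>y\<in>TT (dg P). z y * a (inv y \<otimes> c))) - ((a \<star> z) c - (\<Sum>y\<in>TT (dg P). a y * z (inv y \<otimes> c))) \<in> m"
    by (intro m_diff conv_fixed_mod[OF P h h h] z a c)
  ultimately show "(z \<star> a - a \<star> z) c \<in> m" by simp
qed

section \<open>Relative traces over unions of cosets and the Mackey formula\<close>

abbreviation tr :: "'g set => 'g set => ('g => 'o) => 'g => 'o" where
  "tr D W a \<equiv> rel_trace G (conj_act G) D W a"

text \<open>The summand of the trace at the coset C; for a D-fixed a it does not depend on the
  chosen element. The traces run over arbitrary sets W that are unions of cosets, so that they can
  be split along double cosets.\<close>

definition cval :: "('g => 'o) => 'g set => 'g => 'o" where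
  "cval a C = cj (SOME q. q \<in> C) a"

definition lcs :: "'g set => 'g set => 'g set set" where
  "lcs D W = (%q. q <# D) ` W"

lemma tr_def: "tr D W a = (\<Sum>C\<in>lcs D W. cval a C)"
  by (simp add: rel_trace_def cval_def lcs_def setcompr_eq_image)

lemma cval:
  assumes "subgroup D G" "a \<in> FP D" "q \<in> carrier G"
  shows "cval a (q <# D) = cj q a"
proof -
  have "q \<in> q <# D" using lcos_self[OF assms(3,1)] .
  then have "(SOME x. x \<in> q <# D) \<in> q <# D" by (rule someI)
  then obtain d where d: "d \<in> D" "(SOME x. x \<in> q <# D) = q \<otimes> d" by (auto simp: l_coset_def)
  then show ?thesis
    unfolding cval_def d(2) using cj_cj[OF assms(3), of d a] FP_cj[OF assms(1,2) d(1)] subgroup.mem_carrier[OF assms(1)] by simp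
qed

lemma cval_cong_GA: "cval a C \<in> GA" by (simp add: cval_def)

lemma finite_lcs: "W \<subseteq> carrier G ==> finite (lcs D W)"
  unfolding lcs_def using fin finite_subset by blast

lemma tr_GA: "tr D W a \<in> GA" unfolding tr_def by (intro GA_sum cval_cong_GA)
lemma tr_add: "tr D W (a + c) = tr D W a + tr D W c" unfolding tr_def cval_def by (simp add: cj_add sum.distrib)
lemma tr_diff: "tr D W (a - c) = tr D W a - tr D W c" unfolding tr_def cval_def by (simp add: cj_diff sum_subtractf)
lemma tr_zero [simp]: "tr D W 0 = 0" unfolding tr_def cval_def by simp
lemma tr_sum: "tr D W (\<Sum>i\<in>I. f i) = (\<Sum>i\<in>I. tr D W (f i))"
  using sum_comp_morphism[of "tr D W" f I] by (simp add: tr_add o_def)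
lemma tr_M0: "a \<in> M0 ==> tr D W a \<in> M0" unfolding tr_def cval_def by (intro M0_sum M0_cj)

lemma tr_cj_left:
  assumes "subgroup D G" "a \<in> FP D" "W \<subseteq> carrier G" "h \<in> carrier G"
  shows "cj h (tr D W a) = tr D ((%x. h \<otimes> x) ` W) a"
proof -
  have "tr D ((%x. h \<otimes> x) ` W) a = (\<Sum>C\<in>(%C. h <# C) ` lcs D W. cval a C)"
    unfolding tr_def lcs_def image_image using assms(3,4) subgroup.subset[OF assms(1)]
    by (intro sum.cong) (force simp: lcos_m_assoc subset_iff intro!: image_cong)+
  also have "\<dots> = (\<Sum>C\<in>lcs D W. cval a (h <# C))"
  proof (rule sum.reindex_cong[OF _ refl refl])
    show "inj_on (%C. h <# C) (lcs D W)"
    proof (rule inj_onI)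
      fix C C' assume C: "C \<in> lcs D W" "C' \<in> lcs D W" and e: "h <# C = h <# C'"
      have sub: "K \<subseteq> carrier G" if "K \<in> lcs D W" for K
        using that assms(3) subgroup.subset[OF assms(1)] by (auto simp: lcs_def l_coset_def)
      have "inv h <# (h <# K) = K" if "K \<in> lcs D W" for K
        using sub[OF that] assms(4) by (simp add: lcos_m_assoc lcos_mult_one)
      then show "C = C'" using C e by metis
    qed
  qed
  also have "\<dots> = (\<Sum>C\<in>lcs D W. cj h (cval a C))"
  proof (rule sum.cong[OF refl])
    fix C assume "C \<in> lcs D W"
    then obtain q where q: "q \<in> W" "q \<in> carrier G" "C = q <# D" using assms(3) by (auto simp: lcs_def)
    have "h <# C = (h \<otimes> q) <# D" using q assms(4) subgroup.subset[OF assms(1)] by (simp add: lcos_m_assoc)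
    then show "cval a (h <# C) = cj h (cval a C)"
      using q assms by (simp add: cval cj_cj)
  qed
  finally show ?thesis by (simp add: tr_def cj_sum)
qed

lemma tr_FP:
  assumes "subgroup D G" "a \<in> FP D" "W \<subseteq> carrier G" "subgroup H G"
    "!!h x. h \<in> H ==> x \<in> W ==> h \<otimes> x \<in> W"
  shows "tr D W a \<in> FP H"
proof (rule FPI[OF assms(4) tr_GA])
  fix h assume h: "h \<in> H"
  have hc: "h \<in> carrier G" "inv h \<in> H" using h subgroup.mem_carrier[OF assms(4)] subgroup.m_inv_closed[OF assms(4)] by auto
  have "(%x. h \<otimes> x) ` W = W"
  proof
    show "(%x. h \<otimes> x) ` W \<subseteq> W" using assms(5) h by auto
    show "W \<subseteq> (%x. h \<otimes> x) ` W"
    proof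
      fix x assume x: "x \<in> W"
      then have "x = h \<otimes> (inv h \<otimes> x)" using hc assms(3) by (auto simp: m_assoc[symmetric])
      then show "x \<in> (%x. h \<otimes> x) ` W" using assms(5)[OF hc(2) x] by blast
    qed
  qed
  then show "cj h (tr D W a) = tr D W a" using tr_cj_left[OF assms(1-3) hc(1)] by simp
qed

lemma tr_mult:
  assumes "subgroup D G" "a \<in> FP D" "W \<subseteq> carrier G" "z \<in> FP (carrier G)"
  shows "z \<star> tr D W a = tr D W (z \<star> a)"
proof -
  have zc: "cj h z = z" if "h \<in> carrier G" for h using FP_cj[OF subgroup_self assms(4) that] .
  have za: "z \<star> a \<in> FP D"
    using FP_mult[OF FP_mono[OF subgroup.subset[OF assms(1)] assms(4)] assms(2)] .
  have "z \<star> cval a C = cval (z \<star> a) C" if C: "C \<in> lcs D W" for C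
  proof -
    obtain q where "q \<in> carrier G" "C = q <# D" using C assms(3) by (auto simp: lcs_def)
    then show ?thesis using assms za zc by (simp add: cval cj_mult)
  qed
  then show ?thesis by (simp add: tr_def gm_sum_right)
qed

lemma tr_partition:
  assumes "subgroup D G" "finite YY" "!!Y. Y \<in> YY ==> Y \<subseteq> carrier G" "!!Y x d. Y \<in> YY ==> x \<in> Y ==> d \<in> D ==> x \<otimes> d \<in> Y"
    "!!Y Z. Y \<in> YY ==> Z \<in> YY ==> Y ~= Z ==> Y \<inter> Z = {}"
  shows "tr D (\<Union>YY) a = (\<Sum>Y\<in>YY. tr D Y a)"
proof -
  have "lcs D (\<Union>YY) = (\<Union>Y\<in>YY. lcs D Y)" by (auto simp: lcs_def)
  moreover have "lcs D Y \<inter> lcs D Z = {}" if "Y \<in> YY" "Z \<in> YY" "Y ~= Z" for Y Z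
  proof (rule ccontr)
    assume "lcs D Y \<inter> lcs D Z ~= {}"
    then obtain y z where yz: "y \<in> Y" "z \<in> Z" "y <# D = z <# D" by (auto simp: lcs_def)
    have "z \<in> z <# D" using lcos_self[OF _ assms(1)] assms(3)[OF that(2)] yz by auto
    then have "z \<in> y <# D" using yz by simp
    then have "z \<in> Y" using assms(4)[OF that(1) yz(1)] by (auto simp: l_coset_def)
    then show False using assms(5)[OF that] yz by auto
  qed
  ultimately show ?thesis
    unfolding tr_def using assms(2,3) finite_lcs by (simp add: sum.UNION_disjoint)
qed

lemma tr_transitive:
  assumes R: "subgroup R G" and D: "subgroup D G" "R \<subseteq> D" and a: "a \<in> FP R"
  shows "tr R (carrier G) a = tr D (carrier G) (tr R D a)"
proof -
  have DG: "D \<subseteq> carrier G" and RG: "R \<subseteq> carrier G" using subgroup.subset D R by auto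
  have trF: "tr R D a \<in> FP D" by (rule tr_FP[OF R a DG D(1)]) (rule subgroup.m_closed[OF D(1)])
  define YY where "YY = lcs D (carrier G)"
  have "\<Union>YY = carrier G"
  proof
    show "\<Union>YY \<subseteq> carrier G" using DG by (auto simp: YY_def lcs_def l_coset_def)
    show "carrier G \<subseteq> \<Union>YY" using lcos_self[OF _ D(1)] by (auto simp: YY_def lcs_def)
  qed
  moreover have "tr R (\<Union>YY) a = (\<Sum>Y\<in>YY. tr R Y a)"
  proof (rule tr_partition[OF R])
    show "finite YY" unfolding YY_def by (rule finite_lcs) simp
    show "Y \<subseteq> carrier G" if "Y \<in> YY" for Y using that DG by (auto simp: YY_def lcs_def l_coset_def)
    show "x \<otimes> d \<in> Y" if "Y \<in> YY" "x \<in> Y" "d \<in> R" for Y x d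
      using that D DG subgroup.m_closed[OF D(1)] by (fastforce simp: YY_def lcs_def l_coset_def m_assoc subset_iff)
    show "Y \<inter> Z = {}" if "Y \<in> YY" "Z \<in> YY" "Y ~= Z" for Y Z
    proof (rule ccontr)
      assume "Y \<inter> Z ~= {}"
      then obtain x where x: "x \<in> Y" "x \<in> Z" by blast
      obtain y z where yz: "y \<in> carrier G" "z \<in> carrier G" "Y = y <# D" "Z = z <# D"
        using \<open>Y \<in> YY\<close> \<open>Z \<in> YY\<close> by (auto simp: YY_def lcs_def)
      then have "Y = x <# D" "Z = x <# D" using l_repr_independence[OF _ _ D(1)] x by blast+
      then show False using \<open>Y ~= Z\<close> by simp
    qed
  qed
  moreover have "tr R Y a = cval (tr R D a) Y" if Y: "Y \<in> YY" for Y
  proof -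
    obtain q where q: "q \<in> carrier G" "Y = q <# D" using Y by (auto simp: YY_def lcs_def)
    have "cval (tr R D a) Y = cj q (tr R D a)" using cval[OF D(1) trF q(1)] q(2) by simp
    also have "\<dots> = tr R ((%x. q \<otimes> x) ` D) a" by (rule tr_cj_left[OF R a DG q(1)])
    also have "(%x. q \<otimes> x) ` D = Y" by (auto simp: q(2) l_coset_def)
    finally show ?thesis by simp
  qed
  ultimately show ?thesis by (simp add: tr_def[of D] YY_def)
qed

text \<open>The x with R contained in x D x^-1; their cosets x D are the fixed points of R on
  G/D.\<close>

definition WW :: "'g set => 'g set => 'g set" where
  "WW R D = {x \<in> carrier G. \<forall>r\<in>R. inv x \<otimes> r \<otimes> x \<in> D}"

text \<open>R permutes the cosets of D, and at a group element c centralizing R the summands are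
  constant on R-orbits. Only the fixed cosets survive modulo p; this is the Mackey formula after the
  Brauer map.\<close>

lemma mackey_mod:
  assumes R: "p_subgroup p G R" and D: "subgroup D G" and a: "a \<in> FP D"
  shows "tr D (carrier G) a - tr D (WW R D) a \<in> KP R"
  unfolding Kr_def
proof (intro CollectI conjI ballI)
  have sR: "subgroup R G" using R by (rule psub)
  have RG: "!!r. r \<in> R ==> r \<in> carrier G" by (rule subgroup.mem_carrier[OF sR])
  have DG: "D \<subseteq> carrier G" using D by (rule subgroup.subset)
  have WG: "WW R D \<subseteq> carrier G" by (auto simp: WW_def)
  have "h \<otimes> x \<in> WW R D" if "h \<in> R" "x \<in> WW R D" for h x
  proof -
    have "inv (h \<otimes> x) \<otimes> r \<otimes> (h \<otimes> x) = inv x \<otimes> (inv h \<otimes> r \<otimes> h) \<otimes> x" if "r \<in> R" for r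
      using that \<open>h \<in> R\<close> \<open>x \<in> WW R D\<close> RG by (auto simp: WW_def inv_mult_group m_assoc)
    moreover have "inv h \<otimes> r \<otimes> h \<in> R" if "r \<in> R" for r
      using that \<open>h \<in> R\<close> sR by (meson subgroup.m_closed subgroup.m_inv_closed)
    ultimately show ?thesis using that RG by (auto simp: WW_def)
  qed
  then show "tr D (carrier G) a - tr D (WW R D) a \<in> FP R"
    using RG by (intro Fx_diff tr_FP[OF D a _ sR] WG) auto
  fix c assume c: "c \<in> TT (dg R)"
  then have cG: "c \<in> carrier G" by (auto simp: TT_def)
  obtain n where n: "group (G\<lparr>carrier := R\<rparr>)" "finite (carrier (G\<lparr>carrier := R\<rparr>))" "card (carrier (G\<lparr>carrier := R\<rparr>)) = p ^ n"
    using p_subgroup_group[OF R] .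
  have lsub: "C \<subseteq> carrier G" if "C \<in> lcs D (carrier G)" for C using that DG by (auto simp: lcs_def l_coset_def)
  have "is_action (G\<lparr>carrier := R\<rparr>) (%r C. r <# C) (lcs D (carrier G))"
    unfolding is_action_def using RG lsub DG
    by (auto simp: lcs_def lcos_m_assoc lcos_mult_one subset_iff image_iff)
  moreover have "cval a (r <# C) c = cval a C c" if r: "r \<in> R" and C: "C \<in> lcs D (carrier G)" for r C
  proof -
    obtain q where q: "q \<in> carrier G" "C = q <# D" using C by (auto simp: lcs_def)
    have "r <# C = (r \<otimes> q) <# D" using q RG[OF r] DG by (simp add: lcos_m_assoc)
    then have "cval a (r <# C) = cj r (cval a C)" using q RG[OF r] D a by (simp add: cval cj_cj)
    moreover have "inv r \<otimes> c \<otimes> r = c"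
      using c r RG[OF r] cG unfolding TT_dg by (metis inv_solve_left inv_closed m_assoc m_closed)
    ultimately show ?thesis using cG by (simp add: cj_apply)
  qed
  ultimately have "(\<Sum>C\<in>lcs D (carrier G). cval a C c) -
     (\<Sum>C\<in>{C \<in> lcs D (carrier G). \<forall>r\<in>carrier (G\<lparr>carrier := R\<rparr>). r <# C = C}. cval a C c) \<in> m"
    by (intro sum_fixed_mod[OF n] finite_lcs) auto
  moreover have "{C \<in> lcs D (carrier G). \<forall>r\<in>carrier (G\<lparr>carrier := R\<rparr>). r <# C = C} = lcs D (WW R D)"
  proof -
    have "r <# (x <# D) = x <# D \<longleftrightarrow> inv x \<otimes> r \<otimes> x \<in> D" if "x \<in> carrier G" "r \<in> R" for x r
      using lcos_eq_iff[OF D that(1), of "r \<otimes> x"] that RG DG by (auto simp: lcos_m_assoc m_assoc)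
    then show ?thesis unfolding lcs_def WW_def by auto
  qed
  ultimately show "(tr D (carrier G) a - tr D (WW R D) a) c \<in> m"
    by (simp add: tr_def fsum_apply)
qed

end

subsection \<open>Primitive idempotents modulo an ideal\<close>

lemma ring_ideal_power_diff:
  assumes "ring_ideal I" "a - c \<in> I"
  shows "a ^ n - c ^ n \<in> I"
proof (induction n)
  case 0
  then show ?case by (simp add: ring_idealD[OF assms(1)])
next
  case (Suc n)
  have "a * (a ^ n - c ^ n) + (a - c) * c ^ n \<in> I"
    by (intro ring_idealD(2-4)[OF assms(1)] Suc assms(2))
  then show ?case by (simp add: algebra_simps)
qed

declare plus_fun_apply [simp del] zero_fun_apply [simp del] minus_apply [simp del] uminus_apply [simp del]

context group_alg
begin

definition eqm :: "('g => 'o) => ('g => 'o) set => ('g => 'o) => bool" ("(_ \<approx>\<^bsub>_\<^esub> _)" [51, 0, 51] 50) where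
  "a \<approx>\<^bsub>K\<^esub> c \<longleftrightarrow> a - c \<in> K"

definition subalg :: "('g => 'o) set => bool" where
  "subalg B \<longleftrightarrow> B \<subseteq> GA \<and> 0 \<in> B \<and> (\<forall>a\<in>B. \<forall>c\<in>B. a + c \<in> B \<and> a - c \<in> B \<and> a \<star> c \<in> B) \<and> (\<forall>r. \<forall>a\<in>B. sm r a \<in> B)"

text \<open>The clause \<open>M0 \<inter> B \<subseteq> K\<close> makes B/K an algebra over the
  residue field, finite-dimensional because it is a quotient of a subalgebra of the group algebra
  over k.\<close>

definition alg_ideal :: "('g => 'o) set => ('g => 'o) set => bool" where
  "alg_ideal B K \<longleftrightarrow> K \<subseteq> B \<and> 0 \<in> K \<and> (\<forall>a\<in>K. \<forall>c\<in>K. a + c \<in> K \<and> a - c \<in> K) \<and> (\<forall>r. \<forall>a\<in>K. sm r a \<in> K) \<and>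
     (\<forall>a\<in>B. \<forall>k\<in>K. a \<star> k \<in> K \<and> k \<star> a \<in> K) \<and> M0 \<inter> B \<subseteq> K"

text \<open>\<open>kprim B K e\<close>: the image of \<open>e\<close> is a primitive idempotent of \<open>B / K\<close>.\<close>

definition kprim :: "('g => 'o) set => ('g => 'o) set => ('g => 'o) => bool" where
  "kprim B K e \<longleftrightarrow> subalg B \<and> alg_ideal B K \<and> e \<in> B \<and> e \<star> e - e \<in> K \<and> e \<notin> K \<and>
     (\<forall>u\<in>B. e \<star> u - u \<in> K --> u \<star> e - u \<in> K --> u \<star> u - u \<in> K --> u \<in> K \<or> e - u \<in> K)"

end

locale algebra_mod = group_alg G m p
  for G :: "'g monoid" (structure) and m :: "'o::idom set" and p +
  fixes B K :: "('g => 'o) set"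
  assumes sB: "subalg B" and iK: "alg_ideal B K"
begin

abbreviation eqv (infix "\<approx>" 50) where "a \<approx> c \<equiv> a \<approx>\<^bsub>K\<^esub> c"

lemma B_GA: "a \<in> B ==> a \<in> GA" and B_zero [simp]: "0 \<in> B" and B_add: "a \<in> B ==> c \<in> B ==> a + c \<in> B"
  and B_diff: "a \<in> B ==> c \<in> B ==> a - c \<in> B" and B_mult: "a \<in> B ==> c \<in> B ==> a \<star> c \<in> B"
  and B_sm: "a \<in> B ==> sm r a \<in> B"
  using sB by (auto simp: subalg_def)

lemma K_B: "a \<in> K ==> a \<in> B" and K_zero [simp]: "0 \<in> K" and K_add: "a \<in> K ==> c \<in> K ==> a + c \<in> K"
  and K_diff: "a \<in> K ==> c \<in> K ==> a - c \<in> K" and K_sm: "a \<in> K ==> sm r a \<in> K"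
  and K_left: "k \<in> K ==> a \<in> B ==> k \<star> a \<in> K" and K_right: "k \<in> K ==> a \<in> B ==> a \<star> k \<in> K"
  and K_M0: "a \<in> M0 ==> a \<in> B ==> a \<in> K"
  using iK by (auto simp: alg_ideal_def)

lemma B_sum: "(!!i. i \<in> I ==> f i \<in> B) ==> sum f I \<in> B"
  by (induction I rule: infinite_finite_induct) (auto intro: B_add)
lemma K_sum: "(!!i. i \<in> I ==> f i \<in> K) ==> sum f I \<in> K"
  by (induction I rule: infinite_finite_induct) (auto intro: K_add)

lemma eq_refl [simp]: "a \<approx> a" by (simp add: eqm_def)
lemma eq_sym: "a \<approx> c ==> c \<approx> a" unfolding eqm_def using K_diff[of 0 "a - c"] by simp
lemma eq_trans [trans]: "a \<approx> c ==> c \<approx> d ==> a \<approx> d" unfolding eqm_def using K_add[of "a - c" "c - d"] by simp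
lemma eq_add: "a \<approx> a' ==> c \<approx> c' ==> a + c \<approx> a' + c'"
  unfolding eqm_def using K_add[of "a - a'" "c - c'"] by (simp add: algebra_simps)
lemma eq_diff: "a \<approx> a' ==> c \<approx> c' ==> a - c \<approx> a' - c'"
  unfolding eqm_def using K_diff[of "a - a'" "c - c'"] by (simp add: algebra_simps)
lemma eq_sm: "a \<approx> c ==> sm r a \<approx> sm r c" unfolding eqm_def by (simp add: K_sm sm_diff[symmetric])
lemma eq_left: "a \<approx> c ==> d \<in> B ==> d \<star> a \<approx> d \<star> c" unfolding eqm_def by (simp add: K_right gm_diff_right[symmetric])
lemma eq_right: "a \<approx> c ==> d \<in> B ==> a \<star> d \<approx> c \<star> d" unfolding eqm_def by (simp add: K_left gm_diff_left[symmetric])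
lemma eq_mult: "a \<approx> a' ==> c \<approx> c' ==> c \<in> B ==> a' \<in> B ==> a \<star> c \<approx> a' \<star> c'"
  using eq_left eq_right eq_trans by blast
lemma eq_K: "a \<approx> c ==> a \<in> K \<longleftrightarrow> c \<in> K"
  unfolding eqm_def using K_add[of "a - c" c] K_diff[of a "a - c"] by auto
lemma eq_zero: "a \<approx> 0 \<longleftrightarrow> a \<in> K" by (simp add: eqm_def)
lemma eq_sum: "(!!i. i \<in> I ==> f i \<approx> h i) ==> sum f I \<approx> sum h I"
  unfolding eqm_def sum_subtractf[symmetric] by (rule K_sum)

end

locale primitive_mod = algebra_mod G m p B K
  for G :: "'g monoid" (structure) and m :: "'o::idom set" and p and B K +
  fixes e :: "'g => 'o"
  assumes eB: "e \<in> B" and idem: "e \<star> e - e \<in> K" and eK: "e \<notin> K"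
    and prim: "!!u. u \<in> B ==> e \<star> u - u \<in> K ==> u \<star> e - u \<in> K ==> u \<star> u - u \<in> K ==> u \<in> K \<or> e - u \<in> K"
begin

lemma ee: "e \<star> e \<approx> e" using idem by (simp add: eqm_def)

text \<open>x represents an element of e (B/K) e, a ring with identity e. Primitivity of e says that
  this ring has only trivial idempotents, and the lemmas below derive that it is local.\<close>

definition corner :: "('g => 'o) => bool" where
  "corner x \<longleftrightarrow> x \<in> B \<and> e \<star> x \<approx> x \<and> x \<star> e \<approx> x"

lemma cB: "corner x ==> x \<in> B" and ce: "corner x ==> e \<star> x \<approx> x" and ce': "corner x ==> x \<star> e \<approx> x"
  by (auto simp: corner_def)

lemma corner_e: "corner e" by (simp add: corner_def eB ee)
lemma corner_zero: "corner 0" by (simp add: corner_def)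
lemma corner_add: "corner x ==> corner y ==> corner (x + y)"
  unfolding corner_def by (auto simp: gm_add_left gm_add_right intro: B_add eq_add)
lemma corner_diff: "corner x ==> corner y ==> corner (x - y)"
  unfolding corner_def by (auto simp: gm_diff_left gm_diff_right intro: B_diff eq_diff)
lemma corner_sm: "corner x ==> corner (sm r x)"
  unfolding corner_def by (auto simp: gm_sm_left gm_sm_right intro: B_sm eq_sm)
lemma corner_mult:
  assumes "corner x" "corner y" shows "corner (x \<star> y)"
proof -
  have "e \<star> x \<star> y \<approx> x \<star> y" by (rule eq_right[OF ce cB]) fact+
  moreover have "x \<star> (y \<star> e) \<approx> x \<star> y" by (rule eq_left[OF ce' cB]) fact+
  ultimately show ?thesis using assms by (simp add: corner_def B_mult gm_assoc)
qed
lemma corner_sum: "(!!i. i \<in> I ==> corner (f i)) ==> corner (sum f I)"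
  by (induction I rule: infinite_finite_induct) (auto intro: corner_add corner_zero)
lemma corner_eq: "corner x ==> y \<approx> x ==> y \<in> B ==> corner y"
  unfolding corner_def using eq_left[OF _ eB] eq_right[OF _ eB] eq_trans eq_sym by meson
lemma corner_ebe: "a \<in> B ==> corner (e \<star> a \<star> e)"
proof -
  assume a: "a \<in> B"
  have "e \<star> e \<star> (a \<star> e) \<approx> e \<star> (a \<star> e)" by (rule eq_right[OF ee]) (intro B_mult a eB)
  moreover have "e \<star> a \<star> (e \<star> e) \<approx> e \<star> a \<star> e" by (rule eq_left[OF ee]) (intro B_mult a eB)
  ultimately show ?thesis using a eB by (simp add: corner_def B_mult gm_assoc)
qed

primrec kpow :: "('g => 'o) => nat => ('g => 'o)" where
  "kpow x 0 = e"
| "kpow x (Suc n) = x \<star> kpow x n"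

text \<open>Evaluation of polynomials at x inside the corner, with e as the unit for constant terms.
  It is additive on the nose but multiplicative only modulo K.\<close>

definition pev :: "('g => 'o) => 'o poly => ('g => 'o)" where
  "pev x f = fold_coeffs (%a r. sm a e + x \<star> r) f 0"

lemma pev_0 [simp]: "pev x 0 = 0" by (simp add: pev_def)
lemma pev_pCons: "pev x (pCons a f) = sm a e + x \<star> pev x f"
  by (cases "f = 0 \<and> a = 0") (auto simp: pev_def)

lemma corner_kpow: "corner x ==> corner (kpow x n)"
  by (induction n) (auto intro: corner_e corner_mult)

lemma corner_pev: "corner x ==> corner (pev x f)"
proof (induction f)
  case 0
  then show ?case by (simp add: corner_zero)
next
  case (pCons a f)
  then show ?case by (auto simp: pev_pCons intro!: corner_add corner_sm corner_e corner_mult)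
qed

lemma pev_add: "pev x (f + g) = pev x f + pev x g"
proof (induction f g rule: poly_induct2)
  case (pCons a f c g)
  have "pev x (f + g) = pev x f + pev x g" by (rule pCons)
  then have "pev x (pCons a f + pCons c g) = sm a e + sm c e + (x \<star> pev x f + x \<star> pev x g)"
    by (simp only: add_pCons pev_pCons sm_add_scalar gm_add_right)
  then show ?case by (simp only: pev_pCons add.assoc add.left_commute)
qed (simp only: add_0_right pev_0)

lemma pev_smult: "pev x (Polynomial.smult c f) = sm c (pev x f)"
proof (induction f)
  case (pCons a f)
  have "pev x (Polynomial.smult c f) = sm c (pev x f)" by (rule pCons)
  then show ?case by (simp only: smult_pCons pev_pCons sm_add sm_sm gm_sm_right)
qed (simp only: smult_0_right pev_0 sm_zero_right)

lemma pev_diff: "pev x (f - g) = pev x f - pev x g"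
  unfolding eq_diff_eq pev_add[symmetric] by simp

lemma pev_one: "pev x 1 = e" unfolding one_pCons pev_pCons by simp

lemma pev_mult: "corner x ==> pev x (f * g) \<approx> pev x f \<star> pev x g"
proof (induction f)
  case 0
  then show ?case by simp
next
  case (pCons a f)
  have 1: "pev x (pCons a f * g) = sm a (pev x g) + x \<star> pev x (f * g)"
    by (simp only: mult_pCons_left pev_add pev_smult pev_pCons sm_zero add_0_left)
  have 2: "pev x (pCons a f) \<star> pev x g = sm a (e \<star> pev x g) + x \<star> (pev x f \<star> pev x g)"
    by (simp only: pev_pCons gm_add_left gm_sm_left gm_assoc)
  have e: "sm a (pev x g) \<approx> sm a (e \<star> pev x g)"
    using ce[OF corner_pev[OF pCons.prems]] by (rule eq_sm[OF eq_sym])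
  have "pev x (f * g) \<approx> pev x f \<star> pev x g" using pCons.prems by (rule pCons.IH)
  then have "x \<star> pev x (f * g) \<approx> x \<star> (pev x f \<star> pev x g)" using cB[OF pCons.prems] by (rule eq_left)
  with e show ?case unfolding 1 2 by (rule eq_add)
qed

lemma pev_monom: "pev x (monom c n) = sm c (kpow x n)"
proof (induction n)
  case 0
  show ?case by (simp only: monom_0 pev_pCons pev_0 gm_zero_right kpow.simps add_0_right)
next
  case (Suc n)
  show ?case by (simp only: monom_Suc pev_pCons Suc sm_zero gm_sm_right kpow.simps add_0_left)
qed

lemma pev_sum: "pev x (\<Sum>i\<in>I. f i) = (\<Sum>i\<in>I. pev x (f i))"
  using sum_comp_morphism[of "pev x" f I] by (simp add: pev_add o_def)

definition pid :: "('g => 'o) => 'o poly set" where "pid x = {f. pev x f \<in> K}"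

lemma ring_ideal_pid: "corner x ==> ring_ideal (pid x)"
  unfolding ring_ideal_def
proof (intro conjI ballI allI)
  assume x: "corner x"
  show "0 \<in> pid x" by (simp add: pid_def)
  show "f \<in> pid x ==> g \<in> pid x ==> f + g \<in> pid x" for f g
    by (simp add: pid_def pev_add K_add)
  fix r f assume "f \<in> pid x"
  then have "pev x r \<star> pev x f \<in> K" using cB[OF corner_pev[OF x]] K_right by (simp add: pid_def)
  then show "r * f \<in> pid x" using eq_K[OF pev_mult[OF x]] by (simp add: pid_def)
qed

text \<open>The |G| + 1 powers of x from exponent 0 to |G| are linearly dependent modulo
  \<open>m\<close>, which gives a polynomial in \<open>pid x\<close> with a coefficient outside
  \<open>m\<close>. An idempotent of O[x]/(pid x) evaluates to one of the corner and is therefore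
  trivial.\<close>

lemma eval_exists_poly:
  assumes x: "corner x"
  shows "\<exists>c N. [:- c, 1:] ^ N \<in> pid x"
proof -
  let ?n = "card (carrier G)"
  obtain v where v: "\<exists>j\<in>{..?n}. v j \<notin> m" "!!i. i \<in> carrier G ==> (\<Sum>j\<in>{..?n}. kpow x j i * v j) \<in> m"
    using kernel_vector[OF fin, of "{..?n}" "%i j. kpow x j i"] by auto
  define f where "f = (\<Sum>j\<le>?n. monom (v j) j)"
  have coef: "coeff f j = v j" if "j \<le> ?n" for j
    using that by (simp add: f_def coeff_sum)
  have pf: "pev x f = (\<Sum>j\<le>?n. sm (v j) (kpow x j))" by (simp add: f_def pev_sum pev_monom)
  have pfB: "pev x f \<in> B" using cB[OF corner_pev[OF x]] .
  have "pev x f \<in> M0"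
    unfolding M0_def
  proof (intro CollectI allI)
    fix i
    show "pev x f i \<in> m"
    proof (cases "i \<in> carrier G")
      case True
      then show ?thesis using v(2)[OF True] by (simp add: pf fsum_apply sm_apply mult.commute)
    next
      case False
      then show ?thesis using GA_outside[OF B_GA[OF pfB]] by simp
    qed
  qed
  then have fI: "f \<in> pid x" using pfB K_M0 by (simp add: pid_def)
  obtain i where "i \<le> ?n" "v i \<notin> m" using v(1) by auto
  then have j: "coeff f i \<notin> m" using coef by simp
  show ?thesis
  proof (rule poly_ideal_local[OF alg_closed ring_ideal_pid[OF x] _ _ _ fI j])
    show "1 \<notin> pid x" using eK by (simp add: pid_def pev_one)
    show "[:c:] \<in> pid x" if "c \<in> m" for c
      using K_M0[OF M0_sm'[OF that] B_sm[OF eB]] by (simp add: pid_def pev_pCons)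
    fix f assume "f * f - f \<in> pid x"
    then have "pev x (f * f) \<approx> pev x f" by (simp add: pid_def pev_diff eqm_def)
    then have "pev x f \<star> pev x f \<approx> pev x f" using pev_mult[OF x, of f f] eq_sym eq_trans by blast
    then have "pev x f \<in> K \<or> e - pev x f \<in> K"
      using corner_pev[OF x, of f] by (intro prim) (auto simp: corner_def eqm_def)
    then show "f \<in> pid x \<or> 1 - f \<in> pid x" by (simp add: pid_def pev_diff pev_one)
  qed
qed

definition nil :: "('g => 'o) => bool" where "nil x \<longleftrightarrow> (\<exists>N. kpow x N \<in> K)"
definition unitc :: "('g => 'o) => bool" where "unitc x \<longleftrightarrow> (\<exists>y. corner y \<and> x \<star> y \<approx> e \<and> y \<star> x \<approx> e)"

lemma nil_iff: "nil x \<longleftrightarrow> (\<exists>N. monom 1 N \<in> pid x)" by (simp add: nil_def pid_def pev_monom)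

lemma monom_1: "monom 1 N = [:0, 1:] ^ N"
proof (induction N)
  case 0
  show ?case by (simp only: monom_0 one_pCons power_0)
next
  case (Suc N)
  show ?case by (simp add: monom_Suc Suc)
qed

lemma pev_X: "corner x ==> pev x [:0, 1:] \<approx> x"
  using ce' by (simp add: pev_pCons)

lemma unit_poly:
  assumes x: "corner x" and y: "pev x f \<approx> y" "y \<in> B" and g: "f * g - 1 \<in> pid x"
  shows "unitc y"
proof -
  have fg: "pev x (f * g) \<approx> e" "pev x (g * f) \<approx> e"
    using g by (simp_all add: pid_def pev_diff pev_one eqm_def mult.commute)
  have gB: "pev x g \<in> B" using cB[OF corner_pev[OF x]] .
  have "y \<star> pev x g \<approx> pev x f \<star> pev x g" by (rule eq_right[OF eq_sym[OF y(1)] gB])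
  also have "\<dots> \<approx> pev x (f * g)" by (rule eq_sym[OF pev_mult[OF x]])
  also note fg(1)
  finally have 1: "y \<star> pev x g \<approx> e" .
  have "pev x g \<star> y \<approx> pev x g \<star> pev x f" by (rule eq_left[OF eq_sym[OF y(1)] gB])
  also have "\<dots> \<approx> pev x (g * f)" by (rule eq_sym[OF pev_mult[OF x]])
  also note fg(2)
  finally show ?thesis using 1 corner_pev[OF x] unfolding unitc_def by blast
qed

text \<open>x - c is nilpotent for some scalar c. If c lies in \<open>m\<close> then x itself is
  nilpotent modulo K; otherwise x is a unit plus a nilpotent element commuting with it.\<close>

lemma nil_or_unit:
  assumes x: "corner x"
  shows "nil x \<or> unitc x"
proof -
  obtain c N where cN: "[:- c, 1:] ^ N \<in> pid x" using eval_exists_poly[OF x] by blast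
  note I = ring_ideal_pid[OF x]
  show ?thesis
  proof (cases "c \<in> m")
    case True
    have "[:c:] \<in> pid x"
      using K_M0[OF M0_sm'[OF True] B_sm[OF eB]] by (simp add: pid_def pev_pCons)
    then have "[:0, 1:] - [:- c, 1:] \<in> pid x" by simp
    from ring_ideal_power_diff[OF I this, of N] cN
    have "[:0, 1:] ^ N - [:- c, 1:] ^ N + [:- c, 1:] ^ N \<in> pid x" using ring_idealD(2)[OF I] by blast
    then have "monom 1 N \<in> pid x" by (simp add: monom_1)
    then show ?thesis by (auto simp: nil_iff)
  next
    case False
    then obtain w where w: "c * w = 1" using unit by blast
    \<comment> \<open>Modulo the multiples of the variable, (x - c)^N is the unit constant (-c)^N;
      dividing by it turns the relation for x into an inverse of x that is a polynomial in
      x.\<close>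
    let ?T = "{f :: 'o poly. [:0, 1:] dvd f}"
    have IT: "ring_ideal ?T" by (auto simp: ring_ideal_def)
    have "[:- c, 1:] - [:- c:] \<in> ?T" by simp
    from ring_ideal_power_diff[OF IT this, of N]
    obtain q where q: "[:- c, 1:] ^ N - [:- c:] ^ N = [:0, 1:] * q" by (auto elim: dvdE)
    have cw: "[:- c:] ^ N * [:- w:] ^ N = 1"
    proof -
      have "[:- c:] * [:- w:] = 1" using w by (simp add: mult.commute)
      then show ?thesis by (simp only: power_mult_distrib[symmetric] power_one)
    qed
    have "[:- c, 1:] ^ N * (- ([:- w:] ^ N)) \<in> pid x" by (rule ring_idealD(4)[OF I cN])
    also have "[:- c, 1:] ^ N = [:0, 1:] * q + [:- c:] ^ N" using q by (simp only: diff_eq_eq)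
    also have "([:0, 1:] * q + [:- c:] ^ N) * (- ([:- w:] ^ N)) = [:0, 1:] * (- (q * [:- w:] ^ N)) - [:- c:] ^ N * [:- w:] ^ N"
    proof -
      have "(X * q + C) * (- W) = X * (- (q * W)) - C * W" for X C W :: "'o poly" by (simp add: algebra_simps)
      then show ?thesis .
    qed
    finally have "[:0, 1:] * (- (q * [:- w:] ^ N)) - 1 \<in> pid x" by (simp only: cw)
    then have "unitc x" by (rule unit_poly[OF x pev_X[OF x] cB[OF x]])
    then show ?thesis ..
  qed
qed

lemma unit_one_minus_nil:
  assumes x: "corner x" and "nil x"
  shows "unitc (e - x)"
proof -
  obtain N where N: "monom 1 N \<in> pid x" using assms(2) by (auto simp: nil_iff)
  have "(1 - [:0, 1:]) * (\<Sum>i<N. [:0, 1:] ^ i) - 1 = - ([:0, 1:] ^ N :: 'o poly)"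
  proof -
    have "(1 - [:0, 1:]) * (\<Sum>i<N. [:0, 1:] ^ i) = 1 - ([:0, 1:] ^ N :: 'o poly)"
      by (rule one_diff_power_eq[symmetric])
    moreover have "1 - Y - 1 = - Y" for Y :: "'o poly" by simp
    ultimately show ?thesis by (simp only:)
  qed
  also have "\<dots> = (- 1) * monom 1 N" by (simp add: monom_1)
  also have "\<dots> \<in> pid x" by (rule ring_idealD(3)[OF ring_ideal_pid[OF x] N])
  finally have *: "(1 - [:0, 1:]) * (\<Sum>i<N. [:0, 1:] ^ i) - 1 \<in> pid x" .
  have "pev x (1 - [:0, 1:]) \<approx> e - x" unfolding pev_diff pev_one by (intro eq_diff eq_refl pev_X x)
  from unit_poly[OF x this B_diff[OF eB cB[OF x]] *] show ?thesis .
qed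

lemma kpow_Suc2:
  assumes "corner x"
  shows "kpow x (Suc n) \<approx> kpow x n \<star> x"
proof (induction n)
  case 0
  have "x \<star> e \<approx> e \<star> x" using eq_trans[OF ce'[OF assms] eq_sym[OF ce[OF assms]]] .
  then show ?case by simp
next
  case (Suc n)
  have "x \<star> kpow x (Suc n) \<approx> x \<star> (kpow x n \<star> x)" by (rule eq_left[OF Suc cB[OF assms]])
  then show ?case by (simp add: gm_assoc)
qed

lemma left_inverse_pow:
  assumes "corner x" "corner y" "y \<star> x \<approx> e"
  shows "kpow y n \<star> kpow x n \<approx> e"
proof (induction n)
  case 0
  show ?case by (simp add: ee)
next
  case (Suc n)
  have xn: "corner (kpow x n)" "corner (kpow y n)" using corner_kpow assms by auto
  have "kpow y (Suc n) \<star> kpow x (Suc n) \<approx> kpow y n \<star> y \<star> (x \<star> kpow x n)"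
    using eq_right[OF kpow_Suc2[OF assms(2)]] cB[OF corner_kpow[OF assms(1)], of "Suc n"] by simp
  also have "\<dots> = kpow y n \<star> (y \<star> x \<star> kpow x n)" by (simp add: gm_assoc)
  also have "\<dots> \<approx> kpow y n \<star> (e \<star> kpow x n)" by (intro eq_left eq_right assms cB xn)
  also have "\<dots> \<approx> kpow y n \<star> kpow x n" by (intro eq_left ce cB xn)
  also note Suc
  finally show ?case .
qed

lemma not_nil_if_invertible:
  assumes "corner x" "corner y" "y \<star> x \<approx> e"
  shows "\<not> nil x" "\<not> nil y"
proof -
  { fix N assume "kpow x N \<in> K \<or> kpow y N \<in> K"
    then have "kpow y N \<star> kpow x N \<in> K"
      using K_left K_right cB[OF corner_kpow] assms by blast
    then have "e \<in> K" using eq_K[OF left_inverse_pow[OF assms]] by blast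
    then have False using eK by simp }
  then show "\<not> nil x" "\<not> nil y" by (auto simp: nil_def)
qed

lemma nil_iff_not_unit: "corner x ==> nil x \<longleftrightarrow> \<not> unitc x"
  using nil_or_unit not_nil_if_invertible unfolding unitc_def by blast

text \<open>If x y were a unit, x would have a right inverse and y a left inverse, which excludes
  nilpotence on either side.\<close>

lemma nil_mult:
  assumes "corner x" "corner y" "nil x \<or> nil y"
  shows "nil (x \<star> y)"
proof (rule ccontr)
  assume "\<not> nil (x \<star> y)"
  then obtain z where z: "corner z" "x \<star> y \<star> z \<approx> e" "z \<star> (x \<star> y) \<approx> e"
    using nil_iff_not_unit[OF corner_mult[OF assms(1,2)]] unfolding unitc_def by blast
  have "x \<star> (y \<star> z) \<approx> e" "z \<star> x \<star> y \<approx> e" using z by (simp_all add: gm_assoc)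
  then have "\<not> nil x" "\<not> nil y"
    using not_nil_if_invertible[OF corner_mult[OF assms(2) z(1)] assms(1)]
      not_nil_if_invertible[OF assms(2) corner_mult[OF z(1) assms(1)]] by blast+
  then show False using assms(3) by blast
qed

lemma kpow_cong:
  assumes "corner x" "y \<approx> x" "y \<in> B"
  shows "kpow y n \<approx> kpow x n"
proof (induction n)
  case (Suc n)
  have "y \<star> kpow y n \<approx> x \<star> kpow x n"
    using corner_kpow[OF corner_eq[OF assms]] assms cB by (intro eq_mult Suc) auto
  then show ?case by simp
qed simp

lemma nil_cong: "corner x ==> y \<approx> x ==> y \<in> B ==> nil x ==> nil y"
  unfolding nil_def using kpow_cong eq_K by blast

lemma nil_K: "x \<in> K ==> nil x"
  unfolding nil_def by (rule exI[of _ 1]) (simp add: K_left eB)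

lemma not_nil_e: "\<not> nil e"
  using not_nil_if_invertible[OF corner_e corner_e ee] by blast

text \<open>If w were a left inverse of x + y, then e - w x = w y would be a unit by the geometric
  series and at the same time nilpotent.\<close>

lemma nil_add:
  assumes "corner x" "corner y" "nil x" "nil y"
  shows "nil (x + y)"
proof (rule ccontr)
  assume "\<not> nil (x + y)"
  then obtain w where w: "corner w" "w \<star> (x + y) \<approx> e"
    using nil_iff_not_unit[OF corner_add[OF assms(1,2)]] unfolding unitc_def by blast
  have cw: "corner (w \<star> x)" "corner (w \<star> y)" using corner_mult w assms by auto
  have "unitc (e - w \<star> x)" using unit_one_minus_nil[OF cw(1)] nil_mult[OF w(1) assms(1)] assms(3) by blast
  then have "\<not> nil (e - w \<star> x)" using nil_iff_not_unit[OF corner_diff[OF corner_e cw(1)]] by blast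
  moreover have "e - w \<star> x \<approx> w \<star> y"
    using eq_sym[OF w(2)] unfolding eqm_def by (simp add: gm_add_right algebra_simps)
  moreover have "nil (w \<star> y)" using nil_mult[OF w(1) assms(2)] assms(4) by blast
  ultimately show False using nil_cong[OF cw(2)] corner_diff[OF corner_e cw(1)] cB by blast
qed

lemma nil_sum:
  assumes "!!i. i \<in> I ==> corner (f i)" "!!i. i \<in> I ==> nil (f i)"
  shows "nil (sum f I)"
  using assms by (induction I rule: infinite_finite_induct) (auto intro: nil_add corner_sum nil_K)

lemma nil_sm: "corner x ==> nil x ==> nil (sm c x)"
proof -
  assume x: "corner x" "nil x"
  have "nil (sm c e \<star> x)" using nil_mult[OF corner_sm[OF corner_e] x(1)] x(2) by blast
  moreover have "sm c x \<approx> sm c e \<star> x" using eq_sm[OF eq_sym[OF ce[OF x(1)]]] by (simp add: gm_sm_left)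
  ultimately show "nil (sm c x)" using nil_cong corner_mult[OF corner_sm[OF corner_e] x(1)] cB[OF corner_sm[OF x(1)]] by blast
qed

text \<open>\<open>ev x c\<close>: the element \<open>x\<close> of the local algebra \<open>e B e / K\<close> has residue \<open>c\<close>.\<close>

definition ev :: "('g => 'o) => 'o => bool" where "ev x c \<longleftrightarrow> nil (x - sm c e)"

lemma ev_exists:
  assumes x: "corner x"
  shows "\<exists>c. ev x c"
proof -
  obtain c N where cN: "[:- c, 1:] ^ N \<in> pid x" using eval_exists_poly[OF x] by blast
  let ?y = "x - sm c e"
  have y: "corner ?y" by (intro corner_diff corner_sm corner_e x)
  have py: "pev x [:- c, 1:] \<approx> ?y"
  proof -
    have "x \<star> e - sm c e \<approx> ?y" by (intro eq_diff eq_refl ce' x)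
    then show ?thesis by (simp add: pev_pCons sm_minus_scalar)
  qed
  have "kpow ?y n \<approx> pev x ([:- c, 1:] ^ n)" for n
  proof (induction n)
    case 0
    then show ?case by (simp add: pev_one)
  next
    case (Suc n)
    have "kpow ?y (Suc n) \<approx> pev x [:- c, 1:] \<star> pev x ([:- c, 1:] ^ n)"
      using cB[OF corner_pev[OF x]] cB[OF corner_kpow[OF y]] by (simp, intro eq_mult Suc eq_sym[OF py]) auto
    also have "\<dots> \<approx> pev x ([:- c, 1:] * [:- c, 1:] ^ n)" by (rule eq_sym[OF pev_mult[OF x]])
    finally show ?case by (simp only: power_Suc)
  qed
  then have "kpow ?y N \<in> K" using eq_K cN unfolding pid_def by blast
  then show ?thesis unfolding ev_def nil_def by blast
qed

lemma nil_sm_e: "nil (sm c e) ==> c \<in> m"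
proof (rule ccontr)
  assume a: "nil (sm c e)" "c \<notin> m"
  then obtain w where w: "c * w = 1" using unit by blast
  have "nil (sm w (sm c e))" by (rule nil_sm[OF corner_sm[OF corner_e] a(1)])
  then show False using w not_nil_e by (simp add: sm_sm mult.commute)
qed

lemma ev_unique:
  assumes "corner x" "ev x c" "ev x d"
  shows "c - d \<in> m"
proof -
  have "nil ((x - sm d e) + sm (- 1) (x - sm c e))"
    using assms corner_diff[OF _ corner_sm[OF corner_e]] unfolding ev_def
    by (intro nil_add nil_sm corner_sm) auto
  also have "(x - sm d e) + sm (- 1) (x - sm c e) = sm (c - d) e"
    by (simp add: sm_diff_scalar sm_minus_scalar sm_diff)
  finally show ?thesis by (rule nil_sm_e)
qed

lemma ev_e: "ev e 1" by (simp add: ev_def nil_K)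

lemma ev_cong: "corner x ==> y \<approx> x ==> y \<in> B ==> ev x c ==> ev y c"
  unfolding ev_def by (rule nil_cong) (auto intro: corner_diff corner_sm corner_e eq_diff B_diff B_sm eB)

lemma ev_sum:
  assumes "!!i. i \<in> I ==> corner (f i)" "!!i. i \<in> I ==> ev (f i) (c i)"
  shows "ev (sum f I) (sum c I)"
proof -
  have "sum f I - sm (sum c I) e = (\<Sum>i\<in>I. f i - sm (c i) e)" by (simp add: sum_subtractf sm_sum_scalar)
  then show ?thesis
    unfolding ev_def using assms by (auto simp: ev_def intro!: nil_sum corner_diff corner_sm corner_e)
qed

text \<open>The nilpotent elements are closed under addition, so in a decomposition of e some
  summand is a unit. Whenever one term has to be selected from a trace, a Mackey sum or a
  decomposition of 1, this is the reason.\<close>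

lemma rosenberg:
  assumes "finite I" "!!i. i \<in> I ==> corner (f i)" "sum f I \<approx> e"
  shows "\<exists>i\<in>I. unitc (f i)"
proof (rule ccontr)
  assume "\<not> (\<exists>i\<in>I. unitc (f i))"
  then have "nil (sum f I)" using assms nil_iff_not_unit by (intro nil_sum) auto
  then show False using nil_cong[OF corner_sum[of I f] eq_sym[OF assms(3)] eB] assms(2) not_nil_e by blast
qed

end

context group_alg
begin

lemma primitive_modI: "kprim B K e ==> primitive_mod G m p B K e"
  by unfold_locales (auto simp: kprim_def)

end

subsection \<open>Decompositions and blocks\<close>

context group_alg
begin

section \<open>Lifting of idempotents and the algebras attached to a p-subgroup\<close>

definition Mk :: "nat => ('g => 'o) set" where "Mk k = {a. \<forall>x. a x \<in> mpow m k}"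

lemma mpow_ideal: "ring_ideal (mpow m k)" by (rule ring_ideal_mpow[OF ideal])

lemma Mk_add: "a \<in> Mk k ==> c \<in> Mk k ==> a + c \<in> Mk k" and Mk_diff: "a \<in> Mk k ==> c \<in> Mk k ==> a - c \<in> Mk k"
  unfolding Mk_def by (auto simp: plus_fun_apply minus_apply intro: ring_idealD(2,5)[OF mpow_ideal])
lemma Mk_zero: "0 \<in> Mk k"
  unfolding Mk_def by (simp add: zero_fun_apply ring_idealD(1)[OF mpow_ideal])
lemma Mk_left: "a \<in> Mk k ==> a \<star> c \<in> Mk k"
  unfolding Mk_def by (auto simp: gmult_def intro!: ring_idealD(6)[OF mpow_ideal] ring_idealD(4)[OF mpow_ideal] ring_idealD(1)[OF mpow_ideal])
lemma Mk_right: "c \<in> Mk k ==> a \<star> c \<in> Mk k"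
  unfolding Mk_def by (auto simp: gmult_def intro!: ring_idealD(6)[OF mpow_ideal] ring_idealD(3)[OF mpow_ideal] ring_idealD(1)[OF mpow_ideal])
lemma Mk_cj: "a \<in> Mk k ==> cj g a \<in> Mk k"
  unfolding Mk_def by (auto simp: conj_act_def ring_idealD(1)[OF mpow_ideal])
lemma Mk_mono: "j \<le> k ==> a \<in> Mk k ==> a \<in> Mk j"
  unfolding Mk_def using mpow_mono[OF ideal] by blast
lemma M0_Mk: "M0 = Mk (Suc 0)"
  unfolding Mk_def M0_def mpow_1[OF ideal] ..
lemma Mk_M0_mult:
  assumes "a \<in> Mk k" "c \<in> M0"
  shows "c \<star> a \<in> Mk (Suc k)"
proof -
  have "c y * a z \<in> mpow m (Suc k)" for y z
    using assms by (intro mpow_Suc_prod) (auto simp: M0_def Mk_def)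
  then show ?thesis
    unfolding Mk_def gmult_def
    by (auto simp del: mpow.simps intro!: ring_idealD(6)[OF mpow_ideal] ring_idealD(1)[OF mpow_ideal])
qed
lemma Mk_all_zero:
  assumes "!!k. a \<in> Mk k"
  shows "a = 0"
proof (rule ext)
  fix x
  show "a x = 0 x" using krull_intersection[OF cln, of "a x"] assms by (simp add: Mk_def zero_fun_apply)
qed

text \<open>An idempotent with coefficients in \<open>m\<close> has coefficients in every power of
  \<open>m\<close>, and these intersect in zero.\<close>

lemma idem_in_M0:
  assumes "e \<in> M0" "e \<star> e = e"
  shows "e = 0"
proof (rule Mk_all_zero)
  fix k show "e \<in> Mk k"
  proof (induction k)
    case 0
    show ?case by (simp add: Mk_def)
  next
    case (Suc k)
    show ?case using Mk_M0_mult[OF Suc.IH assms(1)] by (simp only: assms(2))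
  qed
qed

text \<open>Newton iteration \<open>u \<mapsto> 3 u\<^sup>2 - 2 u\<^sup>3\<close> lifts idempotents modulo \<open>m\<close>.\<close>

definition newton :: "('g => 'o) => 'g => 'o" where
  "newton u = u \<star> u + u \<star> u + u \<star> u - (u \<star> (u \<star> u) + u \<star> (u \<star> u))"

lemma newton_step:
  "newton u - u = (u \<star> u - u) - (u \<star> (u \<star> u - u) + u \<star> (u \<star> u - u))"
  unfolding newton_def gm_diff_right by (rule ext) (simp add: plus_fun_apply minus_apply uminus_apply)

text \<open>Every term on the right is quadratic in the defect d, because w is itself a multiple of
  d by \<open>newton_step\<close>; each iteration therefore gains at least one power of
  \<open>m\<close>.\<close>

lemma newton_idem:
  fixes u defines "d \<equiv> u \<star> u - u" and "w \<equiv> newton u - u"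
  shows "newton u \<star> newton u - newton u = w \<star> w - (d \<star> d + d \<star> d + (d \<star> d + d \<star> d))"
  unfolding d_def w_def newton_def
  by (simp only: gm_add_left gm_add_right gm_diff_left gm_diff_right gm_assoc)
     (rule ext, simp add: plus_fun_apply minus_apply algebra_simps)

text \<open>The iteration starts at i u i rather than u, so that every iterate lies exactly in the
  corner of i and not just modulo \<open>m\<close>. Completeness gives a limit coefficient by
  coefficient, finiteness of G makes the approximation uniform, and the required identities hold
  modulo all powers of \<open>m\<close>, hence exactly.\<close>

lemma idem_lift:
  assumes P: "subgroup P G" and i: "i \<in> FP P" "i \<star> i = i"
    and u: "u \<in> FP P" "i \<star> u - u \<in> M0" "u \<star> i - u \<in> M0" "u \<star> u - u \<in> M0"
  obtains L where "L \<in> FP P" "L \<star> L = L" "i \<star> L = L" "L \<star> i = L" "L - u \<in> M0"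
proof -
  define u0 where "u0 = i \<star> u \<star> i"
  have u0u: "u0 - u \<in> M0"
  proof -
    have "u0 - u = (i \<star> u - u) \<star> i + (u \<star> i - u)" by (simp add: u0_def gm_diff_left)
    then show ?thesis using u M0_add M0_gm_left by metis
  qed
  have idem0: "u0 \<star> u0 - u0 \<in> M0"
  proof -
    have "u0 \<star> u0 - u0 = (u0 - u) \<star> u0 + u \<star> (u0 - u) + (u \<star> u - u) - (u0 - u)"
      by (simp add: gm_diff_left gm_diff_right)
    then show ?thesis using M0_add M0_diff M0_gm_left[OF u0u] M0_gm_right[OF u0u] u(4) u0u by metis
  qed
  define U where "U n = (newton ^^ n) u0" for n
  have U0: "U 0 = u0" and US: "U (Suc n) = newton (U n)" for n by (simp_all add: U_def)
  have UF: "U n \<in> FP P \<and> i \<star> U n = U n \<and> U n \<star> i = U n" for n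
  proof (induction n)
    case 0
    have "u0 \<in> FP P" unfolding u0_def by (intro FP_mult i u)
    moreover have "i \<star> u0 = u0" "u0 \<star> i = u0" unfolding u0_def using i(2) by (simp_all add: gm_assoc[symmetric]) (simp add: gm_assoc i(2))
    ultimately show ?case by (simp add: U0)
  next
    case (Suc n)
    then have F: "U n \<in> FP P" and l: "i \<star> U n = U n" and r: "U n \<star> i = U n" by auto
    have l': "i \<star> (U n \<star> c) = U n \<star> c" for c using l by (simp add: gm_assoc[symmetric])
    have "newton (U n) \<in> FP P" unfolding newton_def by (intro Fx_add Fx_diff FP_mult F)
    moreover have "i \<star> newton (U n) = newton (U n)"
      unfolding newton_def by (simp only: gm_add_right gm_diff_right l')
    moreover have "newton (U n) \<star> i = newton (U n)"
      unfolding newton_def by (simp only: gm_add_left gm_diff_left gm_assoc r)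
    ultimately show ?case unfolding US by blast
  qed
  have Ud: "U n \<star> U n - U n \<in> Mk (Suc n)" for n
  proof (induction n)
    case 0
    show ?case using idem0 by (simp add: U0 M0_Mk)
  next
    case (Suc n)
    let ?d = "U n \<star> U n - U n" and ?w = "newton (U n) - U n"
    have d0: "?d \<in> M0" unfolding M0_Mk using Mk_mono[OF _ Suc] by simp
    have w: "?w \<in> Mk (Suc n)" unfolding newton_step by (rule Mk_diff[OF Suc Mk_add[OF Mk_right[OF Suc] Mk_right[OF Suc]]])
    have w0: "?w \<in> M0" unfolding M0_Mk using Mk_mono[OF _ w] by simp
    have dd: "?d \<star> ?d \<in> Mk (Suc (Suc n))" by (rule Mk_M0_mult[OF Suc d0])
    show ?case unfolding US newton_idem
      by (rule Mk_diff[OF Mk_M0_mult[OF w w0] Mk_add[OF Mk_add[OF dd dd] Mk_add[OF dd dd]]])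
  qed
  have step: "U (Suc n) - U n \<in> Mk (Suc n)" for n
    unfolding US newton_step by (rule Mk_diff[OF Ud Mk_add[OF Mk_right[OF Ud] Mk_right[OF Ud]]])
  have tail: "U n - U k \<in> Mk (Suc k)" if "k \<le> n" for n k
    using that
  proof (induction n rule: dec_induct)
    case base
    show ?case by (simp add: Mk_zero)
  next
    case (step n)
    have "U (Suc n) - U n \<in> Mk (Suc k)" using Mk_mono[OF _ \<open>U (Suc n) - U n \<in> Mk (Suc n)\<close>] step.hyps by simp
    then have "(U (Suc n) - U n) + (U n - U k) \<in> Mk (Suc k)" using step.IH by (rule Mk_add)
    then show ?case by simp
  qed
  have compl: "\<exists>L. \<forall>k. \<exists>N. \<forall>n\<ge>N. s n - L \<in> mpow m k"
    if "!!k. \<exists>N. \<forall>n\<ge>N. \<forall>n'\<ge>N. s n - s n' \<in> mpow m k" for s :: "nat => 'o"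
  proof -
    have *: "\<forall>s::nat => 'o. (\<forall>k. \<exists>N. \<forall>n\<ge>N. \<forall>n'\<ge>N. s n - s n' \<in> mpow m k) -->
         (\<exists>L. \<forall>k. \<exists>N. \<forall>n\<ge>N. s n - L \<in> mpow m k)"
      using cln unfolding cln_domain_def by (elim conjE)
    show ?thesis by (rule mp[OF spec[OF *]], rule allI, rule that)
  qed
  have "\<exists>l. \<forall>k. \<exists>N. \<forall>n\<ge>N. U n g - l \<in> mpow m k" for g
  proof (rule compl)
    fix k
    have "U n g - U n' g \<in> mpow m k" if "n \<ge> k" "n' \<ge> k" for n n'
    proof -
      have "(U n - U k) - (U n' - U k) \<in> Mk k"
        by (rule Mk_diff[OF Mk_mono[OF _ tail[OF that(1)]] Mk_mono[OF _ tail[OF that(2)]]]) auto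
      then have "U n - U n' \<in> Mk k" by simp
      then show ?thesis by (simp add: Mk_def minus_apply)
    qed
    then show "\<exists>N. \<forall>n\<ge>N. \<forall>n'\<ge>N. U n g - U n' g \<in> mpow m k" by blast
  qed
  then have "\<forall>g. \<exists>l. \<forall>k. \<exists>N. \<forall>n\<ge>N. U n g - l \<in> mpow m k" by blast
  then obtain L0 where L0: "!!g k. \<exists>N. \<forall>n\<ge>N. U n g - L0 g \<in> mpow m k" by metis
  define L where "L g = (if g \<in> carrier G then L0 g else 0)" for g
  have LG: "L \<in> GA" by (simp add: L_def grpalg_def)
  have appr: "\<exists>n\<ge>k. L - U n \<in> Mk k" for k
  proof -
    obtain N where N: "!!g n. n \<ge> N g ==> U n g - L0 g \<in> mpow m k" using L0[of _ k] by metis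
    let ?n = "Max (insert k (N ` carrier G))"
    have finN: "finite (insert k (N ` carrier G))" using fin by simp
    have "(L - U ?n) g \<in> mpow m k" for g
    proof (cases "g \<in> carrier G")
      case True
      then have "N g \<le> ?n" using Max_ge[OF finN] by blast
      then have "U ?n g - L0 g \<in> mpow m k" by (rule N)
      from ring_idealD(5)[OF mpow_ideal ring_idealD(1)[OF mpow_ideal] this]
      show ?thesis using True by (simp add: L_def minus_apply)
    next
      case False
      then show ?thesis using GA_outside[OF Fx_GA[OF UF[THEN conjunct1]] False] ring_idealD(1)[OF mpow_ideal]
        by (simp add: L_def minus_apply)
    qed
    moreover have "k \<le> ?n" using Max_ge[OF finN] by blast
    ultimately show ?thesis by (auto simp: Mk_def)
  qed
  have LL: "L \<star> L = L"
  proof -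
    have "L \<star> L - L \<in> Mk k" for k
    proof -
      obtain n where n: "n \<ge> k" "L - U n \<in> Mk k" using appr by blast
      have "U n \<star> U n - U n \<in> Mk k" using Mk_mono[OF _ Ud[of n]] n(1) by simp
      then have "(L - U n) \<star> L + U n \<star> (L - U n) + (U n \<star> U n - U n) - (L - U n) \<in> Mk k"
        by (intro Mk_diff[OF Mk_add[OF Mk_add[OF Mk_left[OF n(2)] Mk_right[OF n(2)]]] n(2)])
      then show ?thesis by (simp add: gm_diff_left gm_diff_right)
    qed
    then have "L \<star> L - L = 0" by (rule Mk_all_zero)
    then show ?thesis by simp
  qed
  have iL: "i \<star> L = L"
  proof -
    have "i \<star> L - L \<in> Mk k" for k
    proof -
      obtain n where n: "n \<ge> k" "L - U n \<in> Mk k" using appr by blast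
      have "i \<star> (L - U n) - (L - U n) \<in> Mk k" by (rule Mk_diff[OF Mk_right[OF n(2)] n(2)])
      then show ?thesis using UF[of n] by (simp add: gm_diff_right)
    qed
    then have "i \<star> L - L = 0" by (rule Mk_all_zero)
    then show ?thesis by simp
  qed
  have Li: "L \<star> i = L"
  proof -
    have "L \<star> i - L \<in> Mk k" for k
    proof -
      obtain n where n: "n \<ge> k" "L - U n \<in> Mk k" using appr by blast
      have "(L - U n) \<star> i - (L - U n) \<in> Mk k" by (rule Mk_diff[OF Mk_left[OF n(2)] n(2)])
      then show ?thesis using UF[of n] by (simp add: gm_diff_left)
    qed
    then have "L \<star> i - L = 0" by (rule Mk_all_zero)
    then show ?thesis by simp
  qed
  have LF: "L \<in> FP P"
  proof (rule FPI[OF P LG])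
    fix q assume q: "q \<in> P"
    have "cj q L - L \<in> Mk k" for k
    proof -
      obtain n where n: "n \<ge> k" "L - U n \<in> Mk k" using appr by blast
      have "cj q (L - U n) - (L - U n) \<in> Mk k" by (rule Mk_diff[OF Mk_cj[OF n(2)] n(2)])
      then show ?thesis using FP_cj[OF P _ q] UF[of n] by (simp add: cj_diff)
    qed
    then have "cj q L - L = 0" by (rule Mk_all_zero)
    then show "cj q L = L" by simp
  qed
  have "L - u \<in> M0"
  proof -
    obtain n where n: "n \<ge> Suc 0" "L - U n \<in> Mk (Suc 0)" using appr by blast
    have "U n - u0 \<in> Mk (Suc 0)" using tail[of 0 n] by (simp add: U0)
    then have "(L - U n) + (U n - u0) + (u0 - u) \<in> M0"
      using Mk_add[OF Mk_add[OF n(2)]] u0u unfolding M0_Mk by blast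
    then show ?thesis by simp
  qed
  then show ?thesis using that LF LL iL Li by blast
qed

lemma subalg_FP: "subalg (FP P)"
  unfolding subalg_def by (auto intro: Fx_GA Fx_add Fx_diff Fx_sm FP_mult)

lemma ideal_M0: "alg_ideal (FP P) (M0 \<inter> FP P)"
  unfolding alg_ideal_def
  by (auto intro: Fx_add Fx_diff Fx_sm FP_mult M0_add M0_diff M0_sm M0_gm_left M0_gm_right)

lemma ideal_KP: "p_subgroup p G P ==> alg_ideal (FP P) (KP P)"
  unfolding alg_ideal_def
proof (intro conjI ballI allI subsetI)
  assume P: "p_subgroup p G P"
  show "k \<in> FP P" if "k \<in> KP P" for k using Kr_Fx[OF that] .
  show "0 \<in> KP P" by (rule Kr_zero)
  show "a + c \<in> KP P" "a - c \<in> KP P" if "a \<in> KP P" "c \<in> KP P" for a c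
    by (rule Kr_add[OF that], rule Kr_diff[OF that])
  show "sm r a \<in> KP P" if "a \<in> KP P" for r a using Kr_sm[OF that] .
  show "a \<star> k \<in> KP P" "k \<star> a \<in> KP P" if "a \<in> FP P" "k \<in> KP P" for a k
    by (rule KP_right[OF P that], rule KP_left[OF P that(2,1)])
  show "a \<in> KP P" if "a \<in> M0 \<inter> FP P" for a using M0_Kr that by blast
qed

text \<open>The preimage in (OG)^P of the centre of the Brauer quotient (OG)(P).\<close>

definition ZP :: "'g set => ('g => 'o) set" where
  "ZP P = {z \<in> FP P. \<forall>a\<in>FP P. z \<star> a - a \<star> z \<in> KP P}"

lemma ZP_FP: "z \<in> ZP P ==> z \<in> FP P" by (simp add: ZP_def)
lemma ZP_central: "z \<in> ZP P ==> a \<in> FP P ==> z \<star> a - a \<star> z \<in> KP P" by (simp add: ZP_def)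

lemma KP_ZP: "p_subgroup p G P ==> k \<in> KP P ==> k \<in> ZP P"
  by (simp add: ZP_def Kr_Fx Kr_diff KP_left KP_right)

lemma subalg_ZP:
  assumes P: "p_subgroup p G P"
  shows "subalg (ZP P)"
proof -
  have ZPI: "z \<in> ZP P" if "z \<in> FP P" "!!x. x \<in> FP P ==> z \<star> x - x \<star> z \<in> KP P" for z
    unfolding ZP_def using that by blast
  have "a + c \<in> ZP P" if a: "a \<in> ZP P" and c: "c \<in> ZP P" for a c
  proof (rule ZPI)
    show "a + c \<in> FP P" by (rule Fx_add[OF ZP_FP[OF a] ZP_FP[OF c]])
    fix x assume x: "x \<in> FP P"
    have "(a + c) \<star> x - x \<star> (a + c) = (a \<star> x - x \<star> a) + (c \<star> x - x \<star> c)"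
      by (simp add: gm_add_left gm_add_right)
    also have "\<dots> \<in> KP P" by (rule Kr_add[OF ZP_central[OF a x] ZP_central[OF c x]])
    finally show "(a + c) \<star> x - x \<star> (a + c) \<in> KP P" .
  qed
  moreover have "a - c \<in> ZP P" if a: "a \<in> ZP P" and c: "c \<in> ZP P" for a c
  proof (rule ZPI)
    show "a - c \<in> FP P" by (rule Fx_diff[OF ZP_FP[OF a] ZP_FP[OF c]])
    fix x assume x: "x \<in> FP P"
    have "(a - c) \<star> x - x \<star> (a - c) = (a \<star> x - x \<star> a) - (c \<star> x - x \<star> c)"
      by (simp add: gm_diff_left gm_diff_right)
    also have "\<dots> \<in> KP P" by (rule Kr_diff[OF ZP_central[OF a x] ZP_central[OF c x]])
    finally show "(a - c) \<star> x - x \<star> (a - c) \<in> KP P" .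
  qed
  moreover have "a \<star> c \<in> ZP P" if a: "a \<in> ZP P" and c: "c \<in> ZP P" for a c
  proof (rule ZPI)
    show "a \<star> c \<in> FP P" by (rule FP_mult[OF ZP_FP[OF a] ZP_FP[OF c]])
    fix x assume x: "x \<in> FP P"
    have "a \<star> c \<star> x - x \<star> (a \<star> c) = a \<star> (c \<star> x - x \<star> c) + (a \<star> x - x \<star> a) \<star> c"
      by (simp add: gm_diff_left gm_diff_right gm_assoc)
    also have "\<dots> \<in> KP P"
      by (rule Kr_add[OF KP_right[OF P ZP_FP[OF a] ZP_central[OF c x]] KP_left[OF P ZP_central[OF a x] ZP_FP[OF c]]])
    finally show "a \<star> c \<star> x - x \<star> (a \<star> c) \<in> KP P" .
  qed
  moreover have "sm r a \<in> ZP P" if "a \<in> ZP P" for r a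
  proof (rule ZPI)
    show "sm r a \<in> FP P" by (rule Fx_sm[OF ZP_FP[OF that]])
    fix x assume x: "x \<in> FP P"
    show "sm r a \<star> x - x \<star> sm r a \<in> KP P"
      unfolding gm_sm_left gm_sm_right sm_diff[symmetric] by (rule Kr_sm[OF ZP_central[OF that x]])
  qed
  moreover have "0 \<in> ZP P" by (rule ZPI) simp_all
  ultimately show ?thesis unfolding subalg_def
    using ZP_FP[THEN Fx_GA] by (intro conjI ballI allI subsetI) simp_all
qed

lemma ideal_ZP: "p_subgroup p G P ==> alg_ideal (ZP P) (KP P)"
  unfolding alg_ideal_def
proof (intro conjI ballI allI subsetI)
  assume P: "p_subgroup p G P"
  show "k \<in> ZP P" if "k \<in> KP P" for k using KP_ZP[OF P that] .
  show "0 \<in> KP P" by (rule Kr_zero)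
  show "a + c \<in> KP P" "a - c \<in> KP P" if "a \<in> KP P" "c \<in> KP P" for a c
    by (rule Kr_add[OF that], rule Kr_diff[OF that])
  show "sm r a \<in> KP P" if "a \<in> KP P" for r a using Kr_sm[OF that] .
  show "a \<star> k \<in> KP P" "k \<star> a \<in> KP P" if "a \<in> ZP P" "k \<in> KP P" for a k
    by (rule KP_right[OF P ZP_FP[OF that(1)] that(2)], rule KP_left[OF P that(2) ZP_FP[OF that(1)]])
  show "a \<in> KP P" if "a \<in> M0 \<inter> ZP P" for a using M0_Kr[OF _ ZP_FP] that by blast
qed

lemma algebra_mod_FP: "algebra_mod G m p (FP P) (M0 \<inter> FP P)"
  by unfold_locales (rule subalg_FP ideal_M0)+
lemma algebra_mod_KP: "p_subgroup p G P ==> algebra_mod G m p (FP P) (KP P)"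
  by unfold_locales (rule subalg_FP ideal_KP, assumption?)+
lemma algebra_mod_ZP: "p_subgroup p G P ==> algebra_mod G m p (ZP P) (KP P)"
  by unfold_locales (rule subalg_ZP ideal_ZP, assumption)+

text \<open>An idempotent modulo \<open>m\<close> in the corner of i lifts to a true idempotent
  there, which must be 0 or i. From here on primitivity can be used over the residue field.\<close>

lemma prim_idem_kprim:
  assumes P: "subgroup P G" and i: "prim_idem (gmult G) (FP P) i"
  shows "kprim (FP P) (M0 \<inter> FP P) i"
proof -
  have iF: "i \<in> FP P" and ii: "i \<star> i = i" and i0: "i ~= 0"
    and pr: "!!u v. u \<in> FP P ==> v \<in> FP P ==> u \<star> u = u ==> v \<star> v = v ==> u \<star> v = 0 ==> v \<star> u = 0 ==> i = u + v ==> u = 0 \<or> v = 0"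
    using i unfolding prim_idem_def by blast+
  have "i \<notin> M0" using idem_in_M0[OF _ ii] i0 by blast
  moreover have "u \<in> M0 \<or> i - u \<in> M0"
    if u: "u \<in> FP P" "i \<star> u - u \<in> M0" "u \<star> i - u \<in> M0" "u \<star> u - u \<in> M0" for u
  proof -
    obtain L where L: "L \<in> FP P" "L \<star> L = L" "i \<star> L = L" "L \<star> i = L" "L - u \<in> M0"
      using idem_lift[OF P iF ii u] .
    have "L = 0 \<or> i - L = 0"
      using L ii by (intro pr Fx_diff iF) (simp_all add: gm_diff_left gm_diff_right)
    then show ?thesis
    proof
      assume "L = 0"
      then show ?thesis using M0_diff[OF M0_zero L(5)] by simp
    qed (use L(5) in simp)
  qed
  ultimately show ?thesis
    unfolding kprim_def using subalg_FP ideal_M0 iF ii by (auto intro: Fx_diff)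
qed

end

section \<open>Primitive decompositions and transport by conjugation\<close>

context algebra_mod
begin

lemma kprimI:
  assumes "e \<in> B" "e \<star> e \<approx> e" "e \<notin> K"
    "!!u. u \<in> B ==> e \<star> u \<approx> u ==> u \<star> e \<approx> u ==> u \<star> u \<approx> u ==> u \<in> K \<or> e - u \<in> K"
  shows "kprim B K e"
  using assms sB iK unfolding kprim_def eqm_def by blast

text \<open>Families of orthogonal idempotents outside K with sum 1 modulo K have at most |G|
  members, by linear independence modulo \<open>m\<close>. In a largest family each member is
  primitive, since a nontrivial idempotent u below e s would let e s be replaced by u and e s -
  u.\<close>

lemma primitive_decomposition:
  assumes one: "el \<one> \<in> B"
  shows "\<exists>n e. (\<forall>s<(n::nat). kprim B K (e s)) \<and> (\<Sum>s<n. e s) \<approx> el \<one>"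
proof -
  define fam where "fam n e \<longleftrightarrow> (\<forall>s<n. e s \<in> B \<and> e s \<notin> K \<and> e s \<star> e s \<approx> e s) \<and>
     (\<forall>s<n. \<forall>t<n. s ~= t --> e s \<star> e t \<in> K) \<and> (\<Sum>s<n. e s) \<approx> el \<one>" for n :: nat and e
  have bound: "n \<le> card (carrier G)" if f: "fam n e" for n e
  proof (rule ccontr)
    assume "\<not> n \<le> card (carrier G)"
    then have "card (carrier G) < card {..<n}" by simp
    from kernel_vector[OF fin _ this, of "%i s. e s i"]
    obtain v where v: "\<exists>s\<in>{..<n}. v s \<notin> m" "\<forall>i\<in>carrier G. (\<Sum>s\<in>{..<n}. e s i * v s) \<in> m" by auto
    define z where "z = (\<Sum>s<n. sm (v s) (e s))"
    have zB: "z \<in> B" unfolding z_def using f by (intro B_sum B_sm) (auto simp: fam_def)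
    have "z i \<in> m" for i
    proof (cases "i \<in> carrier G")
      case True
      then show ?thesis using v(2) by (simp add: z_def fsum_apply sm_apply mult.commute)
    qed (use GA_outside[OF B_GA[OF zB]] in simp)
    then have zK: "z \<in> K" using zB by (intro K_M0) (auto simp: M0_def)
    obtain t where t: "t < n" "v t \<notin> m" using v(1) by auto
    obtain w where w: "v t * w = 1" using unit[OF t(2)] by blast
    have etB: "e t \<in> B" and et: "e t \<star> e t \<approx> e t" and etK: "e t \<notin> K" using f t by (auto simp: fam_def)
    have "z \<star> e t = sm (v t) (e t \<star> e t) + (\<Sum>s\<in>{..<n} - {t}. sm (v s) (e s \<star> e t))"
      unfolding z_def gm_sum_left gm_sm_left using t(1) by (simp add: sum.remove[of "{..<n}" t])
    moreover have "(\<Sum>s\<in>{..<n} - {t}. sm (v s) (e s \<star> e t)) \<in> K"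
      using f t by (intro K_sum K_sm) (auto simp: fam_def)
    moreover have "z \<star> e t \<in> K" using K_left[OF zK etB] .
    ultimately have "sm (v t) (e t \<star> e t) \<in> K"
      using K_diff[of "z \<star> e t" "\<Sum>s\<in>{..<n} - {t}. sm (v s) (e s \<star> e t)"] by simp
    then have "sm w (sm (v t) (e t \<star> e t)) \<in> K" by (rule K_sm)
    then have "e t \<star> e t \<in> K" using w by (simp add: sm_sm mult.commute)
    then show False using eq_K[OF et] etK by blast
  qed
  have ex: "\<exists>n e. fam n e"
  proof (cases "el \<one> \<in> K")
    case True
    \<comment> \<open>If B/K is zero, the empty family is the decomposition.\<close>
    then have "fam 0 (%_. 0)" using eq_sym[of "el \<one>" 0] by (simp add: fam_def eq_zero)
    then show ?thesis by blast
  next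
    case False
    then have "fam 1 (%_. el \<one>)" using one el_one_left[OF B_GA[OF one]] by (simp add: fam_def)
    then show ?thesis by blast
  qed
  define n where "n = Max {n. \<exists>e. fam n e}"
  have finN: "finite {n. \<exists>e. fam n e}" by (rule finite_subset[of _ "{..card (carrier G)}"]) (use bound in auto)
  have "\<exists>e. fam n e" using Max_in[OF finN] ex unfolding n_def by blast
  then obtain e where e: "fam n e" by blast
  have nomore: "\<not> fam (Suc n) e'" for e' using Max_ge[OF finN, of "Suc n"] unfolding n_def by auto
  have eB: "!!s. s < n ==> e s \<in> B" and eK: "!!s. s < n ==> e s \<notin> K" and ei: "!!s. s < n ==> e s \<star> e s \<approx> e s"
    and eo: "!!s t. s < n ==> t < n ==> s ~= t ==> e s \<star> e t \<in> K" and e1: "(\<Sum>s<n. e s) \<approx> el \<one>"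
    using e unfolding fam_def by blast+
  have "kprim B K (e s)" if s: "s < n" for s
  proof (rule kprimI[OF eB[OF s] ei[OF s] eK[OF s]], rule ccontr)
    fix u assume u: "u \<in> B" "e s \<star> u \<approx> u" "u \<star> e s \<approx> u" "u \<star> u \<approx> u" and "\<not> (u \<in> K \<or> e s - u \<in> K)"
    then have uK: "u \<notin> K" "e s - u \<notin> K" by auto
    define v where "v = e s - u"
    have vB: "v \<in> B" using B_diff eB[OF s] u(1) by (simp add: v_def)
    have uv: "u \<star> v \<in> K" "v \<star> u \<in> K"
      using eq_diff[OF u(3,4)] eq_diff[OF u(2,4)] by (simp_all add: v_def gm_diff_left gm_diff_right eq_zero)
    have vv: "v \<star> v \<approx> v"
    proof -
      have "v \<star> v = e s \<star> v - u \<star> v" by (simp add: v_def gm_diff_left)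
      moreover have "e s \<star> v \<approx> v" unfolding v_def gm_diff_right by (rule eq_diff[OF ei[OF s] u(2)])
      ultimately show ?thesis using eq_diff[of "e s \<star> v" v "u \<star> v" 0] uv(1) by (simp add: eq_zero)
    qed
    have ort: "u \<star> e t \<in> K" "e t \<star> u \<in> K" "v \<star> e t \<in> K" "e t \<star> v \<in> K" if t: "t < n" "t ~= s" for t
    proof -
      have "u \<star> (e s \<star> e t) \<in> K" "e t \<star> e s \<star> u \<in> K" using eo s t u(1) K_left K_right by auto
      then show *: "u \<star> e t \<in> K" "e t \<star> u \<in> K"
        using eq_K[OF eq_right[OF u(3) eB[OF t(1)]]] eq_K[OF eq_left[OF u(2) eB[OF t(1)]]] by (simp_all add: gm_assoc)
      show "v \<star> e t \<in> K" "e t \<star> v \<in> K"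
        unfolding v_def gm_diff_left gm_diff_right using * eo s t by (auto intro: K_diff)
    qed
    define e' where "e' t = (if t = s then u else if t = n then v else e t)" for t
    have "(\<Sum>t<Suc n. e' t) = (\<Sum>t<n. e t)"
    proof -
      have "(\<Sum>t<n. e' t) = u + (\<Sum>t\<in>{..<n} - {s}. e t)"
        using s by (simp add: sum.remove[of "{..<n}" s] e'_def)
      moreover have "(\<Sum>t<n. e t) = e s + (\<Sum>t\<in>{..<n} - {s}. e t)"
        using s by (simp add: sum.remove[of "{..<n}" s])
      ultimately show ?thesis using s by (simp add: e'_def v_def)
    qed
    moreover have "e' t \<in> B \<and> e' t \<notin> K \<and> e' t \<star> e' t \<approx> e' t" if "t < Suc n" for t
      using that u uK vB vv eB eK ei unfolding e'_def v_def[symmetric] by auto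
    moreover have "e' t \<star> e' r \<in> K" if "t < Suc n" "r < Suc n" "t ~= r" for t r
      using that uv ort eo unfolding e'_def by (auto simp: less_Suc_eq)
    ultimately have "fam (Suc n) e'" using e1 unfolding fam_def by auto
    then show False using nomore by blast
  qed
  then show ?thesis using e1 by blast
qed

end

context group_alg
begin

text \<open>A decomposition e = u + v into orthogonal central idempotents is the same as an
  idempotent u absorbed by e on both sides, with v = e - u. The other ingredient is that on fixed
  points the Brauer kernel is given by coefficients.\<close>

lemma brauer_block_iff:
  assumes P: "p_subgroup p G P"
  shows "brauer_block m G P e \<longleftrightarrow> kprim (ZP P) (KP P) e"
proof -
  interpret Z: algebra_mod G m p "ZP P" "KP P" by (rule algebra_mod_ZP[OF P])
  have sP: "subgroup P G" using P by (rule psub)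
  have ker: "a \<in> ogker m G P \<longleftrightarrow> a \<in> KP P" if "a \<in> FP P" for a by (rule ogker_iff[OF P that])
  have cent: "(\<forall>a\<in>FP P. z \<star> a - a \<star> z \<in> ogker m G P) \<longleftrightarrow> z \<in> ZP P" if "z \<in> FP P" for z
    using that ker[OF Fx_diff[OF FP_mult FP_mult]] unfolding ZP_def by blast
  show ?thesis
  proof
    assume b: "brauer_block m G P e"
    have eF: "e \<in> FP P" and eZ: "e \<in> ZP P" and ee: "e \<star> e - e \<in> KP P" and eK: "e \<notin> KP P"
      using b cent ker[OF Fx_diff[OF FP_mult]] ker unfolding brauer_block_def Let_def ogfix_eq[OF sP] by blast+
    have pr: "u \<in> ogker m G P \<or> v \<in> ogker m G P"
      if "u \<in> FP P" "v \<in> FP P" "\<forall>a\<in>FP P. u \<star> a - a \<star> u \<in> ogker m G P" "\<forall>a\<in>FP P. v \<star> a - a \<star> v \<in> ogker m G P"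
        "u \<star> u - u \<in> ogker m G P" "v \<star> v - v \<in> ogker m G P" "u \<star> v \<in> ogker m G P" "v \<star> u \<in> ogker m G P"
        "e - (u + v) \<in> ogker m G P" for u v
      using b that unfolding brauer_block_def Let_def ogfix_eq[OF sP] by blast
    show "kprim (ZP P) (KP P) e"
    proof (rule Z.kprimI[OF eZ _ eK])
      show "e \<star> e \<approx>\<^bsub>KP P\<^esub> e" using ee by (simp add: eqm_def)
      fix u assume u: "u \<in> ZP P" "e \<star> u \<approx>\<^bsub>KP P\<^esub> u" "u \<star> e \<approx>\<^bsub>KP P\<^esub> u" "u \<star> u \<approx>\<^bsub>KP P\<^esub> u"
      define v where "v = e - u"
      have vZ: "v \<in> ZP P" using Z.B_diff eZ u(1) by (simp add: v_def)
      have uF: "u \<in> FP P" and vF: "v \<in> FP P" using u vZ ZP_FP by auto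
      have uv: "u \<star> v \<in> KP P" "v \<star> u \<in> KP P"
        using Z.eq_diff[OF u(3,4)] Z.eq_diff[OF u(2,4)] by (simp_all add: v_def gm_diff_left gm_diff_right Z.eq_zero)
      have "v \<star> v \<approx>\<^bsub>KP P\<^esub> v"
      proof -
        have "v \<star> v = e \<star> v - u \<star> v" by (simp add: v_def gm_diff_left)
        moreover have "e \<star> v \<approx>\<^bsub>KP P\<^esub> v" unfolding v_def gm_diff_right using ee u(2) by (intro Z.eq_diff) (simp_all add: eqm_def)
        ultimately show ?thesis using Z.eq_diff[of "e \<star> v" v "u \<star> v" 0] uv(1) by (simp add: Z.eq_zero)
      qed
      then have vv: "v \<star> v - v \<in> KP P" by (simp add: eqm_def)
      have uu: "u \<star> u - u \<in> KP P" using u(4) by (simp add: eqm_def)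
      have sum0: "e - (u + v) = 0" by (simp add: v_def)
      have "u \<in> ogker m G P \<or> v \<in> ogker m G P"
      proof (rule pr[OF uF vF])
        show "\<forall>a\<in>FP P. u \<star> a - a \<star> u \<in> ogker m G P" "\<forall>a\<in>FP P. v \<star> a - a \<star> v \<in> ogker m G P"
          using cent[OF uF] cent[OF vF] u(1) vZ by blast+
        show "u \<star> u - u \<in> ogker m G P" "v \<star> v - v \<in> ogker m G P" "u \<star> v \<in> ogker m G P" "v \<star> u \<in> ogker m G P"
          using ker uu vv uv Kr_Fx by blast+
        show "e - (u + v) \<in> ogker m G P" unfolding sum0 using ker[OF Fx_zero] by simp
      qed
      then show "u \<in> KP P \<or> e - u \<in> KP P" using ker[OF uF] ker[OF vF] by (simp add: v_def)
    qed
  next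
    assume k: "kprim (ZP P) (KP P) e"
    have eZ: "e \<in> ZP P" and ee: "e \<star> e - e \<in> KP P" and eK: "e \<notin> KP P"
      and pr: "!!u. u \<in> ZP P ==> e \<star> u - u \<in> KP P ==> u \<star> e - u \<in> KP P ==> u \<star> u - u \<in> KP P ==> u \<in> KP P \<or> e - u \<in> KP P"
      using k unfolding kprim_def by blast+
    have eF: "e \<in> FP P" using eZ by (rule ZP_FP)
    have "u \<in> ogker m G P \<or> v \<in> ogker m G P"
      if uv: "u \<in> FP P" "v \<in> FP P" "\<forall>a\<in>FP P. u \<star> a - a \<star> u \<in> ogker m G P" "\<forall>a\<in>FP P. v \<star> a - a \<star> v \<in> ogker m G P"
        "u \<star> u - u \<in> ogker m G P" "v \<star> v - v \<in> ogker m G P" "u \<star> v \<in> ogker m G P" "v \<star> u \<in> ogker m G P"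
        "e - (u + v) \<in> ogker m G P" for u v
    proof -
      have uZ: "u \<in> ZP P" "v \<in> ZP P" using uv cent by blast+
      have uu: "u \<star> u \<approx>\<^bsub>KP P\<^esub> u" unfolding eqm_def using uv(5) ker[OF Fx_diff[OF FP_mult[OF uv(1,1)] uv(1)]] by blast
      have uvK: "u \<star> v \<in> KP P" "v \<star> u \<in> KP P" using uv(7,8) ker[OF FP_mult] uv(1,2) by blast+
      have euv: "e \<approx>\<^bsub>KP P\<^esub> u + v" unfolding eqm_def using uv(9) ker[OF Fx_diff[OF eF Fx_add[OF uv(1,2)]]] by blast
      have "e \<star> u \<approx>\<^bsub>KP P\<^esub> (u + v) \<star> u" by (rule Z.eq_right[OF euv uZ(1)])
      moreover have "(u + v) \<star> u \<approx>\<^bsub>KP P\<^esub> u"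
        using Z.eq_add[OF uu, of "v \<star> u" 0] uvK by (simp add: gm_add_left Z.eq_zero)
      ultimately have 1: "e \<star> u \<approx>\<^bsub>KP P\<^esub> u" by (rule Z.eq_trans)
      have "u \<star> e \<approx>\<^bsub>KP P\<^esub> u \<star> (u + v)" by (rule Z.eq_left[OF euv uZ(1)])
      moreover have "u \<star> (u + v) \<approx>\<^bsub>KP P\<^esub> u"
        using Z.eq_add[OF uu, of "u \<star> v" 0] uvK by (simp add: gm_add_right Z.eq_zero)
      ultimately have 2: "u \<star> e \<approx>\<^bsub>KP P\<^esub> u" by (rule Z.eq_trans)
      have "u \<in> KP P \<or> e - u \<in> KP P" using pr[OF uZ(1)] 1 2 uu by (simp add: eqm_def)
      moreover have "v \<in> KP P" if "e - u \<in> KP P"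
      proof -
        have "(e - u) - (e - (u + v)) \<in> KP P" by (rule Kr_diff[OF that euv[unfolded eqm_def]])
        then show ?thesis by simp
      qed
      ultimately show ?thesis using ker uv by blast
    qed
    then show "brauer_block m G P e"
      unfolding brauer_block_def Let_def ogfix_eq[OF sP]
      using eF cent[OF eF] eZ ker[OF Fx_diff[OF FP_mult[OF eF eF] eF]] ker[OF eF] ee eK by blast
  qed
qed

definition cs :: "'g => 'g set => 'g set" where "cs x P = (%y. x \<otimes> y \<otimes> inv x) ` P"

lemma cs_inv:
  assumes "P \<subseteq> carrier G" "x \<in> carrier G"
  shows "cs (inv x) (cs x P) = P" "cs x (cs (inv x) P) = P"
proof -
  have 1: "inv x \<otimes> (x \<otimes> y \<otimes> inv x) \<otimes> x = y" "x \<otimes> (inv x \<otimes> y \<otimes> x) \<otimes> inv x = y" if "y \<in> P" for y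
    using that assms by (auto simp: m_assoc subset_iff) (simp_all add: m_assoc[symmetric] subset_iff)
  then show "cs (inv x) (cs x P) = P" "cs x (cs (inv x) P) = P"
    using assms(2) unfolding cs_def image_image by simp_all
qed

lemma cs_subgroup:
  assumes "subgroup P G" "x \<in> carrier G"
  shows "subgroup (cs x P) G"
proof (rule subgroupI)
  have PG: "!!y. y \<in> P ==> y \<in> carrier G" by (rule subgroup.mem_carrier[OF assms(1)])
  show "cs x P \<subseteq> carrier G" using PG assms(2) by (auto simp: cs_def)
  show "cs x P ~= {}" using subgroup.one_closed[OF assms(1)] by (auto simp: cs_def)
  show "inv a \<in> cs x P" if "a \<in> cs x P" for a
  proof -
    from that obtain y where y: "y \<in> P" "a = x \<otimes> y \<otimes> inv x" by (auto simp: cs_def)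
    then have "inv a = x \<otimes> inv y \<otimes> inv x" using PG assms(2) by (simp add: inv_mult_group m_assoc)
    then show ?thesis using subgroup.m_inv_closed[OF assms(1) y(1)] by (auto simp: cs_def)
  qed
  show "a \<otimes> c \<in> cs x P" if "a \<in> cs x P" "c \<in> cs x P" for a c
  proof -
    from that obtain y z where y: "y \<in> P" "a = x \<otimes> y \<otimes> inv x" and z: "z \<in> P" "c = x \<otimes> z \<otimes> inv x" by (auto simp: cs_def)
    have "inv x \<otimes> (x \<otimes> (z \<otimes> inv x)) = z \<otimes> inv x" using PG[OF z(1)] assms(2) by (simp add: m_assoc[symmetric])
    then have "a \<otimes> c = x \<otimes> (y \<otimes> z) \<otimes> inv x" using PG[OF y(1)] PG[OF z(1)] assms(2) by (simp add: y z m_assoc)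
    then show ?thesis using subgroup.m_closed[OF assms(1) y(1) z(1)] by (auto simp: cs_def)
  qed
qed

lemma card_cs:
  assumes "P \<subseteq> carrier G" "x \<in> carrier G"
  shows "card (cs x P) = card P"
proof -
  have "inj_on (%y. x \<otimes> y \<otimes> inv x) P"
    using assms by (intro inj_on_inverseI[where g = "%y. inv x \<otimes> y \<otimes> x"])
      (auto simp: m_assoc subset_iff, simp add: m_assoc[symmetric])
  then show ?thesis unfolding cs_def by (rule card_image)
qed

lemma cs_psub: "p_subgroup p G P ==> x \<in> carrier G ==> p_subgroup p G (cs x P)"
  unfolding p_subgroup_def using cs_subgroup card_cs subgroup.subset by metis

lemma cj_FP:
  assumes "subgroup P G" "x \<in> carrier G" "a \<in> FP P"
  shows "cj x a \<in> FP (cs x P)"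
proof (rule FPI[OF cs_subgroup[OF assms(1,2)] cj_in])
  fix q assume "q \<in> cs x P"
  then obtain y where y: "y \<in> P" "q = x \<otimes> y \<otimes> inv x" by (auto simp: cs_def)
  have yc: "y \<in> carrier G" using subgroup.mem_carrier[OF assms(1) y(1)] .
  have "cj q (cj x a) = cj (x \<otimes> y) a" using y yc assms(2) by (simp add: cj_cj m_assoc)
  also have "\<dots> = cj x (cj y a)" using yc assms(2) by (simp add: cj_cj)
  finally show "cj q (cj x a) = cj x a" using FP_cj[OF assms(1,3) y(1)] by simp
qed

lemma cj_KP:
  assumes "subgroup P G" "x \<in> carrier G" "a \<in> KP P"
  shows "cj x a \<in> KP (cs x P)"
  unfolding Kr_def
proof (intro CollectI conjI ballI)
  show "cj x a \<in> FP (cs x P)" by (rule cj_FP[OF assms(1,2) Kr_Fx[OF assms(3)]])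
  fix g assume g: "g \<in> TT (dg (cs x P))"
  then have gc: "g \<in> carrier G" by (simp add: TT_dg)
  have "inv x \<otimes> g \<otimes> x \<in> TT (dg P)"
    unfolding TT_dg
  proof (intro conjI ballI)
    show "inv x \<otimes> g \<otimes> x \<in> carrier G" using gc assms(2) by simp
    fix y assume y: "y \<in> P"
    have yc: "y \<in> carrier G" using subgroup.mem_carrier[OF assms(1) y] .
    have "x \<otimes> y \<otimes> inv x \<otimes> g = g \<otimes> (x \<otimes> y \<otimes> inv x)" using g y unfolding TT_dg cs_def by blast
    then have "inv x \<otimes> (x \<otimes> y \<otimes> inv x \<otimes> g) \<otimes> x = inv x \<otimes> (g \<otimes> (x \<otimes> y \<otimes> inv x)) \<otimes> x" by simp
    moreover have "inv x \<otimes> (x \<otimes> y \<otimes> inv x \<otimes> g) \<otimes> x = y \<otimes> (inv x \<otimes> g \<otimes> x)"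
      using yc gc assms(2) by (simp add: m_assoc) (simp add: m_assoc[symmetric])
    moreover have "inv x \<otimes> (g \<otimes> (x \<otimes> y \<otimes> inv x)) \<otimes> x = inv x \<otimes> g \<otimes> x \<otimes> y"
      using yc gc assms(2) by (simp add: m_assoc)
    ultimately show "y \<otimes> (inv x \<otimes> g \<otimes> x) = inv x \<otimes> g \<otimes> x \<otimes> y" by simp
  qed
  then show "cj x a g \<in> m" using assms(3) gc by (simp add: Kr_def cj_apply)
qed

lemma cj_transport:
  assumes "subgroup P G" "x \<in> carrier G" "a \<in> GA"
  shows "cj x a \<in> FP (cs x P) \<longleftrightarrow> a \<in> FP P" "cj x a \<in> KP (cs x P) \<longleftrightarrow> a \<in> KP P"
  using cj_FP[OF assms(1,2)] cj_KP[OF assms(1,2)]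
    cj_FP[OF cs_subgroup[OF assms(1,2)] inv_closed[OF assms(2)], of "cj x a"]
    cj_KP[OF cs_subgroup[OF assms(1,2)] inv_closed[OF assms(2)], of "cj x a"]
    cs_inv(1)[OF subgroup.subset[OF assms(1)] assms(2)] cj_inv(2)[OF assms(2,3)]
  by auto

lemma cj_image:
  assumes "subgroup P G" "x \<in> carrier G"
  shows "FP (cs x P) = cj x ` FP P" "KP (cs x P) = cj x ` KP P" "M0 \<inter> FP (cs x P) = cj x ` (M0 \<inter> FP P)"
proof -
  have bk: "a = cj x (cj (inv x) a)" if "a \<in> FP (cs x P)" for a
    using cj_inv(1)[OF assms(2) Fx_GA[OF that]] by simp
  have b2: "cj (inv x) a \<in> FP P" if "a \<in> FP (cs x P)" for a
    using cj_transport(1)[OF assms, of "cj (inv x) a"] bk[OF that] that by simp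
  have b3: "cj (inv x) a \<in> KP P" if "a \<in> KP (cs x P)" for a
    using cj_transport(2)[OF assms, of "cj (inv x) a"] bk[OF Kr_Fx[OF that]] that by simp
  show "FP (cs x P) = cj x ` FP P" using cj_FP[OF assms] bk b2 by blast
  show "KP (cs x P) = cj x ` KP P" using cj_KP[OF assms] bk[OF Kr_Fx] b3 by blast
  show "M0 \<inter> FP (cs x P) = cj x ` (M0 \<inter> FP P)" using cj_FP[OF assms] M0_cj bk b2 by blast
qed

lemma cj_ZP:
  assumes "subgroup P G" "x \<in> carrier G"
  shows "ZP (cs x P) = cj x ` ZP P"
proof -
  have *: "cj x z \<in> ZP (cs x P) \<longleftrightarrow> z \<in> ZP P" if z: "z \<in> FP P" for z
  proof -
    have "(\<forall>a\<in>cj x ` FP P. cj x z \<star> a - a \<star> cj x z \<in> KP (cs x P)) \<longleftrightarrow> (\<forall>a\<in>FP P. z \<star> a - a \<star> z \<in> KP P)"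
      using cj_transport(2)[OF assms] by (simp add: cj_mult[OF assms(2), symmetric] cj_diff[symmetric] GA_diff)
    then show ?thesis unfolding ZP_def cj_image(1)[OF assms] using z by blast
  qed
  show ?thesis
  proof (intro equalityI subsetI)
    fix w assume w: "w \<in> ZP (cs x P)"
    then obtain z where "z \<in> FP P" "w = cj x z" using ZP_FP cj_image(1)[OF assms] by blast
    then show "w \<in> cj x ` ZP P" using * w by blast
  qed (use * ZP_FP in blast)
qed

lemma kprim_cj:
  assumes x: "x \<in> carrier G" and k: "kprim B K e" and "subalg (cj x ` B)" "alg_ideal (cj x ` B) (cj x ` K)"
  shows "kprim (cj x ` B) (cj x ` K) (cj x e)"
proof -
  have BG: "B \<subseteq> GA" and KB: "K \<subseteq> B" and eB: "e \<in> B" using k by (auto simp: kprim_def subalg_def alg_ideal_def)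
  have mem: "cj x a \<in> cj x ` K \<longleftrightarrow> a \<in> K" if "a \<in> GA" for a
  proof
    assume "cj x a \<in> cj x ` K"
    then obtain k where k: "k \<in> K" "cj x a = cj x k" by (rule imageE)
    have "k \<in> GA" using k(1) BG KB by blast
    from cj_inv(2)[OF x this] have "k = a" unfolding k(2)[symmetric] cj_inv(2)[OF x that] by (rule sym)
    then show "a \<in> K" using k(1) by simp
  qed (rule imageI)
  have eG: "e \<in> GA" using eB BG by blast
  have ei: "cj x e \<star> cj x e - cj x e \<in> cj x ` K" "cj x e \<notin> cj x ` K"
    using k mem[OF GA_diff[OF gm_in eG]] mem[OF eG] by (simp_all add: cj_mult[OF x, symmetric] cj_diff[symmetric] kprim_def)
  have pr0: "cj x u \<in> cj x ` K \<or> cj x e - cj x u \<in> cj x ` K"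
    if "u \<in> B" "cj x e \<star> cj x u - cj x u \<in> cj x ` K" "cj x u \<star> cj x e - cj x u \<in> cj x ` K"
      "cj x u \<star> cj x u - cj x u \<in> cj x ` K" for u
  proof -
    have uG: "u \<in> GA" using that BG by blast
    have "e \<star> u - u \<in> K" "u \<star> e - u \<in> K" "u \<star> u - u \<in> K"
      using that(2-4) mem[OF GA_diff[OF gm_in uG]] by (simp_all add: cj_mult[OF x, symmetric] cj_diff[symmetric])
    then have "u \<in> K \<or> e - u \<in> K" using k that(1) by (auto simp: kprim_def)
    then show ?thesis using mem[OF uG] mem[OF GA_diff[OF eG uG]] by (simp add: cj_diff[symmetric])
  qed
  have pr: "w \<in> cj x ` K \<or> cj x e - w \<in> cj x ` K"
    if wB: "w \<in> cj x ` B" and wK: "cj x e \<star> w - w \<in> cj x ` K" "w \<star> cj x e - w \<in> cj x ` K" "w \<star> w - w \<in> cj x ` K" for w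
  proof -
    obtain u where u: "u \<in> B" "w = cj x u" using wB by blast
    show ?thesis using pr0[OF u(1)] wK unfolding u(2) by (simp only:)
  qed
  show ?thesis unfolding kprim_def using assms(3,4) imageI[OF eB, of "cj x"] ei pr by (intro conjI ballI impI) (assumption | rule pr)+
qed

lemma kprim_FP_cj:
  "subgroup P G ==> x \<in> carrier G ==> kprim (FP P) (M0 \<inter> FP P) i ==>
    kprim (FP (cs x P)) (M0 \<inter> FP (cs x P)) (cj x i)"
  using kprim_cj[of x "FP P" "M0 \<inter> FP P" i] cj_image[of P x] subalg_FP[of "cs x P"] ideal_M0[of "cs x P"] by simp

lemma kprim_ZP_cj:
  "p_subgroup p G P ==> x \<in> carrier G ==> kprim (ZP P) (KP P) e ==>
    kprim (ZP (cs x P)) (KP (cs x P)) (cj x e)"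
  using kprim_cj[of x "ZP P" "KP P" e] cj_image[OF psub, of P x] cj_ZP[OF psub, of P x]
    subalg_ZP[OF cs_psub, of P x] ideal_ZP[OF cs_psub, of P x] by simp

end

section \<open>Ideals generated by an idempotent and traces over double cosets\<close>

context group_alg
begin

text \<open>The two-sided ideal of (OG)^P generated by i.\<close>

inductive_set gid :: "'g set => ('g => 'o) => ('g => 'o) set" for P i where
  gid_zero: "0 \<in> gid P i"
| gid_step: "v \<in> gid P i ==> \<alpha> \<in> FP P ==> \<beta> \<in> FP P ==> v + \<alpha> \<star> i \<star> \<beta> \<in> gid P i"

lemma gid_base: "\<alpha> \<in> FP P ==> \<beta> \<in> FP P ==> \<alpha> \<star> i \<star> \<beta> \<in> gid P i"
  using gid_step[OF gid_zero, of \<alpha> P \<beta> i] by simp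

lemma gid_FP:
  assumes "i \<in> FP P" "v \<in> gid P i"
  shows "v \<in> FP P"
  using assms(2)
proof (induction rule: gid.induct)
  case (gid_step v \<alpha> \<beta>)
  show ?case by (rule Fx_add[OF gid_step.IH FP_mult[OF FP_mult[OF gid_step.hyps(2) assms(1)] gid_step.hyps(3)]])
qed (rule Fx_zero)

lemma gid_add:
  assumes "v \<in> gid P i" "w \<in> gid P i"
  shows "v + w \<in> gid P i"
  using assms(2)
proof (induction rule: gid.induct)
  case gid_zero
  show ?case using assms(1) by simp
next
  case (gid_step w \<alpha> \<beta>)
  have "v + w + \<alpha> \<star> i \<star> \<beta> \<in> gid P i" by (rule gid.gid_step[OF gid_step.IH gid_step.hyps(2,3)])
  then show ?case by (simp only: add.assoc)
qed

lemma gid_sum: "(!!s. s \<in> S ==> f s \<in> gid P i) ==> sum f S \<in> gid P i"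
  by (induction S rule: infinite_finite_induct) (auto intro: gid_add gid_zero)

lemma gid_left:
  assumes "c \<in> FP P" "v \<in> gid P i"
  shows "c \<star> v \<in> gid P i"
  using assms(2)
proof (induction rule: gid.induct)
  case gid_zero
  show ?case by (simp only: gm_zero_right gid.gid_zero)
next
  case (gid_step w \<alpha> \<beta>)
  have "c \<star> w + c \<star> \<alpha> \<star> i \<star> \<beta> \<in> gid P i"
    by (rule gid.gid_step[OF gid_step.IH FP_mult[OF assms(1) gid_step.hyps(2)] gid_step.hyps(3)])
  then show ?case by (simp only: gm_add_right gm_assoc)
qed

lemma gid_ne:
  assumes P: "p_subgroup p G P" and v: "v \<in> gid P i" and y: "v \<star> y \<notin> KP P"
  shows "\<exists>\<beta>\<in>FP P. i \<star> \<beta> \<star> y \<notin> KP P"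
proof (rule ccontr)
  assume "\<not> (\<exists>\<beta>\<in>FP P. i \<star> \<beta> \<star> y \<notin> KP P)"
  then have a: "!!\<beta>. \<beta> \<in> FP P ==> i \<star> \<beta> \<star> y \<in> KP P" by blast
  from v have "v \<star> y \<in> KP P"
  proof (induction rule: gid.induct)
    case gid_zero
    show ?case by (simp only: gm_zero_left Kr_zero)
  next
    case (gid_step w \<alpha> \<beta>)
    have "w \<star> y + \<alpha> \<star> (i \<star> \<beta> \<star> y) \<in> KP P"
      by (rule Kr_add[OF gid_step.IH KP_right[OF P gid_step.hyps(2) a[OF gid_step.hyps(3)]]])
    then show ?case by (simp only: gm_add_left gm_assoc)
  qed
  then show False using y by blast
qed

lemma WW_cj_FP:
  assumes R: "subgroup R G" and D: "subgroup D G" and x: "x \<in> WW R D" and a: "a \<in> FP D"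
  shows "cj x a \<in> FP R"
proof (rule FPI[OF R cj_in])
  fix r assume r: "r \<in> R"
  have c: "r \<in> carrier G" "x \<in> carrier G" using subgroup.mem_carrier[OF R r] x by (auto simp: WW_def)
  have d: "inv x \<otimes> r \<otimes> x \<in> D" using x r by (auto simp: WW_def)
  have "x \<otimes> (inv x \<otimes> r \<otimes> x) = r \<otimes> x" using c by (simp add: m_assoc[symmetric])
  then have "cj r (cj x a) = cj x (cj (inv x \<otimes> r \<otimes> x) a)" using c by (simp add: cj_cj)
  then show "cj r (cj x a) = cj x a" using FP_cj[OF D a d] by simp
qed

text \<open>The double coset C_G(R) x D. The Mackey sum is split along these, rather than along
  cosets of D, because a trace over such a set is central in the Brauer quotient; only then do the
  summands lie in the local ring of a block.\<close>

definition dc :: "'g set => 'g set => 'g => 'g set" where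
  "dc R D x = {c \<otimes> x \<otimes> d | c d. c \<in> TT (dg R) \<and> d \<in> D}"

lemma dcI: "c \<in> TT (dg R) ==> d \<in> D ==> c \<otimes> x \<otimes> d \<in> dc R D x"
  by (auto simp: dc_def)

lemma dc_eq:
  assumes R: "R \<subseteq> carrier G" and D: "subgroup D G" and x: "x \<in> carrier G" and y: "y \<in> dc R D x"
  shows "dc R D y = dc R D x"
proof -
  have sC: "subgroup (TT (dg R)) G" by (rule subgroup_centralizer[OF R])
  obtain c d where cd: "c \<in> TT (dg R)" "d \<in> D" "y = c \<otimes> x \<otimes> d" using y by (auto simp: dc_def)
  have cG: "!!c. c \<in> TT (dg R) ==> c \<in> carrier G" and dG: "!!d. d \<in> D ==> d \<in> carrier G"
    using subgroup.mem_carrier[OF sC] subgroup.mem_carrier[OF D] by auto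
  show ?thesis
  proof
    show "dc R D y \<subseteq> dc R D x"
    proof
      fix u assume "u \<in> dc R D y"
      then obtain c' d' where u: "c' \<in> TT (dg R)" "d' \<in> D" "u = c' \<otimes> y \<otimes> d'" by (auto simp: dc_def)
      then have "u = (c' \<otimes> c) \<otimes> x \<otimes> (d \<otimes> d')" using cd x cG dG by (simp add: m_assoc)
      then show "u \<in> dc R D x" using dcI subgroup.m_closed[OF sC u(1) cd(1)] subgroup.m_closed[OF D cd(2) u(2)] by simp
    qed
    show "dc R D x \<subseteq> dc R D y"
    proof
      fix u assume "u \<in> dc R D x"
      then obtain c' d' where u: "c' \<in> TT (dg R)" "d' \<in> D" "u = c' \<otimes> x \<otimes> d'" by (auto simp: dc_def)
      have c4: "c \<in> carrier G" "d \<in> carrier G" "c' \<in> carrier G" "d' \<in> carrier G" using cd u cG dG by auto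
      have "inv c \<otimes> (c \<otimes> (x \<otimes> (d \<otimes> (inv d \<otimes> d')))) = x \<otimes> d'"
      proof -
        have "d \<otimes> (inv d \<otimes> d') = d'" using c4 by (simp add: m_assoc[symmetric])
        moreover have "inv c \<otimes> (c \<otimes> (x \<otimes> d')) = x \<otimes> d'" using c4 x by (simp add: m_assoc[symmetric])
        ultimately show ?thesis by simp
      qed
      then have "u = (c' \<otimes> inv c) \<otimes> y \<otimes> (inv d \<otimes> d')" using c4 x by (simp add: cd(3) u(3) m_assoc)
      then show "u \<in> dc R D y"
        using dcI subgroup.m_closed[OF sC u(1) subgroup.m_inv_closed[OF sC cd(1)]]
          subgroup.m_closed[OF D subgroup.m_inv_closed[OF D cd(2)] u(2)] by simp
    qed
  qed
qed

lemma dc_self: "R \<subseteq> carrier G ==> subgroup D G ==> x \<in> carrier G ==> x \<in> dc R D x"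
  using dcI[of \<one> R \<one> D x] subgroup.one_closed[OF subgroup_centralizer] subgroup.one_closed[of D G] by simp

lemma dc_WW:
  assumes R: "R \<subseteq> carrier G" and D: "subgroup D G" and x: "x \<in> WW R D"
  shows "dc R D x \<subseteq> WW R D"
proof
  fix u assume "u \<in> dc R D x"
  then obtain c d where u: "c \<in> TT (dg R)" "d \<in> D" "u = c \<otimes> x \<otimes> d" by (auto simp: dc_def)
  have cc: "c \<in> carrier G" "d \<in> carrier G" "x \<in> carrier G"
    using u x subgroup.mem_carrier[OF D] by (auto simp: TT_dg WW_def)
  have "inv u \<otimes> r \<otimes> u \<in> D" if r: "r \<in> R" for r
  proof -
    have rc: "r \<in> carrier G" using r R by auto
    have "r \<otimes> c = c \<otimes> r" using u(1) r by (auto simp: TT_dg)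
    then have "inv c \<otimes> r \<otimes> c = r" using cc rc by (metis inv_solve_left m_assoc inv_closed m_closed)
    moreover have "inv u \<otimes> r \<otimes> u = inv d \<otimes> (inv x \<otimes> (inv c \<otimes> r \<otimes> c) \<otimes> x) \<otimes> d"
      using cc rc by (simp add: u(3) inv_mult_group m_assoc)
    ultimately have "inv u \<otimes> r \<otimes> u = inv d \<otimes> (inv x \<otimes> r \<otimes> x) \<otimes> d" by simp
    moreover have "inv x \<otimes> r \<otimes> x \<in> D" using x r by (auto simp: WW_def)
    ultimately show ?thesis using u(2) subgroup.m_closed[OF D] subgroup.m_inv_closed[OF D] by simp
  qed
  then show "u \<in> WW R D" using cc by (auto simp: WW_def u(3))
qed

text \<open>The double coset is stable under left multiplication by C_G(R), and by R as well since r
  y = y (y^-1 r y) with y^-1 r y in D. The trace is thus fixed by both groups, and fixed points of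
  C_G(R) are central modulo the kernel.\<close>

lemma tr_dc_central:
  assumes R: "p_subgroup p G R" and D: "subgroup D G" and x: "x \<in> WW R D" and a: "a \<in> FP D"
  shows "tr D (dc R D x) a \<in> ZP R"
proof -
  have sR: "subgroup R G" and RG: "R \<subseteq> carrier G" using psub[OF R] subgroup.subset by auto
  have sC: "subgroup (TT (dg R)) G" by (rule subgroup_centralizer[OF RG])
  have xc: "x \<in> carrier G" using x by (simp add: WW_def)
  have YG: "dc R D x \<subseteq> carrier G" using dc_WW[OF RG D x] by (auto simp: WW_def)
  have Cst: "h \<otimes> y \<in> dc R D x" if h: "h \<in> TT (dg R)" and y: "y \<in> dc R D x" for h y
  proof -
    obtain c d where u: "c \<in> TT (dg R)" "d \<in> D" "y = c \<otimes> x \<otimes> d" using y by (auto simp: dc_def)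
    have "h \<otimes> y = (h \<otimes> c) \<otimes> x \<otimes> d"
      using u xc subgroup.mem_carrier[OF sC] h subgroup.mem_carrier[OF D] by (simp add: m_assoc)
    then show ?thesis using dcI[OF subgroup.m_closed[OF sC h u(1)] u(2)] by simp
  qed
  have Rst: "r \<otimes> y \<in> dc R D x" if r: "r \<in> R" and y: "y \<in> dc R D x" for r y
  proof -
    have rc: "r \<in> carrier G" using r RG by auto
    have yc: "y \<in> carrier G" and yd: "inv y \<otimes> r \<otimes> y \<in> D" using dc_WW[OF RG D x] y r by (auto simp: WW_def)
    have "r \<otimes> y = \<one> \<otimes> y \<otimes> (inv y \<otimes> r \<otimes> y)" using rc yc by (simp add: m_assoc[symmetric])
    then have "r \<otimes> y \<in> dc R D y" using dcI[OF subgroup.one_closed[OF sC] yd] by simp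
    then show ?thesis using dc_eq[OF RG D xc y] by simp
  qed
  have F: "tr D (dc R D x) a \<in> FP R" by (rule tr_FP[OF D a YG sR Rst])
  have F2: "tr D (dc R D x) a \<in> FP (TT (dg R))" by (rule tr_FP[OF D a YG sC Cst])
  have "tr D (dc R D x) a \<star> y - y \<star> tr D (dc R D x) a \<in> KP R" if "y \<in> FP R" for y
    by (rule centralizing_central[OF R F FP_cj[OF sC F2] that])
  then show ?thesis using F unfolding ZP_def by blast
qed

text \<open>The summand at c x d is the conjugate by c x, as d fixes the argument. Conjugation by c
  in C_G(R) amounts to multiplication by \<open>el c\<close> and \<open>el (inv c)\<close>, which
  are R-fixed and can be absorbed into the outer factors.\<close>

lemma tr_dc_gid:
  assumes R: "subgroup R G" and D: "subgroup D G" and x: "x \<in> WW R D"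
    and ab: "\<alpha> \<in> FP D" "\<beta> \<in> FP D" "i \<in> FP D"
  shows "tr D (dc R D x) (\<alpha> \<star> i \<star> \<beta>) \<in> gid R (cj x i)"
  unfolding tr_def
proof (rule gid_sum)
  fix C assume "C \<in> lcs D (dc R D x)"
  then obtain c d where u: "c \<in> TT (dg R)" "d \<in> D" "C = (c \<otimes> x \<otimes> d) <# D" by (auto simp: lcs_def dc_def)
  have RG: "R \<subseteq> carrier G" using subgroup.subset[OF R] .
  have sC: "subgroup (TT (dg R)) G" by (rule subgroup_centralizer[OF RG])
  have xc: "x \<in> carrier G" and cc: "c \<in> carrier G" and dcr: "d \<in> carrier G"
    using x u subgroup.mem_carrier[OF sC] subgroup.mem_carrier[OF D] by (auto simp: WW_def)
  have aF: "\<alpha> \<star> i \<star> \<beta> \<in> FP D" by (intro FP_mult ab)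
  have "cval (\<alpha> \<star> i \<star> \<beta>) C = cj (c \<otimes> x \<otimes> d) (\<alpha> \<star> i \<star> \<beta>)"
    unfolding u(3) by (rule cval[OF D aF]) (use xc cc dcr in simp)
  also have "\<dots> = cj c (cj x (cj d (\<alpha> \<star> i \<star> \<beta>)))" using xc cc dcr by (simp add: cj_cj m_assoc)
  also have "cj d (\<alpha> \<star> i \<star> \<beta>) = \<alpha> \<star> i \<star> \<beta>" by (rule FP_cj[OF D aF u(2)])
  also have "cj c (cj x (\<alpha> \<star> i \<star> \<beta>)) = (el c \<star> cj x \<alpha>) \<star> cj x i \<star> (cj x \<beta> \<star> el (inv c))"
    using xc cc by (simp add: cj_mult cj_eq[OF cc] gm_assoc)
  also have "\<dots> \<in> gid R (cj x i)"
    using subgroup.m_inv_closed[OF sC u(1)] u(1)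
    by (intro gid_base FP_mult WW_cj_FP[OF R D x] ab el_FP[OF RG])
  finally show "cval (\<alpha> \<star> i \<star> \<beta>) C \<in> gid R (cj x i)" .
qed

text \<open>This is the Mackey formula multiplied by e: b acts on e as the identity, and only the
  double cosets inside \<open>WW R D\<close> survive.\<close>

lemma block_partition:
  assumes R: "p_subgroup p G R" and D: "subgroup D G" and a: "a \<in> FP D"
    and b: "b - tr D (carrier G) a \<in> M0" "b \<in> FP R" and e: "kprim (ZP R) (KP R) e" "e \<star> b - e \<in> KP R"
  shows "(\<Sum>Y\<in>dc R D ` WW R D. e \<star> tr D Y a) \<approx>\<^bsub>KP R\<^esub> e" "finite (dc R D ` WW R D)"
proof -
  have sR: "subgroup R G" and RG: "R \<subseteq> carrier G" using psub[OF R] subgroup.subset by auto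
  interpret Z: algebra_mod G m p "FP R" "KP R" by (rule algebra_mod_KP[OF R])
  have WG: "WW R D \<subseteq> carrier G" by (auto simp: WW_def)
  have finW: "finite (WW R D)" by (rule finite_subset[OF WG fin])
  then show fin': "finite (dc R D ` WW R D)" by simp
  have U: "\<Union>(dc R D ` WW R D) = WW R D" using dc_WW[OF RG D] dc_self[OF RG D] WG by blast
  have "tr D (\<Union>(dc R D ` WW R D)) a = (\<Sum>Y\<in>dc R D ` WW R D. tr D Y a)"
  proof (rule tr_partition[OF D fin'])
    show "Y \<subseteq> carrier G" if "Y \<in> dc R D ` WW R D" for Y using that dc_WW[OF RG D] WG by blast
    show "x \<otimes> d \<in> Y" if Y: "Y \<in> dc R D ` WW R D" and x: "x \<in> Y" and d: "d \<in> D" for Y x d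
    proof -
      obtain y where y: "y \<in> WW R D" "Y = dc R D y" using Y by blast
      obtain c d' where u: "c \<in> TT (dg R)" "d' \<in> D" "x = c \<otimes> y \<otimes> d'" using x y(2) by (auto simp: dc_def)
      have "x \<otimes> d = c \<otimes> y \<otimes> (d' \<otimes> d)"
        using u y WG d subgroup.mem_carrier[OF D] by (auto simp: m_assoc TT_dg subset_iff)
      then show ?thesis using dcI[OF u(1) subgroup.m_closed[OF D u(2) d]] y(2) by simp
    qed
    show "Y \<inter> Z = {}" if Y: "Y \<in> dc R D ` WW R D" and Z: "Z \<in> dc R D ` WW R D" and ne: "Y ~= Z" for Y Z
    proof (rule ccontr)
      assume "Y \<inter> Z ~= {}"
      then obtain u where u: "u \<in> Y" "u \<in> Z" by blast
      obtain y z where yz: "y \<in> carrier G" "Y = dc R D y" "z \<in> carrier G" "Z = dc R D z" using Y Z WG by blast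
      then have "dc R D u = Y" "dc R D u = Z" using dc_eq[OF RG D] u by blast+
      then show False using ne by simp
    qed
  qed
  then have trW: "tr D (WW R D) a = (\<Sum>Y\<in>dc R D ` WW R D. tr D Y a)" by (simp only: U)
  have eF: "e \<in> FP R" using e(1) ZP_FP by (auto simp: kprim_def)
  have trF: "tr D (carrier G) a \<in> FP R"
    by (rule tr_FP[OF D a _ sR]) (use RG in auto)
  have 1: "tr D (carrier G) a \<approx>\<^bsub>KP R\<^esub> tr D (WW R D) a" unfolding eqm_def by (rule mackey_mod[OF R D a])
  have 2: "b \<approx>\<^bsub>KP R\<^esub> tr D (carrier G) a" unfolding eqm_def by (rule M0_Kr[OF b(1) Fx_diff[OF b(2) trF]])
  have "e \<star> b \<approx>\<^bsub>KP R\<^esub> e \<star> tr D (WW R D) a" by (rule Z.eq_left[OF Z.eq_trans[OF 2 1] eF])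
  moreover have "e \<star> b \<approx>\<^bsub>KP R\<^esub> e" unfolding eqm_def by (rule e(2))
  ultimately have "e \<star> tr D (WW R D) a \<approx>\<^bsub>KP R\<^esub> e" using Z.eq_trans[OF Z.eq_sym] by blast
  then show "(\<Sum>Y\<in>dc R D ` WW R D. e \<star> tr D Y a) \<approx>\<^bsub>KP R\<^esub> e" unfolding trW gm_sum_right .
qed

text \<open>Some summand of the partition is invertible in the local ring of the block \<open>e\<close>.\<close>

lemma block_in_ideal:
  assumes R: "p_subgroup p G R" and D: "subgroup D G" and ab: "\<alpha> \<in> FP D" "\<beta> \<in> FP D" "i \<in> FP D"
    and b: "b - tr D (carrier G) (\<alpha> \<star> i \<star> \<beta>) \<in> M0" "b \<in> FP R" and e: "kprim (ZP R) (KP R) e" "e \<star> b - e \<in> KP R"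
  shows "\<exists>x\<in>WW R D. \<exists>v\<in>gid R (cj x i). e - v \<in> KP R"
proof -
  have sR: "subgroup R G" by (rule psub[OF R])
  have aF: "\<alpha> \<star> i \<star> \<beta> \<in> FP D" by (intro FP_mult ab)
  interpret Z: primitive_mod G m p "ZP R" "KP R" e by (rule primitive_modI[OF e(1)])
  have eF: "e \<in> FP R" using Z.eB by (rule ZP_FP)
  note part = block_partition[OF R D aF b e]
  have cor: "Z.corner (e \<star> tr D Y (\<alpha> \<star> i \<star> \<beta>))" if Y: "Y \<in> dc R D ` WW R D" for Y
  proof -
    obtain x where x: "x \<in> WW R D" "Y = dc R D x" using Y by blast
    define t where "t = tr D Y (\<alpha> \<star> i \<star> \<beta>)"
    have tZ: "t \<in> ZP R" unfolding t_def x(2) by (rule tr_dc_central[OF R D x(1) aF])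
    have comm: "e \<star> t \<approx>\<^bsub>KP R\<^esub> t \<star> e"
      unfolding eqm_def by (rule ZP_central[OF Z.eB ZP_FP[OF tZ]])
    have c1: "e \<star> (e \<star> t) \<approx>\<^bsub>KP R\<^esub> e \<star> t" using Z.eq_right[OF Z.ee tZ] by (simp only: gm_assoc)
    have "e \<star> t \<star> e \<approx>\<^bsub>KP R\<^esub> e \<star> (e \<star> t)"
      unfolding gm_assoc by (rule Z.eq_left[OF Z.eq_sym[OF comm] Z.eB])
    then have c2: "e \<star> t \<star> e \<approx>\<^bsub>KP R\<^esub> e \<star> t" using c1 by (rule Z.eq_trans)
    show ?thesis
      unfolding Z.corner_def t_def[symmetric] by (intro conjI Z.B_mult[OF Z.eB tZ] c1 c2)
  qed
  obtain Y where Y: "Y \<in> dc R D ` WW R D" "Z.unitc (e \<star> tr D Y (\<alpha> \<star> i \<star> \<beta>))"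
    using Z.rosenberg[OF part(2) cor part(1)] by blast
  then obtain x y where x: "x \<in> WW R D" "Y = dc R D x" and y: "Z.corner y" "y \<star> (e \<star> tr D Y (\<alpha> \<star> i \<star> \<beta>)) \<approx>\<^bsub>KP R\<^esub> e"
    unfolding Z.unitc_def by blast
  have "y \<star> e \<star> tr D Y (\<alpha> \<star> i \<star> \<beta>) \<in> gid R (cj x i)"
    unfolding x(2) by (rule gid_left[OF FP_mult[OF ZP_FP[OF Z.cB[OF y(1)]] eF] tr_dc_gid[OF sR D x(1) ab]])
  moreover have "e - y \<star> e \<star> tr D Y (\<alpha> \<star> i \<star> \<beta>) \<in> KP R"
    using Z.eq_sym[OF y(2)] by (simp add: eqm_def gm_assoc[of y])
  ultimately show ?thesis using x(1) by blast
qed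

lemma blocks_equal_or_orthogonal:
  assumes P: "p_subgroup p G P" and e: "kprim (ZP P) (KP P) e" and f: "kprim (ZP P) (KP P) f"
  shows "e \<star> f \<in> KP P \<or> e - f \<in> KP P"
proof -
  interpret E: primitive_mod G m p "ZP P" "KP P" e by (rule primitive_modI[OF e])
  interpret F: primitive_mod G m p "ZP P" "KP P" f by (rule primitive_modI[OF f])
  have comm: "e \<star> f \<approx>\<^bsub>KP P\<^esub> f \<star> e" unfolding eqm_def by (rule ZP_central[OF E.eB ZP_FP[OF F.eB]])
  have uZ: "e \<star> f \<in> ZP P" by (rule E.B_mult[OF E.eB F.eB])
  have eu: "e \<star> (e \<star> f) \<approx>\<^bsub>KP P\<^esub> e \<star> f" using E.eq_right[OF E.ee F.eB] by (simp add: gm_assoc)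
  have uf: "e \<star> f \<star> f \<approx>\<^bsub>KP P\<^esub> e \<star> f" using E.eq_left[OF F.ee E.eB] by (simp add: gm_assoc)
  have ue: "e \<star> f \<star> e \<approx>\<^bsub>KP P\<^esub> e \<star> f"
    unfolding gm_assoc by (rule E.eq_trans[OF E.eq_left[OF E.eq_sym[OF comm] E.eB] eu])
  have fu: "f \<star> (e \<star> f) \<approx>\<^bsub>KP P\<^esub> e \<star> f"
    using E.eq_trans[OF E.eq_right[OF E.eq_sym[OF comm] F.eB] uf] by (simp add: gm_assoc)
  have uu: "e \<star> f \<star> (e \<star> f) \<approx>\<^bsub>KP P\<^esub> e \<star> f"
    using E.eq_trans[OF E.eq_left[OF fu E.eB] eu] by (simp add: gm_assoc)
  have "e \<star> f \<in> KP P \<or> e - e \<star> f \<in> KP P"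
    using E.prim[OF uZ] eu ue uu unfolding eqm_def by blast
  moreover have "e \<star> f \<in> KP P \<or> f - e \<star> f \<in> KP P"
    using F.prim[OF uZ] fu uf uu unfolding eqm_def by blast
  moreover have "e - f \<in> KP P" if "e - e \<star> f \<in> KP P" "f - e \<star> f \<in> KP P"
    using Kr_diff[OF that] by simp
  ultimately show ?thesis by blast
qed

text \<open>For c in C_G(P) the element \<open>el c\<close> is itself P-fixed, so z commutes with it
  modulo the kernel.\<close>

lemma cj_ZP_trivial:
  assumes P: "p_subgroup p G P" and z: "z \<in> ZP P" and c: "c \<in> TT (dg P)"
  shows "cj c z - z \<in> KP P"
proof -
  have PG: "P \<subseteq> carrier G" using subgroup.subset[OF psub[OF P]] .
  have cc: "c \<in> carrier G" using c by (simp add: TT_dg)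
  have elc: "el c \<in> FP P" by (rule el_FP[OF PG c])
  have eli: "el (inv c) \<in> FP P" by (rule el_FP[OF PG subgroup.m_inv_closed[OF subgroup_centralizer[OF PG] c]])
  have "(z \<star> el c - el c \<star> z) \<star> el (inv c) \<in> KP P" by (rule KP_left[OF P ZP_central[OF z elc] eli])
  moreover have "(z \<star> el c - el c \<star> z) \<star> el (inv c) = z - cj c z"
    using cc Fx_GA[OF ZP_FP[OF z]] by (simp add: gm_diff_left cj_eq gm_assoc el_el el_one_right)
  ultimately have "0 - (z - cj c z) \<in> KP P" by (intro Kr_diff[OF Kr_zero]) simp
  then show ?thesis by simp
qed

text \<open>e is idempotent only modulo the Brauer kernel, while the corner of i is local modulo the
  smaller ideal of coefficients in \<open>m\<close>. The powers of i e i stay congruent to i e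
  modulo the kernel, so i e i is not nilpotent in the corner and has an inverse y there; then y (i
  e) = i modulo the kernel, and multiplying by e shows that i absorbs e.\<close>

lemma primitive_block_idem:
  assumes P: "p_subgroup p G P" and i: "kprim (FP P) (M0 \<inter> FP P) i" and e: "kprim (ZP P) (KP P) e" and ie: "i \<star> e \<notin> KP P"
  shows "i \<star> e - i \<in> KP P"
proof -
  interpret I: primitive_mod G m p "FP P" "M0 \<inter> FP P" i by (rule primitive_modI[OF i])
  interpret E: primitive_mod G m p "ZP P" "KP P" e by (rule primitive_modI[OF e])
  interpret Z: algebra_mod G m p "FP P" "KP P" by (rule algebra_mod_KP[OF P])
  have down: "x \<approx>\<^bsub>KP P\<^esub> y" if "x \<approx>\<^bsub>M0 \<inter> FP P\<^esub> y" for x y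
    using that M0_Kr unfolding eqm_def by blast
  have eF: "e \<in> FP P" by (rule ZP_FP[OF E.eB])
  have iF: "i \<in> FP P" by (rule I.eB)
  have ii: "i \<star> i \<approx>\<^bsub>KP P\<^esub> i" by (rule down[OF I.ee])
  have ei: "e \<star> i \<approx>\<^bsub>KP P\<^esub> i \<star> e" unfolding eqm_def by (rule ZP_central[OF E.eB iF])
  have iei: "i \<star> e \<star> i \<approx>\<^bsub>KP P\<^esub> i \<star> e"
    unfolding gm_assoc using Z.eq_trans[OF Z.eq_left[OF ei iF]] Z.eq_right[OF ii eF] by (simp add: gm_assoc)
  have ieie: "i \<star> e \<star> i \<star> (i \<star> e) \<approx>\<^bsub>KP P\<^esub> i \<star> e"
  proof -
    have "i \<star> e \<star> i \<star> (i \<star> e) \<approx>\<^bsub>KP P\<^esub> i \<star> e \<star> (i \<star> e)" by (rule Z.eq_right[OF iei FP_mult[OF iF eF]])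
    also have "i \<star> e \<star> (i \<star> e) \<approx>\<^bsub>KP P\<^esub> i \<star> e \<star> e" using Z.eq_right[OF iei eF] by (simp add: gm_assoc)
    also have "i \<star> e \<star> e \<approx>\<^bsub>KP P\<^esub> i \<star> e" using Z.eq_left[OF E.ee iF] by (simp add: gm_assoc)
    finally show ?thesis .
  qed
  let ?x = "i \<star> e \<star> i"
  have xc: "I.corner ?x" by (rule I.corner_ebe[OF eF])
  have pw: "I.kpow ?x (Suc n) \<approx>\<^bsub>KP P\<^esub> i \<star> e" for n
  proof (induction n)
    case 0
    have "i \<star> e \<star> i \<star> i \<approx>\<^bsub>KP P\<^esub> i \<star> e \<star> i" using Z.eq_left[OF ii FP_mult[OF iF eF]] by (simp add: gm_assoc)
    then show ?case using Z.eq_trans iei by simp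
  next
    case (Suc n)
    have "?x \<star> I.kpow ?x (Suc n) \<approx>\<^bsub>KP P\<^esub> ?x \<star> (i \<star> e)" by (rule Z.eq_left[OF Suc I.cB[OF xc]])
    then show ?case using Z.eq_trans ieie by simp
  qed
  have "\<not> I.nil ?x"
  proof
    assume "I.nil ?x"
    then obtain N where N: "I.kpow ?x N \<in> M0 \<inter> FP P" unfolding I.nil_def by blast
    have "I.kpow ?x (Suc N) \<in> M0 \<inter> FP P" using I.K_right[OF N I.cB[OF xc]] by simp
    then have "I.kpow ?x (Suc N) \<in> KP P" using M0_Kr by blast
    then show False using Z.eq_K[OF pw] ie by blast
  qed
  then obtain y where y: "I.corner y" "y \<star> ?x \<approx>\<^bsub>M0 \<inter> FP P\<^esub> i"
    using I.nil_or_unit[OF xc] unfolding I.unitc_def by blast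
  have yF: "y \<in> FP P" by (rule I.cB[OF y(1)])
  have "y \<star> (i \<star> e) \<approx>\<^bsub>KP P\<^esub> y \<star> ?x" by (rule Z.eq_left[OF Z.eq_sym[OF iei] yF])
  also have "y \<star> ?x \<approx>\<^bsub>KP P\<^esub> i" by (rule down[OF y(2)])
  finally have yie: "y \<star> (i \<star> e) \<approx>\<^bsub>KP P\<^esub> i" .
  have "i \<star> e \<approx>\<^bsub>KP P\<^esub> y \<star> (i \<star> e) \<star> e" by (rule Z.eq_right[OF Z.eq_sym[OF yie] eF])
  also have "y \<star> (i \<star> e) \<star> e \<approx>\<^bsub>KP P\<^esub> y \<star> (i \<star> e)"
    using Z.eq_left[OF E.ee FP_mult[OF yF iF]] by (simp add: gm_assoc)
  also note yie
  finally show ?thesis by (simp add: eqm_def)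
qed

end

subsection \<open>Brauer pairs\<close>

context group_alg
begin

lemma icancel: "x \<in> carrier G ==> w \<in> carrier G ==> inv x \<otimes> (x \<otimes> w) = w"
  "x \<in> carrier G ==> w \<in> carrier G ==> x \<otimes> (inv x \<otimes> w) = w"
  by (simp_all add: m_assoc[symmetric])

lemma ZP_corner:
  assumes R: "p_subgroup p G R" and e: "kprim (ZP R) (KP R) e" and t: "t \<in> ZP R"
  shows "e \<star> t \<in> ZP R" "e \<star> (e \<star> t) \<approx>\<^bsub>KP R\<^esub> e \<star> t" "e \<star> t \<star> e \<approx>\<^bsub>KP R\<^esub> e \<star> t"
proof -
  interpret Z: primitive_mod G m p "ZP R" "KP R" e by (rule primitive_modI[OF e])
  show "e \<star> t \<in> ZP R" by (rule Z.B_mult[OF Z.eB t])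
  have comm: "e \<star> t \<approx>\<^bsub>KP R\<^esub> t \<star> e" unfolding eqm_def by (rule ZP_central[OF Z.eB ZP_FP[OF t]])
  show c1: "e \<star> (e \<star> t) \<approx>\<^bsub>KP R\<^esub> e \<star> t" using Z.eq_right[OF Z.ee t] by (simp only: gm_assoc)
  have "e \<star> t \<star> e \<approx>\<^bsub>KP R\<^esub> e \<star> (e \<star> t)" unfolding gm_assoc by (rule Z.eq_left[OF Z.eq_sym[OF comm] Z.eB])
  then show "e \<star> t \<star> e \<approx>\<^bsub>KP R\<^esub> e \<star> t" using c1 by (rule Z.eq_trans)
qed

lemma normalizer_TT:
  assumes "subgroup D G" "x \<in> carrier G" "cs x D = D" "c \<in> TT (dg D)"
  shows "x \<otimes> c \<otimes> inv x \<in> TT (dg D)"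
proof -
  have cc: "c \<in> carrier G" using assms(4) by (simp add: TT_dg)
  have "y \<otimes> (x \<otimes> c \<otimes> inv x) = x \<otimes> c \<otimes> inv x \<otimes> y" if y: "y \<in> D" for y
  proof -
    have "y \<in> cs x D" using y by (simp only: assms(3))
    then obtain z where z: "z \<in> D" "y = x \<otimes> z \<otimes> inv x" unfolding cs_def by blast
    have zc: "z \<in> carrier G" using subgroup.mem_carrier[OF assms(1) z(1)] .
    have zz: "z \<otimes> c = c \<otimes> z" using z(1) assms(4) by (simp add: TT_dg)
    have "y \<otimes> (x \<otimes> c \<otimes> inv x) = x \<otimes> (z \<otimes> c) \<otimes> inv x" using zc cc assms(2) by (simp add: z(2) m_assoc icancel)
    also have "\<dots> = x \<otimes> c \<otimes> inv x \<otimes> y" unfolding zz using zc cc assms(2) by (simp add: z(2) m_assoc icancel)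
    finally show ?thesis .
  qed
  then show ?thesis using cc assms(2) by (simp add: TT_dg)
qed

lemma cs_inv_self: "subgroup D G ==> x \<in> carrier G ==> cs x D = D ==> cs (inv x) D = D"
  using cs_inv(1)[of D x] subgroup.subset[of D G] by simp

lemma cs_TT: "subgroup D G ==> c \<in> TT (dg D) ==> cs c D = D"
proof -
  assume D: "subgroup D G" and c: "c \<in> TT (dg D)"
  have "c \<otimes> y \<otimes> inv c = y" if "y \<in> D" for y
  proof -
    have "c \<otimes> y = y \<otimes> c" "c \<in> carrier G" "y \<in> carrier G" using c that subgroup.mem_carrier[OF D] by (auto simp: TT_dg)
    then show ?thesis by (simp add: m_assoc)
  qed
  then show ?thesis unfolding cs_def by simp
qed

lemma dc_normal:
  assumes D: "subgroup D G" and x: "x \<in> carrier G" "cs x D = D"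
  shows "dc D D x = (%y. x \<otimes> y) ` dc D D \<one>"
proof
  have DG: "!!d. d \<in> D ==> d \<in> carrier G" by (rule subgroup.mem_carrier[OF D])
  show "dc D D x \<subseteq> (%y. x \<otimes> y) ` dc D D \<one>"
  proof
    fix u assume "u \<in> dc D D x"
    then obtain c d where u: "c \<in> TT (dg D)" "d \<in> D" "u = c \<otimes> x \<otimes> d" by (auto simp: dc_def)
    have cc: "c \<in> carrier G" using u(1) by (simp add: TT_dg)
    have "inv x \<otimes> c \<otimes> inv (inv x) \<in> TT (dg D)"
      by (rule normalizer_TT[OF D _ cs_inv_self[OF D x] u(1)]) (use x in simp)
    then have "inv x \<otimes> c \<otimes> x \<otimes> \<one> \<otimes> d \<in> dc D D \<one>" using dcI[OF _ u(2)] x by simp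
    moreover have "u = x \<otimes> (inv x \<otimes> c \<otimes> x \<otimes> \<one> \<otimes> d)" using cc x DG[OF u(2)] by (simp add: u(3) m_assoc icancel)
    ultimately show "u \<in> (%y. x \<otimes> y) ` dc D D \<one>" by blast
  qed
  show "(%y. x \<otimes> y) ` dc D D \<one> \<subseteq> dc D D x"
  proof
    fix u assume "u \<in> (%y. x \<otimes> y) ` dc D D \<one>"
    then obtain c d where u: "c \<in> TT (dg D)" "d \<in> D" "u = x \<otimes> (c \<otimes> \<one> \<otimes> d)" by (auto simp: dc_def)
    have cc: "c \<in> carrier G" using u(1) by (simp add: TT_dg)
    have "x \<otimes> c \<otimes> inv x \<otimes> x \<otimes> d \<in> dc D D x" by (rule dcI[OF normalizer_TT[OF D x u(1)] u(2)])
    moreover have "u = x \<otimes> c \<otimes> inv x \<otimes> x \<otimes> d" using cc x DG[OF u(2)] by (simp add: u(3) m_assoc icancel)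
    ultimately show "u \<in> dc D D x" by simp
  qed
qed

definition Ne :: "'g set => ('g => 'o) => 'g set" where
  "Ne D e = {x \<in> carrier G. cs x D = D \<and> cj x e - e \<in> KP D}"

lemma WW_self:
  assumes D: "p_subgroup p G D"
  shows "WW D D = {x \<in> carrier G. cs x D = D}"
proof -
  have sD: "subgroup D G" and DG: "D \<subseteq> carrier G" using psub[OF D] subgroup.subset by auto
  have "cs x D = D" if x: "x \<in> WW D D" for x
  proof -
    have xc: "x \<in> carrier G" using x by (simp add: WW_def)
    have "cs (inv x) D \<subseteq> D" using x xc by (auto simp: cs_def WW_def)
    then have "cs (inv x) D = D"
      by (rule card_seteq[OF p_subgroup_finite[OF D]]) (use card_cs[OF DG, of "inv x"] xc in simp)
    then show ?thesis using cs_inv(2)[OF DG xc] by simp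
  qed
  moreover have "x \<in> WW D D" if x: "x \<in> carrier G" "cs x D = D" for x
  proof -
    have "inv x \<otimes> r \<otimes> x \<in> D" if "r \<in> D" for r
    proof -
      have "inv x \<otimes> r \<otimes> inv (inv x) \<in> cs (inv x) D" using that by (auto simp: cs_def)
      then show ?thesis using cs_inv_self[OF sD x] x by simp
    qed
    then show ?thesis using x by (simp add: WW_def)
  qed
  ultimately show ?thesis by (auto simp: WW_def)
qed

text \<open>For R = D the double cosets are indexed by elements of N_G(D), and each summand is e
  times a conjugate of t, the trace over C_G(D) D. Conjugation by x in \<open>Ne D e\<close> fixes e
  modulo the kernel and so preserves the residue \<tau> of e t. For other x the block e is
  orthogonal to its conjugate and the summand vanishes, because t is absorbed by e. Comparing
  residues makes \<tau> a unit too, so that e t is invertible; this is the second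
  conclusion.\<close>

lemma inertial_trace:
  assumes D: "p_subgroup p G D" and a: "a \<in> FP D"
    and b: "b - tr D (carrier G) a \<in> M0" "b \<in> FP D"
    and e: "kprim (ZP D) (KP D) e" "e \<star> b - e \<in> KP D" and ea: "e \<star> a - a \<in> KP D"
  shows "\<not> p dvd card (dc D D ` Ne D e)" "\<exists>w\<in>ZP D. e - w \<star> tr D (dc D D \<one>) a \<in> KP D"
proof -
  have sD: "subgroup D G" and DG: "D \<subseteq> carrier G" using psub[OF D] subgroup.subset by auto
  interpret Z: primitive_mod G m p "ZP D" "KP D" e by (rule primitive_modI[OF e(1)])
  interpret ZF: algebra_mod G m p "FP D" "KP D" by (rule algebra_mod_KP[OF D])
  have eF: "e \<in> FP D" using Z.eB by (rule ZP_FP)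
  define t where "t = tr D (dc D D \<one>) a"
  have one: "\<one> \<in> WW D D" using DG by (auto simp: WW_def)
  have tZ: "t \<in> ZP D" unfolding t_def by (rule tr_dc_central[OF D sD one a])
  have tF: "t \<in> FP D" by (rule ZP_FP[OF tZ])
  have cor: "Z.corner (e \<star> z)" if "z \<in> ZP D" for z
    unfolding Z.corner_def using ZP_corner[OF D e(1) that] by blast
  have cjZ: "cj x z \<in> ZP D" if "x \<in> carrier G" "cs x D = D" "z \<in> ZP D" for x z
    using cj_ZP[OF sD that(1)] that by auto
  have cjF: "cj x z \<in> FP D" if "x \<in> carrier G" "cs x D = D" "z \<in> FP D" for x z
    using cj_FP[OF sD that(1,3)] that by simp
  have cjK: "cj x z \<in> KP D" if "x \<in> carrier G" "cs x D = D" "z \<in> KP D" for x z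
    using cj_KP[OF sD that(1,3)] that by simp
  have cjeq: "cj x y \<approx>\<^bsub>KP D\<^esub> cj x z" if "x \<in> carrier G" "cs x D = D" "y \<approx>\<^bsub>KP D\<^esub> z" for x y z
    using cjK[OF that(1,2), of "y - z"] that(3) by (simp add: eqm_def cj_diff)
  have aea: "a \<approx>\<^bsub>KP D\<^esub> e \<star> a" by (rule ZF.eq_sym) (use ea in \<open>simp add: eqm_def\<close>)
  \<comment> \<open>a is absorbed by e, and t is a sum of conjugates of a under C_G(D), which fixes
    e modulo the kernel.\<close>
  have te: "t \<approx>\<^bsub>KP D\<^esub> e \<star> t"
    unfolding t_def tr_def gm_sum_right
  proof (rule ZF.eq_sum)
    fix C assume "C \<in> lcs D (dc D D \<one>)"
    then obtain c d where u: "c \<in> TT (dg D)" "d \<in> D" "C = (c \<otimes> \<one> \<otimes> d) <# D" by (auto simp: lcs_def dc_def)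
    have cc: "c \<in> carrier G" using u(1) by (simp add: TT_dg)
    have dd: "d \<in> carrier G" by (rule subgroup.mem_carrier[OF sD u(2)])
    note csc = cs_TT[OF sD u(1)]
    have "cval a C = cj (c \<otimes> d) a" unfolding u(3) using cval[OF sD a, of "c \<otimes> d"] cc dd by simp
    also have "\<dots> = cj c (cj d a)" using cc dd by (simp add: cj_cj)
    also have "\<dots> = cj c a" by (simp only: FP_cj[OF sD a u(2)])
    finally have cv: "cval a C = cj c a" .
    have 1: "cj c a \<approx>\<^bsub>KP D\<^esub> cj c e \<star> cj c a" using cjeq[OF cc csc aea] by (simp only: cj_mult[OF cc])
    have 2: "cj c e \<approx>\<^bsub>KP D\<^esub> e" unfolding eqm_def by (rule cj_ZP_trivial[OF D Z.eB u(1)])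
    show "cval a C \<approx>\<^bsub>KP D\<^esub> e \<star> cval a C"
      unfolding cv by (rule ZF.eq_trans[OF 1 ZF.eq_right[OF 2 cjF[OF cc csc a]]])
  qed
  have trx: "tr D (dc D D x) a = cj x t" if "x \<in> carrier G" "cs x D = D" for x
  proof -
    have "dc D D \<one> \<subseteq> carrier G" using dc_WW[OF DG sD one] by (auto simp: WW_def)
    then show ?thesis unfolding t_def dc_normal[OF sD that] by (rule tr_cj_left[OF sD a _ that(1), symmetric])
  qed
  obtain \<tau> where \<tau>: "Z.ev (e \<star> t) \<tau>" using Z.ev_exists[OF cor[OF tZ]] by blast
  have evN: "Z.ev (e \<star> tr D (dc D D x) a) \<tau>" if x: "x \<in> Ne D e" for x
  proof -
    have xc: "x \<in> carrier G" and xD: "cs x D = D" and xe: "cj x e \<approx>\<^bsub>KP D\<^esub> e" using x by (auto simp: Ne_def eqm_def)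
    define y where "y = e \<star> t - sm \<tau> e"
    have yc: "Z.corner y" unfolding y_def by (rule Z.corner_diff[OF cor[OF tZ] Z.corner_sm[OF Z.corner_e]])
    have cjc: "Z.corner (cj x w)" if w: "Z.corner w" for w
    proof -
      have wB: "cj x w \<in> ZP D" by (rule cjZ[OF xc xD Z.cB[OF w]])
      have "e \<star> cj x w \<approx>\<^bsub>KP D\<^esub> cj x e \<star> cj x w" by (rule Z.eq_right[OF Z.eq_sym[OF xe] wB])
      also have "cj x e \<star> cj x w \<approx>\<^bsub>KP D\<^esub> cj x w" using cjeq[OF xc xD Z.ce[OF w]] by (simp only: cj_mult[OF xc])
      finally have 1: "e \<star> cj x w \<approx>\<^bsub>KP D\<^esub> cj x w" .
      have "cj x w \<star> e \<approx>\<^bsub>KP D\<^esub> cj x w \<star> cj x e" by (rule Z.eq_left[OF Z.eq_sym[OF xe] wB])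
      also have "cj x w \<star> cj x e \<approx>\<^bsub>KP D\<^esub> cj x w" using cjeq[OF xc xD Z.ce'[OF w]] by (simp only: cj_mult[OF xc])
      finally show ?thesis unfolding Z.corner_def using 1 wB by blast
    qed
    have kp: "Z.kpow (cj x y) n \<approx>\<^bsub>KP D\<^esub> cj x (Z.kpow y n)" for n
    proof (induction n)
      case 0
      show ?case using Z.eq_sym[OF xe] by simp
    next
      case (Suc n)
      show ?case using Z.eq_left[OF Suc Z.cB[OF cjc[OF yc]]] by (simp add: cj_mult[OF xc])
    qed
    obtain N where "Z.kpow y N \<in> KP D" using \<tau> unfolding Z.ev_def Z.nil_def y_def by blast
    then have "Z.kpow (cj x y) N \<in> KP D" using Z.eq_K[OF kp] cjK[OF xc xD] by blast
    then have ny: "Z.nil (cj x y)" unfolding Z.nil_def by blast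
    have cy: "cj x y = cj x e \<star> cj x t - sm \<tau> (cj x e)" by (simp add: y_def cj_diff cj_sm cj_mult[OF xc])
    have z1: "e \<star> cj x t - sm \<tau> e \<approx>\<^bsub>KP D\<^esub> cj x y"
      unfolding cy by (rule Z.eq_diff[OF Z.eq_right[OF Z.eq_sym[OF xe] cjZ[OF xc xD tZ]] Z.eq_sm[OF Z.eq_sym[OF xe]]])
    have "Z.nil (e \<star> cj x t - sm \<tau> e)"
      by (rule Z.nil_cong[OF cjc[OF yc] z1 _ ny]) (intro Z.B_diff Z.B_mult Z.B_sm Z.eB cjZ[OF xc xD tZ])
    then show ?thesis unfolding Z.ev_def trx[OF xc xD] .
  qed
  have evO: "e \<star> tr D (dc D D x) a \<in> KP D" if x: "x \<in> WW D D" "x \<notin> Ne D e" for x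
  proof -
    have xc: "x \<in> carrier G" and xD: "cs x D = D" using x(1) unfolding WW_self[OF D] by auto
    have ke: "kprim (ZP D) (KP D) (cj x e)" using kprim_ZP_cj[OF D xc e(1)] by (simp add: xD)
    have "e \<star> cj x e \<in> KP D"
    proof -
      have "e - cj x e \<notin> KP D"
      proof
        assume "e - cj x e \<in> KP D"
        then have "0 - (e - cj x e) \<in> KP D" by (rule Kr_diff[OF Kr_zero])
        then show False using x(2) xc xD by (simp add: Ne_def)
      qed
      then show ?thesis using blocks_equal_or_orthogonal[OF D e(1) ke] by blast
    qed
    then have "e \<star> cj x e \<star> cj x t \<in> KP D" by (rule KP_left[OF D _ cjF[OF xc xD tF]])
    moreover have "e \<star> cj x t \<approx>\<^bsub>KP D\<^esub> e \<star> cj x e \<star> cj x t"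
      using ZF.eq_left[OF cjeq[OF xc xD te] eF] by (simp add: cj_mult[OF xc] gm_assoc)
    ultimately show ?thesis unfolding trx[OF xc xD] using ZF.eq_K by blast
  qed
  have NW: "Ne D e \<subseteq> WW D D" unfolding WW_self[OF D] by (auto simp: Ne_def)
  define c where "c Y = (if Y \<in> dc D D ` Ne D e then \<tau> else 0)" for Y
  note part = block_partition[OF D sD a b e]
  have ev: "Z.ev (e \<star> tr D Y a) (c Y)" and corY: "Z.corner (e \<star> tr D Y a)" if Y: "Y \<in> dc D D ` WW D D" for Y
  proof -
    obtain x where x: "x \<in> WW D D" "Y = dc D D x" using Y by blast
    show "Z.corner (e \<star> tr D Y a)" unfolding x(2) by (rule cor[OF tr_dc_central[OF D sD x(1) a]])
    show "Z.ev (e \<star> tr D Y a) (c Y)"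
    proof (cases "Y \<in> dc D D ` Ne D e")
      case True
      then show ?thesis using evN by (auto simp: c_def)
    next
      case False
      then have "e \<star> tr D Y a \<in> KP D" using evO x by blast
      then show ?thesis using Z.nil_K False by (simp add: c_def Z.ev_def)
    qed
  qed
  have "Z.ev (\<Sum>Y\<in>dc D D ` WW D D. e \<star> tr D Y a) (\<Sum>Y\<in>dc D D ` WW D D. c Y)" by (rule Z.ev_sum[OF corY ev])
  moreover have "Z.corner (\<Sum>Y\<in>dc D D ` WW D D. e \<star> tr D Y a)" by (rule Z.corner_sum) (rule corY)
  ultimately have "Z.ev e (\<Sum>Y\<in>dc D D ` WW D D. c Y)"
    using Z.ev_cong[OF _ Z.eq_sym[OF part(1)] Z.eB] by blast
  then have "(\<Sum>Y\<in>dc D D ` WW D D. c Y) - 1 \<in> m" using Z.ev_unique[OF Z.corner_e _ Z.ev_e] by blast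
  moreover have "(\<Sum>Y\<in>dc D D ` WW D D. c Y) = (\<Sum>Y\<in>dc D D ` Ne D e. c Y)"
    by (rule sum.mono_neutral_right[OF part(2)]) (use NW in \<open>auto simp: c_def\<close>)
  moreover have "(\<Sum>Y\<in>dc D D ` Ne D e. c Y) = of_nat (card (dc D D ` Ne D e)) * \<tau>"
    by (simp add: c_def)
  ultimately have key: "of_nat (card (dc D D ` Ne D e)) * \<tau> - 1 \<in> m" by simp
  have one_m: "of_nat (card (dc D D ` Ne D e)) * \<tau> \<notin> m"
    using m_cong[OF key] one_notin by blast
  then show "\<not> p dvd card (dc D D ` Ne D e)" using of_nat_in_m m_mult2 by blast
  have "\<tau> \<notin> m" using one_m m_mult by blast
  have "\<not> Z.nil (e \<star> t)"
  proof
    assume "Z.nil (e \<star> t)"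
    then have "Z.ev (e \<star> t) 0" by (simp add: Z.ev_def)
    then have "\<tau> - 0 \<in> m" by (rule Z.ev_unique[OF cor[OF tZ] \<tau>])
    then show False using \<open>\<tau> \<notin> m\<close> by simp
  qed
  then obtain y where y: "Z.corner y" "y \<star> (e \<star> t) \<approx>\<^bsub>KP D\<^esub> e"
    using Z.nil_or_unit[OF cor[OF tZ]] unfolding Z.unitc_def by blast
  have "e - (y \<star> e) \<star> t \<in> KP D" using Z.eq_sym[OF y(2)] by (simp add: eqm_def gm_assoc)
  then show "\<exists>w\<in>ZP D. e - w \<star> tr D (dc D D \<one>) a \<in> KP D" using Z.B_mult[OF Z.cB[OF y(1)] Z.eB] unfolding t_def by blast
qed

lemma M0_FP_KP: "x \<approx>\<^bsub>M0 \<inter> FP P\<^esub> y ==> x \<approx>\<^bsub>KP P\<^esub> y"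
  unfolding eqm_def using M0_Kr by blast

lemma block_absorbs:
  assumes D: "p_subgroup p G D" and i: "kprim (FP D) (M0 \<inter> FP D) i" and e: "kprim (ZP D) (KP D) e"
    and ie: "i \<star> e \<notin> KP D" and ab: "\<alpha> \<in> FP D" "\<beta> \<in> FP D"
  shows "e \<star> (\<alpha> \<star> i \<star> \<beta>) - \<alpha> \<star> i \<star> \<beta> \<in> KP D"
proof -
  interpret Z: algebra_mod G m p "FP D" "KP D" by (rule algebra_mod_KP[OF D])
  have eZ: "e \<in> ZP D" and iF: "i \<in> FP D" using e i by (auto simp: kprim_def)
  have ea: "e \<star> \<alpha> \<approx>\<^bsub>KP D\<^esub> \<alpha> \<star> e" unfolding eqm_def by (rule ZP_central[OF eZ ab(1)])
  have ei: "e \<star> i \<approx>\<^bsub>KP D\<^esub> i \<star> e" unfolding eqm_def by (rule ZP_central[OF eZ iF])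
  have ii: "i \<star> e \<approx>\<^bsub>KP D\<^esub> i" unfolding eqm_def by (rule primitive_block_idem[OF D i e ie])
  have "e \<star> \<alpha> \<star> (i \<star> \<beta>) \<approx>\<^bsub>KP D\<^esub> \<alpha> \<star> e \<star> (i \<star> \<beta>)" by (rule Z.eq_right[OF ea FP_mult[OF iF ab(2)]])
  also have "\<alpha> \<star> e \<star> (i \<star> \<beta>) = \<alpha> \<star> (e \<star> i) \<star> \<beta>" by (simp only: gm_assoc)
  also have "\<alpha> \<star> (e \<star> i) \<star> \<beta> \<approx>\<^bsub>KP D\<^esub> \<alpha> \<star> i \<star> \<beta>"
    by (rule Z.eq_right[OF Z.eq_left[OF Z.eq_trans[OF ei ii] ab(1)] ab(2)])
  finally show ?thesis by (simp only: eqm_def gm_assoc)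
qed

text \<open>For the subgroup D itself no conjugate of i is required: the trace over C_G(D) D alone
  is already invertible at e.\<close>

lemma block_in_own_ideal:
  assumes D: "p_subgroup p G D" and ab: "\<alpha> \<in> FP D" "\<beta> \<in> FP D" and i: "kprim (FP D) (M0 \<inter> FP D) i"
    and b: "b - tr D (carrier G) (\<alpha> \<star> i \<star> \<beta>) \<in> M0" "b \<in> FP D"
    and e: "kprim (ZP D) (KP D) e" "e \<star> b - e \<in> KP D" "i \<star> e \<notin> KP D"
  shows "\<exists>v\<in>gid D i. e - v \<in> KP D"
proof -
  have sD: "subgroup D G" and DG: "D \<subseteq> carrier G" using psub[OF D] subgroup.subset by auto
  have iF: "i \<in> FP D" using i by (simp add: kprim_def)
  have aF: "\<alpha> \<star> i \<star> \<beta> \<in> FP D" by (intro FP_mult ab iF)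
  obtain w where w: "w \<in> ZP D" "e - w \<star> tr D (dc D D \<one>) (\<alpha> \<star> i \<star> \<beta>) \<in> KP D"
    using inertial_trace(2)[OF D aF b e(1,2) block_absorbs[OF D i e(1,3) ab]] by blast
  have one: "\<one> \<in> WW D D" using DG by (auto simp: WW_def)
  have "tr D (dc D D \<one>) (\<alpha> \<star> i \<star> \<beta>) \<in> gid D i" using tr_dc_gid[OF sD sD one ab iF] cj_one[OF Fx_GA[OF iF]] by simp
  then show ?thesis using gid_left[OF ZP_FP[OF w(1)]] w(2) by blast
qed

text \<open>Only this direction is needed: a primitive idempotent covered by the block generates, up to the
  maximal ideal, every idempotent whose ideal contains the block.\<close>

lemma covered_primitive_generates:
  assumes D: "p_subgroup p G D" and i: "kprim (FP D) (M0 \<inter> FP D) i" and j: "kprim (FP D) (M0 \<inter> FP D) j"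
    and v: "v \<in> gid D i" "e - v \<in> KP D" and e: "kprim (ZP D) (KP D) e" and je: "j \<star> e \<notin> KP D"
  shows "\<exists>\<gamma>\<in>FP D. \<exists>\<delta>\<in>FP D. i - \<gamma> \<star> j \<star> \<delta> \<in> M0"
proof -
  interpret I: primitive_mod G m p "FP D" "M0 \<inter> FP D" i by (rule primitive_modI[OF i])
  interpret J: primitive_mod G m p "FP D" "M0 \<inter> FP D" j by (rule primitive_modI[OF j])
  interpret Z: algebra_mod G m p "FP D" "KP D" by (rule algebra_mod_KP[OF D])
  have eF: "e \<in> FP D" using e ZP_FP by (auto simp: kprim_def)
  have jj: "j \<star> j \<approx>\<^bsub>KP D\<^esub> j" by (rule M0_FP_KP[OF J.ee])
  have "j \<star> e \<approx>\<^bsub>KP D\<^esub> j" unfolding eqm_def by (rule primitive_block_idem[OF D j e je])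
  then have "j \<star> e \<star> j \<approx>\<^bsub>KP D\<^esub> j" using Z.eq_trans[OF Z.eq_right[OF _ J.eB] jj] by blast
  moreover have "e \<approx>\<^bsub>KP D\<^esub> v" using v(2) by (simp only: eqm_def)
  then have "j \<star> v \<star> j \<approx>\<^bsub>KP D\<^esub> j \<star> e \<star> j" by (intro Z.eq_right[OF Z.eq_left[OF Z.eq_sym J.eB] J.eB])
  ultimately have jv: "j \<star> v \<star> j \<approx>\<^bsub>KP D\<^esub> j" using Z.eq_trans by blast
  have vF: "v \<in> FP D" by (rule gid_FP[OF I.eB v(1)])
  have jK: "j \<notin> KP D" using je KP_left[OF D _ eF] by blast
  \<comment> \<open>Otherwise every term of v would give a nilpotent element of the local corner of
    j, and so j v j would be nilpotent modulo \<open>m\<close>. But modulo the Brauer kernel all its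
    positive powers equal j.\<close>
  have ex: "\<exists>\<alpha>\<in>FP D. \<exists>\<beta>\<in>FP D. \<not> J.nil (j \<star> (\<alpha> \<star> i \<star> \<beta>) \<star> j)"
  proof (rule ccontr)
    assume H: "\<not> ?thesis"
    have "J.nil (j \<star> v \<star> j)"
      using v(1)
    proof (induction rule: gid.induct)
      case gid_zero
      show ?case by (simp add: J.nil_K)
    next
      case (gid_step v \<alpha> \<beta>)
      have nn: "J.nil (j \<star> (\<alpha> \<star> i \<star> \<beta>) \<star> j)" using H gid_step.hyps by blast
      have vF: "v \<in> FP D" by (rule gid_FP[OF I.eB gid_step.hyps(1)])
      have "J.nil (j \<star> v \<star> j + j \<star> (\<alpha> \<star> i \<star> \<beta>) \<star> j)"
        by (rule J.nil_add[OF J.corner_ebe[OF vF] J.corner_ebe gid_step.IH nn])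
          (intro FP_mult gid_step.hyps I.eB)
      then show ?case by (simp add: gm_add_left gm_add_right)
    qed
    then obtain N where N: "J.kpow (j \<star> v \<star> j) N \<in> M0 \<inter> FP D" unfolding J.nil_def by blast
    have "J.kpow (j \<star> v \<star> j) n \<approx>\<^bsub>KP D\<^esub> j" for n
    proof (induction n)
      case 0
      show ?case by simp
    next
      case (Suc n)
      have vjF: "j \<star> v \<star> j \<in> FP D" by (intro FP_mult J.eB vF)
      have "j \<star> v \<star> j \<star> J.kpow (j \<star> v \<star> j) n \<approx>\<^bsub>KP D\<^esub> j \<star> v \<star> j \<star> j" by (rule Z.eq_left[OF Suc vjF])
      also have "j \<star> v \<star> j \<star> j \<approx>\<^bsub>KP D\<^esub> j \<star> j" by (rule Z.eq_right[OF jv J.eB])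
      also have "j \<star> j \<approx>\<^bsub>KP D\<^esub> j" by (rule jj)
      finally show ?case by simp
    qed
    moreover have "J.kpow (j \<star> v \<star> j) N \<in> KP D" using N M0_Kr by blast
    ultimately show False using jK Z.eq_K by blast
  qed
  then obtain \<alpha> \<beta> where ab: "\<alpha> \<in> FP D" "\<beta> \<in> FP D" and nn: "\<not> J.nil (j \<star> (\<alpha> \<star> i \<star> \<beta>) \<star> j)" by blast
  have abF: "\<alpha> \<star> i \<star> \<beta> \<in> FP D" by (intro FP_mult ab I.eB)
  obtain y where y: "J.corner y" "j \<star> (\<alpha> \<star> i \<star> \<beta>) \<star> j \<star> y \<approx>\<^bsub>M0 \<inter> FP D\<^esub> j"
    using J.nil_or_unit[OF J.corner_ebe[OF abF]] nn unfolding J.unitc_def by blast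
  have yF: "y \<in> FP D" by (rule J.cB[OF y(1)])
  define \<gamma> where "\<gamma> = j \<star> \<alpha>"
  define \<delta> where "\<delta> = \<beta> \<star> j \<star> y"
  have gF: "\<gamma> \<in> FP D" and dF: "\<delta> \<in> FP D" unfolding \<gamma>_def \<delta>_def by (intro FP_mult J.eB ab yF)+
  have jgd: "\<gamma> \<star> i \<star> \<delta> \<approx>\<^bsub>M0 \<inter> FP D\<^esub> j" using y(2) unfolding \<gamma>_def \<delta>_def by (simp only: gm_assoc)
  \<comment> \<open>Since \<gamma> i \<delta> = j, the element q is an idempotent of the corner of i
    modulo \<open>m\<close>. Multiplying it back by \<gamma> and \<delta> recovers j, so q is
    nonzero and primitivity of i gives q = i.\<close>
  let ?q = "i \<star> \<delta> \<star> j \<star> \<gamma> \<star> i"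
  have qF: "?q \<in> FP D" by (intro FP_mult I.eB J.eB gF dF)
  have iq: "i \<star> ?q \<approx>\<^bsub>M0 \<inter> FP D\<^esub> ?q" using I.eq_right[OF I.ee, of "\<delta> \<star> j \<star> \<gamma> \<star> i"] FP_mult gF dF I.eB J.eB by (simp add: gm_assoc)
  have qi: "?q \<star> i \<approx>\<^bsub>M0 \<inter> FP D\<^esub> ?q" using I.eq_left[OF I.ee, of "i \<star> \<delta> \<star> j \<star> \<gamma>"] FP_mult gF dF I.eB J.eB by (simp add: gm_assoc)
  have gid: "\<gamma> \<star> i \<star> i \<star> \<delta> \<approx>\<^bsub>M0 \<inter> FP D\<^esub> j"
    using I.eq_trans[OF I.eq_right[OF I.eq_left[OF I.ee gF] dF] jgd] by (simp add: gm_assoc)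
  have jgij: "j \<star> (\<gamma> \<star> i \<star> i \<star> \<delta>) \<star> j \<approx>\<^bsub>M0 \<inter> FP D\<^esub> j"
  proof -
    have "j \<star> (\<gamma> \<star> i \<star> i \<star> \<delta>) \<star> j \<approx>\<^bsub>M0 \<inter> FP D\<^esub> j \<star> j \<star> j" by (rule I.eq_right[OF I.eq_left[OF gid J.eB] J.eB])
    also have "j \<star> j \<star> j \<approx>\<^bsub>M0 \<inter> FP D\<^esub> j \<star> j" by (rule I.eq_right[OF J.ee J.eB])
    also have "j \<star> j \<approx>\<^bsub>M0 \<inter> FP D\<^esub> j" by (rule J.ee)
    finally show ?thesis .
  qed
  have idF: "i \<star> \<delta> \<in> FP D" and giF: "\<gamma> \<star> i \<in> FP D" by (intro FP_mult I.eB gF dF)+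
  have qq: "?q \<star> ?q \<approx>\<^bsub>M0 \<inter> FP D\<^esub> ?q"
    using I.eq_right[OF I.eq_left[OF jgij idF] giF] by (simp add: gm_assoc)
  have "?q \<in> M0 \<inter> FP D \<or> i - ?q \<in> M0 \<inter> FP D"
    by (rule I.prim[OF qF]) (use iq qi qq in \<open>simp_all only: eqm_def\<close>)
  moreover have "?q \<notin> M0 \<inter> FP D"
  proof
    assume "?q \<in> M0 \<inter> FP D"
    then have 0: "j \<star> \<gamma> \<star> ?q \<star> \<delta> \<star> j \<in> M0" using M0_gm_left M0_gm_right by blast
    have eq: "j \<star> \<gamma> \<star> ?q \<star> \<delta> \<star> j = j \<star> (\<gamma> \<star> i \<star> \<delta>) \<star> j \<star> (\<gamma> \<star> i \<star> \<delta>) \<star> j" by (simp only: gm_assoc)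
    have 1: "j \<star> (\<gamma> \<star> i \<star> \<delta>) \<star> j \<star> (\<gamma> \<star> i \<star> \<delta>) \<star> j \<approx>\<^bsub>M0 \<inter> FP D\<^esub> j"
    proof -
      have 1: "j \<star> (\<gamma> \<star> i \<star> \<delta>) \<star> j \<approx>\<^bsub>M0 \<inter> FP D\<^esub> j"
      proof -
        have "j \<star> (\<gamma> \<star> i \<star> \<delta>) \<star> j \<approx>\<^bsub>M0 \<inter> FP D\<^esub> j \<star> j \<star> j" by (rule I.eq_right[OF I.eq_left[OF jgd J.eB] J.eB])
        also have "j \<star> j \<star> j \<approx>\<^bsub>M0 \<inter> FP D\<^esub> j \<star> j" by (rule I.eq_right[OF J.ee J.eB])
        also have "j \<star> j \<approx>\<^bsub>M0 \<inter> FP D\<^esub> j" by (rule J.ee)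
        finally show ?thesis .
      qed
      have gidF: "\<gamma> \<star> i \<star> \<delta> \<star> j \<in> FP D" by (intro FP_mult I.eB J.eB gF dF)
      have "j \<star> (\<gamma> \<star> i \<star> \<delta>) \<star> j \<star> (\<gamma> \<star> i \<star> \<delta> \<star> j) \<approx>\<^bsub>M0 \<inter> FP D\<^esub> j \<star> (\<gamma> \<star> i \<star> \<delta> \<star> j)" by (rule I.eq_right[OF 1 gidF])
      also have "j \<star> (\<gamma> \<star> i \<star> \<delta> \<star> j) = j \<star> (\<gamma> \<star> i \<star> \<delta>) \<star> j" by (simp only: gm_assoc)
      also have "j \<star> (\<gamma> \<star> i \<star> \<delta>) \<star> j \<approx>\<^bsub>M0 \<inter> FP D\<^esub> j" by (rule 1)
      finally show ?thesis by (simp only: gm_assoc)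
    qed
    have "j \<star> \<gamma> \<star> ?q \<star> \<delta> \<star> j \<in> FP D" by (intro FP_mult I.eB J.eB gF dF)
    then have "j \<in> M0 \<inter> FP D" using 0 I.eq_K[OF 1] unfolding eq by blast
    then show False using J.eK by blast
  qed
  ultimately have "i - ?q \<in> M0" by blast
  then have "i - (i \<star> \<delta>) \<star> j \<star> (\<gamma> \<star> i) \<in> M0" by (simp only: gm_assoc)
  then show ?thesis using idF giF by blast
qed

text \<open>The order of Brauer pairs quantifies over all primitive idempotents j of (OG)^D met by
  e. One i whose ideal contains e suffices: then i = \<gamma> j \<delta> modulo \<open>m\<close> for
  each such j, so j f in the kernel would force i f into it.\<close>

lemma bp_leI:
  assumes D: "p_subgroup p G D" and i: "kprim (FP D) (M0 \<inter> FP D) i"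
    and v: "v \<in> gid D i" "e - v \<in> KP D" and e: "kprim (ZP D) (KP D) e"
    and P: "p_subgroup p G P" "P \<subseteq> D" and f: "f \<in> ZP P" "i \<star> f \<notin> KP P"
  shows "bp_le m G (P, f) (D, e)"
proof -
  have sD: "subgroup D G" and sP: "subgroup P G" using psub D P by auto
  have eF: "e \<in> FP D" using e ZP_FP by (auto simp: kprim_def)
  have iF: "i \<in> FP D" using i by (simp add: kprim_def)
  interpret Z: algebra_mod G m p "FP P" "KP P" by (rule algebra_mod_KP[OF P(1)])
  have "j \<star> f \<notin> ogker m G P" if j: "prim_idem (gmult G) (ogfix G D) j" and je: "j \<star> e \<notin> ogker m G D" for j
  proof
    assume "j \<star> f \<in> ogker m G P"
    have kj: "kprim (FP D) (M0 \<inter> FP D) j" using prim_idem_kprim[OF sD] j unfolding ogfix_eq[OF sD] by blast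
    have jF: "j \<in> FP D" using kj by (simp add: kprim_def)
    have jeK: "j \<star> e \<notin> KP D" using je ogker_iff[OF D FP_mult[OF jF eF]] by blast
    have jP: "j \<in> FP P" and fF: "f \<in> FP P" using FP_mono[OF P(2) jF] ZP_FP[OF f(1)] by auto
    have jf: "j \<star> f \<in> KP P" using \<open>j \<star> f \<in> ogker m G P\<close> ogker_iff[OF P(1) FP_mult[OF jP fF]] by blast
    obtain \<gamma> \<delta> where gd: "\<gamma> \<in> FP D" "\<delta> \<in> FP D" "i - \<gamma> \<star> j \<star> \<delta> \<in> M0"
      using covered_primitive_generates[OF D i kj v e jeK] by blast
    have gP: "\<gamma> \<in> FP P" and dP: "\<delta> \<in> FP P" and iP: "i \<in> FP P" using FP_mono[OF P(2)] gd iF by auto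
    have "i \<approx>\<^bsub>KP P\<^esub> \<gamma> \<star> j \<star> \<delta>" unfolding eqm_def
      by (rule M0_Kr[OF gd(3)]) (rule Fx_diff[OF iP], intro FP_mult gP jP dP)
    then have "i \<star> f \<approx>\<^bsub>KP P\<^esub> \<gamma> \<star> j \<star> \<delta> \<star> f" by (rule Z.eq_right[OF _ fF])
    also have "\<gamma> \<star> j \<star> \<delta> \<star> f \<approx>\<^bsub>KP P\<^esub> \<gamma> \<star> j \<star> (f \<star> \<delta>)"
    proof -
      have "f \<star> \<delta> \<approx>\<^bsub>KP P\<^esub> \<delta> \<star> f" unfolding eqm_def by (rule ZP_central[OF f(1) dP])
      then have "\<gamma> \<star> j \<star> (\<delta> \<star> f) \<approx>\<^bsub>KP P\<^esub> \<gamma> \<star> j \<star> (f \<star> \<delta>)" by (intro Z.eq_left[OF Z.eq_sym FP_mult[OF gP jP]])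
      then show ?thesis by (simp only: gm_assoc)
    qed
    finally have "i \<star> f \<approx>\<^bsub>KP P\<^esub> \<gamma> \<star> (j \<star> f) \<star> \<delta>" by (simp only: gm_assoc)
    moreover have "\<gamma> \<star> (j \<star> f) \<star> \<delta> \<in> KP P" by (rule KP_left[OF P(1) KP_right[OF P(1) gP jf] dP])
    ultimately show False using f(2) Z.eq_K by blast
  qed
  then show ?thesis using P(2) unfolding bp_le_def by simp
qed

lemma GA_expand: "a \<in> GA ==> a = (\<Sum>g\<in>carrier G. sm (a g) (el g))"
proof (rule GA_ext)
  show "(\<Sum>g\<in>carrier G. sm (a g) (el g)) \<in> GA" by (intro GA_sum GA_sm el_in)
  show "a x = (\<Sum>g\<in>carrier G. sm (a g) (el g)) x" if "x \<in> carrier G" for x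
    using that by (simp add: fsum_apply sm_apply gelem_def fin if_distrib cong: if_cong)
qed

lemma FPG_central: "z \<in> FP (carrier G) ==> a \<in> GA ==> z \<star> a = a \<star> z"
proof -
  assume z: "z \<in> FP (carrier G)" and a: "a \<in> GA"
  have c: "z \<star> el g = el g \<star> z" if "g \<in> carrier G" for g using Fx_eq[OF z, of g g] that by auto
  have "z \<star> (\<Sum>g\<in>carrier G. sm (a g) (el g)) = (\<Sum>g\<in>carrier G. sm (a g) (el g)) \<star> z"
    unfolding gm_sum_left gm_sum_right by (rule sum.cong) (simp_all add: gm_sm_left gm_sm_right c)
  then show ?thesis using GA_expand[OF a] by simp
qed

lemma centre_eq: "centre G = FP (carrier G)"
proof
  show "centre G \<subseteq> FP (carrier G)" by (auto simp: centre_def Fx_def)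
  show "FP (carrier G) \<subseteq> centre G" using FPG_central Fx_GA unfolding centre_def by blast
qed

lemma psub_sub:
  assumes Q: "p_subgroup p G Q" and R: "subgroup R G" "R \<subseteq> Q"
  shows "p_subgroup p G R"
proof -
  obtain n where n: "card Q = p ^ n" using Q by (auto simp: p_subgroup_def)
  have "card {q <# R | q. q \<in> Q} * card R = card Q"
    by (rule card_cosets[OF is_group psub[OF Q] R p_subgroup_finite[OF Q]])
  then have "p ^ n = card R * card {q <# R | q. q \<in> Q}" using n by (simp only: mult.commute)
  then have "card R dvd p ^ n" by (rule dvdI)
  then show ?thesis using R(1) divides_primepow_nat[OF prime_p] unfolding p_subgroup_def by blast
qed

lemma tr_cong: "b - tr Q W a \<in> M0 ==> a - c \<in> M0 ==> b - tr Q W c \<in> M0"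
  using M0_add[of "b - tr Q W a" "tr Q W (a - c)"] tr_M0[of "a - c" Q W] by (simp add: tr_diff)

lemma tr_two_sided:
  assumes R: "subgroup R G" and H: "subgroup H G" "R \<subseteq> H" and c: "c \<in> FP R" and zw: "z \<in> FP H" "w \<in> FP H"
  shows "z \<star> tr R H c \<star> w = tr R H (z \<star> c \<star> w)"
proof -
  have zc: "z \<star> c \<star> w \<in> FP R" 
    by (rule FP_mult[OF FP_mult[OF FP_mono[OF H(2) zw(1)] c] FP_mono[OF H(2) zw(2)]])
  have "z \<star> cval c C \<star> w = cval (z \<star> c \<star> w) C" if C: "C \<in> lcs R H" for C
  proof -
    obtain q where q: "q \<in> H" "C = q <# R" using C by (auto simp: lcs_def)
    have qc: "q \<in> carrier G" by (rule subgroup.mem_carrier[OF H(1) q(1)])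
    have "cval (z \<star> c \<star> w) C = cj q z \<star> cj q c \<star> cj q w" unfolding q(2) by (simp add: cval[OF R zc qc] cj_mult[OF qc])
    then show ?thesis unfolding q(2) by (simp add: cval[OF R c qc] FP_cj[OF H(1) zw(1) q(1)] FP_cj[OF H(1) zw(2) q(1)])
  qed
  then show ?thesis by (simp add: tr_def gm_sum_left gm_sum_right)
qed

text \<open>Right multiplication by x carries the cosets of x Q x^-1 to those of Q.\<close>

lemma tr_conj:
  assumes Q: "subgroup Q G" and x: "x \<in> carrier G" and a: "a \<in> FP Q"
  shows "tr (cs x Q) (carrier G) (cj x a) = tr Q (carrier G) a"
proof -
  have QG: "Q \<subseteq> carrier G" by (rule subgroup.subset[OF Q])
  have sQ: "subgroup (cs x Q) G" by (rule cs_subgroup[OF Q x])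
  have csG: "cs x Q \<subseteq> carrier G" by (rule subgroup.subset[OF sQ])
  have A: "(%y. y \<otimes> x) ` (q <# cs x Q) = (q \<otimes> x) <# Q" if q: "q \<in> carrier G" for q
  proof -
    have "(%y. y \<otimes> x) ` (q <# cs x Q) = (%z. q \<otimes> (x \<otimes> z \<otimes> inv x) \<otimes> x) ` Q" by (auto simp: l_coset_def cs_def)
    also have "\<dots> = (%z. q \<otimes> x \<otimes> z) ` Q"
      by (rule image_cong) (use q x QG in \<open>auto simp: m_assoc\<close>)
    finally show ?thesis by (auto simp: l_coset_def)
  qed
  have B: "(%y. y \<otimes> inv x) ` (q <# Q) = (q \<otimes> inv x) <# cs x Q" if q: "q \<in> carrier G" for q
  proof -
    have "(q \<otimes> inv x) <# cs x Q = (%z. q \<otimes> inv x \<otimes> (x \<otimes> z \<otimes> inv x)) ` Q" by (auto simp: l_coset_def cs_def)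
    also have "\<dots> = (%z. q \<otimes> z \<otimes> inv x) ` Q"
      by (rule image_cong) (use q x QG in \<open>auto simp: m_assoc icancel\<close>)
    finally show ?thesis by (auto simp: l_coset_def)
  qed
  show ?thesis unfolding tr_def
  proof (rule sum.reindex_bij_witness[where j = "%C. (%y. y \<otimes> x) ` C" and i = "%C. (%y. y \<otimes> inv x) ` C"])
    fix C assume "C \<in> lcs (cs x Q) (carrier G)"
    then obtain q where q: "q \<in> carrier G" "C = q <# cs x Q" by (auto simp: lcs_def)
    show "(%y. y \<otimes> inv x) ` (%y. y \<otimes> x) ` C = C" using q x by (simp add: A B m_assoc)
    show "(%y. y \<otimes> x) ` C \<in> lcs Q (carrier G)" using q x by (simp add: A lcs_def)
    show "cval a ((%y. y \<otimes> x) ` C) = cval (cj x a) C"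
      using q x by (simp add: A cval[OF Q a] cval[OF sQ cj_FP[OF Q x a]] cj_cj)
  next
    fix C assume "C \<in> lcs Q (carrier G)"
    then obtain q where q: "q \<in> carrier G" "C = q <# Q" by (auto simp: lcs_def)
    show "(%y. y \<otimes> x) ` (%y. y \<otimes> inv x) ` C = C" using q x by (simp add: A B m_assoc)
    show "(%y. y \<otimes> inv x) ` C \<in> lcs (cs x Q) (carrier G)" using q x by (simp add: B lcs_def)
  qed
qed

lemma tr_scalar:
  assumes S: "subgroup S G" and z: "z \<in> FP (carrier G)"
  shows "tr S (carrier G) (sm c z) = sm (of_nat (card (lcs S (carrier G))) * c) z"
proof -
  have F: "sm c z \<in> FP S" by (rule Fx_sm[OF FP_mono[OF subgroup.subset[OF S] z]])
  have "cval (sm c z) C = sm c z" if C: "C \<in> lcs S (carrier G)" for C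
  proof -
    obtain q where q: "q \<in> carrier G" "C = q <# S" using C by (auto simp: lcs_def)
    then show ?thesis using cval[OF S F q(1)] FP_cj[OF subgroup_self z q(1)] by (simp add: cj_sm)
  qed
  then have "tr S (carrier G) (sm c z) = (\<Sum>C\<in>lcs S (carrier G). sm c z)" by (simp add: tr_def)
  also have "\<dots> = sm (\<Sum>C\<in>lcs S (carrier G). c) z" by (rule sm_sum_scalar[symmetric])
  finally show ?thesis by simp
qed

lemma exists_block:
  assumes P: "p_subgroup p G P" and y: "y \<in> FP P" "y \<notin> KP P"
  shows "\<exists>e. kprim (ZP P) (KP P) e \<and> y \<star> e \<notin> KP P"
proof -
  have PG: "P \<subseteq> carrier G" using subgroup.subset[OF psub[OF P]] .
  interpret Z: algebra_mod G m p "ZP P" "KP P" by (rule algebra_mod_ZP[OF P])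
  interpret F: algebra_mod G m p "FP P" "KP P" by (rule algebra_mod_KP[OF P])
  have one: "el \<one> \<in> ZP P"
    unfolding ZP_def using el_one_FP[OF PG] by (auto simp: el_one_left[OF Fx_GA] el_one_right[OF Fx_GA])
  obtain n e where e: "!!s. s < n ==> kprim (ZP P) (KP P) (e s)" and sum: "(\<Sum>s<(n::nat). e s) \<approx>\<^bsub>KP P\<^esub> el \<one>"
    using Z.primitive_decomposition[OF one] by blast
  have "\<exists>s<n. y \<star> e s \<notin> KP P"
  proof (rule ccontr)
    assume "\<not> ?thesis"
    then have "(\<Sum>s<n. y \<star> e s) \<in> KP P" by (intro Kr_sum) auto
    moreover have "(\<Sum>s<n. y \<star> e s) \<approx>\<^bsub>KP P\<^esub> y"
      using F.eq_left[OF sum y(1)] by (simp add: gm_sum_right el_one_right[OF Fx_GA[OF y(1)]])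
    ultimately show False using y(2) F.eq_K by blast
  qed
  then show ?thesis using e by blast
qed

text \<open>b is a central idempotent, so e b is 0 or e modulo the kernel; it cannot be 0 because y
  b = y while y e is nonzero.\<close>

lemma block_covers:
  assumes P: "p_subgroup p G P" and e: "kprim (ZP P) (KP P) e" and y: "y \<in> FP P" "y \<star> e \<notin> KP P"
    and b: "b \<in> FP (carrier G)" "b \<star> b = b" "y \<star> b - y \<in> KP P"
  shows "e \<star> b - e \<in> KP P"
proof -
  have PG: "P \<subseteq> carrier G" using subgroup.subset[OF psub[OF P]] .
  interpret E: primitive_mod G m p "ZP P" "KP P" e by (rule primitive_modI[OF e])
  interpret F: algebra_mod G m p "FP P" "KP P" by (rule algebra_mod_KP[OF P])
  have eF: "e \<in> FP P" by (rule ZP_FP[OF E.eB])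
  have bP: "b \<in> FP P" by (rule FP_mono[OF PG b(1)])
  have "b \<star> a - a \<star> b \<in> KP P" if "a \<in> FP P" for a
    unfolding FPG_central[OF b(1) Fx_GA[OF that]] by simp
  then have bZ: "b \<in> ZP P" unfolding ZP_def using bP by blast
  have be: "b \<star> e = e \<star> b" by (rule FPG_central[OF b(1) Fx_GA[OF eF]])
  have 1: "e \<star> (e \<star> b) \<approx>\<^bsub>KP P\<^esub> e \<star> b" using F.eq_right[of "e \<star> e" e b] E.ee bP by (simp add: gm_assoc)
  have 2: "e \<star> b \<star> e \<approx>\<^bsub>KP P\<^esub> e \<star> b" using 1 by (simp add: gm_assoc be)
  have "e \<star> b \<star> (e \<star> b) = e \<star> (b \<star> e) \<star> b" by (simp only: gm_assoc)
  also have "\<dots> = e \<star> (e \<star> b)" unfolding be by (simp add: gm_assoc b(2))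
  finally have 3: "e \<star> b \<star> (e \<star> b) \<approx>\<^bsub>KP P\<^esub> e \<star> b" using 1 by simp
  have "e \<star> b \<in> KP P \<or> e - e \<star> b \<in> KP P"
    by (rule E.prim[OF E.B_mult[OF E.eB bZ]]) (use 1 2 3 in \<open>simp_all only: eqm_def\<close>)
  moreover have "e \<star> b \<notin> KP P"
  proof
    assume "e \<star> b \<in> KP P"
    then have "y \<star> (e \<star> b) \<in> KP P" by (rule KP_right[OF P y(1)])
    moreover have "y \<star> b \<approx>\<^bsub>KP P\<^esub> y" using b(3) by (simp only: eqm_def)
    then have "y \<star> b \<star> e \<approx>\<^bsub>KP P\<^esub> y \<star> e" by (rule F.eq_right[OF _ eF])
    ultimately show False using y(2) F.eq_K by (simp add: gm_assoc be)
  qed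
  ultimately have "e - e \<star> b \<in> KP P" by blast
  then have "0 - (e - e \<star> b) \<in> KP P" by (rule Kr_diff[OF Kr_zero])
  then show ?thesis by simp
qed

end

section \<open>The source idempotent and the trace from the defect group\<close>

locale source_block = group_alg G m p
  for G :: "'g monoid" (structure) and m :: "'o::idom set" and p +
  fixes b l eD :: "'g => 'o" and D :: "'g set"
  assumes block: "block_idem G b" and source: "source_idem m p G b D l eD"
begin

lemma D: "p_subgroup p G D" and sD: "subgroup D G" and DG: "D \<subseteq> carrier G" and finD: "finite D"
  and eprim: "kprim (ZP D) (KP D) eD" and eF: "eD \<in> FP D" and eZ: "eD \<in> ZP D"
proof -
  show D: "p_subgroup p G D" using source by (simp add: source_idem_def)
  then show s: "subgroup D G" by (rule psub)
  then show "D \<subseteq> carrier G" by (rule subgroup.subset)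
  show "finite D" by (rule p_subgroup_finite[OF D])
  show k: "kprim (ZP D) (KP D) eD"
    using source brauer_block_iff[OF D] by (simp add: source_idem_def brauer_pair_def)
  then show "eD \<in> ZP D" by (simp add: kprim_def)
  then show "eD \<in> FP D" by (rule ZP_FP)
qed

lemma bF: "b \<in> FP (carrier G)" and bb: "b \<star> b = b" and bprim: "kprim (FP (carrier G)) (M0 \<inter> FP (carrier G)) b"
  and b_notin: "b \<notin> M0" and bFD: "b \<in> FP D"
proof -
  have p: "prim_idem (gmult G) (FP (carrier G)) b" using block by (simp add: block_idem_def centre_eq)
  then show bF: "b \<in> FP (carrier G)" and "b \<star> b = b" by (auto simp: prim_idem_def)
  show k: "kprim (FP (carrier G)) (M0 \<inter> FP (carrier G)) b" by (rule prim_idem_kprim[OF subgroup_self p])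
  then show "b \<notin> M0" using bF by (simp add: kprim_def)
  show "b \<in> FP D" by (rule FP_mono[OF DG bF])
qed

lemma b_comm: "a \<in> GA ==> b \<star> a = a \<star> b" by (rule FPG_central[OF bF])

lemma lF: "l \<in> FP D" and ll: "l \<star> l = l" and bl: "b \<star> l = l" and lb: "l \<star> b = l"
  and lprim_idem: "prim_idem (gmult G) (FP D) l" and lprim: "kprim (FP D) (M0 \<inter> FP D) l" and lK: "l \<notin> KP D" and le: "l \<star> eD - l \<in> KP D"
proof -
  have p: "prim_idem (gmult G) (fixpts (conj_act G) (blockalg G b) D) l" using source by (simp add: source_idem_def)
  have fp: "a \<in> fixpts (conj_act G) (blockalg G b) D ==> a \<in> FP D" for a
    by (rule FPI[OF sD]) (auto simp: fixpts_def blockalg_def)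
  show lF: "l \<in> FP D" by (rule fp) (use p in \<open>simp add: prim_idem_def\<close>)
  show ll: "l \<star> l = l" using p by (simp add: prim_idem_def)
  obtain a where "l = b \<star> a" using p by (auto simp: prim_idem_def fixpts_def blockalg_def)
  then show bl: "b \<star> l = l" using bb by (simp add: gm_assoc[symmetric])
  then show "l \<star> b = l" using b_comm[OF Fx_GA[OF lF]] by simp
  \<comment> \<open>A decomposition of \<open>l\<close> in (OG)^D already takes place in the block
    algebra, since u = l u = b (l u); primitivity therefore passes from the fixed points of the
    block algebra to (OG)^D.\<close>
  have back': "u \<in> fixpts (conj_act G) (blockalg G b) D" if u: "u \<in> FP D" "l \<star> u = u" for u
  proof -
    have "b \<star> (l \<star> u) = b \<star> l \<star> u" by (simp only: gm_assoc)
    then have "u = b \<star> (l \<star> u)" by (simp only: bl u(2))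
    then have "u \<in> blockalg G b" unfolding blockalg_def using gm_in[of l u] by blast
    then show ?thesis using FP_cj[OF sD u(1)] by (simp add: fixpts_def)
  qed
  show "prim_idem (gmult G) (FP D) l"
    unfolding prim_idem_def
  proof (intro conjI ballI impI)
    show "l ~= 0" using p by (simp add: prim_idem_def)
    fix u v assume uv: "u \<in> FP D" "v \<in> FP D" "u \<star> u = u \<and> v \<star> v = v \<and> u \<star> v = 0 \<and> v \<star> u = 0 \<and> l = u + v"
    have "l \<star> u = u" "l \<star> v = v" using uv(3) by (simp_all add: gm_add_left)
    then have "u \<in> fixpts (conj_act G) (blockalg G b) D" "v \<in> fixpts (conj_act G) (blockalg G b) D"
      using back' uv by blast+
    then show "u = 0 \<or> v = 0" using p uv(3) unfolding prim_idem_def by blast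
  qed (use lF ll in auto)
  then show "kprim (FP D) (M0 \<inter> FP D) l" by (rule prim_idem_kprim[OF sD])
  show "l \<notin> KP D" using source ogker_iff[OF D lF] by (simp add: source_idem_def)
  show "l \<star> eD - l \<in> KP D" using source ogker_iff[OF D Fx_diff[OF FP_mult[OF lF eF] lF]] by (simp add: source_idem_def)
qed

lemma leK: "l \<star> eD \<notin> KP D"
proof
  assume "l \<star> eD \<in> KP D"
  then have "l \<star> eD - (l \<star> eD - l) \<in> KP D" by (rule Kr_diff[OF _ le])
  then show False using lK by simp
qed

lemma eb: "eD \<star> b - eD \<in> KP D"
  by (rule block_covers[OF D eprim lF leK bF bb]) (simp add: lb)

lemma max_pair: "brauer_pair m p G P e ==> bp_le m G (D, eD) (P, e) ==> P = D \<and> e - eD \<in> ogker m G D"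
  using source by (simp add: source_idem_def)

text \<open>The traces are G-fixed and central, so b times them lie in the local corner of b and
  some b tr(f s) is a unit there. Its inverse is central and moves under the trace as the factor
  z.\<close>

lemma trace_rosenberg:
  assumes Q: "subgroup Q G" and I: "finite I" "!!s. s \<in> I ==> f s \<in> FP Q" and b: "b - tr Q (carrier G) (\<Sum>s\<in>I. f s) \<in> M0"
  shows "\<exists>s\<in>I. \<exists>z\<in>FP (carrier G). b - tr Q (carrier G) (z \<star> f s) \<in> M0"
proof -
  interpret B: primitive_mod G m p "FP (carrier G)" "M0 \<inter> FP (carrier G)" b by (rule primitive_modI[OF bprim])
  have tF: "tr Q (carrier G) a \<in> FP (carrier G)" if "a \<in> FP Q" for a
    by (rule tr_FP[OF Q that _ subgroup_self]) auto
  have cor: "B.corner (b \<star> t)" if t: "t \<in> FP (carrier G)" for t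
  proof -
    have "b \<star> t \<star> b = b \<star> (b \<star> t)" by (rule b_comm[symmetric]) simp
    moreover have "b \<star> (b \<star> t) = b \<star> t" by (simp add: gm_assoc[symmetric] bb)
    ultimately show ?thesis unfolding B.corner_def using FP_mult[OF bF t] by simp
  qed
  have fF: "(\<Sum>s\<in>I. f s) \<in> FP Q" by (rule Fx_sum[OF I(2)])
  have "b \<approx>\<^bsub>M0 \<inter> FP (carrier G)\<^esub> tr Q (carrier G) (\<Sum>s\<in>I. f s)" unfolding eqm_def using b Fx_diff[OF bF tF[OF fF]] by blast
  then have "b \<star> b \<approx>\<^bsub>M0 \<inter> FP (carrier G)\<^esub> b \<star> tr Q (carrier G) (\<Sum>s\<in>I. f s)" by (rule B.eq_left[OF _ bF])
  then have "b \<approx>\<^bsub>M0 \<inter> FP (carrier G)\<^esub> (\<Sum>s\<in>I. b \<star> tr Q (carrier G) (f s))" by (simp only: bb tr_sum gm_sum_right)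
  then have "(\<Sum>s\<in>I. b \<star> tr Q (carrier G) (f s)) \<approx>\<^bsub>M0 \<inter> FP (carrier G)\<^esub> b" by (rule B.eq_sym)
  then obtain s where s: "s \<in> I" "B.unitc (b \<star> tr Q (carrier G) (f s))"
    using B.rosenberg[OF I(1), of "%s. b \<star> tr Q (carrier G) (f s)"] cor tF I(2) by blast
  then obtain y where y: "B.corner y" "y \<star> (b \<star> tr Q (carrier G) (f s)) \<approx>\<^bsub>M0 \<inter> FP (carrier G)\<^esub> b"
    unfolding B.unitc_def by blast
  have zF: "y \<star> b \<in> FP (carrier G)" by (rule FP_mult[OF B.cB[OF y(1)] bF])
  have "(y \<star> b) \<star> tr Q (carrier G) (f s) = tr Q (carrier G) (y \<star> b \<star> f s)"
    by (rule tr_mult[OF Q I(2)[OF s(1)] subset_refl zF])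
  then have "b - tr Q (carrier G) (y \<star> b \<star> f s) \<in> M0" using B.eq_sym[OF y(2)] by (simp add: eqm_def gm_assoc)
  then show ?thesis using s(1) zF by blast
qed

text \<open>The index of a Sylow subgroup is invertible in O, and b is the trace of b divided by
  this index. This starts the descent to a minimal subgroup.\<close>

lemma sylow_trace: "\<exists>Q a. p_subgroup p G Q \<and> a \<in> FP Q \<and> b - tr Q (carrier G) a \<in> M0"
proof -
  define n where "n = multiplicity p (card (carrier G))"
  have c0: "card (carrier G) ~= 0" using fin by auto
  have nu: "\<not> is_unit p" using prime_p not_prime_unit by blast
  obtain k where k: "card (carrier G) = p ^ n * k" "\<not> p dvd k"
    using multiplicity_decompose'[OF c0 nu] unfolding n_def by metis
  have "Coset.order G = p ^ n * k" by (simp only: Coset.order_def k(1))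
  then obtain S where S: "subgroup S G" "card S = p ^ n"
    using sylow_thm[OF prime_p is_group _ fin] by metis
  have pS: "p_subgroup p G S" using S unfolding p_subgroup_def by blast
  have lcsS: "lcs S (carrier G) = {q <# S | q. q \<in> carrier G}" by (auto simp: lcs_def)
  have "card (lcs S (carrier G)) * card S = card (carrier G)"
    unfolding lcsS by (rule card_cosets[OF is_group subgroup_self S(1) subgroup.subset[OF S(1)] fin])
  then have "card (lcs S (carrier G)) * p ^ n = k * p ^ n" by (simp only: S(2) k(1) mult.commute)
  then have ck: "card (lcs S (carrier G)) = k" using prime_gt_0_nat[OF prime_p] by simp
  have "(of_nat k :: 'o) \<notin> m"
    by (rule of_nat_notin_m) (use prime_imp_coprime[OF prime_p k(2)] in \<open>simp add: coprime_commute\<close>)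
  then obtain c :: 'o where kc: "of_nat k * c = 1" using unit by blast
  have "tr S (carrier G) (sm c b) = b" by (simp only: tr_scalar[OF S(1) bF] ck kc sm_one)
  then have "b - tr S (carrier G) (sm c b) \<in> M0" by simp
  moreover have "sm c b \<in> FP S" by (rule Fx_sm[OF FP_mono[OF subgroup.subset[OF S(1)] bF]])
  ultimately show ?thesis using pS by blast
qed

text \<open>If i were in the Brauer kernel of Q it would be, modulo \<open>m\<close>, a sum of
  traces from proper subgroups. Rosenberg's lemma in the corner of i selects one subgroup R, and
  transitivity of the trace then writes b as a trace from R, against minimality.\<close>

lemma minimal_not_kernel:
  assumes Q: "p_subgroup p G Q"
    and min: "!!R a. p_subgroup p G R ==> a \<in> FP R ==> b - tr R (carrier G) a \<in> M0 ==> card Q \<le> card R"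
    and ab: "\<alpha> \<in> FP Q" "\<beta> \<in> FP Q" and i: "kprim (FP Q) (M0 \<inter> FP Q) i" and tr: "b - tr Q (carrier G) (\<alpha> \<star> i \<star> \<beta>) \<in> M0"
  shows "i \<notin> KP Q"
proof
  assume iK: "i \<in> KP Q"
  have sQ: "subgroup Q G" and QG: "Q \<subseteq> carrier G" using psub[OF Q] subgroup.subset by auto
  interpret I: primitive_mod G m p "FP Q" "M0 \<inter> FP Q" i by (rule primitive_modI[OF i])
  have fpR: "fixpts (conj_act G) GA R = FP R" if "subgroup R G" for R
    using ogfix_eq[OF that] by (simp add: ogfix_def)
  let ?RR = "{R. subgroup R G \<and> R \<subset> Q}"
  have finR: "finite ?RR" by (rule finite_subset[of _ "Pow Q"]) (use p_subgroup_finite[OF Q] in auto)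
  obtain u v where uv: "i = u + v" "u \<in> mod_span m (fixpts (conj_act G) GA Q)"
    "v \<in> {\<Sum>R\<in>?RR. tr R Q (f R) | f. \<forall>R. subgroup R G \<and> R \<subset> Q --> f R \<in> fixpts (conj_act G) GA R}"
    using KP_subset_ogker[OF Q iK] unfolding ogker_def brauer_kernel_def by blast
  then obtain f where f: "v = (\<Sum>R\<in>?RR. tr R Q (f R))" "!!R. R \<in> ?RR ==> f R \<in> FP R"
    using fpR by blast
  obtain N c g where "u = (\<Sum>i<(N::nat). sm (c i) (g i))" "\<forall>i<N. c i \<in> m" using uv(2) unfolding mod_span_def by blast
  then have uM: "u \<in> M0" using M0_sum[of "{..<N}" "%i. sm (c i) (g i)"] M0_sm' by auto
  have tF: "tr R Q (f R) \<in> FP Q" if R: "R \<in> ?RR" for R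
    by (rule tr_FP[OF _ f(2)[OF R] QG sQ]) (use R subgroup.m_closed[OF sQ] in auto)
  have vF: "v \<in> FP Q" unfolding f(1) by (rule Fx_sum[OF tF])
  have uF: "u \<in> FP Q" using Fx_diff[OF I.eB vF] uv(1) by simp
  have "i \<star> u \<star> i \<in> M0 \<inter> FP Q" 
    by (rule IntI[OF M0_gm_left[OF M0_gm_right[OF uM]] FP_mult[OF FP_mult[OF I.eB uF] I.eB]])
  moreover have "i \<star> i \<star> i - i \<star> v \<star> i = i \<star> u \<star> i"
  proof -
    have "u = i - v" using uv(1) by simp
    then show ?thesis by (simp add: gm_diff_left gm_diff_right)
  qed
  ultimately have "i \<star> i \<star> i \<approx>\<^bsub>M0 \<inter> FP Q\<^esub> i \<star> v \<star> i" by (simp add: eqm_def)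
  then have "i \<star> v \<star> i \<approx>\<^bsub>M0 \<inter> FP Q\<^esub> i"
    using I.eq_trans[OF I.eq_sym I.eq_trans[OF I.eq_right[OF I.ee I.eB] I.ee]] by blast
  then have "(\<Sum>R\<in>?RR. i \<star> tr R Q (f R) \<star> i) \<approx>\<^bsub>M0 \<inter> FP Q\<^esub> i" by (simp only: f(1) gm_sum_left gm_sum_right)
  then obtain R where R: "R \<in> ?RR" "I.unitc (i \<star> tr R Q (f R) \<star> i)"
    using I.rosenberg[OF finR, of "%R. i \<star> tr R Q (f R) \<star> i"] I.corner_ebe[OF tF] by blast
  then obtain y where y: "I.corner y" "y \<star> (i \<star> tr R Q (f R) \<star> i) \<approx>\<^bsub>M0 \<inter> FP Q\<^esub> i" unfolding I.unitc_def by blast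
  have sR: "subgroup R G" and RQ: "R \<subseteq> Q" using R(1) by auto
  have zF: "\<alpha> \<star> y \<star> i \<in> FP Q" "i \<star> \<beta> \<in> FP Q" by (intro FP_mult ab I.eB I.cB[OF y(1)])+
  have "\<alpha> \<star> i \<star> \<beta> \<approx>\<^bsub>M0 \<inter> FP Q\<^esub> \<alpha> \<star> (y \<star> (i \<star> tr R Q (f R) \<star> i)) \<star> \<beta>"
    by (rule I.eq_right[OF I.eq_left[OF I.eq_sym[OF y(2)] ab(1)] ab(2)])
  also have "\<alpha> \<star> (y \<star> (i \<star> tr R Q (f R) \<star> i)) \<star> \<beta> = (\<alpha> \<star> y \<star> i) \<star> tr R Q (f R) \<star> (i \<star> \<beta>)" by (simp only: gm_assoc)
  also have "(\<alpha> \<star> y \<star> i) \<star> tr R Q (f R) \<star> (i \<star> \<beta>) = tr R Q (\<alpha> \<star> y \<star> i \<star> f R \<star> (i \<star> \<beta>))"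
    by (rule tr_two_sided[OF sR sQ RQ f(2)[OF R(1)] zF])
  finally have "b - tr Q (carrier G) (tr R Q (\<alpha> \<star> y \<star> i \<star> f R \<star> (i \<star> \<beta>))) \<in> M0"
    using tr_cong[OF tr] unfolding eqm_def by blast
  moreover have fF: "\<alpha> \<star> y \<star> i \<star> f R \<star> (i \<star> \<beta>) \<in> FP R" 
    by (rule FP_mult[OF FP_mult[OF FP_mono[OF RQ zF(1)] f(2)[OF R(1)]] FP_mono[OF RQ zF(2)]])
  ultimately have "b - tr R (carrier G) (\<alpha> \<star> y \<star> i \<star> f R \<star> (i \<star> \<beta>)) \<in> M0"
    using tr_transitive[OF sR sQ RQ fF] by simp
  then have "card Q \<le> card R" by (rule min[OF psub_sub[OF Q sR RQ] fF])
  moreover have "card R < card Q" by (rule psubset_card_mono[OF p_subgroup_finite[OF Q]]) (use R(1) in simp)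
  ultimately show False by simp
qed

text \<open>A minimal \<open>Q\<close> with \<open>b\<close> in the image of the trace from \<open>Q\<close> is \<open>D\<close> up to conjugation, because its
  Brauer pair contains a conjugate of the maximal pair.\<close>

theorem source_trace: "\<exists>\<alpha>\<in>FP D. \<exists>\<beta>\<in>FP D. b - tr D (carrier G) (\<alpha> \<star> l \<star> \<beta>) \<in> M0"
proof -
  define good where "good Q \<longleftrightarrow> p_subgroup p G Q \<and> (\<exists>a\<in>FP Q. b - tr Q (carrier G) a \<in> M0)" for Q
  obtain S where "good S"
  proof -
    obtain S a0 where "p_subgroup p G S" "a0 \<in> FP S" "b - tr S (carrier G) a0 \<in> M0" using sylow_trace by blast
    then have "good S" unfolding good_def by blast
    then show ?thesis by (rule that)
  qed
  then obtain Q where Q: "good Q" and minQ: "\<forall>R. good R --> card Q \<le> card R"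
    using ex_has_least_nat[of good S card] by blast
  have pQ: "p_subgroup p G Q" using Q by (simp add: good_def)
  have sQ: "subgroup Q G" by (rule psub[OF pQ])
  have QG: "Q \<subseteq> carrier G" by (rule subgroup.subset[OF sQ])
  obtain a where a: "a \<in> FP Q" "b - tr Q (carrier G) a \<in> M0" using Q by (auto simp: good_def)
  interpret F: algebra_mod G m p "FP Q" "M0 \<inter> FP Q" by (rule algebra_mod_FP)
  obtain n i' where i': "!!s. s < n ==> kprim (FP Q) (M0 \<inter> FP Q) (i' s)" and sum: "(\<Sum>s<(n::nat). i' s) \<approx>\<^bsub>M0 \<inter> FP Q\<^esub> el \<one>"
    using F.primitive_decomposition[OF el_one_FP[OF QG]] by blast
  have "a \<approx>\<^bsub>M0 \<inter> FP Q\<^esub> (\<Sum>s<n. i' s \<star> a)"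
    using F.eq_sym[OF F.eq_right[OF sum a(1)]] by (simp add: gm_sum_left el_one_left[OF Fx_GA[OF a(1)]])
  then have "b - tr Q (carrier G) (\<Sum>s<n. i' s \<star> a) \<in> M0" using tr_cong[OF a(2)] unfolding eqm_def by blast
  moreover have "!!s. s \<in> {..<n} ==> i' s \<star> a \<in> FP Q" using i' FP_mult a(1) by (auto simp: kprim_def)
  ultimately obtain s z where s: "s < n" and z: "z \<in> FP (carrier G)" "b - tr Q (carrier G) (z \<star> (i' s \<star> a)) \<in> M0"
    using trace_rosenberg[OF sQ, of "{..<n}" "%s. i' s \<star> a"] by blast
  define i where "i = i' s"
  have ki: "kprim (FP Q) (M0 \<inter> FP Q) i" unfolding i_def by (rule i'[OF s])
  have iF: "i \<in> FP Q" using ki by (simp add: kprim_def)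
  have zF: "z \<in> FP Q" by (rule FP_mono[OF QG z(1)])
  have tri: "b - tr Q (carrier G) (z \<star> i \<star> a) \<in> M0" using z(2) unfolding i_def by (simp only: gm_assoc)
  have iK: "i \<notin> KP Q"
    by (rule minimal_not_kernel[OF pQ _ zF a(1) ki tri]) (use minQ in \<open>auto simp: good_def\<close>)
  interpret I: primitive_mod G m p "FP Q" "M0 \<inter> FP Q" i by (rule primitive_modI[OF ki])
  have bQ: "b \<in> FP Q" by (rule FP_mono[OF QG bF])
  \<comment> \<open>i b is 0 or i modulo \<open>m\<close>. If it were 0, then b times the trace of z
    i a would vanish modulo \<open>m\<close>; but that trace is b modulo \<open>m\<close>, and b is
    idempotent and not in \<open>M0\<close>.\<close>
  have bi: "i \<star> b - i \<in> M0"
  proof -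
    have comm: "b \<star> i = i \<star> b" by (rule b_comm[OF Fx_GA[OF iF]])
    have 1: "i \<star> (i \<star> b) \<approx>\<^bsub>M0 \<inter> FP Q\<^esub> i \<star> b" using F.eq_right[OF I.ee bQ] by (simp only: gm_assoc)
    have 2: "i \<star> b \<star> i = i \<star> (i \<star> b)" by (simp only: gm_assoc comm)
    have "i \<star> b \<star> (i \<star> b) = i \<star> (b \<star> i) \<star> b" by (simp only: gm_assoc)
    then have 3: "i \<star> b \<star> (i \<star> b) = i \<star> (i \<star> b)" unfolding comm by (simp add: gm_assoc bb)
    have "i \<star> b \<in> M0 \<inter> FP Q \<or> i - i \<star> b \<in> M0 \<inter> FP Q"
      by (rule I.prim[OF FP_mult[OF iF bQ]]) (use 1 in \<open>simp_all only: eqm_def 2 3\<close>)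
    moreover have "i \<star> b \<notin> M0"
    proof
      assume "i \<star> b \<in> M0"
      then have "z \<star> (i \<star> b) \<star> a \<in> M0" using M0_gm_left M0_gm_right by blast
      moreover have "z \<star> (i \<star> b) \<star> a = b \<star> (z \<star> i \<star> a)" using b_comm[of "z \<star> i"] by (metis gm_assoc gm_in)
      ultimately have "b \<star> tr Q (carrier G) (z \<star> i \<star> a) \<in> M0"
        using tr_mult[OF sQ _ subset_refl bF, of "z \<star> i \<star> a"] FP_mult zF iF a(1) tr_M0 by simp
      moreover have "b \<star> (b - tr Q (carrier G) (z \<star> i \<star> a)) \<in> M0" by (rule M0_gm_right[OF tri])
      ultimately have "b \<star> (b - tr Q (carrier G) (z \<star> i \<star> a)) + b \<star> tr Q (carrier G) (z \<star> i \<star> a) \<in> M0" by (intro M0_add)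
      then show False using b_notin by (simp add: gm_diff_right bb)
    qed
    ultimately have "i - i \<star> b \<in> M0" by blast
    then show ?thesis using M0_diff[OF M0_zero, of "i - i \<star> b"] by simp
  qed
  obtain e where e: "kprim (ZP Q) (KP Q) e" "i \<star> e \<notin> KP Q" using exists_block[OF pQ iF iK] by blast
  have eFQ: "e \<in> FP Q" using e(1) ZP_FP by (auto simp: kprim_def)
  have ebQ: "e \<star> b - e \<in> KP Q"
    by (rule block_covers[OF pQ e(1) iF e(2) bF bb M0_Kr[OF bi Fx_diff[OF FP_mult[OF iF bQ] iF]]])
  obtain v0 where v0: "v0 \<in> gid Q i" "e - v0 \<in> KP Q"
    using block_in_own_ideal[OF pQ zF a(1) ki tri bQ e(1) ebQ e(2)] by blast
  \<comment> \<open>The block \<open>eD\<close> of D is now compared with the trace from Q: this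
    yields x with D contained in x Q x^-1 and \<open>eD\<close> in the ideal of x i x^-1 modulo the
    kernel.\<close>
  obtain x v where x: "x \<in> WW D Q" and v: "v \<in> gid D (cj x i)" "eD - v \<in> KP D"
    using block_in_ideal[OF D sQ zF a(1) iF tri bFD eprim eb] by blast
  have xc: "x \<in> carrier G" using x by (simp add: WW_def)
  have sub: "D \<subseteq> cs x Q"
  proof
    fix r assume r: "r \<in> D"
    then have "inv x \<otimes> r \<otimes> x \<in> Q" "r \<in> carrier G" using x DG by (auto simp: WW_def)
    moreover then have "r = x \<otimes> (inv x \<otimes> r \<otimes> x) \<otimes> inv x" using xc by (simp add: m_assoc icancel)
    ultimately show "r \<in> cs x Q" unfolding cs_def by blast
  qed
  have pX: "p_subgroup p G (cs x Q)" by (rule cs_psub[OF pQ xc])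
  have kX: "kprim (FP (cs x Q)) (M0 \<inter> FP (cs x Q)) (cj x i)" by (rule kprim_FP_cj[OF sQ xc ki])
  have eX: "kprim (ZP (cs x Q)) (KP (cs x Q)) (cj x e)" by (rule kprim_ZP_cj[OF pQ xc e(1)])
  have iX: "cj x i \<in> FP (cs x Q)" by (rule cj_FP[OF sQ xc iF])
  have iD: "cj x i \<in> FP D" by (rule FP_mono[OF sub iX])
  interpret Z: algebra_mod G m p "FP D" "KP D" by (rule algebra_mod_KP[OF D])
  have ieD: "cj x i \<star> eD \<notin> KP D"
  proof
    assume H: "cj x i \<star> eD \<in> KP D"
    have vF: "v \<in> FP D" by (rule gid_FP[OF iD v(1)])
    have "eD \<approx>\<^bsub>KP D\<^esub> v" using v(2) by (simp only: eqm_def)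
    then have "eD \<star> eD \<approx>\<^bsub>KP D\<^esub> v \<star> eD" by (rule Z.eq_right[OF _ eF])
    moreover have "eD \<star> eD \<approx>\<^bsub>KP D\<^esub> eD" "eD \<notin> KP D" using eprim by (auto simp: kprim_def eqm_def)
    ultimately have "v \<star> eD \<notin> KP D" using Z.eq_K by blast
    then obtain \<beta> where be: "\<beta> \<in> FP D" "cj x i \<star> \<beta> \<star> eD \<notin> KP D" using gid_ne[OF D v(1)] by blast
    have "eD \<star> \<beta> \<approx>\<^bsub>KP D\<^esub> \<beta> \<star> eD" unfolding eqm_def by (rule ZP_central[OF eZ be(1)])
    then have "cj x i \<star> (eD \<star> \<beta>) \<approx>\<^bsub>KP D\<^esub> cj x i \<star> (\<beta> \<star> eD)" by (rule Z.eq_left[OF _ iD])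
    moreover have "cj x i \<star> (eD \<star> \<beta>) \<in> KP D" using KP_left[OF D H be(1)] by (simp only: gm_assoc)
    ultimately show False using be(2) Z.eq_K by (simp add: gm_assoc)
  qed
  obtain vX where vX: "vX \<in> gid (cs x Q) (cj x i)" "cj x e - vX \<in> KP (cs x Q)"
  proof -
    have bX: "cj x b = b" by (rule FP_cj[OF subgroup_self bF xc])
    have z3: "cj x z \<in> FP (cs x Q)" "cj x a \<in> FP (cs x Q)" by (intro cj_FP[OF sQ xc] zF a(1))+
    have "b - tr (cs x Q) (carrier G) (cj x (z \<star> i \<star> a)) \<in> M0"
      using tri tr_conj[OF sQ xc, of "z \<star> i \<star> a"] FP_mult zF iF a(1) by simp
    then have t: "b - tr (cs x Q) (carrier G) (cj x z \<star> cj x i \<star> cj x a) \<in> M0" by (simp only: cj_mult[OF xc])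
    have bFX: "b \<in> FP (cs x Q)" by (rule FP_mono[OF _ bF]) (rule subgroup.subset[OF psub[OF pX]])
    have ie: "cj x i \<star> cj x e \<notin> KP (cs x Q)"
      using e(2) cj_transport(2)[OF sQ xc, of "i \<star> e"] by (simp add: cj_mult[OF xc])
    have eb: "cj x e \<star> b - cj x e \<in> KP (cs x Q)"
      using cj_KP[OF sQ xc ebQ] by (simp add: cj_diff cj_mult[OF xc] bX)
    show ?thesis using block_in_own_ideal[OF pX z3 kX t bFX eX eb ie] that by blast
  qed
  \<comment> \<open>The conjugate of (Q, e) contains (D, eD), and maximality of the latter forces x
    Q x^-1 = D.\<close>
  have "bp_le m G (D, eD) (cs x Q, cj x e)"
    by (rule bp_leI[OF pX kX vX eX D sub eZ ieD])
  moreover have "brauer_pair m p G (cs x Q) (cj x e)" using pX eX brauer_block_iff[OF pX] by (simp add: brauer_pair_def)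
  ultimately have QD: "cs x Q = D" using max_pair by blast
  have kD: "kprim (FP D) (M0 \<inter> FP D) (cj x i)" using kX by (simp only: QD)
  \<comment> \<open>The ideal of x i x^-1 contains \<open>eD\<close>, which meets \<open>l\<close>;
    hence x i x^-1 is of the form \<gamma> l \<delta> modulo \<open>m\<close> and can be replaced
    under the trace.\<close>
  obtain \<gamma> \<delta> where gd: "\<gamma> \<in> FP D" "\<delta> \<in> FP D" "cj x i - \<gamma> \<star> l \<star> \<delta> \<in> M0"
    using covered_primitive_generates[OF D kD lprim v eprim leK] by blast
  have z3: "cj x z \<in> FP D" "cj x a \<in> FP D" using cj_FP[OF sQ xc zF] cj_FP[OF sQ xc a(1)] by (auto simp: QD)
  have "b - tr D (carrier G) (cj x (z \<star> i \<star> a)) \<in> M0"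
    using tri tr_conj[OF sQ xc, of "z \<star> i \<star> a"] FP_mult zF iF a(1) by (simp add: QD)
  then have "b - tr D (carrier G) (cj x z \<star> cj x i \<star> cj x a) \<in> M0" by (simp only: cj_mult[OF xc])
  moreover have "cj x z \<star> cj x i \<star> cj x a - (cj x z \<star> \<gamma>) \<star> l \<star> (\<delta> \<star> cj x a) \<in> M0"
  proof -
    have "cj x z \<star> (cj x i - \<gamma> \<star> l \<star> \<delta>) \<star> cj x a \<in> M0" using gd(3) M0_gm_left M0_gm_right by blast
    then show ?thesis by (simp add: gm_diff_left gm_diff_right gm_assoc)
  qed
  ultimately have "b - tr D (carrier G) ((cj x z \<star> \<gamma>) \<star> l \<star> (\<delta> \<star> cj x a)) \<in> M0" by (rule tr_cong)
  then show ?thesis using FP_mult[OF z3(1) gd(1)] FP_mult[OF gd(2) z3(2)] by blast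
qed

end

subsection \<open>Source algebras and invariant bases\<close>

context group_alg
begin

lemma hm_inv:
  assumes h: "hm P \<alpha>" and P: "subgroup P G" and x: "x \<in> P"
  shows "\<alpha> (inv x) = inv (\<alpha> x)"
proof -
  have xc: "x \<in> carrier G" and ix: "inv x \<in> P" using subgroup.mem_carrier[OF P x] subgroup.m_inv_closed[OF P x] by auto
  have "\<alpha> (inv x) \<otimes> \<alpha> x = \<alpha> (inv x \<otimes> x)" using h x ix by (simp add: hm_def)
  then have "\<alpha> (inv x) \<otimes> \<alpha> x = \<one>" using xc hm_one[OF h P] by simp
  moreover have "\<alpha> x \<in> carrier G" "\<alpha> (inv x) \<in> carrier G" using h x ix by (auto simp: hm_def)
  ultimately show ?thesis by (rule inv_equality[symmetric])
qed

lemma hm_image_subgroup: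
  assumes h: "hm P \<alpha>" and P: "subgroup P G"
  shows "subgroup (\<alpha> ` P) G"
proof (rule subgroupI)
  show "\<alpha> ` P \<subseteq> carrier G" using h by (auto simp: hm_def)
  show "\<alpha> ` P ~= {}" using subgroup.one_closed[OF P] by blast
  fix a assume "a \<in> \<alpha> ` P"
  then obtain x where x: "x \<in> P" "a = \<alpha> x" by blast
  then show "inv a \<in> \<alpha> ` P" using hm_inv[OF h P x(1)] subgroup.m_inv_closed[OF P x(1)] by (metis imageI)
  fix c assume "c \<in> \<alpha> ` P"
  then obtain y where y: "y \<in> P" "c = \<alpha> y" by blast
  have "a \<otimes> c = \<alpha> (x \<otimes> y)" using h x y by (simp add: hm_def)
  then show "a \<otimes> c \<in> \<alpha> ` P" using subgroup.m_closed[OF P x(1) y(1)] by blast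
qed

lemma Rl_subgroup:
  assumes h: "hm P \<alpha>" "hm P \<beta>" and P: "subgroup P G"
  shows "subgroup (Rl \<alpha> \<beta> P) (G \<times>\<times> G)"
proof -
  interpret GG: group "G \<times>\<times> G" by (rule DirProd_group[OF is_group is_group])
  show ?thesis
  proof (rule GG.subgroupI)
    show "Rl \<alpha> \<beta> P \<subseteq> carrier (G \<times>\<times> G)" using h by (auto simp: hm_def)
    show "Rl \<alpha> \<beta> P ~= {}" using subgroup.one_closed[OF P] by blast
    fix a assume "a \<in> Rl \<alpha> \<beta> P"
    then obtain x where x: "x \<in> P" "a = (\<alpha> x, \<beta> x)" by blast
    have "inv\<^bsub>G \<times>\<times> G\<^esub> a = (\<alpha> (inv x), \<beta> (inv x))"
      using h x by (simp add: hm_inv[OF h(1) P] hm_inv[OF h(2) P] hm_def)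
    then show "inv\<^bsub>G \<times>\<times> G\<^esub> a \<in> Rl \<alpha> \<beta> P" using subgroup.m_inv_closed[OF P x(1)] by blast
    fix c assume "c \<in> Rl \<alpha> \<beta> P"
    then obtain y where y: "y \<in> P" "c = (\<alpha> y, \<beta> y)" by blast
    have "a \<otimes>\<^bsub>G \<times>\<times> G\<^esub> c = (\<alpha> (x \<otimes> y), \<beta> (x \<otimes> y))" using h x y by (simp add: hm_def)
    then show "a \<otimes>\<^bsub>G \<times>\<times> G\<^esub> c \<in> Rl \<alpha> \<beta> P" using subgroup.m_closed[OF P x(1) y(1)] by blast
  qed
qed

definition cg :: "'g => 'g => 'g" where "cg g x = g \<otimes> x \<otimes> inv g"

lemma cg_mult: "g \<in> carrier G ==> x \<in> carrier G ==> y \<in> carrier G ==> cg g (x \<otimes> y) = cg g x \<otimes> cg g y"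
  by (simp add: cg_def m_assoc icancel)

lemma cs_cg: "cs g P = cg g ` P"
  by (simp add: cs_def cg_def)

lemma hm_cg: "subgroup P G ==> g \<in> carrier G ==> hm P (cg g)"
  unfolding hm_def using subgroup.mem_carrier[of P G] by (auto simp: cg_mult) (simp add: cg_def)

lemma inj_cg: "subgroup P G ==> g \<in> carrier G ==> inj_on (cg g) P"
  by (rule inj_on_inverseI[where g = "%y. inv g \<otimes> y \<otimes> g"]) (use subgroup.mem_carrier[of P G] in \<open>auto simp: cg_def m_assoc icancel\<close>)

lemma cg_el: "g \<in> carrier G ==> x \<in> carrier G ==> el (cg g x) \<star> el g = el g \<star> el x"
  "g \<in> carrier G ==> x \<in> carrier G ==> el x \<star> el (inv g) = el (inv g) \<star> el (cg g x)"
  by (simp_all add: el_el cg_def m_assoc icancel)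

lemma el_conj_Fx:
  assumes "P \<subseteq> carrier G" "g \<in> carrier G"
  shows "el g \<in> Fx (Rl (cg g) (%x. x) P)" "el (inv g) \<in> Fx (Rl (%x. x) (cg g) P)"
proof -
  have "el (cg g x) \<star> el g = el g \<star> el x" "el x \<star> el (inv g) = el (inv g) \<star> el (cg g x)" if "x \<in> P" for x
    using cg_el[OF assms(2), of x] that assms(1) by auto
  then show "el g \<in> Fx (Rl (cg g) (%x. x) P)" "el (inv g) \<in> Fx (Rl (%x. x) (cg g) P)"
    unfolding Fx_def using assms(2) by (auto simp only: mem_Collect_eq el_in inv_closed ball_simps image_iff split_paired_all case_prod_conv prod.inject)
qed

text \<open>The blocks of P sum to 1 modulo the kernel, so y survives multiplication by one of
  them.\<close>

lemma block_detects:
  assumes P: "p_subgroup p G P" and h: "hm P \<alpha>" and y: "y \<in> Fx (Rl \<alpha> (%x. x) P)" "y \<notin> Kr (Rl \<alpha> (%x. x) P)"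
  shows "\<exists>e. kprim (ZP P) (KP P) e \<and> y \<star> e \<notin> Kr (Rl \<alpha> (%x. x) P)"
proof -
  have PG: "P \<subseteq> carrier G" using subgroup.subset[OF psub[OF P]] .
  have hi: "hm P (%x. x)" by (rule hm_id[OF psub[OF P]])
  interpret Z: algebra_mod G m p "ZP P" "KP P" by (rule algebra_mod_ZP[OF P])
  have one: "el \<one> \<in> ZP P"
    unfolding ZP_def using el_one_FP[OF PG] by (auto simp: el_one_left[OF Fx_GA] el_one_right[OF Fx_GA])
  obtain n e where e: "!!s. s < n ==> kprim (ZP P) (KP P) (e s)" and sum: "(\<Sum>s<(n::nat). e s) \<approx>\<^bsub>KP P\<^esub> el \<one>"
    using Z.primitive_decomposition[OF one] by blast
  have "\<exists>s<n. y \<star> e s \<notin> Kr (Rl \<alpha> (%x. x) P)"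
  proof (rule ccontr)
    assume "\<not> ?thesis"
    then have 1: "(\<Sum>s<n. y \<star> e s) \<in> Kr (Rl \<alpha> (%x. x) P)" by (intro Kr_sum) auto
    have "y \<star> ((\<Sum>s<n. e s) - el \<one>) \<in> Kr (Rl \<alpha> (%x. x) P)"
      by (rule Kr_mult_right[OF P h hi hi y(1)]) (use sum in \<open>simp only: eqm_def\<close>)
    then have 2: "(\<Sum>s<n. y \<star> e s) - y \<in> Kr (Rl \<alpha> (%x. x) P)"
      by (simp add: gm_diff_right gm_sum_right el_one_right[OF Fx_GA[OF y(1)]])
    have "(\<Sum>s<n. y \<star> e s) - ((\<Sum>s<n. y \<star> e s) - y) \<in> Kr (Rl \<alpha> (%x. x) P)" by (rule Kr_diff[OF 1 2])
    then show False using y(2) by simp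
  qed
  then show ?thesis using e by blast
qed

text \<open>The two-sided action on all of OG without reference to \<open>l\<close>; it agrees with
  \<open>dd_act\<close> on the source algebra.\<close>

definition ac :: "'g \<times> 'g => ('g => 'o) => ('g => 'o)" where
  "ac h a = el (fst h) \<star> a \<star> el (inv (snd h))"

lemma ac_ac:
  assumes "s \<in> carrier G" "t \<in> carrier G" "s' \<in> carrier G" "t' \<in> carrier G"
  shows "ac (s, t) (ac (s', t') a) = ac (s \<otimes> s', t \<otimes> t') a"
proof -
  have "ac (s, t) (ac (s', t') a) = el s \<star> el s' \<star> a \<star> (el (inv t') \<star> el (inv t))"
    unfolding ac_def fst_conv snd_conv by (simp only: gm_assoc)
  also have "el s \<star> el s' = el (s \<otimes> s')" using assms by (simp only: el_el)
  also have "el (inv t') \<star> el (inv t) = el (inv (t \<otimes> t'))" using assms by (simp only: el_el inv_closed inv_mult_group)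
  finally show ?thesis unfolding ac_def fst_conv snd_conv .
qed

lemma ac_one: "a \<in> GA ==> ac (\<one>, \<one>) a = a"
  by (simp add: ac_def el_one_left el_one_right)

lemma ac_inv: "s \<in> carrier G ==> t \<in> carrier G ==> a \<in> GA ==> ac (s, t) (ac (inv s, inv t) a) = a"
  "s \<in> carrier G ==> t \<in> carrier G ==> a \<in> GA ==> ac (inv s, inv t) (ac (s, t) a) = a"
  by (simp_all add: ac_ac ac_one)

lemma ac_sum: "ac h (\<Sum>i\<in>I. sm (c i) (f i)) = (\<Sum>i\<in>I. sm (c i) (ac h (f i)))"
  by (simp add: ac_def gm_sum_left gm_sum_right gm_sm_left gm_sm_right)

lemma ac_apply: "s \<in> carrier G ==> t \<in> carrier G ==> g \<in> carrier G ==> ac (s, t) a g = a (inv s \<otimes> (g \<otimes> t))"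
  by (simp add: ac_def gm_assoc el_gm_apply gm_el_apply m_assoc)

lemma ac_fix: "s \<in> carrier G ==> t \<in> carrier G ==> a \<in> GA ==> ac (s, t) a = a \<longleftrightarrow> el s \<star> a = a \<star> el t"
proof
  assume st: "s \<in> carrier G" "t \<in> carrier G" "a \<in> GA"
  { assume "ac (s, t) a = a"
    then have "ac (s, t) a \<star> el t = a \<star> el t" by simp
    then show "el s \<star> a = a \<star> el t" using st by (simp add: ac_def gm_assoc el_el el_one_right) }
  { assume "el s \<star> a = a \<star> el t"
    then have "ac (s, t) a = a \<star> el t \<star> el (inv t)" by (simp add: ac_def)
    then show "ac (s, t) a = a" using st by (simp add: gm_assoc el_el el_one_right) }
qed

lemma Fx_ac:
  assumes K: "K \<subseteq> carrier G \<times> carrier G" and a: "a \<in> GA"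
  shows "a \<in> Fx K \<longleftrightarrow> (\<forall>h\<in>K. ac h a = a)"
proof -
  have "ac (s, t) a = a \<longleftrightarrow> el s \<star> a = a \<star> el t" if "(s, t) \<in> K" for s t
    by (rule ac_fix[OF _ _ a]) (use K that in auto)
  then have "(\<forall>h\<in>K. ac h a = a) \<longleftrightarrow> (\<forall>(s, t)\<in>K. el s \<star> a = a \<star> el t)" by fastforce
  then show ?thesis unfolding Fx_def using a by blast
qed

lemma TT_inv_eq: "g \<in> TT K ==> (s, t) \<in> K ==> s \<in> carrier G ==> t \<in> carrier G ==> inv s \<otimes> (g \<otimes> t) = g"
proof -
  assume H: "g \<in> TT K" "(s, t) \<in> K" "s \<in> carrier G" "t \<in> carrier G"
  then have "s \<otimes> g = g \<otimes> t" "g \<in> carrier G" by (auto simp: TT_def)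
  then have "inv s \<otimes> (g \<otimes> t) = inv s \<otimes> (s \<otimes> g)" by simp
  then show ?thesis using H \<open>g \<in> carrier G\<close> by (simp add: icancel)
qed

end

section \<open>Coordinates in the invariant basis\<close>

locale source_basis = source_block G m p b l eD D
  for G :: "'g monoid" (structure) and m :: "'o::idom set" and p b l eD D +
  fixes X :: "('g => 'o) set"
  assumes units: "all_twisted_units m G b D l" and basis: "dd_inv_basis G b D l X"
begin

definition S :: "('g => 'o) set" where "S = {a \<in> GA. l \<star> a = a \<and> a \<star> l = a}"

lemma S_GA: "a \<in> S ==> a \<in> GA" and S_l: "a \<in> S ==> l \<star> a = a" and S_l': "a \<in> S ==> a \<star> l = a"
  by (simp_all add: S_def)

lemma lla: "l \<star> (l \<star> a) = l \<star> a" by (simp add: gm_assoc[symmetric] ll)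

lemma S_lal: "l \<star> a \<star> l \<in> S"
  by (simp add: S_def gm_assoc lla ll)

lemma S_eq: "srcalg G b l = S"
proof
  show "srcalg G b l \<subseteq> S" using S_lal by (auto simp: srcalg_def)
  show "S \<subseteq> srcalg G b l"
  proof
    fix a assume a: "a \<in> S"
    have "b \<star> (l \<star> a) = b \<star> l \<star> a" by (simp only: gm_assoc)
    then have "b \<star> a = a" by (simp only: bl S_l[OF a])
    then have "a = l \<star> (b \<star> a) \<star> l" by (simp only: S_l[OF a] S_l'[OF a])
    then show "a \<in> srcalg G b l" unfolding srcalg_def blockalg_def using S_GA[OF a] by blast
  qed
qed

lemma S_mult: "a \<in> S ==> c \<in> S ==> a \<star> c \<in> S"
proof -
  assume "a \<in> S" "c \<in> S"
  moreover have "l \<star> (a \<star> c) = l \<star> a \<star> c" "a \<star> c \<star> l = a \<star> (c \<star> l)" by (simp_all only: gm_assoc)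
  ultimately show ?thesis by (simp add: S_def)
qed

lemma S_sm: "a \<in> S ==> sm r a \<in> S" and S_add: "a \<in> S ==> c \<in> S ==> a + c \<in> S" and S_zero: "0 \<in> S"
  and S_diff: "a \<in> S ==> c \<in> S ==> a - c \<in> S" and l_S: "l \<in> S"
  using Fx_GA[OF lF] by (simp_all add: S_def GA_sm GA_add GA_diff gm_sm_left gm_sm_right gm_add_left gm_add_right gm_diff_left gm_diff_right ll)

lemma S_sum: "(!!i. i \<in> I ==> f i \<in> S) ==> sum f I \<in> S"
  by (induction I rule: infinite_finite_induct) (auto intro: S_add S_zero)

lemma Dc: "d \<in> D ==> d \<in> carrier G" and Dinv: "d \<in> D ==> inv d \<in> D"
  using DG subgroup.m_inv_closed[OF sD] by auto

lemma el_l: "d \<in> D ==> el d \<star> l = l \<star> el d"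
  by (rule Fx_eq[OF lF]) simp

lemma S_el: "a \<in> S ==> d \<in> D ==> el d \<star> a \<in> S" and S_el': "a \<in> S ==> d \<in> D ==> a \<star> el d \<in> S"
proof -
  assume a: "a \<in> S" and d: "d \<in> D"
  have "l \<star> (el d \<star> a) = l \<star> el d \<star> a" by (simp only: gm_assoc)
  also have "\<dots> = el d \<star> (l \<star> a)" by (simp only: el_l[OF d, symmetric] gm_assoc)
  finally show "el d \<star> a \<in> S" using a by (simp add: S_def gm_assoc)
  have "a \<star> el d \<star> l = a \<star> (l \<star> el d)" by (simp only: gm_assoc el_l[OF d])
  also have "\<dots> = a \<star> l \<star> el d" by (simp only: gm_assoc)
  finally show "a \<star> el d \<in> S" using a by (simp add: S_def gm_assoc[symmetric])
qed

lemma lact_eq: "a \<in> S ==> lact G l d a = el d \<star> a"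
  by (simp add: lact_def gm_assoc S_l)

lemma ract_eq: "a \<in> S ==> d \<in> D ==> ract G l a d = a \<star> el d"
  by (simp add: ract_def el_l gm_assoc[symmetric] S_l')

lemma dd_act_eq: "a \<in> S ==> s \<in> D ==> t \<in> D ==> dd_act G l (s, t) a = ac (s, t) a"
  by (simp add: dd_act_def ac_def lact_eq ract_eq S_el Dinv)

lemma XS: "x \<in> X ==> x \<in> S" and Xl: "x \<in> X ==> d \<in> D ==> el d \<star> x \<in> X" and Xr: "x \<in> X ==> d \<in> D ==> x \<star> el d \<in> X"
proof -
  assume x: "x \<in> X"
  show xS: "x \<in> S" using basis x by (auto simp: dd_inv_basis_def S_eq)
  { assume d: "d \<in> D"
    have im: "lact G l d ` X = X" "(%x. ract G l x d) ` X = X" using basis d by (auto simp only: dd_inv_basis_def)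
    have "lact G l d x \<in> X" "ract G l x d \<in> X"
      using imageI[OF x, of "lact G l d"] imageI[OF x, of "%x. ract G l x d"] unfolding im .
    then show "el d \<star> x \<in> X" "x \<star> el d \<in> X" using d xS by (simp_all add: lact_eq ract_eq) }
qed

lemma X_GA: "x \<in> X ==> x \<in> GA" using XS S_GA by blast

lemma ac_X: "x \<in> X ==> s \<in> D ==> t \<in> D ==> ac (s, t) x \<in> X"
  by (simp add: ac_def Xl Xr Dinv)

lemma S_expand:
  assumes a: "a \<in> S"
  shows "a = (\<Sum>g\<in>carrier G. sm (a g) (l \<star> el g \<star> l))"
proof -
  have "l \<star> a \<star> l = l \<star> (\<Sum>g\<in>carrier G. sm (a g) (el g)) \<star> l" using GA_expand[OF S_GA[OF a]] by simp
  then show ?thesis by (simp add: S_l[OF a] S_l'[OF a] gm_sum_left gm_sum_right gm_sm_left gm_sm_right)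
qed

lemma S_span: "a \<in> S ==> \<exists>F c. finite F \<and> F \<subseteq> X \<and> a = (\<Sum>x\<in>F. sm (c x) x)"
  using basis unfolding dd_inv_basis_def S_eq lin_span_def by blast

lemma X_indep: "finite F ==> F \<subseteq> X ==> (\<Sum>x\<in>F. sm (c x) x) = 0 ==> x \<in> F ==> c x = 0"
  using basis unfolding dd_inv_basis_def lin_indep_def by blast

lemma sum_extend:
  "finite F' ==> F \<subseteq> F' ==> (\<Sum>x\<in>F. sm (c x) (f x)) = (\<Sum>x\<in>F'. sm (if x \<in> F then c x else 0) (f x))"
  by (rule sum.mono_neutral_cong_left) auto

text \<open>The source algebra is spanned by the finitely many elements l g l, and each of them
  involves finitely many members of X. Any further member of X would be a combination of
  those.\<close>

lemma finX: "finite X"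
proof -
  have "\<forall>g. \<exists>F c. finite F \<and> F \<subseteq> X \<and> l \<star> el g \<star> l = (\<Sum>x\<in>F. sm (c x) x)" using S_span[OF S_lal] by blast
  then obtain F where "\<forall>g. \<exists>c. finite (F g) \<and> F g \<subseteq> X \<and> l \<star> el g \<star> l = (\<Sum>x\<in>F g. sm (c x) x)" by (rule choice[THEN exE]) blast
  then obtain c where Fc: "!!g. finite (F g)" "!!g. F g \<subseteq> X" "!!g. l \<star> el g \<star> l = (\<Sum>x\<in>F g. sm (c g x) x)"
    using choice[of "%g c. finite (F g) \<and> F g \<subseteq> X \<and> l \<star> el g \<star> l = (\<Sum>x\<in>F g. sm (c x) x)"] by blast
  define F0 where "F0 = (\<Union>g\<in>carrier G. F g)"
  have fF: "finite F0" and FX: "F0 \<subseteq> X" unfolding F0_def using fin Fc by auto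
  have "X \<subseteq> F0"
  proof
    fix x assume x: "x \<in> X"
    show "x \<in> F0"
    proof (rule ccontr)
      assume xF: "x \<notin> F0"
      define d where "d y = (\<Sum>g\<in>carrier G. x g * (if y \<in> F g then c g y else 0))" for y
      have "l \<star> el g \<star> l = (\<Sum>y\<in>F0. sm (if y \<in> F g then c g y else 0) y)" if "g \<in> carrier G" for g
        unfolding Fc(3) by (rule sum_extend[OF fF]) (use that in \<open>auto simp: F0_def\<close>)
      then have "x = (\<Sum>g\<in>carrier G. \<Sum>y\<in>F0. sm (x g) (sm (if y \<in> F g then c g y else 0) y))"
        using S_expand[OF XS[OF x]] by (simp add: sm_sum)
      also have "\<dots> = (\<Sum>y\<in>F0. sm (d y) y)"
        unfolding d_def sm_sum_scalar sm_sm by (rule sum.swap)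
      finally have xd: "x = (\<Sum>y\<in>F0. sm (d y) y)" .
      have "(\<Sum>y\<in>insert x F0. sm ((d(x := - 1)) y) y) = sm (- 1) x + (\<Sum>y\<in>F0. sm (d y) y)"
        using fF xF by (simp add: sum.insert) (rule sum.cong, auto)
      also have "\<dots> = 0" using xd by (simp add: sm_minus_scalar)
      finally have "(d(x := - 1)) x = 0" by (rule X_indep[rotated 2]) (use fF FX x in auto)
      then show False by simp
    qed
  qed
  then show ?thesis using fF by (rule finite_subset)
qed

definition kf :: "'g => ('g => 'o) => 'o" where
  "kf g = (SOME c. l \<star> el g \<star> l = (\<Sum>x\<in>X. sm (c x) x))"

text \<open>The coordinate at x of l a l, written as a sum over the group. This form is linear in a
  without further argument and is a sum over a set permuted by subgroups of D x D.\<close>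

definition cf :: "('g => 'o) => ('g => 'o) => 'o" where
  "cf a x = (\<Sum>g\<in>carrier G. a g * kf g x)"

lemma kf: "l \<star> el g \<star> l = (\<Sum>x\<in>X. sm (kf g x) x)"
proof -
  obtain F c where F: "F \<subseteq> X" "l \<star> el g \<star> l = (\<Sum>x\<in>F. sm (c x) x)" using S_span[OF S_lal] by blast
  have "l \<star> el g \<star> l = (\<Sum>x\<in>X. sm (if x \<in> F then c x else 0) x)"
    using F(2) sum_extend[OF finX F(1), of c "%x. x"] by simp
  then have "\<exists>c. l \<star> el g \<star> l = (\<Sum>x\<in>X. sm (c x) x)" by (rule exI[where x = "%x. if x \<in> F then c x else 0"])
  then show ?thesis unfolding kf_def by (rule someI_ex)
qed

lemma cf_expand: "a \<in> S ==> a = (\<Sum>x\<in>X. sm (cf a x) x)"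
proof -
  assume a: "a \<in> S"
  have "a = (\<Sum>g\<in>carrier G. \<Sum>x\<in>X. sm (a g) (sm (kf g x) x))"
    using S_expand[OF a] by (simp add: kf sm_sum)
  also have "\<dots> = (\<Sum>x\<in>X. sm (cf a x) x)" unfolding cf_def sm_sum_scalar sm_sm by (rule sum.swap)
  finally show ?thesis .
qed

lemma X_unique: "(\<Sum>x\<in>X. sm (c x) x) = (\<Sum>x\<in>X. sm (d x) x) ==> x \<in> X ==> c x = d x"
proof -
  assume H: "(\<Sum>x\<in>X. sm (c x) x) = (\<Sum>x\<in>X. sm (d x) x)" and x: "x \<in> X"
  have "(\<Sum>x\<in>X. sm (c x - d x) x) = 0" using H by (simp add: sm_diff_scalar sum_subtractf)
  then have "c x - d x = 0" by (rule X_indep[OF finX subset_refl _ x])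
  then show ?thesis by simp
qed

lemma cf_unique: "x \<in> X ==> cf (\<Sum>y\<in>X. sm (c y) y) x = c x"
proof -
  assume x: "x \<in> X"
  have "(\<Sum>y\<in>X. sm (c y) y) \<in> S" by (intro S_sum S_sm XS)
  then have "(\<Sum>y\<in>X. sm (cf (\<Sum>y\<in>X. sm (c y) y) y) y) = (\<Sum>y\<in>X. sm (c y) y)" by (rule cf_expand[symmetric])
  then show ?thesis by (rule X_unique[OF _ x])
qed

lemma cf_X: "x \<in> X ==> y \<in> X ==> cf x y = (if y = x then 1 else 0)"
proof -
  assume x: "x \<in> X" and y: "y \<in> X"
  have "(\<Sum>z\<in>X. sm (if z = x then 1 else 0) z) = (\<Sum>z\<in>X. if z = x then z else 0)"
    by (rule sum.cong) auto
  also have "\<dots> = x" using x finX by simp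
  finally show ?thesis using cf_unique[OF y, of "%z. if z = x then 1 else 0"] by simp
qed

lemma cf_add: "cf (a + c) x = cf a x + cf c x" and cf_diff: "cf (a - c) x = cf a x - cf c x"
  and cf_sm: "cf (sm r a) x = r * cf a x" and cf_zero: "cf 0 x = 0"
  by (simp_all add: cf_def plus_fun_apply minus_apply zero_fun_apply sm_apply distrib_right left_diff_distrib sum.distrib sum_subtractf sum_distrib_left mult.assoc)

lemma cf_sum: "cf (\<Sum>i\<in>I. f i) x = (\<Sum>i\<in>I. cf (f i) x)"
  by (induction I rule: infinite_finite_induct) (simp_all add: cf_add cf_zero)

lemma bij_ac: "s \<in> D ==> t \<in> D ==> bij_betw (ac (s, t)) X X"
proof (rule bij_betw_byWitness[where f' = "ac (inv s, inv t)"])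
  assume st: "s \<in> D" "t \<in> D"
  show "\<forall>x\<in>X. ac (inv s, inv t) (ac (s, t) x) = x" "\<forall>x\<in>X. ac (s, t) (ac (inv s, inv t) x) = x"
    using st Dc X_GA by (auto simp: ac_inv)
  show "ac (s, t) ` X \<subseteq> X" "ac (inv s, inv t) ` X \<subseteq> X" using st Dinv ac_X by auto
qed

lemma cf_ac:
  assumes a: "a \<in> S" and st: "s \<in> D" "t \<in> D" and x: "x \<in> X"
  shows "cf (ac (s, t) a) (ac (s, t) x) = cf a x"
proof -
  have c: "s \<in> carrier G" "t \<in> carrier G" using st Dc by auto
  have "ac (s, t) a = (\<Sum>y\<in>X. sm (cf a y) (ac (s, t) y))"
    using cf_expand[OF a] ac_sum[of "(s, t)" "cf a" "%y. y" X] by simp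
  also have "\<dots> = (\<Sum>y\<in>X. sm (cf a (ac (inv s, inv t) (ac (s, t) y))) (ac (s, t) y))"
    by (rule sum.cong) (auto simp: ac_inv c X_GA)
  also have "\<dots> = (\<Sum>y\<in>X. sm (cf a (ac (inv s, inv t) y)) y)"
    by (rule sum.reindex_bij_betw[OF bij_ac[OF st]])
  finally have "cf (ac (s, t) a) (ac (s, t) x) = cf a (ac (inv s, inv t) (ac (s, t) x))"
    using cf_unique[OF ac_X[OF x st], of "%y. cf a (ac (inv s, inv t) y)"] by simp
  then show ?thesis using ac_inv(2)[OF c X_GA[OF x]] by simp
qed

definition ddsub :: "('g \<times> 'g) set => bool" where "ddsub K \<longleftrightarrow> subgroup K (G \<times>\<times> G) \<and> K \<subseteq> D \<times> D"

lemma GG: "group (G \<times>\<times> G)" by (rule DirProd_group[OF is_group is_group])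

lemma ddsub_group:
  assumes K: "ddsub K"
  obtains n where "group ((G \<times>\<times> G)\<lparr>carrier := K\<rparr>)" "finite K" "card K = p ^ n"
proof -
  have DD: "subgroup (D \<times> D) (G \<times>\<times> G)" by (rule DirProd_subgroups[OF is_group sD is_group sD])
  have fD: "finite (D \<times> D)" using finD by simp
  have fK: "finite K" using K fD by (auto simp: ddsub_def intro: finite_subset)
  obtain n where n: "card D = p ^ n" using D by (auto simp: p_subgroup_def)
  have sK: "subgroup K (G \<times>\<times> G)" and KD: "K \<subseteq> D \<times> D" using K by (auto simp: ddsub_def)
  have "card K dvd card (D \<times> D)"
    by (rule dvdI[OF trans[OF card_cosets[OF GG DD sK KD fD, symmetric] mult.commute]])
  then have "card K dvd p ^ (n + n)" by (simp add: card_cartesian_product n power_add)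
  then obtain k where "card K = p ^ k" using divides_primepow_nat[OF prime_p] by blast
  then show ?thesis using that group.subgroup_imp_group[OF GG sK] fK by blast
qed

lemma ddsub_carrier: "ddsub K ==> K \<subseteq> carrier G \<times> carrier G" using Dc by (auto simp: ddsub_def)

lemma ac_action: "K \<subseteq> D \<times> D ==> is_action ((G \<times>\<times> G)\<lparr>carrier := K\<rparr>) ac X"
  unfolding is_action_def using Dc by (auto simp: ac_X ac_one X_GA ac_ac subset_iff)

text \<open>a(g) is the sum over x in X of the coordinate of a at x times x(g). For g fixed by K the
  summand is constant on K-orbits of X, so modulo p only the K-fixed x contribute.\<close>

lemma Kr_of_coeffs:
  assumes K: "ddsub K" and a: "a \<in> S" "a \<in> Fx K" and c: "!!x. x \<in> X ==> x \<in> Fx K ==> cf a x \<in> m"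
  shows "a \<in> Kr K"
  unfolding Kr_def
proof (intro CollectI conjI a(2) ballI)
  fix g assume g: "g \<in> TT K"
  have gc: "g \<in> carrier G" using g by (simp add: TT_def)
  obtain n where n: "group ((G \<times>\<times> G)\<lparr>carrier := K\<rparr>)" "finite K" "card K = p ^ n" using ddsub_group[OF K] .
  have KD: "!!s t. (s, t) \<in> K ==> s \<in> D \<and> t \<in> D" using K by (auto simp: ddsub_def)
  define f where "f x = cf a x * x g" for x
  have aca: "ac h a = a" if "h \<in> K" for h using Fx_ac[OF ddsub_carrier[OF K] S_GA[OF a(1)]] a(2) that by blast
  have "sum f X - sum f {x \<in> X. \<forall>h\<in>carrier ((G \<times>\<times> G)\<lparr>carrier := K\<rparr>). ac h x = x} \<in> m"
  proof (rule sum_fixed_mod[OF n(1) _ _ finX ac_action])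
    show "f (ac h x) = f x" if h: "h \<in> carrier ((G \<times>\<times> G)\<lparr>carrier := K\<rparr>)" and x: "x \<in> X" for h x
    proof -
      obtain s t where st: "h = (s, t)" "(s, t) \<in> K" using h by (cases h) auto
      have sD: "s \<in> D" "t \<in> D" using KD st by auto
      have "cf a (ac h x) = cf a x" using cf_ac[OF a(1) sD x] aca[OF st(2)] st(1) by simp
      moreover have "ac h x g = x g" using ac_apply[of s t g x] TT_inv_eq[OF g st(2)] sD Dc gc st(1) by simp
      ultimately show ?thesis by (simp add: f_def)
    qed
  qed (use n K in \<open>auto simp: ddsub_def\<close>)
  moreover have "sum f {x \<in> X. \<forall>h\<in>carrier ((G \<times>\<times> G)\<lparr>carrier := K\<rparr>). ac h x = x} \<in> m"
  proof (rule m_sum)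
    fix x assume "x \<in> {x \<in> X. \<forall>h\<in>carrier ((G \<times>\<times> G)\<lparr>carrier := K\<rparr>). ac h x = x}"
    then have x: "x \<in> X" "\<forall>h\<in>K. ac h x = x" by auto
    then have "x \<in> Fx K" using Fx_ac[OF ddsub_carrier[OF K] X_GA[OF x(1)]] by blast
    then show "f x \<in> m" unfolding f_def by (intro m_mult2 c x)
  qed
  ultimately have "sum f X \<in> m" using m_cong by blast
  moreover have "a g = sum f X"
    using arg_cong[OF cf_expand[OF a(1)], of "%a. a g"] by (simp add: fsum_apply sm_apply f_def)
  ultimately show "a g \<in> m" by simp
qed

text \<open>The same argument with X and G exchanged: the coordinate at a fixed x is a sum over G of
  a(g) \<open>kf g x\<close>, constant on the K-orbits of G, and the K-fixed g are exactly those
  where a is known to lie in \<open>m\<close>.\<close>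

lemma coeffs_of_Kr:
  assumes K: "ddsub K" and a: "a \<in> S" "a \<in> Kr K" and x: "x \<in> X" "x \<in> Fx K"
  shows "cf a x \<in> m"
proof -
  obtain n where n: "group ((G \<times>\<times> G)\<lparr>carrier := K\<rparr>)" "finite K" "card K = p ^ n" using ddsub_group[OF K] .
  have KD: "!!s t. (s, t) \<in> K ==> s \<in> D \<and> t \<in> D" using K by (auto simp: ddsub_def)
  let ?act = "%h g. fst h \<otimes> g \<otimes> inv (snd h)"
  define f where "f g = a g * kf g x" for g
  have kfcf: "kf g y = cf (l \<star> el g \<star> l) y" if "y \<in> X" for g y
    unfolding kf[of g] using cf_unique[OF that, of "kf g"] by simp
  have act: "is_action ((G \<times>\<times> G)\<lparr>carrier := K\<rparr>) ?act (carrier G)"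
    unfolding is_action_def using KD Dc by (auto simp: m_assoc inv_mult_group)
  have "sum f (carrier G) - sum f {g \<in> carrier G. \<forall>h\<in>carrier ((G \<times>\<times> G)\<lparr>carrier := K\<rparr>). ?act h g = g} \<in> m"
  proof (rule sum_fixed_mod[OF n(1) _ _ fin act])
    show "f (?act h g) = f g" if h: "h \<in> carrier ((G \<times>\<times> G)\<lparr>carrier := K\<rparr>)" and g: "g \<in> carrier G" for h g
    proof -
      obtain s t where st: "h = (s, t)" "(s, t) \<in> K" using h by (cases h) auto
      have sD: "s \<in> D" "t \<in> D" using KD st by auto
      have cc: "s \<in> carrier G" "t \<in> carrier G" using sD Dc by auto
      have 1: "a (s \<otimes> g \<otimes> inv t) = a g" by (rule Fx_apply[OF Kr_Fx[OF a(2)] st(2) cc g])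
      have xx: "ac (s, t) x = x" using Fx_ac[OF ddsub_carrier[OF K] X_GA[OF x(1)]] x(2) st(2) by blast
      have "l \<star> el (s \<otimes> g \<otimes> inv t) \<star> l = l \<star> el s \<star> el g \<star> (el (inv t) \<star> l)"
        using cc g by (simp add: gm_assoc el_el[symmetric])
      also have "\<dots> = el s \<star> l \<star> el g \<star> (l \<star> el (inv t))" by (simp only: el_l[OF sD(1)] el_l[OF Dinv[OF sD(2)]])
      also have "\<dots> = ac (s, t) (l \<star> el g \<star> l)" by (simp add: ac_def gm_assoc)
      finally have "kf (s \<otimes> g \<otimes> inv t) x = cf (ac (s, t) (l \<star> el g \<star> l)) (ac (s, t) x)" using kfcf[OF x(1)] xx by simp
      also have "\<dots> = kf g x" using cf_ac[OF S_lal sD x(1)] kfcf[OF x(1)] by simp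
      finally show ?thesis using 1 st(1) by (simp add: f_def)
    qed
  qed (use n in auto)
  moreover have "sum f {g \<in> carrier G. \<forall>h\<in>carrier ((G \<times>\<times> G)\<lparr>carrier := K\<rparr>). ?act h g = g} \<in> m"
  proof (rule m_sum)
    fix g assume "g \<in> {g \<in> carrier G. \<forall>h\<in>carrier ((G \<times>\<times> G)\<lparr>carrier := K\<rparr>). ?act h g = g}"
    then have g: "g \<in> carrier G" "\<forall>h\<in>K. ?act h g = g" by auto
    have "s \<otimes> g = g \<otimes> t" if "(s, t) \<in> K" for s t
    proof -
      have "s \<otimes> g \<otimes> inv t = g" using g(2) that by force
      moreover have "s \<in> carrier G" "t \<in> carrier G" using KD[OF that] Dc by auto
      ultimately show ?thesis using g(1) by (metis inv_solve_right' inv_closed m_closed)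
    qed
    then have "g \<in> TT K" using g(1) by (auto simp: TT_def)
    then show "f g \<in> m" using a(2) unfolding f_def Kr_def by (auto intro: m_mult2)
  qed
  ultimately have "sum f (carrier G) \<in> m" using m_cong by blast
  then show ?thesis by (simp add: f_def cf_def)
qed

lemma X_notin_Kr: "ddsub K ==> x \<in> X ==> x \<in> Fx K ==> x \<notin> Kr K"
  using coeffs_of_Kr[of K x x] XS one_notin by (auto simp: cf_X)

text \<open>A K-fixed basis element has coordinate 1 at itself and so is not in the Brauer kernel,
  which needs a K-fixed group element to detect it. This is what forces point stabilizers to be
  graphs of conjugations.\<close>

lemma X_TT: "ddsub K ==> x \<in> X ==> x \<in> Fx K ==> \<exists>g\<in>TT K. x g \<notin> m"
  using X_notin_Kr unfolding Kr_def by blast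

text \<open>The fixed points of X represent a basis of the Brauer quotient. As g is a left inverse
  of f modulo kernels, f is injective on quotients; fewer fixed points on the target side would give
  a combination that f kills, with some coefficient outside \<open>m\<close>.\<close>

lemma embed_card:
  assumes K: "ddsub K1" "ddsub K2"
    and f: "!!a. a \<in> S ==> a \<in> Fx K1 ==> f a \<in> S \<and> f a \<in> Fx K2" and g: "!!a. a \<in> S ==> a \<in> Kr K2 ==> g a \<in> Kr K1"
    and gf: "!!a. a \<in> S ==> a \<in> Fx K1 ==> g (f a) - a \<in> Kr K1"
    and fsum: "!!v J. f (\<Sum>j\<in>J. sm (v j) j) = (\<Sum>j\<in>J. sm (v j) (f j))"
  shows "card (X \<inter> Fx K1) \<le> card (X \<inter> Fx K2)"
proof (rule ccontr)
  let ?J = "X \<inter> Fx K1" and ?I = "X \<inter> Fx K2"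
  assume "\<not> ?thesis"
  then have lt: "card ?I < card ?J" by simp
  have "\<exists>v. (\<exists>j\<in>?J. v j \<notin> m) \<and> (\<forall>i\<in>?I. (\<Sum>j\<in>?J. cf (f j) i * v j) \<in> m)"
    by (rule kernel_vector[OF _ _ lt]) (simp_all add: finX)
  then obtain v where v: "\<exists>j\<in>?J. v j \<notin> m" "\<forall>i\<in>?I. (\<Sum>j\<in>?J. cf (f j) i * v j) \<in> m" by blast
  define a where "a = (\<Sum>j\<in>?J. sm (v j) j)"
  have aS: "a \<in> S" unfolding a_def by (intro S_sum S_sm XS) simp
  have aF: "a \<in> Fx K1" unfolding a_def by (intro Fx_sum Fx_sm) simp
  have "cf (f a) i \<in> m" if "i \<in> X" "i \<in> Fx K2" for i
  proof -
    have "cf (f a) i = (\<Sum>j\<in>?J. cf (f j) i * v j)" unfolding a_def fsum cf_sum cf_sm by (simp add: mult.commute)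
    then show ?thesis using v(2) that by simp
  qed
  then have "f a \<in> Kr K2" using Kr_of_coeffs[OF K(2)] f[OF aS aF] by blast
  then have "g (f a) \<in> Kr K1" using g f[OF aS aF] by blast
  then have "g (f a) - (g (f a) - a) \<in> Kr K1" by (rule Kr_diff[OF _ gf[OF aS aF]])
  then have aK: "a \<in> Kr K1" by simp
  have "v j \<in> m" if j: "j \<in> ?J" for j
  proof -
    have "a = (\<Sum>x\<in>X. sm (if x \<in> ?J then v x else 0) x)" unfolding a_def by (rule sum_extend[OF finX]) simp
    then have "cf a j = v j" using cf_unique[of j "%x. if x \<in> ?J then v x else 0"] j by simp
    then show ?thesis using coeffs_of_Kr[OF K(1) aS aK, of j] j by simp
  qed
  then show False using v(1) by blast
qed

section \<open>Twisted units and numbers of fixed points\<close>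

definition gr :: "'g set => ('g => 'g) => bool" where "gr P \<alpha> \<longleftrightarrow> hm P \<alpha> \<and> inj_on \<alpha> P \<and> \<alpha> ` P \<subseteq> D"

lemma gr_hm: "gr P \<alpha> ==> hm P \<alpha>" by (simp add: gr_def)

lemma gr_id: "subgroup P G ==> P \<subseteq> D ==> gr P (%x. x)" by (simp add: gr_def hm_id)

lemma Rl_ddsub: "subgroup P G ==> gr P \<alpha> ==> gr P \<beta> ==> ddsub (Rl \<alpha> \<beta> P)"
  unfolding ddsub_def using Rl_subgroup[of P \<alpha> \<beta>] by (auto simp: gr_def)

lemma l_Fx: "gr P \<beta> ==> l \<in> Fx (Rl \<beta> \<beta> P)"
  using el_l Fx_GA[OF lF] by (auto simp: gr_def Fx_def)

lemma l_notin_Kr: "gr P \<beta> ==> l \<notin> Kr (Rl \<beta> \<beta> P)"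
proof -
  assume g: "gr P \<beta>"
  obtain g where g': "g \<in> TT (dg D)" "l g \<notin> m" using lK lF unfolding Kr_def by blast
  then have "g \<in> TT (Rl \<beta> \<beta> P)" using g by (auto simp: gr_def TT_def)
  then show ?thesis using g'(2) unfolding Kr_def by blast
qed

lemma tw_fix_eq: "Delta phi P \<subseteq> D \<times> D ==> tw_fix G b l phi P = S \<inter> Fx (Delta phi P)"
proof -
  assume H: "Delta phi P \<subseteq> D \<times> D"
  then have C: "Delta phi P \<subseteq> carrier G \<times> carrier G" using Dc by blast
  have "(\<forall>q\<in>Delta phi P. dd_act G l q a = a) \<longleftrightarrow> a \<in> Fx (Delta phi P)" if "a \<in> S" for a
  proof -
    have "dd_act G l q a = ac q a" if q: "q \<in> Delta phi P" for q
    proof -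
      obtain s t where st: "q = (s, t)" by (cases q)
      have "s \<in> D" "t \<in> D" using H q st by auto
      then show ?thesis unfolding st by (rule dd_act_eq[OF \<open>a \<in> S\<close>])
    qed
    then show ?thesis unfolding Fx_ac[OF C S_GA[OF \<open>a \<in> S\<close>]] by simp
  qed
  then show ?thesis unfolding tw_fix_def fixpts_def S_eq by blast
qed

lemma tw_ker_Kr:
  assumes K: "ddsub (Delta phi P)" and a: "a \<in> S" "a \<in> Fx (Delta phi P)" "a \<in> tw_ker m G b l phi P"
  shows "a \<in> Kr (Delta phi P)"
  unfolding Kr_def
proof (intro CollectI conjI a(2) ballI)
  fix g assume g: "g \<in> TT (Delta phi P)"
  obtain n where n: "finite (Delta phi P)" "card (Delta phi P) = p ^ n" using ddsub_group[OF K] .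
  have sK: "subgroup (Delta phi P) (G \<times>\<times> G)" using K by (simp add: ddsub_def)
  show "a g \<in> m"
  proof (rule brauer_kernel_eval[OF GG sK n])
    show "a \<in> brauer_kernel m (G \<times>\<times> G) (dd_act G l) S (Delta phi P)" using a(3) by (simp add: tw_ker_def S_eq)
    fix q c assume q: "q \<in> Delta phi P" and c: "c \<in> S"
    obtain s t where st: "q = (s, t)" "(s, t) \<in> Delta phi P" using q by (cases q) auto
    have sD: "s \<in> D" "t \<in> D" using K st by (auto simp: ddsub_def)
    have gc: "g \<in> carrier G" using g by (simp add: TT_def)
    show "dd_act G l q c g = c g"
      using ac_apply[of s t g c] TT_inv_eq[OF g st(2)] sD Dc gc dd_act_eq[OF c sD] st(1) by simp
  qed
qed

text \<open>For maps satisfying \<open>gr P\<close> this says that the twisted Brauer quotient of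
  the morphism \<open>\<alpha> \<circ> \<beta>\<^sup>-\<^sup>1\<close> is nonzero.\<close>

definition NZ :: "('g => 'g) => ('g => 'g) => 'g set => bool" where
  "NZ \<alpha> \<beta> P \<longleftrightarrow> (\<exists>a\<in>S. a \<in> Fx (Rl \<alpha> \<beta> P) \<and> a \<notin> Kr (Rl \<alpha> \<beta> P))"

lemma unit_exists:
  assumes P: "subgroup P G" and g: "gr P \<alpha>" "gr P \<beta>" and nz: "NZ \<alpha> \<beta> P"
  obtains u u' where "u \<in> S" "u' \<in> S" "u \<in> Fx (Rl \<alpha> \<beta> P)" "u' \<in> Fx (Rl \<beta> \<alpha> P)" "u' \<star> u - l \<in> Kr (Rl \<beta> \<beta> P)"
proof -
  \<comment> \<open>The hypothesis on twisted units speaks of one isomorphism between subgroups of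
    D; here it is \<open>\<alpha> \<circ> \<beta>\<^sup>-\<^sup>1\<close> from
    \<open>\<beta>\<close> P\<open>to\<close>\<alpha> \<open>P\<close>.\<close>
  define phi where "phi = (%y. \<alpha> (inv_into P \<beta> y))"
  have inv: "inv_into P \<beta> (\<beta> x) = x" if "x \<in> P" for x using g(2) that by (simp add: gr_def)
  have phi: "phi (\<beta> x) = \<alpha> x" if "x \<in> P" for x using inv[OF that] by (simp add: phi_def)
  have inj: "inj_on phi (\<beta> ` P)" using g(1) by (auto simp: inj_on_def phi gr_def)
  have inv2: "inv_into (\<beta> ` P) phi (\<alpha> x) = \<beta> x" if "x \<in> P" for x
    by (rule inv_into_f_eq[OF inj]) (use that phi in auto)
  have D1: "Delta phi (\<beta> ` P) = Rl \<alpha> \<beta> P"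
  proof -
    have "Delta phi (\<beta> ` P) = (%x. (phi (\<beta> x), \<beta> x)) ` P" by (auto simp: Delta_def)
    also have "\<dots> = Rl \<alpha> \<beta> P" by (rule image_cong) (simp_all add: phi)
    finally show ?thesis .
  qed
  have D2: "Delta (inv_into (\<beta> ` P) phi) (\<alpha> ` P) = Rl \<beta> \<alpha> P"
  proof -
    have "Delta (inv_into (\<beta> ` P) phi) (\<alpha> ` P) = (%x. (inv_into (\<beta> ` P) phi (\<alpha> x), \<alpha> x)) ` P" by (auto simp: Delta_def)
    also have "\<dots> = Rl \<beta> \<alpha> P" by (rule image_cong) (simp_all add: inv2)
    finally show ?thesis .
  qed
  have D3: "Delta id (\<beta> ` P) = Rl \<beta> \<beta> P" by (auto simp: Delta_def)
  have s: "subgroup (\<beta> ` P) G" "subgroup (\<alpha> ` P) G" using hm_image_subgroup P g gr_hm by blast+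
  have sub: "\<beta> ` P \<subseteq> D" "\<alpha> ` P \<subseteq> D" using g by (auto simp: gr_def)
  have dd: "ddsub (Rl \<alpha> \<beta> P)" "ddsub (Rl \<beta> \<alpha> P)" "ddsub (Rl \<beta> \<beta> P)" using Rl_ddsub[OF P] g by blast+
  have le: "Rl \<alpha> \<beta> P \<subseteq> D \<times> D" "Rl \<beta> \<alpha> P \<subseteq> D \<times> D" using dd by (auto simp: ddsub_def)
  have hom: "\<forall>x\<in>\<beta> ` P. \<forall>y\<in>\<beta> ` P. phi (x \<otimes> y) = phi x \<otimes> phi y"
  proof (intro ballI)
    fix u v assume "u \<in> \<beta> ` P" "v \<in> \<beta> ` P"
    then obtain x y where xy: "x \<in> P" "u = \<beta> x" "y \<in> P" "v = \<beta> y" by blast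
    have "u \<otimes> v = \<beta> (x \<otimes> y)" using g(2) xy by (simp add: gr_def hm_def)
    then have "phi (u \<otimes> v) = \<alpha> (x \<otimes> y)" using phi[OF subgroup.m_closed[OF P xy(1,3)]] by simp
    also have "\<dots> = \<alpha> x \<otimes> \<alpha> y" using g(1) xy by (simp add: gr_def hm_def)
    finally show "phi (u \<otimes> v) = phi u \<otimes> phi v" using phi xy by simp
  qed
  have bij: "bij_betw phi (\<beta> ` P) (\<alpha> ` P)"
    unfolding bij_betw_def using inj by (simp add: image_image phi cong: image_cong)
  obtain a where a: "a \<in> S" "a \<in> Fx (Rl \<alpha> \<beta> P)" "a \<notin> Kr (Rl \<alpha> \<beta> P)" using nz by (auto simp: NZ_def)
  have tf: "tw_fix G b l phi (\<beta> ` P) = S \<inter> Fx (Rl \<alpha> \<beta> P)"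
    using tw_fix_eq[of phi "\<beta> ` P"] le(1) by (simp only: D1)
  have tf': "tw_fix G b l (inv_into (\<beta> ` P) phi) (\<alpha> ` P) = S \<inter> Fx (Rl \<beta> \<alpha> P)"
    using tw_fix_eq[of "inv_into (\<beta> ` P) phi" "\<alpha> ` P"] le(2) by (simp only: D2)
  have "a \<notin> tw_ker m G b l phi (\<beta> ` P)" using tw_ker_Kr[of phi "\<beta> ` P" a] dd(1) a by (auto simp only: D1)
  then have "\<exists>a\<in>tw_fix G b l phi (\<beta> ` P). a \<notin> tw_ker m G b l phi (\<beta> ` P)" using a tf by blast
  then obtain u u' where u: "u \<in> S \<inter> Fx (Rl \<alpha> \<beta> P)" "u' \<in> S \<inter> Fx (Rl \<beta> \<alpha> P)"
    "u' \<star> u - l \<in> tw_ker m G b l id (\<beta> ` P)"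
    using units s sub hom bij unfolding all_twisted_units_def tf[symmetric] tf'[symmetric] by metis
  have "u' \<star> u - l \<in> S" using u by (intro S_diff S_mult l_S) auto
  moreover have "u' \<star> u - l \<in> Fx (Rl \<beta> \<beta> P)" using u by (intro Fx_diff Fx_mult l_Fx g) auto
  ultimately have "u' \<star> u - l \<in> Kr (Rl \<beta> \<beta> P)"
    using tw_ker_Kr[of id "\<beta> ` P" "u' \<star> u - l"] dd(3) u(3) by (simp only: D3)
  then show thesis using that[of u u'] u by blast
qed

lemma psubD: "subgroup P G ==> P \<subseteq> D ==> p_subgroup p G P" by (rule psub_sub[OF D])

text \<open>The partner u' of a twisted unit is nonzero, since u' u = l modulo the kernel and l is
  not in it.\<close>

lemma NZ_sym:
  assumes P: "subgroup P G" "P \<subseteq> D" and g: "gr P \<alpha>" "gr P \<beta>" and nz: "NZ \<alpha> \<beta> P"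
  shows "NZ \<beta> \<alpha> P"
proof -
  obtain u u' where u: "u \<in> S" "u' \<in> S" "u \<in> Fx (Rl \<alpha> \<beta> P)" "u' \<in> Fx (Rl \<beta> \<alpha> P)" "u' \<star> u - l \<in> Kr (Rl \<beta> \<beta> P)"
    by (rule unit_exists[OF P(1) g nz])
  have "u' \<notin> Kr (Rl \<beta> \<alpha> P)"
  proof
    assume "u' \<in> Kr (Rl \<beta> \<alpha> P)"
    then have 1: "u' \<star> u \<in> Kr (Rl \<beta> \<beta> P)"
      by (rule Kr_mult_left[OF psubD[OF P] gr_hm[OF g(2)] gr_hm[OF g(1)] gr_hm[OF g(2)] _ u(3)])
    have "u' \<star> u - (u' \<star> u - l) \<in> Kr (Rl \<beta> \<beta> P)" by (rule Kr_diff[OF 1 u(5)])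
    then show False using l_notin_Kr[OF g(2)] by simp
  qed
  then show ?thesis using u by (auto simp: NZ_def)
qed

text \<open>The product of two twisted units is nonzero, as multiplying back by their partners
  recovers l modulo the kernel.\<close>

lemma NZ_trans:
  assumes P: "subgroup P G" "P \<subseteq> D" and g: "gr P \<alpha>" "gr P \<beta>" "gr P \<gamma>" and nz: "NZ \<alpha> \<beta> P" "NZ \<beta> \<gamma> P"
  shows "NZ \<alpha> \<gamma> P"
proof -
  note pP = psubD[OF P] and h = g[THEN gr_hm]
  obtain u u' where u: "u \<in> S" "u' \<in> S" "u \<in> Fx (Rl \<alpha> \<beta> P)" "u' \<in> Fx (Rl \<beta> \<alpha> P)" "u' \<star> u - l \<in> Kr (Rl \<beta> \<beta> P)"
    by (rule unit_exists[OF P(1) g(1,2) nz(1)])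
  obtain w w' where w: "w \<in> S" "w' \<in> S" "w \<in> Fx (Rl \<beta> \<gamma> P)" "w' \<in> Fx (Rl \<gamma> \<beta> P)" "w' \<star> w - l \<in> Kr (Rl \<gamma> \<gamma> P)"
    by (rule unit_exists[OF P(1) g(2,3) nz(2)])
  have "u \<star> w \<notin> Kr (Rl \<alpha> \<gamma> P)"
  proof
    assume "u \<star> w \<in> Kr (Rl \<alpha> \<gamma> P)"
    then have "u' \<star> (u \<star> w) \<in> Kr (Rl \<beta> \<gamma> P)" by (rule Kr_mult_right[OF pP h(2,1,3) u(4)])
    then have 1: "w' \<star> (u' \<star> (u \<star> w)) \<in> Kr (Rl \<gamma> \<gamma> P)" by (rule Kr_mult_right[OF pP h(3,2,3) w(4)])
    have "(u' \<star> u - l) \<star> w \<in> Kr (Rl \<beta> \<gamma> P)" by (rule Kr_mult_left[OF pP h(2,2,3) u(5) w(3)])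
    then have 2: "w' \<star> ((u' \<star> u - l) \<star> w) \<in> Kr (Rl \<gamma> \<gamma> P)" by (rule Kr_mult_right[OF pP h(3,2,3) w(4)])
    have "w' \<star> (u' \<star> (u \<star> w)) - w' \<star> ((u' \<star> u - l) \<star> w) - (w' \<star> w - l) \<in> Kr (Rl \<gamma> \<gamma> P)"
      by (rule Kr_diff[OF Kr_diff[OF 1 2] w(5)])
    moreover have "w' \<star> (u' \<star> (u \<star> w)) - w' \<star> ((u' \<star> u - l) \<star> w) - (w' \<star> w - l) = l"
      by (simp add: gm_diff_left gm_diff_right gm_assoc S_l[OF w(1)])
    ultimately show False using l_notin_Kr[OF g(3)] by simp
  qed
  moreover have "u \<star> w \<in> Fx (Rl \<alpha> \<gamma> P)" by (rule Fx_mult[OF u(3) w(3)])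
  ultimately show ?thesis using S_mult[OF u(1) w(1)] by (auto simp: NZ_def)
qed

text \<open>Left multiplication by u embeds the quotient for (\<beta>, \<gamma>) into that for
  (\<alpha>, \<gamma>), with left inverse multiplication by u'. For the second argument, right
  multiplication by u' embeds, with u undoing it.\<close>

lemma unit_card:
  assumes P: "subgroup P G" "P \<subseteq> D" and g: "gr P \<alpha>" "gr P \<beta>" "gr P \<gamma>"
    and u: "u \<in> S" "u' \<in> S" "u \<in> Fx (Rl \<alpha> \<beta> P)" "u' \<in> Fx (Rl \<beta> \<alpha> P)" "u' \<star> u - l \<in> Kr (Rl \<beta> \<beta> P)"
  shows "card (X \<inter> Fx (Rl \<beta> \<gamma> P)) \<le> card (X \<inter> Fx (Rl \<alpha> \<gamma> P))" "card (X \<inter> Fx (Rl \<gamma> \<beta> P)) \<le> card (X \<inter> Fx (Rl \<gamma> \<alpha> P))"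
proof -
  note pP = psubD[OF P] and h = g[THEN gr_hm]
  note dd = Rl_ddsub[OF P(1)]
  show "card (X \<inter> Fx (Rl \<beta> \<gamma> P)) \<le> card (X \<inter> Fx (Rl \<alpha> \<gamma> P))"
  proof (rule embed_card[OF dd[OF g(2,3)] dd[OF g(1,3)], where f = "%a. u \<star> a" and g = "%a. u' \<star> a"])
    fix a assume a: "a \<in> S" 
    show "u \<star> a \<in> S \<and> u \<star> a \<in> Fx (Rl \<alpha> \<gamma> P)" if "a \<in> Fx (Rl \<beta> \<gamma> P)" using S_mult[OF u(1) a] Fx_mult[OF u(3) that] by blast
    show "u' \<star> a \<in> Kr (Rl \<beta> \<gamma> P)" if "a \<in> Kr (Rl \<alpha> \<gamma> P)" by (rule Kr_mult_right[OF pP h(2,1,3) u(4) that])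
    show "u' \<star> (u \<star> a) - a \<in> Kr (Rl \<beta> \<gamma> P)" if "a \<in> Fx (Rl \<beta> \<gamma> P)"
      using Kr_mult_left[OF pP h(2,2,3) u(5) that] by (simp add: gm_diff_left S_l[OF a] gm_assoc)
  qed (simp add: gm_sum_right gm_sm_right)
  show "card (X \<inter> Fx (Rl \<gamma> \<beta> P)) \<le> card (X \<inter> Fx (Rl \<gamma> \<alpha> P))"
  proof (rule embed_card[OF dd[OF g(3,2)] dd[OF g(3,1)], where f = "%a. a \<star> u'" and g = "%a. a \<star> u"])
    fix a assume a: "a \<in> S" 
    show "a \<star> u' \<in> S \<and> a \<star> u' \<in> Fx (Rl \<gamma> \<alpha> P)" if "a \<in> Fx (Rl \<gamma> \<beta> P)" using S_mult[OF a u(2)] Fx_mult[OF that u(4)] by blast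
    show "a \<star> u \<in> Kr (Rl \<gamma> \<beta> P)" if "a \<in> Kr (Rl \<gamma> \<alpha> P)" by (rule Kr_mult_left[OF pP h(3,1,2) that u(3)])
    show "a \<star> u' \<star> u - a \<in> Kr (Rl \<gamma> \<beta> P)" if "a \<in> Fx (Rl \<gamma> \<beta> P)"
      using Kr_mult_right[OF pP h(3,2,2) that u(5)] by (simp add: gm_diff_right S_l'[OF a] gm_assoc)
  qed (simp add: gm_sum_left gm_sm_left)
qed

text \<open>Each inequality is used for a unit of the morphism and for a unit of its inverse, which
  exists by symmetry.\<close>

lemma NZ_card:
  assumes P: "subgroup P G" "P \<subseteq> D" and g: "gr P \<alpha>" "gr P \<beta>" and nz: "NZ \<alpha> \<beta> P"
  shows "card (X \<inter> Fx (Rl \<alpha> \<beta> P)) = card (X \<inter> Fx (Rl \<beta> \<beta> P))" "card (X \<inter> Fx (Rl \<alpha> \<beta> P)) = card (X \<inter> Fx (Rl \<alpha> \<alpha> P))"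
proof -
  obtain u u' where u: "u \<in> S" "u' \<in> S" "u \<in> Fx (Rl \<alpha> \<beta> P)" "u' \<in> Fx (Rl \<beta> \<alpha> P)" "u' \<star> u - l \<in> Kr (Rl \<beta> \<beta> P)"
    by (rule unit_exists[OF P(1) g nz])
  obtain w w' where w: "w \<in> S" "w' \<in> S" "w \<in> Fx (Rl \<beta> \<alpha> P)" "w' \<in> Fx (Rl \<alpha> \<beta> P)" "w' \<star> w - l \<in> Kr (Rl \<alpha> \<alpha> P)"
    by (rule unit_exists[OF P(1) g(2,1) NZ_sym[OF P g nz]])
  show "card (X \<inter> Fx (Rl \<alpha> \<beta> P)) = card (X \<inter> Fx (Rl \<beta> \<beta> P))"
    using unit_card(1)[OF P g(1,2,2) u] unit_card(1)[OF P g(2,1,2) w] by simp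
  show "card (X \<inter> Fx (Rl \<alpha> \<beta> P)) = card (X \<inter> Fx (Rl \<alpha> \<alpha> P))"
    using unit_card(2)[OF P g(1,2,1) u] unit_card(2)[OF P g(2,1,1) w] by simp
qed

lemma not_NZ_empty:
  assumes P: "subgroup P G" and g: "gr P \<alpha>" "gr P \<beta>" and nz: "\<not> NZ \<alpha> \<beta> P"
  shows "X \<inter> Fx (Rl \<alpha> \<beta> P) = {}"
proof (rule ccontr)
  assume "X \<inter> Fx (Rl \<alpha> \<beta> P) ~= {}"
  then obtain x where x: "x \<in> X" "x \<in> Fx (Rl \<alpha> \<beta> P)" by blast
  then show False using nz X_notin_Kr[OF Rl_ddsub[OF P g] x] XS[OF x(1)] unfolding NZ_def by blast
qed

text \<open>Either both twisted quotients are nonzero and both counts agree with that of an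
  identity, or both vanish and there are no fixed points on either side.\<close>

lemma card_swap:
  assumes P: "subgroup P G" "P \<subseteq> D" and g: "gr P \<alpha>" "gr P \<beta>"
  shows "card (X \<inter> Fx (Rl \<alpha> \<beta> P)) = card (X \<inter> Fx (Rl \<beta> \<alpha> P))"
proof (cases "NZ \<alpha> \<beta> P")
  case True
  then show ?thesis using NZ_card(1)[OF P g True] NZ_card(2)[OF P g(2,1) NZ_sym[OF P g True]] by simp
next
  case False
  then have "\<not> NZ \<beta> \<alpha> P" using NZ_sym[OF P g(2,1)] by blast
  then show ?thesis using False not_NZ_empty P(1) g by simp
qed

lemma card_transfer:
  assumes P: "subgroup P G" "P \<subseteq> D" and g: "gr P \<alpha>" "gr P \<beta>" "gr P \<gamma>" and nz: "NZ \<gamma> \<alpha> P"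
  shows "card (X \<inter> Fx (Rl \<alpha> \<beta> P)) = card (X \<inter> Fx (Rl \<gamma> \<beta> P))"
proof (cases "NZ \<alpha> \<beta> P")
  case True
  then show ?thesis
    using NZ_card(1)[OF P g(1,2) True] NZ_card(1)[OF P g(3,2) NZ_trans[OF P g(3,1,2) nz True]] by simp
next
  case False
  then have "\<not> NZ \<gamma> \<beta> P" using NZ_trans[OF P g(1,3,2) NZ_sym[OF P g(3,1) nz]] by blast
  then show ?thesis using False not_NZ_empty P(1) g by simp
qed

lemma NZ_mono:
  assumes "NZ \<alpha> \<beta> P" "R \<subseteq> P"
  shows "NZ \<alpha> \<beta> R"
proof -
  obtain a where a: "a \<in> S" "a \<in> Fx (Rl \<alpha> \<beta> P)" "a \<notin> Kr (Rl \<alpha> \<beta> P)" using assms(1) by (auto simp: NZ_def)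
  then obtain g where g: "g \<in> TT (Rl \<alpha> \<beta> P)" "a g \<notin> m" by (auto simp: Kr_def)
  have sub: "Rl \<alpha> \<beta> R \<subseteq> Rl \<alpha> \<beta> P" using assms(2) by blast
  have "g \<in> TT (Rl \<alpha> \<beta> R)" using g(1) sub unfolding TT_def by blast
  then have "a \<notin> Kr (Rl \<alpha> \<beta> R)" using g(2) unfolding Kr_def by blast
  then show ?thesis using a(1) Fx_mono[OF sub a(2)] unfolding NZ_def by blast
qed

end

subsection \<open>Fusion of the invariant basis\<close>

context source_basis
begin

lemma dg_cs: "dg (cs g P) = Rl (cg g) (cg g) P"
  by (simp add: cs_cg image_image)

text \<open>Choose a block e of P with w e nonzero. Since w = w l, also l e is nonzero. The element
  g^-1 w is P-fixed, so e commutes with it modulo the kernel; hence (g e g^-1) w = w e is nonzero,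
  and w = l w transfers this to l.\<close>

lemma fusion_of_point:
  assumes P: "subgroup P G" "P \<subseteq> D" and g: "g \<in> carrier G" "cs g P \<subseteq> D"
    and w: "w \<in> S" "w \<in> Fx (Rl (cg g) (%x. x) P)" "w \<notin> Kr (Rl (cg g) (%x. x) P)"
  shows "\<exists>e. kprim (ZP P) (KP P) e \<and> l \<star> e \<notin> KP P \<and> l \<star> cj g e \<notin> KP (cs g P)"
proof -
  have pP: "p_subgroup p G P" by (rule psubD[OF P])
  have PG: "P \<subseteq> carrier G" by (rule subgroup.subset[OF P(1)])
  have h: "hm P (cg g)" by (rule hm_cg[OF P(1) g(1)])
  have hi: "hm P (%x. x)" by (rule hm_id[OF P(1)])
  obtain e where e: "kprim (ZP P) (KP P) e" "w \<star> e \<notin> Kr (Rl (cg g) (%x. x) P)"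
    using block_detects[OF pP h w(2,3)] by blast
  have eZP: "e \<in> ZP P" using e(1) by (simp add: kprim_def)
  have "l \<star> e \<notin> KP P"
  proof
    assume "l \<star> e \<in> KP P"
    then have "w \<star> (l \<star> e) \<in> Kr (Rl (cg g) (%x. x) P)" by (rule Kr_mult_right[OF pP h hi hi w(2)])
    moreover have "w \<star> (l \<star> e) = w \<star> l \<star> e" by (simp only: gm_assoc)
    ultimately show False using e(2) by (simp only: S_l'[OF w(1)])
  qed
  moreover have "l \<star> cj g e \<notin> KP (cs g P)"
  proof
    assume H: "l \<star> cj g e \<in> KP (cs g P)"
    have ce: "cj g e \<in> ZP (cs g P)" using kprim_ZP_cj[OF pP g(1) e(1)] by (simp add: kprim_def)
    have "cj g e \<star> l - l \<star> cj g e \<in> KP (cs g P)" by (rule ZP_central[OF ce FP_mono[OF g(2) lF]])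
    then have "(cj g e \<star> l - l \<star> cj g e) + l \<star> cj g e \<in> KP (cs g P)" by (rule Kr_add[OF _ H])
    then have "cj g e \<star> l \<in> Kr (Rl (cg g) (cg g) P)" by (simp add: dg_cs)
    then have "cj g e \<star> l \<star> w \<in> Kr (Rl (cg g) (%x. x) P)" by (rule Kr_mult_left[OF pP h h hi _ w(2)])
    then have 1: "cj g e \<star> w \<in> Kr (Rl (cg g) (%x. x) P)" by (simp only: gm_assoc S_l[OF w(1)])
    define v where "v = el (inv g) \<star> w"
    have vF: "v \<in> FP P" unfolding v_def by (rule Fx_mult[OF el_conj_Fx(2)[OF PG g(1)] w(2)])
    have "el g \<star> (e \<star> v - v \<star> e) \<in> Kr (Rl (cg g) (%x. x) P)"
      by (rule Kr_mult_right[OF pP h hi hi el_conj_Fx(1)[OF PG g(1)] ZP_central[OF eZP vF]])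
    moreover have "el g \<star> (e \<star> v) = cj g e \<star> w" unfolding v_def cj_eq[OF g(1)] by (simp only: gm_assoc)
    moreover have "el g \<star> (v \<star> e) = w \<star> e"
    proof -
      have "el g \<star> (v \<star> e) = el g \<star> el (inv g) \<star> w \<star> e" unfolding v_def by (simp only: gm_assoc)
      also have "el g \<star> el (inv g) = el \<one>" using g(1) by (simp add: el_el)
      also have "el \<one> \<star> w = w" by (rule el_one_left[OF S_GA[OF w(1)]])
      finally show ?thesis .
    qed
    ultimately have 2: "cj g e \<star> w - w \<star> e \<in> Kr (Rl (cg g) (%x. x) P)" by (simp only: gm_diff_right)
    have "cj g e \<star> w - (cj g e \<star> w - w \<star> e) \<in> Kr (Rl (cg g) (%x. x) P)" by (rule Kr_diff[OF 1 2])
    then show False using e(2) by simp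
  qed
  ultimately show ?thesis using e(1) by blast
qed

text \<open>By the trace formula \<open>eD\<close> lies in the ideal of \<open>l\<close> modulo the
  kernel, so \<open>l\<close> can serve as the one idempotent on which the order of pairs is
  tested.\<close>

lemma bp_le_source:
  assumes P: "subgroup P G" "P \<subseteq> D" and e: "kprim (ZP P) (KP P) e" "l \<star> e \<notin> KP P"
  shows "bp_le m G (P, e) (D, eD)"
proof -
  obtain \<alpha> \<beta> where ab: "\<alpha> \<in> FP D" "\<beta> \<in> FP D" "b - tr D (carrier G) (\<alpha> \<star> l \<star> \<beta>) \<in> M0" using source_trace by blast
  obtain v where v: "v \<in> gid D l" "eD - v \<in> KP D"
    using block_in_own_ideal[OF D ab(1,2) lprim ab(3) bFD eprim eb leK] by blast
  have "e \<in> ZP P" using e(1) by (simp add: kprim_def)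
  then show ?thesis by (rule bp_leI[OF D lprim v eprim psubD[OF P] P(2) _ e(2)])
qed

lemma conj_pair_eq: "conj_pair G g (P, e) = (cs g P, cj g e)"
  by (simp add: conj_pair_def cs_def)

lemma fus_homI:
  assumes P: "subgroup P G" "P \<subseteq> D" and g: "g \<in> carrier G" "cs g P \<subseteq> D"
    and e: "kprim (ZP P) (KP P) e" "l \<star> e \<notin> KP P" "l \<star> cj g e \<notin> KP (cs g P)"
  shows "fus_hom m p G D eD P D (cg g)"
proof -
  have pP: "p_subgroup p G P" by (rule psubD[OF P])
  have 1: "brauer_pair m p G P e" using pP e(1) brauer_block_iff[OF pP] by (simp add: brauer_pair_def)
  have 2: "bp_le m G (P, e) (D, eD)" by (rule bp_le_source[OF P e(1,2)])
  have 3: "brauer_pair m p G D eD" using D eprim brauer_block_iff[OF D] by (simp add: brauer_pair_def)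
  have 4: "bp_le m G (D, eD) (D, eD)" by (simp add: bp_le_def)
  have 5: "bp_le m G (conj_pair G g (P, e)) (D, eD)"
    unfolding conj_pair_eq by (rule bp_le_source[OF cs_subgroup[OF P(1) g(1)] g(2) kprim_ZP_cj[OF pP g(1) e(1)] e(3)])
  have 6: "\<forall>x\<in>P. cg g x = g \<otimes> x \<otimes> inv g" by (simp add: cg_def)
  show ?thesis unfolding fus_hom_def using P sD g(1) 1 2 3 4 5 6 by blast
qed

lemma gr_cg: "subgroup P G ==> g \<in> carrier G ==> cs g P \<subseteq> D ==> gr P (cg g)"
  by (simp add: gr_def hm_cg inj_cg cs_cg)

text \<open>The block e lies, modulo the kernel, in the ideal generated by x l x^-1. Tested against
  l it gives a nonzero element for c_(x^-1) and the inclusion; tested against g^-1 l g it gives one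
  for c_(x^-1) and c_g. Symmetry and transitivity of nonvanishing then remove x.\<close>

lemma NZ_of_blocks:
  assumes P: "subgroup P G" "P \<subseteq> D" and g: "g \<in> carrier G" "cs g P \<subseteq> D"
    and e: "kprim (ZP P) (KP P) e" "l \<star> e \<notin> KP P" "l \<star> cj g e \<notin> KP (cs g P)"
  shows "NZ (cg g) (%x. x) P"
proof -
  have pP: "p_subgroup p G P" by (rule psubD[OF P])
  have PG: "P \<subseteq> carrier G" by (rule subgroup.subset[OF P(1)])
  interpret Z: algebra_mod G m p "FP P" "KP P" by (rule algebra_mod_KP[OF pP])
  have lP: "l \<in> FP P" by (rule FP_mono[OF P(2) lF])
  have bP: "b \<in> FP P" by (rule FP_mono[OF P(2) bFD])
  have eZP: "e \<in> ZP P" using e(1) by (simp add: kprim_def)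
  have ebP: "e \<star> b - e \<in> KP P"
    by (rule block_covers[OF pP e(1) lP e(2) bF bb]) (simp add: lb)
  obtain \<alpha> \<beta> where ab: "\<alpha> \<in> FP D" "\<beta> \<in> FP D" "b - tr D (carrier G) (\<alpha> \<star> l \<star> \<beta>) \<in> M0" using source_trace by blast
  obtain x v where x: "x \<in> WW P D" and v: "v \<in> gid P (cj x l)" "e - v \<in> KP P"
    using block_in_ideal[OF pP sD ab(1,2) lF ab(3) bP e(1) ebP] by blast
  have xc: "x \<in> carrier G" and ix: "inv x \<in> carrier G" using x by (auto simp: WW_def)
  have ig: "inv g \<in> carrier G" using g(1) by simp
  have xlP: "cj x l \<in> FP P" by (rule WW_cj_FP[OF P(1) sD x lF])
  have vF: "v \<in> FP P" by (rule gid_FP[OF xlP v(1)])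
  \<comment> \<open>An element y not killed by e is not killed by the ideal of x l x^-1, so some
    product x l x^-1 \<beta> y survives.\<close>
  have detect: "\<exists>\<beta>\<in>FP P. cj x l \<star> \<beta> \<star> y \<notin> KP P" if y: "y \<in> FP P" "y \<star> e \<notin> KP P" for y
  proof -
    have 1: "e \<star> y \<approx>\<^bsub>KP P\<^esub> y \<star> e" unfolding eqm_def by (rule ZP_central[OF eZP y(1)])
    have "e \<approx>\<^bsub>KP P\<^esub> v" using v(2) by (simp only: eqm_def)
    then have 2: "e \<star> y \<approx>\<^bsub>KP P\<^esub> v \<star> y" by (rule Z.eq_right[OF _ y(1)])
    have "v \<star> y \<notin> KP P" using Z.eq_K[OF 1] Z.eq_K[OF 2] y(2) by simp
    then show ?thesis by (rule gid_ne[OF pP v(1)])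
  qed
  have hi: "hm P (%x. x)" by (rule hm_id[OF P(1)])
  have hx: "hm P (cg (inv x))" by (rule hm_cg[OF P(1) ix])
  have hg: "hm P (cg g)" by (rule hm_cg[OF P(1) g(1)])
  have xsub: "cs (inv x) P \<subseteq> D" using x xc by (auto simp: cs_def WW_def)
  have gx: "gr P (cg (inv x))" by (rule gr_cg[OF P(1) ix xsub])
  have gg: "gr P (cg g)" by (rule gr_cg[OF P(1) g])
  have gi: "gr P (%x. x)" by (rule gr_id[OF P])
  have elx: "el (inv x) \<in> Fx (Rl (cg (inv x)) (%x. x) P)" by (rule el_conj_Fx(1)[OF PG ix])
  have elx': "el x \<in> Fx (Rl (%x. x) (cg (inv x)) P)" using el_conj_Fx(2)[OF PG ix] xc by simp
  have elg: "el (inv g) \<in> Fx (Rl (%x. x) (cg g) P)" by (rule el_conj_Fx(2)[OF PG g(1)])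
  have elg': "el g \<in> Fx (Rl (cg g) (%x. x) P)" by (rule el_conj_Fx(1)[OF PG g(1)])
  have xl: "el (inv x) \<star> cj x l = l \<star> el (inv x)"
  proof -
    have "el (inv x) \<star> cj x l = el (inv x) \<star> el x \<star> l \<star> el (inv x)" by (simp only: cj_eq[OF xc] gm_assoc)
    also have "el (inv x) \<star> el x = el \<one>" using xc by (simp add: el_el)
    also have "el \<one> \<star> l = l" by (rule el_one_left[OF S_GA[OF l_S]])
    finally show ?thesis .
  qed
  have xx: "el x \<star> (el (inv x) \<star> y) = y" if "y \<in> GA" for y
  proof -
    have "el x \<star> (el (inv x) \<star> y) = el x \<star> el (inv x) \<star> y" by (simp only: gm_assoc)
    also have "el x \<star> el (inv x) = el \<one>" using xc by (simp add: el_el)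
    finally show ?thesis using el_one_left[OF that] by simp
  qed
  have nz1: "NZ (cg (inv x)) (%x. x) P"
  proof -
    obtain \<beta> where be: "\<beta> \<in> FP P" "cj x l \<star> \<beta> \<star> l \<notin> KP P" using detect[OF lP e(2)] by blast
    let ?a = "el (inv x) \<star> (cj x l \<star> \<beta> \<star> l)"
    have "?a = el (inv x) \<star> cj x l \<star> (\<beta> \<star> l)" by (simp only: gm_assoc)
    also have "\<dots> = l \<star> (el (inv x) \<star> \<beta>) \<star> l" unfolding xl by (simp only: gm_assoc)
    finally have aS: "?a \<in> S" by (simp only: S_lal)
    have yF: "cj x l \<star> \<beta> \<star> l \<in> FP P" by (rule FP_mult[OF FP_mult[OF xlP be(1)] lP])
    have aF: "?a \<in> Fx (Rl (cg (inv x)) (%x. x) P)" by (rule Fx_mult[OF elx yF])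
    have "?a \<notin> Kr (Rl (cg (inv x)) (%x. x) P)"
    proof
      assume "?a \<in> Kr (Rl (cg (inv x)) (%x. x) P)"
      then have "el x \<star> ?a \<in> KP P" by (rule Kr_mult_right[OF pP hi hx hi elx'])
      then show False using be(2) by (simp only: xx[OF gm_in])
    qed
    then show ?thesis using aS aF unfolding NZ_def by blast
  qed
  have nz2: "NZ (cg (inv x)) (cg g) P"
  proof -
    have csi: "cs (inv g) (cs g P) = P" by (rule cs_inv(1)[OF PG g(1)])
    have "cj (inv g) l \<in> FP (cs (inv g) (cs g P))"
      by (rule cj_FP[OF cs_subgroup[OF P(1) g(1)] ig FP_mono[OF g(2) lF]])
    then have glP: "cj (inv g) l \<in> FP P" by (simp only: csi)
    have "cj g (cj (inv g) l \<star> e) = l \<star> cj g e" using cj_inv(1)[OF g(1) S_GA[OF l_S]] by (simp add: cj_mult[OF g(1)])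
    then have "cj (inv g) l \<star> e \<notin> KP P" using e(3) cj_transport(2)[OF P(1) g(1) gm_in, of "cj (inv g) l" e] by simp
    then obtain \<beta> where be: "\<beta> \<in> FP P" "cj x l \<star> \<beta> \<star> cj (inv g) l \<notin> KP P" using detect[OF glP] by blast
    have gl: "cj (inv g) l \<star> el (inv g) = el (inv g) \<star> l"
    proof -
      have "cj (inv g) l \<star> el (inv g) = el (inv g) \<star> l \<star> (el g \<star> el (inv g))"
        using g(1) by (simp add: cj_eq[OF ig] gm_assoc)
      also have "el g \<star> el (inv g) = el \<one>" using g(1) by (simp add: el_el)
      finally show ?thesis by (simp add: gm_assoc el_one_right[OF S_GA[OF l_S]])
    qed
    let ?y = "cj x l \<star> \<beta> \<star> cj (inv g) l"
    let ?a = "el (inv x) \<star> ?y \<star> el (inv g)"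
    have "?a = el (inv x) \<star> cj x l \<star> \<beta> \<star> (cj (inv g) l \<star> el (inv g))" by (simp only: gm_assoc)
    also have "\<dots> = l \<star> (el (inv x) \<star> \<beta> \<star> el (inv g)) \<star> l" unfolding xl gl by (simp only: gm_assoc)
    finally have aS: "?a \<in> S" by (simp only: S_lal)
    have yF: "?y \<in> FP P" by (rule FP_mult[OF FP_mult[OF xlP be(1)] glP])
    have aF: "?a \<in> Fx (Rl (cg (inv x)) (cg g) P)" by (rule Fx_mult[OF Fx_mult[OF elx yF] elg])
    have "?a \<notin> Kr (Rl (cg (inv x)) (cg g) P)"
    proof
      assume "?a \<in> Kr (Rl (cg (inv x)) (cg g) P)"
      then have "el x \<star> ?a \<in> Kr (Rl (%x. x) (cg g) P)" by (rule Kr_mult_right[OF pP hi hx hg elx'])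
      then have "el x \<star> ?a \<star> el g \<in> KP P" by (rule Kr_mult_left[OF pP hi hg hi _ elg'])
      moreover have "el x \<star> ?a \<star> el g = ?y"
      proof -
        have "el x \<star> ?a \<star> el g = el x \<star> (el (inv x) \<star> (?y \<star> (el (inv g) \<star> el g)))" by (simp only: gm_assoc)
        also have "\<dots> = ?y \<star> (el (inv g) \<star> el g)" by (rule xx[OF gm_in])
        also have "el (inv g) \<star> el g = el \<one>" using g(1) by (simp add: el_el)
        finally show ?thesis by (simp only: el_one_right[OF gm_in])
      qed
      ultimately show False using be(2) by simp
    qed
    then show ?thesis using aS aF unfolding NZ_def by blast
  qed
  show ?thesis by (rule NZ_trans[OF P gg gx gi NZ_sym[OF P gx gg nz2] nz1])
qed

text \<open>\<open>l\<close> is one of the primitive idempotents over which the order of pairs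
  quantifies, so each inclusion of pairs turns into a nonvanishing product with
  \<open>l\<close>.\<close>

lemma fus_hom_NZ:
  assumes "fus_hom m p G D eD P D phi"
  shows "subgroup P G" "P \<subseteq> D" "\<exists>g\<in>carrier G. (\<forall>x\<in>P. phi x = cg g x) \<and> cs g P \<subseteq> D \<and> NZ (cg g) (%x. x) P"
proof -
  show P: "subgroup P G" "P \<subseteq> D" using assms by (simp_all add: fus_hom_def)
  obtain g eP eQ where g: "g \<in> carrier G" and bp: "brauer_pair m p G P eP" "bp_le m G (P, eP) (D, eD)"
    "bp_le m G (D, eQ) (D, eD)" "bp_le m G (cs g P, cj g eP) (D, eQ)" and phi: "\<forall>x\<in>P. phi x = cg g x"
    using assms unfolding fus_hom_def conj_pair_eq cg_def by blast
  have pl: "prim_idem (gmult G) (ogfix G D) l" using lprim_idem by (simp only: ogfix_eq[OF sD])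
  have k: "kprim (ZP P) (KP P) eP" using bp(1) brauer_block_iff[OF psubD[OF P]] by (simp add: brauer_pair_def)
  have le': "l \<star> eD \<notin> ogker m G D" using leK ogker_iff[OF D FP_mult[OF lF eF]] by simp
  have "l \<star> eP \<notin> ogker m G P" using bp(2) pl le' by (simp add: bp_le_def)
  then have 1: "l \<star> eP \<notin> KP P" using KP_subset_ogker[OF psubD[OF P]] by blast
  have "l \<star> eQ \<notin> ogker m G D" using bp(3) pl le' by (simp add: bp_le_def)
  then have 2: "cs g P \<subseteq> D" "l \<star> cj g eP \<notin> ogker m G (cs g P)" using bp(4) pl by (simp_all add: bp_le_def)
  then have 3: "l \<star> cj g eP \<notin> KP (cs g P)" using KP_subset_ogker[OF cs_psub[OF psubD[OF P] g]] by blast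
  show "\<exists>g\<in>carrier G. (\<forall>x\<in>P. phi x = cg g x) \<and> cs g P \<subseteq> D \<and> NZ (cg g) (%x. x) P"
    using g phi 2(1) NZ_of_blocks[OF P g 2(1) k 1 3] by blast
qed

section \<open>Stabilizers, duality and fusion stability of the basis\<close>

lemma DDsub: "subgroup (D \<times> D) (G \<times>\<times> G)" by (rule DirProd_subgroups[OF is_group sD is_group sD])

lemma sub_ddsub:
  assumes "subgroup H (G \<times>\<times> G)" "H \<subseteq> D \<times> D" "subgroup K ((G \<times>\<times> G)\<lparr>carrier := H\<rparr>)"
  shows "ddsub K" "K \<subseteq> H"
proof -
  show "K \<subseteq> H" using subgroup.subset[OF assms(3)] by simp
  then show "ddsub K" unfolding ddsub_def using group.incl_subgroup[OF GG assms(1,3)] assms(2) by blast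
qed

text \<open>From s g = g t one reads off s = g t g^-1, so a single fixed group element makes K the
  graph of a conjugation on its second projection.\<close>

lemma graph_of_TT:
  assumes K: "ddsub K" and g: "g \<in> TT K"
  shows "subgroup (snd ` K) G" "snd ` K \<subseteq> D" "cs g (snd ` K) \<subseteq> D" "K = Rl (cg g) (%x. x) (snd ` K)"
proof -
  interpret KK: subgroup K "G \<times>\<times> G" using K by (simp add: ddsub_def)
  have KD: "s \<in> D" "t \<in> D" if "(s, t) \<in> K" for s t using K that by (auto simp: ddsub_def)
  have gc: "g \<in> carrier G" using g by (simp add: TT_def)
  have st: "s = cg g t" if h: "(s, t) \<in> K" for s t
  proof -
    have "s \<otimes> g = g \<otimes> t" "s \<in> carrier G" using g h KD[OF h] Dc by (auto simp: TT_def)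
    then show ?thesis using gc KD[OF h] Dc by (metis cg_def inv_solve_right m_closed)
  qed
  show "snd ` K \<subseteq> D" using KD by auto
  show "subgroup (snd ` K) G"
  proof (rule subgroupI)
    show "snd ` K \<subseteq> carrier G" using KD Dc by auto
    show "snd ` K ~= {}" using KK.one_closed by blast
    fix a assume "a \<in> snd ` K"
    then obtain s where s: "(s, a) \<in> K" by auto
    have "inv\<^bsub>G \<times>\<times> G\<^esub> (s, a) = (inv s, inv a)" using KD[OF s] Dc by (simp add: inv_DirProd[OF is_group is_group])
    then show "inv a \<in> snd ` K" using KK.m_inv_closed[OF s] by force
    fix c assume "c \<in> snd ` K"
    then obtain t where t: "(t, c) \<in> K" by auto
    show "a \<otimes> c \<in> snd ` K" using KK.m_closed[OF s t] by force
  qed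
  show E: "K = Rl (cg g) (%x. x) (snd ` K)"
  proof
    show "K \<subseteq> Rl (cg g) (%x. x) (snd ` K)" using st by force
    show "Rl (cg g) (%x. x) (snd ` K) \<subseteq> K" using st by force
  qed
  show "cs g (snd ` K) \<subseteq> D"
  proof
    fix y assume "y \<in> cs g (snd ` K)"
    then obtain s t where h: "(s, t) \<in> K" "y = cg g t" unfolding cs_cg by auto
    then show "y \<in> D" using st[OF h(1)] KD[OF h(1)] by simp
  qed
qed

lemma fixset_ac: "ddsub K ==> fixset ac K X = X \<inter> Fx K"
  unfolding fixset_def using Fx_ac[OF ddsub_carrier X_GA] by blast

lemma stab_ddsub:
  assumes w: "w \<in> X"
  shows "ddsub {h \<in> D \<times> D. ac h w = w}" "w \<in> Fx {h \<in> D \<times> D. ac h w = w}"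
proof -
  have "subgroup {h \<in> carrier ((G \<times>\<times> G)\<lparr>carrier := D \<times> D\<rparr>). ac h w = w} ((G \<times>\<times> G)\<lparr>carrier := D \<times> D\<rparr>)"
    by (rule subgroup_stabilizer[OF group.subgroup_imp_group[OF GG DDsub] ac_action[OF subset_refl] w])
  then have "subgroup {h \<in> D \<times> D. ac h w = w} ((G \<times>\<times> G)\<lparr>carrier := D \<times> D\<rparr>)" by simp
  then show dd: "ddsub {h \<in> D \<times> D. ac h w = w}" by (rule sub_ddsub(1)[OF DDsub subset_refl])
  show "w \<in> Fx {h \<in> D \<times> D. ac h w = w}" using Fx_ac[OF ddsub_carrier[OF dd] X_GA[OF w]] by blast
qed

text \<open>The stabilizer of w in D x D fixes some group element, hence contains no (s, 1) or (1,
  s) except the identity.\<close>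

lemma free:
  assumes w: "w \<in> X" and s: "s \<in> D"
  shows "el s \<star> w = w ==> s = \<one>" "w \<star> el s = w ==> s = \<one>"
proof -
  let ?K = "{h \<in> D \<times> D. ac h w = w}"
  obtain g where g: "g \<in> TT ?K" using X_TT[OF stab_ddsub(1)[OF w] w stab_ddsub(2)[OF w]] by blast
  have gc: "g \<in> carrier G" and sc: "s \<in> carrier G" using g Dc[OF s] by (auto simp: TT_def)
  have oD: "\<one> \<in> D" by (rule subgroup.one_closed[OF sD])
  have wG: "w \<in> GA" by (rule X_GA[OF w])
  show "s = \<one>" if "el s \<star> w = w"
  proof -
    have "ac (s, \<one>) w = w" using that wG by (simp add: ac_def el_one_right)
    then have "(s, \<one>) \<in> ?K" using s oD by simp
    then have "s \<otimes> g = g" using g gc by (auto simp: TT_def)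
    then show ?thesis using gc sc by simp
  qed
  show "s = \<one>" if "w \<star> el s = w"
  proof -
    have "el \<one> \<star> w = w \<star> el s" using that wG by (simp add: el_one_left)
    then have "ac (\<one>, s) w = w" using ac_fix[of \<one> s w] sc wG by simp
    then have "(\<one>, s) \<in> ?K" using s oD by simp
    then have "g = g \<otimes> s" using g gc using TT_inv_eq sc by fastforce
    then show ?thesis using gc sc by simp
  qed
qed

lemma point_stabilizer:
  assumes w: "w \<in> X"
  shows "\<exists>P phi. subgroup P G \<and> P \<subseteq> D \<and> fus_hom m p G D eD P D phi \<and>
    {(s, t). s \<in> D \<and> t \<in> D \<and> lact G l s w = ract G l w t} = Delta phi P"
proof -
  let ?K = "{h \<in> D \<times> D. ac h w = w}"
  have dd: "ddsub ?K" and wF: "w \<in> Fx ?K" using stab_ddsub[OF w] .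
  obtain g where g: "g \<in> TT ?K" "w g \<notin> m" using X_TT[OF dd w wF] by blast
  have gc: "g \<in> carrier G" using g by (simp add: TT_def)
  note gr = graph_of_TT[OF dd g(1)]
  have wK: "w \<notin> Kr ?K" using g unfolding Kr_def by blast
  obtain e where e: "kprim (ZP (snd ` ?K)) (KP (snd ` ?K)) e" "l \<star> e \<notin> KP (snd ` ?K)" "l \<star> cj g e \<notin> KP (cs g (snd ` ?K))"
    using fusion_of_point[OF gr(1,2) gc gr(3) XS[OF w]] wF wK unfolding gr(4)[symmetric] by blast
  have "fus_hom m p G D eD (snd ` ?K) D (cg g)" by (rule fus_homI[OF gr(1,2) gc gr(3) e])
  moreover have "{(s, t). s \<in> D \<and> t \<in> D \<and> lact G l s w = ract G l w t} = ?K"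
    using ac_fix[OF Dc Dc X_GA[OF w]] by (auto simp: lact_eq[OF XS[OF w]] ract_eq[OF XS[OF w]])
  moreover have "?K = Delta (cg g) (snd ` ?K)" unfolding Delta_Rl by (rule gr(4))
  ultimately show ?thesis using gr(1,2) by auto
qed

text \<open>Marks of X and of its opposite are compared at each K in D x D. If K fixes no group
  element both are zero. Otherwise K is the graph of some c_g, and the two marks count fixed points
  for a morphism and for its inverse.\<close>

lemma self_dual:
  "\<exists>beta. bij_betw beta X X \<and> (\<forall>s\<in>D. \<forall>t\<in>D. \<forall>w\<in>X. beta (ract G l (lact G l s w) t) = ract G l (lact G l (inv t) (beta w)) (inv s))"
proof -
  let ?H = "(G \<times>\<times> G)\<lparr>carrier := D \<times> D\<rparr>"
  let ?b = "%h. ac (snd h, fst h)"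
  have card: "card (fixset ac K X) = card (fixset ?b K X)" if K: "subgroup K ?H" for K
  proof -
    have dd: "ddsub K" and KDD: "K \<subseteq> D \<times> D" using sub_ddsub[OF DDsub subset_refl K] .
    let ?K' = "(%h. (snd h, fst h)) ` K"
    have KC: "?K' \<subseteq> carrier G \<times> carrier G" using KDD Dc by auto
    have fb: "fixset ?b K X = X \<inter> Fx ?K'"
      unfolding fixset_def using Fx_ac[OF KC X_GA] by auto
    show ?thesis
    proof (cases "TT K = {}")
      case True
      have "X \<inter> Fx K = {}" using X_TT[OF dd] True by blast
      moreover have "X \<inter> Fx ?K' = {}"
      proof (rule ccontr)
        assume "X \<inter> Fx ?K' ~= {}"
        then obtain w where w: "w \<in> X" "w \<in> Fx ?K'" by blast
        have sub: "?K' \<subseteq> {h \<in> D \<times> D. ac h w = w}" using KDD w(2) Fx_ac[OF KC X_GA[OF w(1)]] by auto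
        obtain g where g: "g \<in> TT {h \<in> D \<times> D. ac h w = w}"
          using X_TT[OF stab_ddsub(1)[OF w(1)] w(1) stab_ddsub(2)[OF w(1)]] by blast
        have gc: "g \<in> carrier G" using g by (simp add: TT_def)
        have "s \<otimes> inv g = inv g \<otimes> t" if st: "(s, t) \<in> K" for s t
        proof -
          have "(t, s) \<in> ?K'" using st by force
          then have "t \<otimes> g = g \<otimes> s" using g sub unfolding TT_def by blast
          moreover have "s \<in> carrier G" "t \<in> carrier G" using KDD st Dc by auto
          ultimately show ?thesis using gc by (metis inv_closed inv_solve_left inv_solve_right m_assoc m_closed)
        qed
        then have "inv g \<in> TT K" using gc by (auto simp: TT_def)
        then show False using True by blast
      qed
      ultimately show ?thesis unfolding fixset_ac[OF dd] fb by simp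
    next
      case False
      then obtain g where g: "g \<in> TT K" by blast
      have gc: "g \<in> carrier G" using g by (simp add: TT_def)
      note gr = graph_of_TT[OF dd g]
      have K': "?K' = Rl (%x. x) (cg g) (snd ` K)"
      proof -
        have "?K' = (%h. (snd h, fst h)) ` Rl (cg g) (%x. x) (snd ` K)" using gr(4) by (rule arg_cong)
        also have "\<dots> = Rl (%x. x) (cg g) (snd ` K)" by (simp add: image_image)
        finally show ?thesis .
      qed
      have "card (X \<inter> Fx (Rl (cg g) (%x. x) (snd ` K))) = card (X \<inter> Fx (Rl (%x. x) (cg g) (snd ` K)))"
        by (rule card_swap[OF gr(1,2) gr_cg[OF gr(1) gc gr(3)] gr_id[OF gr(1,2)]])
      then show ?thesis unfolding fixset_ac[OF dd] fb K' using gr(4) by simp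
    qed
  qed
  have fH: "finite (carrier ?H)" using finD by simp
  have act: "is_action ?H ?b X"
    unfolding is_action_def using Dc by (auto simp: ac_X ac_one X_GA ac_ac)
  obtain beta where be: "bij_betw beta X X" "!!h x. h \<in> D \<times> D ==> x \<in> X ==> beta (ac h x) = ?b h (beta x)"
    using marks_determine_action[OF group.subgroup_imp_group[OF GG DDsub] fH finX finX ac_action[OF subset_refl] act card] by auto
  have "beta (ract G l (lact G l s w) t) = ract G l (lact G l (inv t) (beta w)) (inv s)" if st: "s \<in> D" "t \<in> D" and w: "w \<in> X" for s t w
  proof -
    have bw: "beta w \<in> X" using be(1) w by (auto simp: bij_betw_def)
    have "ract G l (lact G l s w) t = ac (s, inv t) w"
      using st Dc by (simp add: lact_eq[OF XS[OF w]] ract_eq S_el XS[OF w] ac_def)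
    moreover have "ract G l (lact G l (inv t) (beta w)) (inv s) = ac (inv t, s) (beta w)"
      using st Dinv by (simp add: lact_eq[OF XS[OF bw]] ract_eq S_el XS[OF bw] ac_def)
    ultimately show ?thesis using be(2)[of "(s, inv t)" w] st Dinv w by simp
  qed
  then show ?thesis using be(1) by blast
qed

text \<open>Both bisets are actions of P x D on X, the second one twisted by c_g. At the graph of
  c_h on R, with c_h(R) inside P, the twist replaces c_h by c_g c_h, and nonvanishing of c_g
  restricted to c_h(R) transfers the number of fixed points.\<close>

lemma fusion_stable:
  assumes F: "fus_hom m p G D eD P D phi"
  shows "\<exists>beta. bij_betw beta X X \<and> (\<forall>q\<in>P. \<forall>s\<in>D. \<forall>w\<in>X. beta (ract G l (lact G l q w) s) = ract G l (lact G l (phi q) (beta w)) s)"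
proof -
  have P: "subgroup P G" "P \<subseteq> D" using fus_hom_NZ(1,2)[OF F] .
  obtain g where g: "g \<in> carrier G" "\<forall>x\<in>P. phi x = cg g x" "cs g P \<subseteq> D" and nz: "NZ (cg g) (%x. x) P"
    using fus_hom_NZ(3)[OF F] by blast
  have PD: "subgroup (P \<times> D) (G \<times>\<times> G)" by (rule DirProd_subgroups[OF is_group P(1) is_group sD])
  have PDD: "P \<times> D \<subseteq> D \<times> D" using P(2) by blast
  have cgD: "cg g q \<in> D" if "q \<in> P" for q using g(3) that by (auto simp: cs_cg)
  have Pc: "q \<in> carrier G" if "q \<in> P" for q using P(2) Dc that by blast
  let ?H = "(G \<times>\<times> G)\<lparr>carrier := P \<times> D\<rparr>"
  let ?b = "%h. ac (cg g (fst h), snd h)"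
  have card: "card (fixset ac K X) = card (fixset ?b K X)" if K: "subgroup K ?H" for K
  proof -
    have dd: "ddsub K" and KPD: "K \<subseteq> P \<times> D" using sub_ddsub[OF PD PDD K] .
    let ?K' = "(%h. (cg g (fst h), snd h)) ` K"
    have KC: "?K' \<subseteq> carrier G \<times> carrier G" using KPD Dc cgD by auto
    have fb: "fixset ?b K X = X \<inter> Fx ?K'"
      unfolding fixset_def using Fx_ac[OF KC X_GA] by auto
    show ?thesis
    proof (cases "TT K = {}")
      case True
      have "X \<inter> Fx K = {}" using X_TT[OF dd] True by blast
      moreover have "X \<inter> Fx ?K' = {}"
      proof (rule ccontr)
        assume "X \<inter> Fx ?K' ~= {}"
        then obtain w where w: "w \<in> X" "w \<in> Fx ?K'" by blast
        \<comment> \<open>A point fixed by the twisted group provides a group element h fixed by it,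
          and then g^-1 h is fixed by K itself.\<close>
        have sub: "?K' \<subseteq> {h \<in> D \<times> D. ac h w = w}" using KPD cgD w(2) Fx_ac[OF KC X_GA[OF w(1)]] by auto
        obtain h where h: "h \<in> TT {h \<in> D \<times> D. ac h w = w}"
          using X_TT[OF stab_ddsub(1)[OF w(1)] w(1) stab_ddsub(2)[OF w(1)]] by blast
        have hc: "h \<in> carrier G" using h by (simp add: TT_def)
        have "q \<otimes> (inv g \<otimes> h) = inv g \<otimes> h \<otimes> t" if qt: "(q, t) \<in> K" for q t
        proof -
          have "(cg g q, t) \<in> ?K'" using qt by force
          then have "cg g q \<otimes> h = h \<otimes> t" using h sub unfolding TT_def by blast
          then have "inv g \<otimes> (cg g q \<otimes> h) = inv g \<otimes> (h \<otimes> t)" by simp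
          moreover have "q \<in> carrier G" "t \<in> carrier G" using KPD qt Dc Pc by auto
          ultimately show ?thesis using hc g(1) by (simp add: cg_def m_assoc icancel)
        qed
        then have "inv g \<otimes> h \<in> TT K" using hc g(1) by (auto simp: TT_def)
        then show False using True by blast
      qed
      ultimately show ?thesis unfolding fixset_ac[OF dd] fb by simp
    next
      case False
      then obtain h where h: "h \<in> TT K" by blast
      have hc: "h \<in> carrier G" using h by (simp add: TT_def)
      note gr = graph_of_TT[OF dd h]
      let ?R = "snd ` K"
      have hR: "cg h ` ?R \<subseteq> P"
      proof
        fix y assume "y \<in> cg h ` ?R"
        then obtain t where t: "t \<in> ?R" "y = cg h t" by blast
        then have "(y, t) \<in> K" using gr(4) by blast
        then show "y \<in> P" using KPD by auto
      qed
      have K': "?K' = Rl (%x. cg g (cg h x)) (%x. x) ?R"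
      proof -
        have "?K' = (%h. (cg g (fst h), snd h)) ` Rl (cg h) (%x. x) ?R" using gr(4) by (rule arg_cong)
        also have "\<dots> = Rl (%x. cg g (cg h x)) (%x. x) ?R" by (simp add: image_image)
        finally show ?thesis .
      qed
      have gh: "gr ?R (cg h)" by (rule gr_cg[OF gr(1) hc gr(3)])
      have ggh: "gr ?R (%x. cg g (cg h x))"
        unfolding gr_def
      proof (intro conjI)
        show "hm ?R (%x. cg g (cg h x))"
          using gr_hm[OF gh] cgD Dc hR g(1) unfolding hm_def by (auto simp: cg_mult image_subset_iff)
        have "inj_on (cg g) (cg h ` ?R)" by (rule inj_on_subset[OF inj_cg[OF P(1) g(1)] hR])
        then have "inj_on (cg g \<circ> cg h) ?R" using gh by (intro comp_inj_on) (simp_all add: gr_def)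
        then show "inj_on (%x. cg g (cg h x)) ?R" by (simp add: comp_def)
        show "(%x. cg g (cg h x)) ` ?R \<subseteq> D" using hR cgD by auto
      qed
      \<comment> \<open>Reparametrizing by c_h turns the restriction of c_g to c_h(R) into the pair
        (c_g c_h, c_h) on R.\<close>
      have "Rl (cg g) (%x. x) (cg h ` ?R) = Rl (%x. cg g (cg h x)) (cg h) ?R" by (simp add: image_image)
      then have nz': "NZ (%x. cg g (cg h x)) (cg h) ?R" using NZ_mono[OF nz hR] unfolding NZ_def by simp
      have "card (X \<inter> Fx (Rl (cg h) (%x. x) ?R)) = card (X \<inter> Fx (Rl (%x. cg g (cg h x)) (%x. x) ?R))"
        by (rule card_transfer[OF gr(1,2) gh gr_id[OF gr(1,2)] ggh nz'])
      then show ?thesis unfolding fixset_ac[OF dd] fb K' using gr(4) by simp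
    qed
  qed
  have fH: "finite (carrier ?H)" using finD finite_subset[OF P(2)] by simp
  have act: "is_action ?H ?b X"
    unfolding is_action_def using Dc cgD Pc g(1) by (auto simp: ac_X ac_ac cg_mult) (simp add: cg_def ac_one X_GA)
  obtain beta where be: "bij_betw beta X X" "!!h x. h \<in> P \<times> D ==> x \<in> X ==> beta (ac h x) = ?b h (beta x)"
    using marks_determine_action[OF group.subgroup_imp_group[OF GG PD] fH finX finX ac_action[OF PDD] act card] by auto
  have "beta (ract G l (lact G l q w) s) = ract G l (lact G l (phi q) (beta w)) s" if qs: "q \<in> P" "s \<in> D" and w: "w \<in> X" for q s w
  proof -
    have bw: "beta w \<in> X" using be(1) w by (auto simp: bij_betw_def)
    have qD: "q \<in> D" using qs P by blast
    have "ract G l (lact G l q w) s = ac (q, inv s) w"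
      using qs qD Dc by (simp add: lact_eq[OF XS[OF w]] ract_eq S_el XS[OF w] ac_def)
    moreover have "ract G l (lact G l (phi q) (beta w)) s = ac (cg g q, inv s) (beta w)"
      using qs g(2) cgD Dc by (simp add: lact_eq[OF XS[OF bw]] ract_eq S_el XS[OF bw] ac_def)
    ultimately show ?thesis using be(2)[of "(q, inv s)" w] qs Dinv w by simp
  qed
  then show ?thesis using be(1) by blast
qed

end

subsection \<open>The multiplicity of the biset\<close>

context source_basis
begin

interpretation L: primitive_mod G m p "FP D" "M0 \<inter> FP D" l
  by (rule primitive_modI[OF lprim])

interpretation Z: algebra_mod G m p "FP D" "KP D"
  by (rule algebra_mod_KP[OF D])

text \<open>C_G(D); \<open>Zd\<close> below is the centre Z(D).\<close>

definition Cd :: "'g set" where "Cd = TT (dg D)"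

definition Zd :: "'g set" where "Zd = D \<inter> Cd"

lemma sC: "subgroup Cd G" and CG: "c \<in> Cd ==> c \<in> carrier G" and C_comm: "c \<in> Cd ==> d \<in> D ==> d \<otimes> c = c \<otimes> d"
proof -
  show "subgroup Cd G" unfolding Cd_def by (rule subgroup_centralizer[OF DG])
  show "c \<in> Cd ==> c \<in> carrier G" "c \<in> Cd ==> d \<in> D ==> d \<otimes> c = c \<otimes> d" by (auto simp: Cd_def TT_dg)
qed

lemma sZ: "subgroup Zd G" and ZD: "z \<in> Zd ==> z \<in> D" and ZC: "z \<in> Zd ==> z \<in> Cd" and finZ: "finite Zd" and finC: "finite Cd"
proof -
  show "subgroup Zd G" unfolding Zd_def by (rule subgroups_Inter_pair[OF sD sC])
  show "z \<in> Zd ==> z \<in> D" "z \<in> Zd ==> z \<in> Cd" by (simp_all add: Zd_def)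
  show "finite Zd" unfolding Zd_def using finD by simp
  show "finite Cd" by (rule finite_subset[OF subgroup.subset[OF sC] fin])
qed

lemma Zc: "z \<in> Zd ==> z \<in> carrier G" using ZD Dc by blast

lemma Zinv: "z \<in> Zd ==> inv z \<in> Zd" by (rule subgroup.m_inv_closed[OF sZ])

lemma CZ: "c \<in> Cd ==> z \<in> Zd ==> c \<otimes> z \<in> Cd" using subgroup.m_closed[OF sC] ZC by blast

lemma Cinv: "c \<in> Cd ==> inv c \<in> Cd" by (rule subgroup.m_inv_closed[OF sC])

lemma elC: "c \<in> Cd ==> el c \<in> FP D" unfolding Cd_def by (rule el_FP[OF DG])

definition rp :: "'g => 'g" where "rp c = (SOME r. r \<in> c <# Zd)"

lemma rp: "c \<in> Cd ==> rp c \<in> Cd" "c \<in> Cd ==> inv (rp c) \<otimes> c \<in> Zd"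
  and rp_eq: "c \<in> Cd ==> c' \<in> Cd ==> inv c \<otimes> c' \<in> Zd ==> rp c = rp c'"
proof -
  have s: "rp c \<in> c <# Zd" if "c \<in> Cd" for c
    unfolding rp_def by (rule someI[where x = c]) (rule lcos_self[OF CG[OF that] sZ])
  { assume c: "c \<in> Cd"
    obtain z where z: "z \<in> Zd" "rp c = c \<otimes> z" using s[OF c] by (auto simp: l_coset_def)
    show "rp c \<in> Cd" unfolding z(2) by (rule CZ[OF c z(1)])
    have "inv (rp c) \<otimes> c = inv z" using CG[OF c] Zc[OF z(1)] by (simp add: z(2) inv_mult_group m_assoc)
    then show "inv (rp c) \<otimes> c \<in> Zd" using Zinv[OF z(1)] by simp }
  assume "c \<in> Cd" "c' \<in> Cd" "inv c \<otimes> c' \<in> Zd"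
  then have "c <# Zd = c' <# Zd" using lcos_eq_iff[OF sZ CG CG] by blast
  then show "rp c = rp c'" by (simp add: rp_def)
qed

text \<open>A transversal of Z(D) in C_G(D), and equally of D in C_G(D) D. The first role makes it a
  basis of the group algebra of C_G(D)/Z(D), the second an index set for the trace over
  \<open>dc D D \<one>\<close>.\<close>

definition Tv :: "'g set" where "Tv = rp ` Cd"

lemma IC: "i \<in> Tv ==> i \<in> Cd" and finI: "finite Tv" and I_eq: "i \<in> Tv ==> j \<in> Tv ==> inv i \<otimes> j \<in> Zd ==> i = j"
proof -
  show "i \<in> Tv ==> i \<in> Cd" using rp(1) by (auto simp: Tv_def)
  show "finite Tv" unfolding Tv_def using finC by simp
  assume i: "i \<in> Tv" "j \<in> Tv" "inv i \<otimes> j \<in> Zd"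
  have idem: "rp k = k" if "k \<in> Tv" for k
  proof -
    obtain c where c: "c \<in> Cd" "k = rp c" using \<open>k \<in> Tv\<close> by (auto simp: Tv_def)
    then show ?thesis using rp_eq[OF rp(1)[OF c(1)] c(1) rp(2)[OF c(1)]] by simp
  qed
  have "i \<in> Cd" "j \<in> Cd" using i rp(1) by (auto simp: Tv_def)
  then show "i = j" using rp_eq[of i j] i idem by simp
qed

lemma bij_IZ: "bij_betw (%(k, z). k \<otimes> z) (Tv \<times> Zd) Cd"
proof (rule bij_betw_imageI)
  show "inj_on (%(k, z). k \<otimes> z) (Tv \<times> Zd)"
  proof (rule inj_onI, clarify)
    fix k z k' z' assume h: "k \<in> Tv" "z \<in> Zd" "k' \<in> Tv" "z' \<in> Zd" "k \<otimes> z = k' \<otimes> z'"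
    have c: "k \<in> carrier G" "k' \<in> carrier G" "z \<in> carrier G" "z' \<in> carrier G" using h IC CG Zc by auto
    have "inv k \<otimes> k' = inv k \<otimes> (k' \<otimes> z') \<otimes> inv z'" using c by (simp add: m_assoc)
    also have "\<dots> = z \<otimes> inv z'" unfolding h(5)[symmetric] using c by (simp add: m_assoc icancel)
    finally have "inv k \<otimes> k' \<in> Zd" using subgroup.m_closed[OF sZ h(2) Zinv[OF h(4)]] by simp
    then have "k = k'" by (rule I_eq[OF h(1,3)])
    then show "k = k' \<and> z = z'" using h(5) c by simp
  qed
  show "(%(k, z). k \<otimes> z) ` (Tv \<times> Zd) = Cd"
  proof
    show "(%(k, z). k \<otimes> z) ` (Tv \<times> Zd) \<subseteq> Cd" using IC CZ by auto
    show "Cd \<subseteq> (%(k, z). k \<otimes> z) ` (Tv \<times> Zd)"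
    proof
      fix c assume c: "c \<in> Cd"
      have "c = rp c \<otimes> (inv (rp c) \<otimes> c)" using icancel(2)[OF CG[OF rp(1)[OF c]] CG[OF c]] by simp
      moreover have "(rp c, inv (rp c) \<otimes> c) \<in> Tv \<times> Zd" using c rp(2) by (simp add: Tv_def)
      ultimately show "c \<in> (%(k, z). k \<otimes> z) ` (Tv \<times> Zd)" by (metis (no_types, lifting) case_prod_conv image_eqI)
    qed
  qed
qed

lemma bij_ID: "bij_betw (%(k, d). k \<otimes> d) (Tv \<times> D) (dc D D \<one>)"
proof (rule bij_betw_imageI)
  show "inj_on (%(k, z). k \<otimes> z) (Tv \<times> D)"
  proof (rule inj_onI, clarify)
    fix k z k' z' assume h: "k \<in> Tv" "z \<in> D" "k' \<in> Tv" "z' \<in> D" "k \<otimes> z = k' \<otimes> z'"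
    have c: "k \<in> carrier G" "k' \<in> carrier G" "z \<in> carrier G" "z' \<in> carrier G" using h IC CG Dc by auto
    have "inv k \<otimes> k' = inv k \<otimes> (k' \<otimes> z') \<otimes> inv z'" using c by (simp add: m_assoc)
    also have "\<dots> = z \<otimes> inv z'" unfolding h(5)[symmetric] using c by (simp add: m_assoc icancel)
    finally have "inv k \<otimes> k' \<in> D" using subgroup.m_closed[OF sD h(2) Dinv[OF h(4)]] by simp
    moreover have "inv k \<otimes> k' \<in> Cd" by (rule subgroup.m_closed[OF sC Cinv[OF IC[OF h(1)]] IC[OF h(3)]])
    ultimately have "k = k'" using I_eq[OF h(1,3)] by (simp add: Zd_def)
    then show "k = k' \<and> z = z'" using h(5) c by simp
  qed
  show "(%(k, z). k \<otimes> z) ` (Tv \<times> D) = dc D D \<one>"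
  proof
    show "(%(k, z). k \<otimes> z) ` (Tv \<times> D) \<subseteq> dc D D \<one>"
    proof clarify
      fix k z assume h: "k \<in> Tv" "z \<in> D"
      have "k \<otimes> \<one> \<otimes> z \<in> dc D D \<one>" by (rule dcI) (use h IC in \<open>auto simp: Cd_def\<close>)
      then show "k \<otimes> z \<in> dc D D \<one>" using CG[OF IC[OF h(1)]] by simp
    qed
    show "dc D D \<one> \<subseteq> (%(k, z). k \<otimes> z) ` (Tv \<times> D)"
    proof
      fix u assume "u \<in> dc D D \<one>"
      then obtain c d where u: "c \<in> Cd" "d \<in> D" "u = c \<otimes> \<one> \<otimes> d" unfolding dc_def Cd_def by blast
      have cc: "c \<in> carrier G" "rp c \<in> carrier G" "d \<in> carrier G" using u CG rp(1) Dc by auto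
      have "u = rp c \<otimes> (inv (rp c) \<otimes> c \<otimes> d)" using cc by (simp add: u(3) m_assoc icancel)
      moreover have "(rp c, inv (rp c) \<otimes> c \<otimes> d) \<in> Tv \<times> D"
        using u subgroup.m_closed[OF sD ZD[OF rp(2)[OF u(1)]] u(2)] by (simp add: Tv_def)
      ultimately show "u \<in> (%(k, z). k \<otimes> z) ` (Tv \<times> D)" by (metis (no_types, lifting) case_prod_conv image_eqI)
    qed
  qed
qed

lemma bij_lcs: "bij_betw (%i. i <# D) Tv (lcs D (dc D D \<one>))"
proof (rule bij_betw_imageI)
  show "inj_on (%i. i <# D) Tv"
  proof (rule inj_onI)
    fix i j assume h: "i \<in> Tv" "j \<in> Tv" "i <# D = j <# D"
    have "inv i \<otimes> j \<in> D" using lcos_eq_iff[OF sD CG[OF IC[OF h(1)]] CG[OF IC[OF h(2)]]] h(3) by blast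
    moreover have "inv i \<otimes> j \<in> Cd" by (rule subgroup.m_closed[OF sC Cinv[OF IC[OF h(1)]] IC[OF h(2)]])
    ultimately show "i = j" using I_eq[OF h(1,2)] by (simp add: Zd_def)
  qed
  have "(%i. i <# D) ` Tv = (%u. u <# D) ` ((%(k, d). k \<otimes> d) ` (Tv \<times> D))"
  proof
    have "i = i \<otimes> \<one>" if "i \<in> Tv" for i using CG[OF IC[OF that]] by simp
    then show "(%i. i <# D) ` Tv \<subseteq> (%u. u <# D) ` ((%(k, d). k \<otimes> d) ` (Tv \<times> D))"
      using subgroup.one_closed[OF sD] by force
    have "(k \<otimes> d) <# D = k <# D" if h: "k \<in> Tv" "d \<in> D" for k d
    proof -
      have c: "k \<in> carrier G" "d \<in> carrier G" using h IC CG Dc by auto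
      have "inv k \<otimes> (k \<otimes> d) = d" using c by (simp add: icancel)
      then show ?thesis using lcos_eq_iff[OF sD c(1), of "k \<otimes> d"] c h(2) by simp
    qed
    then show "(%u. u <# D) ` ((%(k, d). k \<otimes> d) ` (Tv \<times> D)) \<subseteq> (%i. i <# D) ` Tv" by force
  qed
  then show "(%i. i <# D) ` Tv = lcs D (dc D D \<one>)"
    using bij_ID unfolding lcs_def bij_betw_def by simp
qed

text \<open>Modulo \<open>m\<close> this is the coefficient at the identity after mapping an element
  to the group algebra of C_G(D)/Z(D), that is, the symmetrizing form of that algebra.\<close>

definition sg :: "('g => 'o) => 'o" where "sg y = (\<Sum>z\<in>Zd. y z)"

lemma sg_diff: "sg (x - y) = sg x - sg y"
  by (simp add: sg_def minus_apply sum_subtractf)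

lemma sg_KP: "y \<in> KP D ==> sg y \<in> m"
  unfolding sg_def by (rule m_sum) (use ZC in \<open>auto simp: Kr_def Cd_def\<close>)

lemma sg_cong: "x - y \<in> KP D ==> sg x \<in> m \<longleftrightarrow> sg y \<in> m"
  by (rule m_cong) (simp add: sg_KP flip: sg_diff)

text \<open>Symmetry of the form: the two convolution sums over C_G(D) correspond under c to c^-1 z,
  as z in Z(D) commutes with c.\<close>

lemma sg_comm:
  assumes x: "x \<in> FP D" and y: "y \<in> FP D"
  shows "sg (x \<star> y) \<in> m \<longleftrightarrow> sg (y \<star> x) \<in> m"
proof -
  have hi: "hm D (%x. x)" by (rule hm_id[OF sD])
  have 1: "(u \<star> v) z - (\<Sum>c\<in>Cd. u c * v (inv c \<otimes> z)) \<in> m" if "u \<in> FP D" "v \<in> FP D" "z \<in> Zd" for u v z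
    unfolding Cd_def by (rule conv_fixed_mod[OF D hi hi hi that(1,2)]) (use ZC[OF that(3)] in \<open>simp only: Cd_def\<close>)
  have 2: "(\<Sum>c\<in>Cd. x c * y (inv c \<otimes> z)) = (\<Sum>c\<in>Cd. y c * x (inv c \<otimes> z))" if z: "z \<in> Zd" for z
  proof (rule sum.reindex_bij_witness[where i = "%c. inv c \<otimes> z" and j = "%c. inv c \<otimes> z"])
    fix c assume c: "c \<in> Cd"
    have cc: "c \<in> carrier G" "z \<in> carrier G" using CG[OF c] Zc[OF z] by auto
    have "z \<otimes> c = c \<otimes> z" by (rule C_comm[OF c ZD[OF z]])
    then have "inv z \<otimes> c \<otimes> z = c" using cc by (simp add: m_assoc) (metis icancel(1) m_assoc)
    then show e: "inv (inv c \<otimes> z) \<otimes> z = c" using cc by (simp add: inv_mult_group)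
    show "inv c \<otimes> z \<in> Cd" by (rule CZ[OF Cinv[OF c] z])
    show "y (inv c \<otimes> z) * x (inv (inv c \<otimes> z) \<otimes> z) = x c * y (inv c \<otimes> z)" unfolding e by (rule mult.commute)
    show "inv (inv c \<otimes> z) \<otimes> z = c" by (rule e)
    show "inv c \<otimes> z \<in> Cd" by (rule CZ[OF Cinv[OF c] z])
  qed
  have "(x \<star> y) z - (y \<star> x) z \<in> m" if "z \<in> Zd" for z
    using m_diff[OF 1[OF x y that] 1[OF y x that]] 2[OF that] by simp
  then have "(\<Sum>z\<in>Zd. (x \<star> y) z - (y \<star> x) z) \<in> m" by (rule m_sum)
  then have "sg (x \<star> y) - sg (y \<star> x) \<in> m" by (simp add: sg_def sum_subtractf)
  then show ?thesis by (rule m_cong)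
qed

text \<open>The factor w from \<open>inertial_trace\<close> is central and fixed by C_G(D) modulo
  the kernel, so it can be moved under the trace. The result says that \<open>eD\<close> is a
  relative trace from Z(D) to C_G(D), hence that its image for C_G(D)/Z(D) has defect zero.\<close>

lemma central_trace:
  "\<not> p dvd card (dc D D ` Ne D eD)" "\<exists>a\<in>FP D. eD - tr D (dc D D \<one>) a \<in> KP D"
proof -
  obtain \<alpha> \<beta> where ab: "\<alpha> \<in> FP D" "\<beta> \<in> FP D" "b - tr D (carrier G) (\<alpha> \<star> l \<star> \<beta>) \<in> M0" using source_trace by blast
  define a where "a = \<alpha> \<star> l \<star> \<beta>"
  have aF: "a \<in> FP D" unfolding a_def by (rule FP_mult[OF FP_mult[OF ab(1) lF] ab(2)])
  have tra: "b - tr D (carrier G) a \<in> M0" using ab(3) by (simp only: a_def)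
  have ea: "eD \<star> a - a \<in> KP D" unfolding a_def by (rule block_absorbs[OF D lprim eprim leK ab(1,2)])
  note it = inertial_trace[OF D aF tra bFD eprim eb ea]
  show "\<not> p dvd card (dc D D ` Ne D eD)" by (rule it(1))
  obtain w where w: "w \<in> ZP D" "eD - w \<star> tr D (dc D D \<one>) a \<in> KP D" using it(2) by blast
  have wF: "w \<in> FP D" by (rule ZP_FP[OF w(1)])
  have awF: "a \<star> w \<in> FP D" by (rule FP_mult[OF aF wF])
  have one: "\<one> \<in> WW D D" using Dc by (auto simp: WW_def)
  define t where "t = tr D (dc D D \<one>) a"
  have tF: "t \<in> FP D" unfolding t_def by (rule ZP_FP[OF tr_dc_central[OF D sD one aF]])
  have c1: "tr D (dc D D \<one>) (a \<star> w) \<approx>\<^bsub>KP D\<^esub> t \<star> w"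
    unfolding t_def tr_def gm_sum_left
  proof (rule Z.eq_sum)
    fix C assume "C \<in> lcs D (dc D D \<one>)"
    then obtain c d where u: "c \<in> TT (dg D)" "d \<in> D" "C = (c \<otimes> \<one> \<otimes> d) <# D" by (auto simp: lcs_def dc_def)
    have cc: "c \<in> carrier G" using u(1) by (simp add: TT_dg)
    have dd: "d \<in> carrier G" by (rule Dc[OF u(2)])
    have cv: "cval y C = cj c y" if y: "y \<in> FP D" for y
    proof -
      have "cval y C = cj (c \<otimes> d) y" unfolding u(3) using cval[OF sD y, of "c \<otimes> d"] cc dd by simp
      also have "\<dots> = cj c (cj d y)" using cc dd by (simp add: cj_cj)
      finally show ?thesis by (simp only: FP_cj[OF sD y u(2)])
    qed
    have caF: "cj c a \<in> FP D" using cj_FP[OF sD cc aF] by (simp only: cs_TT[OF sD u(1)])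
    have "cj c w \<approx>\<^bsub>KP D\<^esub> w" unfolding eqm_def by (rule cj_ZP_trivial[OF D w(1) u(1)])
    then have "cj c a \<star> cj c w \<approx>\<^bsub>KP D\<^esub> cj c a \<star> w" by (rule Z.eq_left[OF _ caF])
    then show "cval (a \<star> w) C \<approx>\<^bsub>KP D\<^esub> cval a C \<star> w" by (simp only: cv[OF awF] cv[OF aF] cj_mult[OF cc])
  qed
  have c2: "w \<star> t \<approx>\<^bsub>KP D\<^esub> t \<star> w" unfolding eqm_def by (rule ZP_central[OF w(1) tF])
  have c3: "eD \<approx>\<^bsub>KP D\<^esub> w \<star> t" using w(2) by (simp only: eqm_def t_def)
  have "eD \<approx>\<^bsub>KP D\<^esub> tr D (dc D D \<one>) (a \<star> w)" by (rule Z.eq_trans[OF c3 Z.eq_trans[OF c2 Z.eq_sym[OF c1]]])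
  then show "\<exists>a\<in>FP D. eD - tr D (dc D D \<one>) a \<in> KP D" using awF by (auto simp: eqm_def)
qed

text \<open>The operator \<open>y \<mapsto> \<nu> y a\<close> on the group algebra of \<open>C(D)/Z(D)\<close> is nilpotent, and its trace is
  the sum over \<open>Z(D)\<close> of the coefficients of \<open>\<nu>\<close> times the central trace of \<open>a\<close>.\<close>

lemma nil_sg:
  assumes v: "v \<in> S" "v \<in> FP D" "L.nil v"
  shows "sg v \<in> m"
proof -
  obtain a where a: "a \<in> FP D" "eD - tr D (dc D D \<one>) a \<in> KP D" using central_trace(2) by blast
  obtain N where N: "L.kpow v N \<in> M0" using v(3) unfolding L.nil_def by blast
  define f where "f y = v \<star> y \<star> a" for y
  have fF: "f y \<in> FP D" if "y \<in> FP D" for y unfolding f_def by (rule FP_mult[OF FP_mult[OF v(2) that] a(1)])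
  \<comment> \<open>The matrix of f on the group algebra of C_G(D)/Z(D) in the basis
    \<open>Tv\<close>: the entry adds the coefficients along the coset i Z(D).\<close>
  define M where "M i j = (\<Sum>z\<in>Zd. f (el j) (i \<otimes> z))" for i j
  have IG: "i \<in> carrier G" if "i \<in> Tv" for i by (rule CG[OF IC[OF that]])
  have M_shift: "(\<Sum>z\<in>Zd. f (el (k \<otimes> t)) (i \<otimes> z)) = M i k" if k: "k \<in> Tv" and t: "t \<in> Zd" and i: "i \<in> Tv" for i k t
  proof -
    have c: "k \<in> carrier G" "t \<in> carrier G" "i \<in> carrier G" using IG k i Zc[OF t] by auto
    have "el t \<star> a = a \<star> el t" by (rule Fx_eq[OF a(1)]) (use ZD[OF t] in blast)
    moreover have "f (el (k \<otimes> t)) = v \<star> el k \<star> (el t \<star> a)" using c by (simp add: f_def gm_assoc el_el[symmetric])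
    ultimately have e: "f (el (k \<otimes> t)) = f (el k) \<star> el t" by (simp add: f_def gm_assoc)
    have "(\<Sum>z\<in>Zd. f (el (k \<otimes> t)) (i \<otimes> z)) = (\<Sum>z\<in>Zd. f (el k) (i \<otimes> (z \<otimes> inv t)))"
      unfolding e by (rule sum.cong[OF refl]) (use c Zc in \<open>simp add: gm_el_apply m_assoc\<close>)
    also have "\<dots> = (\<Sum>z\<in>Zd. f (el k) (i \<otimes> z))"
    proof (rule sum.reindex_bij_witness[where i = "%z. z \<otimes> t" and j = "%z. z \<otimes> inv t"])
      fix z assume z: "z \<in> Zd"
      show "z \<otimes> inv t \<otimes> t = z" "z \<otimes> t \<otimes> inv t = z" using Zc[OF z] c by (simp_all add: m_assoc)
      show "z \<otimes> inv t \<in> Zd" "z \<otimes> t \<in> Zd" using subgroup.m_closed[OF sZ z] t Zinv by auto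
    qed simp
    finally show ?thesis by (simp only: M_def)
  qed
  \<comment> \<open>Modulo the kernel y may be replaced by its restriction to C_G(D). By
    \<open>M_shift\<close> the image of k t under f has the same coset sums for all t in Z(D), so
    only the coset sums of y matter.\<close>
  have step: "(\<Sum>z\<in>Zd. f y (i \<otimes> z)) - (\<Sum>k\<in>Tv. M i k * (\<Sum>z\<in>Zd. y (k \<otimes> z))) \<in> m" if y: "y \<in> FP D" and i: "i \<in> Tv" for y i
  proof -
    define y0 where "y0 = (\<Sum>c\<in>Cd. sm (y c) (el c))"
    have y0F: "y0 \<in> FP D" unfolding y0_def by (intro Fx_sum Fx_sm elC)
    have "y0 c = y c" if "c \<in> Cd" for c
      unfolding y0_def using that finC by (simp add: fsum_apply sm_apply gelem_def if_distrib cong: if_cong)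
    then have "y - y0 \<in> KP D" unfolding Kr_def using Fx_diff[OF y y0F] by (auto simp: minus_apply Cd_def)
    then have "v \<star> (y - y0) \<star> a \<in> KP D" by (rule KP_left[OF D KP_right[OF D v(2)] a(1)])
    then have K: "f y - f y0 \<in> KP D" by (simp add: f_def gm_diff_left gm_diff_right)
    have "f y (i \<otimes> z) - f y0 (i \<otimes> z) \<in> m" if "z \<in> Zd" for z
      using K CZ[OF IC[OF i] that] unfolding Kr_def by (auto simp: minus_apply Cd_def)
    then have "(\<Sum>z\<in>Zd. f y (i \<otimes> z) - f y0 (i \<otimes> z)) \<in> m" by (rule m_sum)
    moreover have "(\<Sum>z\<in>Zd. f y0 (i \<otimes> z)) = (\<Sum>k\<in>Tv. M i k * (\<Sum>z\<in>Zd. y (k \<otimes> z)))"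
    proof -
      have "f y0 = (\<Sum>c\<in>Cd. sm (y c) (f (el c)))" by (simp add: f_def y0_def gm_sum_left gm_sum_right gm_sm_left gm_sm_right)
      then have "(\<Sum>z\<in>Zd. f y0 (i \<otimes> z)) = (\<Sum>z\<in>Zd. \<Sum>c\<in>Cd. y c * f (el c) (i \<otimes> z))" by (simp add: fsum_apply sm_apply)
      also have "\<dots> = (\<Sum>c\<in>Cd. y c * (\<Sum>z\<in>Zd. f (el c) (i \<otimes> z)))" by (subst sum.swap) (simp add: sum_distrib_left)
      also have "\<dots> = (\<Sum>(k, t)\<in>Tv \<times> Zd. y (k \<otimes> t) * (\<Sum>z\<in>Zd. f (el (k \<otimes> t)) (i \<otimes> z)))"
        using sum.reindex_bij_betw[OF bij_IZ, of "%c. y c * (\<Sum>z\<in>Zd. f (el c) (i \<otimes> z))"] by (simp add: split_def)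
      also have "\<dots> = (\<Sum>(k, t)\<in>Tv \<times> Zd. y (k \<otimes> t) * M i k)" by (rule sum.cong) (auto simp: M_shift i)
      also have "\<dots> = (\<Sum>k\<in>Tv. \<Sum>t\<in>Zd. y (k \<otimes> t) * M i k)" by (simp add: sum.cartesian_product)
      also have "\<dots> = (\<Sum>k\<in>Tv. M i k * (\<Sum>z\<in>Zd. y (k \<otimes> z)))"
        by (rule sum.cong[OF refl]) (simp add: sum_distrib_left mult.commute)
      finally show ?thesis .
    qed
    ultimately show ?thesis by (simp add: sum_subtractf)
  qed
  have pF: "(f ^^ n) (el j) \<in> FP D" if "j \<in> Tv" for n j
    by (induction n) (use elC[OF IC[OF that]] fF in auto)
  have mp: "matpow Tv M n i j - (\<Sum>z\<in>Zd. (f ^^ n) (el j) (i \<otimes> z)) \<in> m" if i: "i \<in> Tv" and j: "j \<in> Tv" for n i j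
    using i
  proof (induction n arbitrary: i)
    case 0
    have "(\<Sum>z\<in>Zd. el j (i \<otimes> z)) = (if i = j then 1 else 0)"
    proof (cases "i = j")
      case True
      have "el j (i \<otimes> z) = (if z = \<one> then 1 else 0)" if "z \<in> Zd" for z
        using True IG[OF j] Zc[OF that] by (simp add: gelem_def)
      then have "(\<Sum>z\<in>Zd. el j (i \<otimes> z)) = (\<Sum>z\<in>Zd. if z = \<one> then 1 else 0)" by (rule sum.cong[OF refl])
      then show ?thesis using True finZ subgroup.one_closed[OF sZ] by simp
    next
      case False
      have "el j (i \<otimes> z) = 0" if z: "z \<in> Zd" for z
      proof -
        have "i \<otimes> z ~= j"
        proof
          assume "i \<otimes> z = j"
          then have "inv i \<otimes> j = z" using IG[OF 0] Zc[OF z] icancel(1) by blast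
          then show False using I_eq[OF 0 j] z False by simp
        qed
        then show ?thesis by (simp add: gelem_def)
      qed
      then show ?thesis using False by simp
    qed
    then show ?case by simp
  next
    case (Suc n)
    let ?y = "(f ^^ n) (el j)"
    have "(\<Sum>k\<in>Tv. M i k * (matpow Tv M n k j - (\<Sum>z\<in>Zd. ?y (k \<otimes> z)))) \<in> m"
      by (intro m_sum m_mult Suc.IH)
    then have "matpow Tv M (Suc n) i j - (\<Sum>k\<in>Tv. M i k * (\<Sum>z\<in>Zd. ?y (k \<otimes> z))) \<in> m"
      by (simp add: right_diff_distrib sum_subtractf)
    then have "matpow Tv M (Suc n) i j - (\<Sum>k\<in>Tv. M i k * (\<Sum>z\<in>Zd. ?y (k \<otimes> z)))
        - ((\<Sum>z\<in>Zd. f ?y (i \<otimes> z)) - (\<Sum>k\<in>Tv. M i k * (\<Sum>z\<in>Zd. ?y (k \<otimes> z)))) \<in> m"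
      by (rule m_diff[OF _ step[OF pF[OF j] Suc.prems]])
    then show ?case by simp
  qed
  \<comment> \<open>Iterates of f carry a growing power of v on the left, so they vanish modulo
    \<open>m\<close> once v does.\<close>
  have pw: "\<exists>q. (f ^^ Suc n) y = L.kpow v n \<star> (v \<star> (y \<star> q))" for n y
  proof (induction n)
    case 0
    have "l \<star> (v \<star> (y \<star> a)) = l \<star> v \<star> (y \<star> a)" by (simp only: gm_assoc)
    then have "f y = l \<star> (v \<star> (y \<star> a))" by (simp add: S_l[OF v(1)] f_def gm_assoc)
    then show ?case by auto
  next
    case (Suc n)
    then obtain q where q: "(f ^^ Suc n) y = L.kpow v n \<star> (v \<star> (y \<star> q))" by blast
    have "(f ^^ Suc (Suc n)) y = f ((f ^^ Suc n) y)" by simp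
    also have "\<dots> = L.kpow v (Suc n) \<star> (v \<star> (y \<star> (q \<star> a)))" unfolding q f_def by (simp add: gm_assoc)
    finally show ?case by blast
  qed
  have "(\<Sum>i\<in>Tv. M i i) \<in> m"
  proof (rule trace_nilpotent[where M = M and N = "Suc N", OF finI])
    fix i j assume ij: "i \<in> Tv" "j \<in> Tv"
    obtain q where "(f ^^ Suc N) (el j) = L.kpow v N \<star> (v \<star> (el j \<star> q))" using pw by blast
    then have "(f ^^ Suc N) (el j) \<in> M0" using M0_gm_left[OF N] by simp
    then have "(\<Sum>z\<in>Zd. (f ^^ Suc N) (el j) (i \<otimes> z)) \<in> m" unfolding M0_def by (intro m_sum) blast
    then show "matpow Tv M (Suc N) i j \<in> m" using m_cong[OF mp[OF ij, of "Suc N"]] by blast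
  qed
  \<comment> \<open>The diagonal entry at i is the form \<open>sg\<close> of v times the conjugate
    of a by i; summing over the transversal gives the trace of a, which is \<open>eD\<close> modulo
    the kernel and acts trivially on v.\<close>
  moreover have "(\<Sum>i\<in>Tv. M i i) = sg (v \<star> tr D (dc D D \<one>) a)"
  proof -
    have "M i i = sg (v \<star> cj i a)" if i: "i \<in> Tv" for i
    proof -
      have "f (el i) = v \<star> cj i a \<star> el i" using el_gm_cj[OF IG[OF i], of a] by (simp add: f_def gm_assoc)
      moreover have "(v \<star> cj i a \<star> el i) (i \<otimes> z) = (v \<star> cj i a) z" if z: "z \<in> Zd" for z
      proof -
        have "i \<otimes> z = z \<otimes> i" by (rule C_comm[OF IC[OF i] ZD[OF z], symmetric])
        then show ?thesis using IG[OF i] Zc[OF z] by (simp add: gm_el_apply m_assoc)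
      qed
      ultimately show ?thesis unfolding M_def sg_def by simp
    qed
    then have "(\<Sum>i\<in>Tv. M i i) = (\<Sum>i\<in>Tv. sg (v \<star> cj i a))" by (rule sum.cong[OF refl])
    also have "\<dots> = sg (\<Sum>i\<in>Tv. v \<star> cj i a)" unfolding sg_def by (subst sum.swap) (simp add: fsum_apply)
    also have "(\<Sum>i\<in>Tv. v \<star> cj i a) = v \<star> (\<Sum>i\<in>Tv. cj i a)" by (simp only: gm_sum_right)
    also have "(\<Sum>i\<in>Tv. cj i a) = tr D (dc D D \<one>) a"
    proof -
      have "(\<Sum>i\<in>Tv. cj i a) = (\<Sum>i\<in>Tv. cval a (i <# D))" by (rule sum.cong[OF refl]) (simp add: cval[OF sD a(1) IG])
      also have "\<dots> = (\<Sum>C\<in>lcs D (dc D D \<one>). cval a C)" by (rule sum.reindex_bij_betw[OF bij_lcs])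
      finally show ?thesis by (simp only: tr_def)
    qed
    finally show ?thesis .
  qed
  ultimately have t: "sg (v \<star> tr D (dc D D \<one>) a) \<in> m" by simp
  have "v \<star> (l \<star> eD - l) \<in> KP D" by (rule KP_right[OF D v(2) le])
  moreover have "v \<star> (l \<star> eD - l) = v \<star> l \<star> eD - v \<star> l" by (simp only: gm_diff_right gm_assoc)
  ultimately have 1: "v \<star> eD - v \<in> KP D" by (simp only: S_l'[OF v(1)])
  have 2: "v \<star> eD - v \<star> tr D (dc D D \<one>) a \<in> KP D" using KP_right[OF D v(2) a(2)] by (simp only: gm_diff_right)
  show ?thesis using sg_cong[OF 1] sg_cong[OF 2] t by blast
qed

definition Nz :: "'g => 'o" where "Nz = (\<Sum>z\<in>Zd. el z)"

text \<open>The coefficient at c is the form \<open>sg\<close> of c^-1 v. By symmetry of the form,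
  c^-1 may be replaced by its compression to the corner of l, where the product with v remains
  nilpotent.\<close>

lemma Nz_nil:
  assumes v: "v \<in> S" "v \<in> FP D" "L.nil v"
  shows "Nz \<star> v \<in> KP D"
  unfolding Kr_def
proof (intro CollectI conjI ballI)
  have NF: "Nz \<in> FP D" unfolding Nz_def by (intro Fx_sum elC ZC)
  show "Nz \<star> v \<in> FP D" by (rule FP_mult[OF NF v(2)])
  fix c assume "c \<in> TT (dg D)"
  then have c: "c \<in> Cd" by (simp only: Cd_def)
  have cc: "c \<in> carrier G" by (rule CG[OF c])
  have "(Nz \<star> v) c = (\<Sum>z\<in>Zd. v (inv z \<otimes> c))"
    unfolding Nz_def gm_sum_left fsum_apply by (rule sum.cong[OF refl]) (simp add: el_gm_apply Zc cc)
  also have "\<dots> = (\<Sum>z\<in>Zd. v (c \<otimes> z))"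
  proof (rule sum.reindex_bij_witness[where i = "%z. inv z" and j = "%z. inv z"])
    fix z assume z: "z \<in> Zd"
    show "inv (inv z) = z" "inv (inv z) = z" using Zc[OF z] by simp_all
    show "inv z \<in> Zd" "inv z \<in> Zd" by (rule Zinv[OF z])+
    show "v (c \<otimes> inv z) = v (inv z \<otimes> c)" using C_comm[OF c ZD[OF Zinv[OF z]]] by simp
  qed
  also have "\<dots> = sg (el (inv c) \<star> v)"
    unfolding sg_def by (rule sum.cong[OF refl]) (simp add: el_gm_apply Zc cc)
  finally have e: "(Nz \<star> v) c = sg (el (inv c) \<star> v)" .
  let ?y = "el (inv c)"
  have yF: "?y \<in> FP D" by (rule elC[OF Cinv[OF c]])
  have vc: "L.corner v" unfolding L.corner_def using v(2) S_l[OF v(1)] S_l'[OF v(1)] by simp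
  have lyl: "L.corner (l \<star> ?y \<star> l)" by (rule L.corner_ebe[OF yF])
  have nil: "L.nil (l \<star> ?y \<star> l \<star> v)" by (rule L.nil_mult[OF lyl vc]) (use v(3) in blast)
  have "sg (l \<star> ?y \<star> l \<star> v) \<in> m"
    by (rule nil_sg[OF S_mult[OF S_lal v(1)] FP_mult[OF FP_mult[OF FP_mult[OF lF yF] lF] v(2)] nil])
  moreover have "l \<star> ?y \<star> l \<star> v = l \<star> (?y \<star> v)" by (simp only: gm_assoc S_l[OF v(1)])
  ultimately have "sg (l \<star> (?y \<star> v)) \<in> m" by simp
  then have "sg (?y \<star> v \<star> l) \<in> m" using sg_comm[OF lF FP_mult[OF yF v(2)]] by simp
  moreover have "?y \<star> v \<star> l = ?y \<star> v" by (simp only: gm_assoc S_l'[OF v(1)])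
  ultimately show "(Nz \<star> v) c \<in> m" using e by simp
qed

text \<open>Z(D) acts freely on the D-fixed basis elements, at least one of which exists because l
  is not in the kernel. A second orbit is excluded by multiplying with \<open>Nz\<close>, which
  retains only the residue of each element.\<close>

lemma card_centralizer: "card (X \<inter> FP D) = card Zd"
proof -
  have dd: "ddsub (dg D)" by (rule Rl_ddsub[OF sD gr_id gr_id]) (use sD in auto)
  have NF: "Nz \<in> FP D" unfolding Nz_def by (intro Fx_sum elC ZC)
  have zX: "el z \<star> x \<in> X \<inter> FP D" if "z \<in> Zd" "x \<in> X \<inter> FP D" for z x
    using that Xl[OF _ ZD] FP_mult[OF elC[OF ZC]] by blast
  have NS: "Nz \<star> x \<in> S" if "x \<in> X" for x
    unfolding Nz_def gm_sum_left by (intro S_sum S_el XS that ZD)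
  have cfN: "cf (Nz \<star> x) y = (\<Sum>z\<in>Zd. if y = el z \<star> x then 1 else 0)" if "x \<in> X" "y \<in> X" for x y
    unfolding Nz_def gm_sum_left cf_sum by (rule sum.cong[OF refl]) (simp add: cf_X Xl that ZD)
  have cfNx: "cf (Nz \<star> x) x = 1" if x: "x \<in> X" for x
  proof -
    have "(x = el z \<star> x) = (z = \<one>)" if z: "z \<in> Zd" for z
      using free(1)[OF x ZD[OF z]] el_one_left[OF X_GA[OF x]] by auto
    then have "cf (Nz \<star> x) x = (\<Sum>z\<in>Zd. if z = \<one> then 1 else 0)" unfolding cfN[OF x x] by (intro sum.cong) auto
    then show ?thesis using finZ subgroup.one_closed[OF sZ] by simp
  qed
  have corner: "L.corner x" if "x \<in> X \<inter> FP D" for x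
    unfolding L.corner_def using that S_l[OF XS] S_l'[OF XS] by simp
  have orbit: "\<exists>z\<in>Zd. x = el z \<star> y" if x: "x \<in> X \<inter> FP D" and y: "y \<in> X \<inter> FP D" for x y
  proof (rule ccontr)
    assume H: "\<not> ?thesis"
    obtain r where r: "L.ev x r" using L.ev_exists[OF corner[OF x]] by blast
    obtain s where s: "L.ev y s" using L.ev_exists[OF corner[OF y]] by blast
    have key: "Nz \<star> u - sm q (Nz \<star> l) \<in> KP D" if "u \<in> X \<inter> FP D" "L.ev u q" for u q
    proof -
      have "Nz \<star> (u - sm q l) \<in> KP D"
        by (rule Nz_nil) (use that XS l_S lF in \<open>auto simp: L.ev_def intro: S_diff S_sm Fx_diff Fx_sm\<close>)
      then show ?thesis by (simp add: gm_diff_right gm_sm_right)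
    qed
    \<comment> \<open>Each product Nz u equals its residue times Nz l. Eliminating Nz l relates Nz x
      and Nz y; in different orbits, comparing coordinates at x gives s in \<open>m\<close>, and
      then Nz y is in the kernel although its coordinate at y is 1.\<close>
    have "sm s (Nz \<star> x - sm r (Nz \<star> l)) - sm r (Nz \<star> y - sm s (Nz \<star> l)) \<in> KP D"
      by (rule Kr_diff[OF Kr_sm[OF key[OF x r]] Kr_sm[OF key[OF y s]]])
    then have K: "sm s (Nz \<star> x) - sm r (Nz \<star> y) \<in> KP D" by (simp add: sm_diff sm_sm mult.commute)
    have "sm s (Nz \<star> x) - sm r (Nz \<star> y) \<in> S" by (intro S_diff S_sm NS) (use x y in auto)
    then have "cf (sm s (Nz \<star> x) - sm r (Nz \<star> y)) x \<in> m"
      by (rule coeffs_of_Kr[OF dd _ K]) (use x in auto)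
    moreover have "cf (Nz \<star> y) x = 0"
      using H x y by (simp add: cfN)
    ultimately have sm: "s \<in> m" using x cfNx by (simp add: cf_diff cf_sm)
    have NlF: "Nz \<star> l \<in> FP D" by (rule FP_mult[OF NF lF])
    have "sm s (Nz \<star> l) \<in> KP D" by (rule M0_Kr[OF M0_sm'[OF sm] Fx_sm[OF NlF]])
    then have "(Nz \<star> y - sm s (Nz \<star> l)) + sm s (Nz \<star> l) \<in> KP D" by (rule Kr_add[OF key[OF y s]])
    then have "Nz \<star> y \<in> KP D" by simp
    then have "cf (Nz \<star> y) y \<in> m" using coeffs_of_Kr[OF dd NS] y by simp
    then show False using cfNx y one_notin by simp
  qed
  have "\<exists>x. x \<in> X \<inter> FP D"
  proof (rule ccontr)
    assume "\<not> ?thesis"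
    then have "l \<in> KP D" using Kr_of_coeffs[OF dd l_S lF] by blast
    then show False using lK by simp
  qed
  then obtain y where y: "y \<in> X \<inter> FP D" by blast
  have "bij_betw (%z. el z \<star> y) Zd (X \<inter> FP D)"
  proof (rule bij_betw_imageI)
    show "inj_on (%z. el z \<star> y) Zd"
    proof (rule inj_onI)
      fix z t assume h: "z \<in> Zd" "t \<in> Zd" "el z \<star> y = el t \<star> y"
      have c: "z \<in> carrier G" "t \<in> carrier G" using h Zc by auto
      have "el (inv t \<otimes> z) \<star> y = el (inv t) \<star> (el z \<star> y)" using c by (simp add: gm_assoc[symmetric] el_el)
      also have "\<dots> = el (inv t \<otimes> t) \<star> y" unfolding h(3) using c by (simp add: gm_assoc[symmetric] el_el)
      also have "\<dots> = y" using c y X_GA by (simp add: el_one_left)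
      finally have "inv t \<otimes> z = \<one>"
        using free(1)[of y "inv t \<otimes> z"] y subgroup.m_closed[OF sD Dinv[OF ZD[OF h(2)]] ZD[OF h(1)]] by blast
      then show "z = t" using c by (metis inv_closed inv_equality inv_inv)
    qed
    show "(%z. el z \<star> y) ` Zd = X \<inter> FP D" using zX[OF _ y] orbit[OF _ y] by blast
  qed
  then show ?thesis by (metis bij_betw_same_card)
qed

section \<open>Counting the points with equal left and right orbits\<close>

lemma block_is_eD:
  assumes e: "kprim (ZP D) (KP D) e" "l \<star> e \<notin> KP D"
  shows "eD - e \<in> KP D"
proof -
  have eZ': "e \<in> FP D" using e(1) ZP_FP by (auto simp: kprim_def)
  have "eD \<star> e \<notin> KP D"
  proof
    assume "eD \<star> e \<in> KP D"
    then have 1: "l \<star> (eD \<star> e) \<in> KP D" by (rule KP_right[OF D lF])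
    have "(l \<star> eD - l) \<star> e \<in> KP D" by (rule KP_left[OF D le eZ'])
    then have "l \<star> (eD \<star> e) - (l \<star> eD - l) \<star> e \<in> KP D" by (rule Kr_diff[OF 1])
    then show False using e(2) by (simp add: gm_diff_left gm_assoc)
  qed
  then show ?thesis using blocks_equal_or_orthogonal[OF D eprim e(1)] by blast
qed

lemma cjK: "x \<in> carrier G ==> cs x D = D ==> z \<in> KP D ==> cj x z \<in> KP D"
  using cj_KP[OF sD] by metis

text \<open>An element of the inertial group defines a morphism with nonvanishing twisted quotient,
  so its fixed points are as many as those of the identity of D.\<close>

lemma Ne_card:
  assumes g: "g \<in> Ne D eD"
  shows "card (X \<inter> Fx (Rl (cg g) (%x. x) D)) = card Zd"
proof -
  have gc: "g \<in> carrier G" and gD: "cs g D = D" and ge: "cj g eD - eD \<in> KP D" using g by (auto simp: Ne_def)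
  have gs: "cs g D \<subseteq> D" using gD by simp
  have "l \<star> cj g eD \<notin> KP D"
  proof
    assume H: "l \<star> cj g eD \<in> KP D"
    have "l \<star> (cj g eD - eD) \<in> KP D" by (rule KP_right[OF D lF ge])
    then have "l \<star> cj g eD - l \<star> (cj g eD - eD) \<in> KP D" by (rule Kr_diff[OF H])
    then show False using leK by (simp add: gm_diff_right)
  qed
  then have "l \<star> cj g eD \<notin> KP (cs g D)" by (simp add: gD)
  then have nz: "NZ (cg g) (%x. x) D" by (rule NZ_of_blocks[OF sD subset_refl gc gs eprim leK])
  then show ?thesis
    using NZ_card(1)[OF sD subset_refl gr_cg[OF sD gc gs] gr_id[OF sD subset_refl] nz] card_centralizer by simp
qed

definition Wd :: "('g => 'o) set" where "Wd = {x \<in> X. \<forall>d\<in>D. \<exists>d'\<in>D. el d \<star> x = x \<star> el d'}"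

text \<open>For x D = D x the stabilizer projects onto D, so it is the graph of conjugation by some
  g normalizing D. A block of D met by l is \<open>eD\<close>, and this applied to the block of
  \<open>fusion_of_point\<close> and to its conjugate shows that g stabilizes
  \<open>eD\<close>.\<close>

lemma Wd_eq: "x \<in> Wd \<longleftrightarrow> x \<in> X \<and> (\<exists>g\<in>Ne D eD. x \<in> Fx (Rl (cg g) (%x. x) D))"
proof
  assume "x \<in> Wd"
  then have x: "x \<in> X" and W: "!!d. d \<in> D ==> \<exists>d'\<in>D. el d \<star> x = x \<star> el d'" by (auto simp: Wd_def)
  let ?K = "{h \<in> D \<times> D. ac h x = x}"
  have dd: "ddsub ?K" and xF: "x \<in> Fx ?K" using stab_ddsub[OF x] .
  obtain g where g: "g \<in> TT ?K" "x g \<notin> m" using X_TT[OF dd x xF] by blast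
  have gc: "g \<in> carrier G" using g by (simp add: TT_def)
  note gr = graph_of_TT[OF dd g(1)]
  have "D \<subseteq> cs g (snd ` ?K)"
  proof
    fix d assume d: "d \<in> D"
    then obtain d' where d': "d' \<in> D" "el d \<star> x = x \<star> el d'" using W by blast
    then have "(d, d') \<in> ?K" using ac_fix[OF Dc[OF d] Dc[OF d'(1)] X_GA[OF x]] d by simp
    then show "d \<in> cs g (snd ` ?K)" unfolding cs_cg using gr(4) by blast
  qed
  then have "card D \<le> card (snd ` ?K)"
    using card_mono[OF finite_subset[OF gr(3) finD]] card_cs[OF subgroup.subset[OF gr(1)] gc] by force
  then have P: "snd ` ?K = D" by (rule card_seteq[OF finD gr(2)])
  have K: "?K = Rl (cg g) (%x. x) D" using gr(4) unfolding P .
  have gs: "cs g D \<subseteq> D" using gr(3) unfolding P .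
  have gD: "cs g D = D" by (rule card_seteq[OF finD gs]) (simp add: card_cs[OF DG gc])
  have xF': "x \<in> Fx (Rl (cg g) (%x. x) D)" using xF unfolding K .
  have xK: "x \<notin> Kr (Rl (cg g) (%x. x) D)" using g unfolding K Kr_def by blast
  obtain e where e: "kprim (ZP D) (KP D) e" "l \<star> e \<notin> KP D" "l \<star> cj g e \<notin> KP D"
    using fusion_of_point[OF sD subset_refl gc gs XS[OF x] xF' xK] unfolding gD by blast
  have ce: "kprim (ZP D) (KP D) (cj g e)" using kprim_ZP_cj[OF D gc e(1)] by (simp only: gD)
  have "cj g (eD - e) - (eD - cj g e) \<in> KP D"
    by (rule Kr_diff[OF cjK[OF gc gD block_is_eD[OF e(1,2)]] block_is_eD[OF ce e(3)]])
  then have "cj g eD - eD \<in> KP D" by (simp add: cj_diff)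
  then show "x \<in> X \<and> (\<exists>g\<in>Ne D eD. x \<in> Fx (Rl (cg g) (%x. x) D))" using x xF' gc gD unfolding Ne_def by blast
next
  assume "x \<in> X \<and> (\<exists>g\<in>Ne D eD. x \<in> Fx (Rl (cg g) (%x. x) D))"
  then obtain g where x: "x \<in> X" and g: "cs g D = D" and xF: "x \<in> Fx (Rl (cg g) (%x. x) D)" by (auto simp: Ne_def)
  have "\<exists>d'\<in>D. el d \<star> x = x \<star> el d'" if d: "d \<in> D" for d
  proof -
    obtain d' where d': "d' \<in> D" "d = cg g d'" using g d unfolding cs_cg by blast
    then show ?thesis using Fx_eq[OF xF, of d d'] by blast
  qed
  then show "x \<in> Wd" using x by (simp add: Wd_def)
qed

lemma Ne_mult:
  assumes x: "x \<in> Ne D eD" and c: "c \<in> Cd"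
  shows "x \<otimes> c \<in> Ne D eD" "c \<otimes> x \<in> Ne D eD"
proof -
  have xc: "x \<in> carrier G" and xD: "cs x D = D" and xe: "cj x eD - eD \<in> KP D" using x by (auto simp: Ne_def)
  have cc: "c \<in> carrier G" and cD: "cs c D = D" using CG[OF c] cs_TT[OF sD] c by (auto simp: Cd_def)
  have ce: "cj c eD - eD \<in> KP D" using cj_ZP_trivial[OF D eZ] c by (simp add: Cd_def)
  have cs2: "cs (g \<otimes> h) D = cs g (cs h D)" if "g \<in> carrier G" "h \<in> carrier G" for g h
    unfolding cs_def image_image by (rule image_cong) (use that Dc in \<open>auto simp: m_assoc inv_mult_group\<close>)
  have "cj x (cj c eD - eD) + (cj x eD - eD) \<in> KP D" by (rule Kr_add[OF cjK[OF xc xD ce] xe])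
  then have "cj (x \<otimes> c) eD - eD \<in> KP D" using xc cc by (simp add: cj_diff cj_cj)
  then show "x \<otimes> c \<in> Ne D eD" using xc cc xD cD by (simp add: Ne_def cs2)
  have "cj c (cj x eD - eD) + (cj c eD - eD) \<in> KP D" by (rule Kr_add[OF cjK[OF cc cD xe] ce])
  then have "cj (c \<otimes> x) eD - eD \<in> KP D" using xc cc by (simp add: cj_diff cj_cj)
  then show "c \<otimes> x \<in> Ne D eD" using xc cc xD cD by (simp add: Ne_def cs2)
qed

lemma D_Ne:
  assumes x: "x \<in> Ne D eD" and d: "d \<in> D"
  shows "x \<otimes> d \<in> Ne D eD"
proof -
  have xc: "x \<in> carrier G" and xD: "cs x D = D" and xe: "cj x eD - eD \<in> KP D" using x by (auto simp: Ne_def)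
  have dc: "d \<in> carrier G" by (rule Dc[OF d])
  have "cs d D \<subseteq> D" using d Dinv subgroup.m_closed[OF sD] by (auto simp: cs_def)
  then have dD: "cs d D = D" by (rule card_seteq[OF finD]) (simp add: card_cs[OF DG dc])
  have "cs (x \<otimes> d) D = cs x (cs d D)"
    unfolding cs_def image_image by (rule image_cong) (use xc dc Dc in \<open>auto simp: m_assoc inv_mult_group\<close>)
  moreover have "cj (x \<otimes> d) eD = cj x eD" using cj_cj[OF xc dc, of eD] FP_cj[OF sD eF d] by simp
  ultimately show ?thesis using xc dc xD dD xe by (simp add: Ne_def)
qed

lemma card_Ne: "card (Ne D eD) = card (dc D D ` Ne D eD) * card (dc D D \<one>)"
proof -
  have fN: "finite (Ne D eD)" by (rule finite_subset[OF _ fin]) (auto simp: Ne_def)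
  have sub: "dc D D x \<subseteq> Ne D eD" if x: "x \<in> Ne D eD" for x
  proof
    fix u assume "u \<in> dc D D x"
    then obtain c d where u: "c \<in> Cd" "d \<in> D" "u = c \<otimes> x \<otimes> d" unfolding dc_def Cd_def by blast
    show "u \<in> Ne D eD" unfolding u(3) by (rule D_Ne[OF Ne_mult(2)[OF x u(1)] u(2)])
  qed
  have NG: "x \<in> carrier G" if "x \<in> Ne D eD" for x using that by (simp add: Ne_def)
  have U: "\<Union>(dc D D ` Ne D eD) = Ne D eD" using sub dc_self[OF DG sD NG] by blast
  have "card (dc D D \<one>) * card (dc D D ` Ne D eD) = card (\<Union>(dc D D ` Ne D eD))"
  proof (rule card_partition)
    show "finite (dc D D ` Ne D eD)" "finite (\<Union>(dc D D ` Ne D eD))" unfolding U using fN by simp_all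
    fix Y assume "Y \<in> dc D D ` Ne D eD"
    then obtain x where x: "x \<in> Ne D eD" "Y = dc D D x" by blast
    have xc: "x \<in> carrier G" "cs x D = D" using x(1) by (auto simp: Ne_def)
    have one: "dc D D \<one> \<subseteq> carrier G" using dc_WW[OF DG sD, of \<one>] Dc by (auto simp: WW_def)
    show "card Y = card (dc D D \<one>)"
      unfolding x(2) dc_normal[OF sD xc]
      by (rule card_image, rule inj_on_inverseI[where g = "%u. inv x \<otimes> u"]) (use one xc(1) icancel(1) in blast)
  next
    fix Y Y' assume Y: "Y \<in> dc D D ` Ne D eD" "Y' \<in> dc D D ` Ne D eD" "Y ~= Y'"
    show "Y \<inter> Y' = {}"
    proof (rule ccontr)
      assume "Y \<inter> Y' ~= {}"
      then obtain u where u: "u \<in> Y" "u \<in> Y'" by blast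
      obtain x x' where x: "x \<in> Ne D eD" "Y = dc D D x" "x' \<in> Ne D eD" "Y' = dc D D x'" using Y by blast
      have "dc D D u = Y" "dc D D u = Y'" using dc_eq[OF DG sD NG] x u by blast+
      then show False using Y(3) by simp
    qed
  qed
  then show ?thesis unfolding U by (simp add: mult.commute)
qed

text \<open>By freeness of the left action, two such g induce the same conjugation on D, so they
  differ by an element of C_G(D).\<close>

lemma Wd_fibre:
  assumes x: "x \<in> Wd"
  shows "card {g \<in> Ne D eD. x \<in> Fx (Rl (cg g) (%x. x) D)} = card Cd"
proof -
  obtain g0 where g0: "g0 \<in> Ne D eD" "x \<in> Fx (Rl (cg g0) (%x. x) D)" and xX: "x \<in> X" using x Wd_eq by blast
  have gc: "g0 \<in> carrier G" and gD: "cs g0 D = D" using g0(1) by (auto simp: Ne_def)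
  have "{g \<in> Ne D eD. x \<in> Fx (Rl (cg g) (%x. x) D)} = (%c. g0 \<otimes> c) ` Cd"
  proof
    show "{g \<in> Ne D eD. x \<in> Fx (Rl (cg g) (%x. x) D)} \<subseteq> (%c. g0 \<otimes> c) ` Cd"
    proof
      fix g assume "g \<in> {g \<in> Ne D eD. x \<in> Fx (Rl (cg g) (%x. x) D)}"
      then have g: "g \<in> Ne D eD" "x \<in> Fx (Rl (cg g) (%x. x) D)" by auto
      have g1: "g \<in> carrier G" "cs g D = D" using g(1) by (auto simp: Ne_def)
      have "d \<otimes> (inv g0 \<otimes> g) = inv g0 \<otimes> g \<otimes> d" if d: "d \<in> D" for d
      proof -
        have dc: "d \<in> carrier G" by (rule Dc[OF d])
        have cD: "cg g d \<in> D" "cg g0 d \<in> D" using d gD g1(2) unfolding cs_cg by blast+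
        have cG: "cg g d \<in> carrier G" "cg g0 d \<in> carrier G" using cD Dc by auto
        have "el (cg g d) \<star> x = el (cg g0 d) \<star> x"
          using Fx_eq[OF g(2), of "cg g d" d] Fx_eq[OF g0(2), of "cg g0 d" d] d by simp
        then have "el (inv (cg g0 d)) \<star> (el (cg g d) \<star> x) = el (inv (cg g0 d)) \<star> (el (cg g0 d) \<star> x)" by simp
        then have "el (inv (cg g0 d) \<otimes> cg g d) \<star> x = x"
          using cG X_GA[OF xX] by (simp add: gm_assoc[symmetric] el_el el_one_left)
        then have "inv (cg g0 d) \<otimes> cg g d = \<one>" by (rule free(1)[OF xX subgroup.m_closed[OF sD Dinv[OF cD(2)] cD(1)]])
        then have "cg g0 d \<otimes> (inv (cg g0 d) \<otimes> cg g d) = cg g0 d" using cG by simp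
        then have "cg g d = cg g0 d" using cG by (simp add: icancel)
        then have "inv g0 \<otimes> cg g d \<otimes> g = inv g0 \<otimes> cg g0 d \<otimes> g" by simp
        then show ?thesis using gc g1 dc by (simp add: cg_def m_assoc icancel)
      qed
      then have "inv g0 \<otimes> g \<in> Cd" using gc g1 by (simp add: Cd_def TT_dg)
      moreover have "g = g0 \<otimes> (inv g0 \<otimes> g)" using gc g1 by (simp add: icancel)
      ultimately show "g \<in> (%c. g0 \<otimes> c) ` Cd" by blast
    qed
    show "(%c. g0 \<otimes> c) ` Cd \<subseteq> {g \<in> Ne D eD. x \<in> Fx (Rl (cg g) (%x. x) D)}"
    proof clarify
      fix c assume c: "c \<in> Cd"
      have cc: "c \<in> carrier G" by (rule CG[OF c])
      have "cg (g0 \<otimes> c) d = cg g0 d" if d: "d \<in> D" for d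
      proof -
        have dd: "d \<in> carrier G" by (rule Dc[OF d])
        have "cg (g0 \<otimes> c) d = g0 \<otimes> (c \<otimes> d) \<otimes> inv c \<otimes> inv g0" using gc cc dd by (simp add: cg_def m_assoc inv_mult_group)
        also have "c \<otimes> d = d \<otimes> c" by (rule C_comm[OF c d, symmetric])
        finally show ?thesis using gc cc dd by (simp add: cg_def m_assoc)
      qed
      then have "Rl (cg (g0 \<otimes> c)) (%x. x) D = Rl (cg g0) (%x. x) D" by (intro image_cong) simp_all
      then show "g0 \<otimes> c \<in> Ne D eD \<and> x \<in> Fx (Rl (cg (g0 \<otimes> c)) (%x. x) D)" using Ne_mult(1)[OF g0(1) c] g0(2) by simp
    qed
  qed
  then show ?thesis
    by (simp add: card_image inj_on_inverseI[where g = "%u. inv g0 \<otimes> u"] icancel gc CG)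
qed

text \<open>Pairs (x, g) with x fixed by the graph of c_g are counted twice: |C_G(D)| for each x and
  |Z(D)| for each g. The orders |C_G(D)| = t |Z(D)| and |D C_G(D)| = t |D|, with t the size of
  \<open>Tv\<close>, turn this into the inertial index times |D|.\<close>

lemma card_Wd: "card Wd = card (dc D D ` Ne D eD) * card D"
proof -
  have fN: "finite (Ne D eD)" by (rule finite_subset[OF _ fin]) (auto simp: Ne_def)
  have WX: "Wd \<subseteq> X" by (auto simp: Wd_def)
  have fW: "finite Wd" by (rule finite_subset[OF WX finX])
  let ?R = "%x g. x \<in> Fx (Rl (cg g) (%x. x) D)"
  have "(\<Sum>x\<in>Wd. card {g \<in> Ne D eD. ?R x g}) = (\<Sum>g\<in>Ne D eD. card {x \<in> Wd. ?R x g})"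
    using sum.swap_restrict[OF fW fN, of "%_ _. 1::nat" ?R] by simp
  moreover have "{x \<in> Wd. ?R x g} = X \<inter> Fx (Rl (cg g) (%x. x) D)" if "g \<in> Ne D eD" for g
    using Wd_eq that by blast
  ultimately have "card Wd * card Cd = card (Ne D eD) * card Zd" using Wd_fibre Ne_card by simp
  moreover have "card Cd = card Tv * card Zd" "card (dc D D \<one>) = card Tv * card D"
    using bij_betw_same_card[OF bij_IZ] bij_betw_same_card[OF bij_ID] by (simp_all add: card_cartesian_product)
  ultimately have "card Wd * (card Tv * card Zd) = card (dc D D ` Ne D eD) * card D * (card Tv * card Zd)"
    by (simp add: card_Ne mult.assoc mult.commute mult.left_commute)
  moreover have "card Cd ~= 0" using finC subgroup.one_closed[OF sC] by auto
  then have "card Tv * card Zd ~= 0" using \<open>card Cd = card Tv * card Zd\<close> by simp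
  ultimately show ?thesis by simp
qed

definition ro :: "('g => 'o) => ('g => 'o) set" where "ro x = (%d. x \<star> el d) ` D"

lemma ro_self: "x \<in> X ==> x \<in> ro x"
  unfolding ro_def using subgroup.one_closed[OF sD] el_one_right[OF X_GA] by force

lemma ro_eq: "x \<in> X ==> y \<in> ro x ==> ro y = ro x"
proof -
  assume x: "x \<in> X" and "y \<in> ro x"
  then obtain d where d: "d \<in> D" "y = x \<star> el d" by (auto simp: ro_def)
  have dc: "d \<in> carrier G" by (rule Dc[OF d(1)])
  have sub: "x \<star> el d \<star> el d' = x \<star> el (d \<otimes> d')" if "d' \<in> D" for d' using dc Dc[OF that] by (simp add: gm_assoc el_el)
  show "ro y = ro x"
  proof
    show "ro y \<subseteq> ro x" unfolding ro_def d(2) using sub subgroup.m_closed[OF sD d(1)] by auto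
    show "ro x \<subseteq> ro y"
    proof
      fix u assume "u \<in> ro x"
      then obtain t where t: "t \<in> D" "u = x \<star> el t" by (auto simp: ro_def)
      have it: "inv d \<otimes> t \<in> D" by (rule subgroup.m_closed[OF sD Dinv[OF d(1)] t(1)])
      have "y \<star> el (inv d \<otimes> t) = u" unfolding d(2) sub[OF it] using dc Dc[OF t(1)] by (simp add: icancel t(2))
      then show "u \<in> ro y" unfolding ro_def using it by blast
    qed
  qed
qed

lemma card_ro: "x \<in> X ==> card (ro x) = card D"
  unfolding ro_def
proof (rule card_image, rule inj_onI)
  fix d t assume x: "x \<in> X" and h: "d \<in> D" "t \<in> D" "x \<star> el d = x \<star> el t"
  have c: "d \<in> carrier G" "t \<in> carrier G" using h Dc by auto
  have "x \<star> el d \<star> el (inv t) = x \<star> el t \<star> el (inv t)" using h(3) by simp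
  then have "x \<star> el (d \<otimes> inv t) = x" using c X_GA[OF x] by (simp add: gm_assoc el_el el_one_right)
  then have "d \<otimes> inv t = \<one>" by (rule free(2)[OF x subgroup.m_closed[OF sD h(1) Dinv[OF h(2)]]])
  then show "d = t" using c by (metis inv_closed inv_equality inv_inv)
qed

lemma card_ro_union:
  assumes V: "V \<subseteq> X" "!!x d. x \<in> V ==> d \<in> D ==> x \<star> el d \<in> V"
  shows "card V = card (ro ` V) * card D"
proof -
  have U: "\<Union>(ro ` V) = V" using V ro_self unfolding ro_def by force
  have "card D * card (ro ` V) = card (\<Union>(ro ` V))"
  proof (rule card_partition)
    show "finite (ro ` V)" "finite (\<Union>(ro ` V))" unfolding U using finite_subset[OF V(1) finX] by simp_all
    show "card Y = card D" if "Y \<in> ro ` V" for Y using that V(1) card_ro by blast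
    show "Y \<inter> Y' = {}" if "Y \<in> ro ` V" "Y' \<in> ro ` V" "Y ~= Y'" for Y Y'
    proof (rule ccontr)
      assume "Y \<inter> Y' ~= {}"
      then obtain u where u: "u \<in> Y" "u \<in> Y'" by blast
      obtain x x' where x: "x \<in> V" "Y = ro x" "x' \<in> V" "Y' = ro x'" using \<open>Y \<in> ro ` V\<close> \<open>Y' \<in> ro ` V\<close> by blast
      have "ro u = Y" "ro u = Y'" using ro_eq x u V(1) by blast+
      then show False using \<open>Y ~= Y'\<close> by simp
    qed
  qed
  then show ?thesis unfolding U by (simp add: mult.commute)
qed

text \<open>D acts from the left on the right orbits, and an orbit x D is fixed exactly when x D = D
  x. The number of orbits is thus congruent modulo p to the inertial index, which is prime to
  p.\<close>

lemma card_coprime: "coprime (card X div card D) p"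
proof -
  let ?H = "G\<lparr>carrier := D\<rparr>"
  let ?act = "%d. image (%x. el d \<star> x)"
  have act_ro: "?act d (ro x) = ro (el d \<star> x)" for d x by (simp add: ro_def image_image gm_assoc)
  have act: "is_action ?H ?act (ro ` X)"
    unfolding is_action_def
  proof (intro conjI ballI)
    show "?act h w \<in> ro ` X" if "h \<in> carrier ?H" "w \<in> ro ` X" for h w using that act_ro Xl by auto
    show "?act \<one>\<^bsub>?H\<^esub> w = w" if w: "w \<in> ro ` X" for w
    proof -
      obtain x where x: "x \<in> X" "w = ro x" using w by blast
      show ?thesis unfolding x(2) using act_ro[of \<one> x] el_one_left[OF X_GA[OF x(1)]] by simp
    qed
    show "?act (h \<otimes>\<^bsub>?H\<^esub> k) w = ?act h (?act k w)" if "h \<in> carrier ?H" "k \<in> carrier ?H" "w \<in> ro ` X" for h k w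
      using that Dc by (simp add: image_image gm_assoc[symmetric] el_el)
  qed
  obtain n where n: "group ?H" "finite (carrier ?H)" "card (carrier ?H) = p ^ n" using p_subgroup_group[OF D] .
  obtain c where c: "sum (%_. 1::nat) (ro ` X) = sum (%_. 1) {w \<in> ro ` X. \<forall>h\<in>carrier ?H. ?act h w = w} + of_nat p * c"
    using pgroup_sum_fixed[where f = "%_. 1::nat" and act = ?act, OF n prime_p finite_imageI[OF finX] act] by auto
  have fx: "{w \<in> ro ` X. \<forall>h\<in>carrier ?H. ?act h w = w} = ro ` Wd"
  proof
    show "{w \<in> ro ` X. \<forall>h\<in>carrier ?H. ?act h w = w} \<subseteq> ro ` Wd"
    proof
      fix w assume "w \<in> {w \<in> ro ` X. \<forall>h\<in>carrier ?H. ?act h w = w}"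
      then obtain x where x: "x \<in> X" "w = ro x" and h: "\<forall>d\<in>D. ro (el d \<star> x) = ro x" using act_ro by auto
      have "\<exists>d'\<in>D. el d \<star> x = x \<star> el d'" if d: "d \<in> D" for d
      proof -
        have "el d \<star> x \<in> ro x" using ro_self[OF Xl[OF x(1) d]] h d by simp
        then show ?thesis by (auto simp: ro_def)
      qed
      then show "w \<in> ro ` Wd" using x by (auto simp: Wd_def)
    qed
    show "ro ` Wd \<subseteq> {w \<in> ro ` X. \<forall>h\<in>carrier ?H. ?act h w = w}"
    proof
      fix w assume "w \<in> ro ` Wd"
      then obtain x where x: "x \<in> X" "w = ro x" "!!d. d \<in> D ==> \<exists>d'\<in>D. el d \<star> x = x \<star> el d'" by (auto simp: Wd_def)
      have "ro (el d \<star> x) = ro x" if d: "d \<in> D" for d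
        by (rule ro_eq[OF x(1)]) (use x(3)[OF d] in \<open>auto simp: ro_def\<close>)
      then show "w \<in> {w \<in> ro ` X. \<forall>h\<in>carrier ?H. ?act h w = w}" using x(1,2) act_ro by simp
    qed
  qed
  have D0: "card D ~= 0" using finD subgroup.one_closed[OF sD] by auto
  have Wcl: "x \<star> el d \<in> Wd" if x: "x \<in> Wd" and d: "d \<in> D" for x d
  proof -
    have "\<exists>d'\<in>D. el t \<star> (x \<star> el d) = x \<star> el d \<star> el d'" if t: "t \<in> D" for t
    proof -
      obtain t' where t': "t' \<in> D" "el t \<star> x = x \<star> el t'" using x t by (auto simp: Wd_def)
      have m: "inv d \<otimes> t' \<otimes> d \<in> D" using subgroup.m_closed[OF sD] Dinv d t' by simp
      have cc: "d \<in> carrier G" "t' \<in> carrier G" using d t' Dc by auto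
      have "el t \<star> (x \<star> el d) = x \<star> el t' \<star> el d" unfolding t'(2)[symmetric] by (simp only: gm_assoc)
      also have "\<dots> = x \<star> el d \<star> el (inv d \<otimes> t' \<otimes> d)" using cc by (simp add: gm_assoc el_el m_assoc icancel)
      finally show ?thesis using m by blast
    qed
    then show ?thesis using x Xr d by (auto simp: Wd_def)
  qed
  have "card Wd = card (ro ` Wd) * card D" by (rule card_ro_union[OF _ Wcl]) (auto simp: Wd_def)
  then have "card (ro ` Wd) = card (dc D D ` Ne D eD)" using card_Wd D0 by simp
  moreover have "card X = card (ro ` X) * card D" by (rule card_ro_union[OF subset_refl Xr])
  then have "card X div card D = card (ro ` X)" using D0 by simp
  ultimately have "card X div card D = card (dc D D ` Ne D eD) + p * c" using c unfolding fx by simp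
  then have "\<not> p dvd card X div card D" using central_trace(1) by (simp add: dvd_add_left_iff)
  then show ?thesis using prime_imp_coprime[OF prime_p] using coprime_commute by blast
qed

theorem char_biset_basis: "char_biset p G D (fus_hom m p G D eD) (lact G l) (ract G l) X"
  unfolding char_biset_def
proof (intro conjI ballI impI allI)
  show "finite X" by (rule finX)
  show "s = \<one>" if "s \<in> D" "w \<in> X" "lact G l s w = w" for s w
    using free(1)[OF that(2,1)] that(3) by (simp add: lact_eq[OF XS[OF that(2)]])
  show "t = \<one>" if "t \<in> D" "w \<in> X" "ract G l w t = w" for t w
    using free(2)[OF that(2,1)] that(3) by (simp add: ract_eq[OF XS[OF that(2)] that(1)])
  show "\<exists>beta. bij_betw beta X X \<and> (\<forall>s\<in>D. \<forall>t\<in>D. \<forall>w\<in>X. beta (ract G l (lact G l s w) t) = ract G l (lact G l (inv t) (beta w)) (inv s))"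
    by (rule self_dual)
  show "\<exists>P phi. subgroup P G \<and> P \<subseteq> D \<and> fus_hom m p G D eD P D phi \<and>
      {(s, t). s \<in> D \<and> t \<in> D \<and> lact G l s w = ract G l w t} = Delta phi P" if "w \<in> X" for w
    by (rule point_stabilizer[OF that])
  show "\<exists>beta. bij_betw beta X X \<and> (\<forall>q\<in>P. \<forall>s\<in>D. \<forall>w\<in>X. beta (ract G l (lact G l q w) s) = ract G l (lact G l (phi q) (beta w)) s)"
    if "subgroup P G \<and> P \<subseteq> D \<and> fus_hom m p G D eD P D phi" for P phi
    by (rule fusion_stable) (use that in blast)
  show "coprime (card X div card D) p" by (rule card_coprime)
qed

end

theorem theorem4:
  fixes G :: "'g monoid" and m :: "'o::idom set" and p :: nat
    and b l eD :: "'g \<Rightarrow> 'o" and D :: "'g set" and X :: "('g \<Rightarrow> 'o) set"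
  assumes "group G" and "finite (carrier G)"
    and "cln_domain m" and "residue_alg_closed_char m p"
    and "block_idem G b"
    and "source_idem m p G b D l eD"
    and "all_twisted_units m G b D l"
    and "dd_inv_basis G b D l X"
  shows "char_biset p G D (fus_hom m p G D eD) (lact G l) (ract G l) X"
proof -
  have "group_alg G m p" by (rule group_alg.intro[OF assms(1) group_alg_axioms.intro[OF assms(2-4)]])
  then have "source_block G m p b l eD D" by (rule source_block.intro[OF _ source_block_axioms.intro[OF assms(5,6)]])
  then have "source_basis G m p b l eD D X" by (rule source_basis.intro[OF _ source_basis_axioms.intro[OF assms(7,8)]])
  then show ?thesis by (rule source_basis.char_biset_basis)
qed

end
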